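(* Let $\mathcal{H}$ be a finite-dimensional Hilbert space and $\mathcal{A}_1,\mathcal{B}_1\subseteq\mathcal{D}(\mathcal{H})$ non-empty closed sets. Then $$\mathrm{Stein}(\mathcal{A}_1^{\mathrm{iid}}\|\mathcal{B}_1^{\mathrm{iid}})=\operatorname{min^*}_{\mu\in\mathcal{P}(\mathcal{B}_1)}\lim_{n\to\infty}\frac1n\inf_{\rho\in\mathcal{A}_1}D\Big(\rho^{\otimes n}\Big\|\int_{\mathcal{B}_1}\mathrm{d}\mu(\sigma)\,\sigma^{\otimes n}\Big),$$ $$\mathrm{Stein}(\mathcal{A}_1^{\mathrm{av}}\|\mathcal{B}_1^{\mathrm{iid}})=\operatorname{min^*}_{\mu\in\mathcal{P}(\mathcal{B}_1)}\lim_{n\to\infty}\frac1n\inf_{\rho_n\in\mathrm{co}(\mathcal{A}_1^{\otimes n,\mathrm{av}})}D\Big(\rho_n\Big\|\int_{\mathcal{B}_1}\mathrm{d}\mu(\sigma)\,\sigma^{\otimes n}\Big).$$ If moreover $\mathcal{B}_1$ is convex, then $$\mathrm{Stein}(\mathcal{A}_1^{\mathrm{iid}}\|\mathcal{B}_1^{\mathrm{iid}})=\operatorname{min^*}_{\rho\in\mathcal{A}_1,\ \mu\in\mathcal{P}(\mathcal{B}_1)}\lim_{n\to\infty}\frac1n D\Big(\rho^{\otimes n}\Big\|\int_{\mathcal{B}_1}\mathrm{d}\mu(\sigma)\,\sigma^{\otimes n}\Big).$$ Finally, for arbitrarily varying alternative hypotheses (with no convexity assumption on $\mathcal{B}_1$):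 $$\mathrm{Stein}(\mathcal{A}_1^{\mathrm{iid}}\|\mathcal{B}_1^{\mathrm{av}})=\mathrm{Stein}(\mathcal{A}_1^{\mathrm{iid}}\|\mathrm{co}(\mathcal{B}_1)^{\mathrm{av}})=\mathrm{Stein}(\mathcal{A}_1^{\mathrm{iid}}\|\mathrm{co}(\mathcal{B}_1)^{\mathrm{iid}})=\operatorname{min^*}_{\rho\in\mathcal{A}_1,\ \mu\in\mathcal{P}(\mathrm{co}(\mathcal{B}_1))}\lim_{n\to\infty}\frac1n D\Big(\rho^{\otimes n}\Big\|\int_{\mathrm{co}(\mathcal{B}_1)}\mathrm{d}\mu(\sigma)\,\sigma^{\otimes n}\Big),$$ $$\mathrm{Stein}(\mathcal{A}_1^{\mathrm{av}}\|\mathcal{B}_1^{\mathrm{av}})=\mathrm{Stein}(\mathcal{A}_1^{\mathrm{av}}\|\mathrm{co}(\mathcal{B}_1)^{\mathrm{av}})=\mathrm{Stein}(\mathcal{A}_1^{\mathrm{av}}\|\mathrm{co}(\mathcal{B}_1)^{\mathrm{iid}})=\operatorname{min^*}_{\mu\in\mathcal{P}(\mathrm{co}(\mathcal{B}_1))}\lim_{n\to\infty}\frac1n\inf_{\rho_n\in\mathrm{co}(\mathcal{A}_1^{\otimes n,\mathrm{av}})}D\Big(\rho_n\Big\|\int_{\mathrm{co}(\mathcal{B}_1)}\mathrm{d}\mu(\sigma)\,\sigma^{\otimes n}\Big).$$ In every formula, the set of arguments (measures, or pairs) for which the inner limit exists is non-empty and the minimum over it is attained.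
   Context: $\mathcal{D}(\mathcal{K})$ is the set of density operators on $\mathcal{K}$. For $\mathcal{F}_1\subseteq\mathcal{D}(\mathcal{H})$: $\mathcal{F}_1^{\otimes n,\mathrm{iid}}=\{\rho^{\otimes n}:\rho\in\mathcal{F}_1\}$, $\mathcal{F}_1^{\mathrm{iid}}=(\mathcal{F}_1^{\otimes n,\mathrm{iid}})_n$, $\mathcal{F}_1^{\otimes n,\mathrm{av}}=\{\rho_1\otimes\cdots\otimes\rho_n:\rho_i\in\mathcal{F}_1\}$, $\mathcal{F}_1^{\mathrm{av}}=(\mathcal{F}_1^{\otimes n,\mathrm{av}})_n$; $\mathrm{co}$ is convex hull. For sequences $\mathcal{A}=(\mathcal{A}_n)_n,\mathcal{B}=(\mathcal{B}_n)_n$ of sets of states on $\mathcal{H}^{\otimes n}$: $\beta_\varepsilon(\mathcal{A}_n\|\mathcal{B}_n)=\inf\{\sup_{\sigma\in\mathcal{B}_n}\mathrm{Tr}[\sigma E]:0\le E\le\mathbb{1},\sup_{\rho\in\mathcal{A}_n}\mathrm{Tr}[\rho(\mathbb{1}-E)]\le\varepsilon\}$, $\mathrm{Stein}(\mathcal{A}\|\mathcal{B})=\lim_{\varepsilon\to0^+}\liminf_n-\frac1n\log\beta_\varepsilon(\mathcal{A}_n\|\mathcal{B}_n)$. $D$ is the Umegaki relative entropy $D(\rho\|\sigma)=\mathrm{Tr}[\rho(\log\rho-\log\sigma)]$ ($+\infty$ if supports are not nested). $\mathcal{P}(\mathcal{C})$ is the set of Borel probability measures on compact $\mathcal{C}$;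 $\operatorname{min^*}$ restricts the minimum to arguments for which the inner limit exists. *)

theory Defs
  imports "HOL-Analysis.Analysis" "HOL-Probability.Probability" "Jordan_Normal_Form.Schur_Decomposition"
begin

definition mtrace :: "complex Matrix.mat \<Rightarrow> complex" where
  "mtrace A = (\<Sum>i<dim_row A. A $$ (i, i))"

definition unitary_mat :: "nat \<Rightarrow> complex Matrix.mat \<Rightarrow> bool" where
  "unitary_mat n U \<longleftrightarrow> U \<in> carrier_mat n n \<and> mat_adjoint U * U = 1\<^sub>m n"

definition hermitian_mat :: "nat \<Rightarrow> complex Matrix.mat \<Rightarrow> bool" where
  "hermitian_mat n A \<longleftrightarrow> A \<in> carrier_mat n n \<and> mat_adjoint A = A"

definition psd_mat :: "nat \<Rightarrow> complex Matrix.mat \<Rightarrow> bool" where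
  "psd_mat n A \<longleftrightarrow> hermitian_mat n A \<and>
     (\<forall>v \<in> carrier_vec n. 0 \<le> Re ((A *\<^sub>v v) \<bullet>c v))"

definition density_mat :: "nat \<Rightarrow> complex Matrix.mat \<Rightarrow> bool" where
  "density_mat n A \<longleftrightarrow> psd_mat n A \<and> mtrace A = 1"

definition diag_of :: "nat \<Rightarrow> (nat \<Rightarrow> real) \<Rightarrow> complex Matrix.mat" where
  "diag_of n l = Matrix.mat n n (\<lambda>(i,j). if i = j then complex_of_real (l i) else 0)"

text \<open>A spectral decomposition A = U diag(l) U^* of a Hermitian matrix (chosen arbitrarily),
  and the resulting matrix function f(A) (independent of the choice).\<close>
definition herm_decomp :: "nat \<Rightarrow> complex Matrix.mat \<Rightarrow> complex Matrix.mat \<times> (nat \<Rightarrow> real)" where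
  "herm_decomp n A = (SOME (U, l). unitary_mat n U \<and> A = U * diag_of n l * mat_adjoint U)"

definition mat_fun :: "nat \<Rightarrow> (real \<Rightarrow> real) \<Rightarrow> complex Matrix.mat \<Rightarrow> complex Matrix.mat" where
  "mat_fun n f A = (case herm_decomp n A of (U, l) \<Rightarrow> U * diag_of n (f \<circ> l) * mat_adjoint U)"

text \<open>Logarithm on the support (0 log 0 convention).\<close>
definition log_supp :: "real \<Rightarrow> real" where
  "log_supp x = (if x > 0 then ln x else 0)"

text \<open>Umegaki relative entropy; +\<infinity> unless supp rho \<subseteq> supp sigma (i.e. ker sigma \<subseteq> ker rho).\<close>
definition rel_ent :: "nat \<Rightarrow> complex Matrix.mat \<Rightarrow> complex Matrix.mat \<Rightarrow> ereal" where
  "rel_ent n \<rho> \<sigma> =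
     (if (\<forall>v \<in> carrier_vec n. \<sigma> *\<^sub>v v = 0\<^sub>v n \<longrightarrow> \<rho> *\<^sub>v v = 0\<^sub>v n)
      then ereal (Re (mtrace (\<rho> * (mat_fun n log_supp \<rho> - mat_fun n log_supp \<sigma>))))
      else \<infinity>)"

definition kron :: "complex Matrix.mat \<Rightarrow> complex Matrix.mat \<Rightarrow> complex Matrix.mat" where
  "kron A B = Matrix.mat (dim_row A * dim_row B) (dim_col A * dim_col B)
     (\<lambda>(i,j). A $$ (i div dim_row B, j div dim_col B) * B $$ (i mod dim_row B, j mod dim_col B))"

definition tensor_list :: "complex Matrix.mat list \<Rightarrow> complex Matrix.mat" where
  "tensor_list Ms = foldr kron Ms (1\<^sub>m 1)"

definition tpow :: "nat \<Rightarrow> complex Matrix.mat \<Rightarrow> complex Matrix.mat" where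
  "tpow n A = tensor_list (replicate n A)"

definition mat_co :: "nat \<Rightarrow> complex Matrix.mat set \<Rightarrow> complex Matrix.mat set" where
  "mat_co N S = {M. \<exists>cs Ms. length cs = length Ms \<and> Ms \<noteq> [] \<and> set Ms \<subseteq> S \<and>
      (\<forall>c \<in> set cs. 0 \<le> c) \<and> sum_list cs = 1 \<and>
      M = foldr (+) (map2 (\<lambda>c A. complex_of_real c \<cdot>\<^sub>m A) cs Ms) (0\<^sub>m N N)}"

section \<open>Single-copy states as elements of complex^'d^'d (a Euclidean space), H = C^d, d = CARD('d)\<close>

definition idx :: "nat \<Rightarrow> 'd::finite" where
  "idx = (SOME f. bij_betw f {..<CARD('d)} (UNIV :: 'd set))"

definition to_mat :: "complex^'d^'d \<Rightarrow> complex Matrix.mat" where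
  "to_mat \<sigma> = Matrix.mat CARD('d) CARD('d) (\<lambda>(i,j). \<sigma> $ idx i $ idx j)"

definition dens :: "(complex^'d::finite^'d) set" where
  "dens = {\<sigma>. density_mat CARD('d) (to_mat \<sigma>)}"

definition iid_seq :: "(complex^'d::finite^'d) set \<Rightarrow> nat \<Rightarrow> complex Matrix.mat set" where
  "iid_seq F n = (\<lambda>\<sigma>. tpow n (to_mat \<sigma>)) ` F"

definition av_seq :: "(complex^'d::finite^'d) set \<Rightarrow> nat \<Rightarrow> complex Matrix.mat set" where
  "av_seq F n = {tensor_list (map to_mat rs) | rs. length rs = n \<and> set rs \<subseteq> F}"

definition is_test :: "nat \<Rightarrow> complex Matrix.mat \<Rightarrow> bool" where
  "is_test N E \<longleftrightarrow> psd_mat N E \<and> psd_mat N (1\<^sub>m N - E)"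

definition beta :: "nat \<Rightarrow> real \<Rightarrow> complex Matrix.mat set \<Rightarrow> complex Matrix.mat set \<Rightarrow> real" where
  "beta N \<epsilon> A B = Inf {Sup {Re (mtrace (\<sigma> * E)) | \<sigma>. \<sigma> \<in> B} | E.
      is_test N E \<and> Sup {Re (mtrace (\<rho> * (1\<^sub>m N - E))) | \<rho>. \<rho> \<in> A} \<le> \<epsilon>}"

definition neg_ln :: "real \<Rightarrow> ereal" where
  "neg_ln b = (if b \<le> 0 then \<infinity> else ereal (- ln b))"

definition stein :: "nat \<Rightarrow> (nat \<Rightarrow> complex Matrix.mat set) \<Rightarrow> (nat \<Rightarrow> complex Matrix.mat set) \<Rightarrow> ereal" where
  "stein d A B = Lim (at_right (0::real))
     (\<lambda>\<epsilon>. liminf (\<lambda>n. ereal (1 / real n) * neg_ln (beta (d ^ n) \<epsilon> (A n) (B n))))"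

definition prob_on :: "(complex^'d::finite^'d) set \<Rightarrow> (complex^'d^'d) measure set" where
  "prob_on C = {\<mu>. prob_space \<mu> \<and> sets \<mu> = sets (restrict_space borel C)}"

definition mixture :: "nat \<Rightarrow> (complex^'d::finite^'d) measure \<Rightarrow> complex Matrix.mat" where
  "mixture n \<mu> = Matrix.mat (CARD('d) ^ n) (CARD('d) ^ n)
     (\<lambda>(i,j). integral\<^sup>L \<mu> (\<lambda>\<sigma>. tpow n (to_mat \<sigma>) $$ (i,j)))"

definition is_min_star :: "'x set \<Rightarrow> ('x \<Rightarrow> nat \<Rightarrow> ereal) \<Rightarrow> ereal \<Rightarrow> bool" where
  "is_min_star S F v \<longleftrightarrow> (\<exists>x \<in> S. (F x \<longlonglongrightarrow> v)) \<and> (\<forall>x \<in> S. \<forall>L. (F x \<longlonglongrightarrow> L) \<longrightarrow> v \<le> L)"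

end

theory Submission
  imports Defs "HOL-Combinatorics.Multiset_Permutations" "HOL-Real_Asymp.Real_Asymp"
begin

text \<open>
  The lower bound on every relative entropy is the usual converse: by a Nussbaum--Szkola argument a test that separates
  \<open>\<rho>\<close> from \<open>\<integral> d\<mu>(\<sigma>) \<sigma>\<^sup>\<otimes>\<^sup>n\<close> with exponent \<open>x\<close> forces the normalised relative entropy to be at least \<open>x\<close> asymptotically.
  For the matching direction one uses a single universal measure \<open>\<mu>\<close>, independent of \<open>n\<close>: a countable mixture of finitely
  supported measures on barycentric spanners of \<open>{\<sigma>\<^sup>\<otimes>\<^sup>n}\<close>, which dominates every \<open>\<sigma>\<^sup>\<otimes>\<^sup>n\<close> up to a polynomial factor.
  If the relative entropy of a block of length \<open>k\<close> to this mixture exceeds \<open>k z\<close>, pinching (with polynomially many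
  eigenvalues, by permutation invariance) and convex minimisation give an observable on \<open>k\<close> copies which is large on the
  null hypothesis and has bounded exponential moment on the alternative; a Chernoff bound over independent blocks turns
  it into tests with exponent \<open>z\<close>. Compactness of \<open>\<A>\<^sub>1\<close> and unions of finitely many tests handle composite null hypotheses.
  For arbitrarily varying alternatives, tests extend to the convex hull by multilinearity, and symmetrised tests against
  i.i.d. states of a convex set also work for products of different states, by the method of types on a finite net.
\<close>

section \<open>Adjoints, traces and spectral decompositions\<close>

text \<open>The main obstacle is that a mixture of i.i.d. states is not a product, so a block test
  built against it does not multiply over blocks. Exponential moments under products do. Domination
  of each k-fold power by the mixture turns a moment bound 1 under the mixture into a bound
  \<open>univ_const\<close> under every single \<sigma>, and from there moments factorise. The price
  for a block of length k is \<open>loss\<close>, the logarithm of \<open>univ_const\<close> plus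
  that of the bound on the number of eigenvalues. It is o(k), so for the universal measure the
  normalised relative entropies are squeezed onto the exponent: the limit exists there, while the
  converse keeps the limit for any other measure from being smaller. The second obstacle is that a
  minimiser of the relative entropy may be singular, where logarithms are not controlled. All states
  are therefore mixed with a little identity before minimising. Lower semicontinuity and compactness
  provide one mixing weight that works for the whole null set, and its effect on the observable
  vanishes with the weight.\<close>

lemma mat_adjoint_dim [simp]:
  "dim_row (mat_adjoint A) = dim_col A" "dim_col (mat_adjoint A) = dim_row A"
  by (simp_all add: mat_adjoint_def)

lemma mat_adjoint_carrier [simp]: "A \<in> carrier_mat n m \<Longrightarrow> mat_adjoint A \<in> carrier_mat m n"
  by (auto intro!: carrier_matI)

lemma mat_adjoint_index [simp]:
  fixes A :: "complex Matrix.mat"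
  shows "i < dim_col A \<Longrightarrow> j < dim_row A \<Longrightarrow> mat_adjoint A $$ (i, j) = cnj (A $$ (j, i))"
  by (simp add: mat_adjoint_def mat_of_rows_index)

lemma mult_mat_index:
  "A \<in> carrier_mat n m \<Longrightarrow> B \<in> carrier_mat m k \<Longrightarrow> i < n \<Longrightarrow> j < k \<Longrightarrow>
    (A * B) $$ (i, j) = (\<Sum>l<m. A $$ (i, l) * B $$ (l, j))"
  by (auto simp: scalar_prod_def atLeast0LessThan)

declare index_mult_mat(1) [simp del] sum.lessThan_Suc [simp del]

lemma mult_square_carrier [simp]:
  "A \<in> carrier_mat n n \<Longrightarrow> B \<in> carrier_mat n n \<Longrightarrow> A * B \<in> carrier_mat n n"
  by simp

lemma mat_adjoint_mult:
  fixes A B :: "complex Matrix.mat"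
  assumes "A \<in> carrier_mat n m" "B \<in> carrier_mat m k"
  shows "mat_adjoint (A * B) = mat_adjoint B * mat_adjoint A"
proof (rule eq_matI)
  fix i j assume "i < dim_row (mat_adjoint B * mat_adjoint A)" "j < dim_col (mat_adjoint B * mat_adjoint A)"
  with assms have ij: "i < k" "j < n" by auto
  then show "mat_adjoint (A * B) $$ (i, j) = (mat_adjoint B * mat_adjoint A) $$ (i, j)"
    using assms by (simp add: mult_mat_index[OF assms] mult_mat_index[of "mat_adjoint B" k m _ n] mult.commute)
qed (use assms in auto)

lemma mat_adjoint_adjoint [simp]: "mat_adjoint (mat_adjoint A) = (A :: complex Matrix.mat)"
  by (rule eq_matI) auto

lemma mtrace_mult:
  assumes "A \<in> carrier_mat n m" "B \<in> carrier_mat m n"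
  shows "mtrace (A * B) = (\<Sum>i<n. \<Sum>j<m. A $$ (i, j) * B $$ (j, i))"
  using assms by (simp add: mtrace_def mult_mat_index[OF assms])

lemma mtrace_mult_commute:
  assumes "A \<in> carrier_mat n m" "B \<in> carrier_mat m n"
  shows "mtrace (A * B) = mtrace (B * A)"
  unfolding mtrace_mult[OF assms] mtrace_mult[OF assms(2,1)]
  by (subst sum.swap) (simp add: mult.commute)

lemma unitary_iff:
  "unitary_mat n U \<longleftrightarrow> U \<in> carrier_mat n n \<and>
    (\<forall>i<n. \<forall>j<n. (\<Sum>k<n. cnj (U $$ (k, i)) * U $$ (k, j)) = (if i = j then 1 else 0))"
proof -
  have "mat_adjoint U * U = 1\<^sub>m n \<longleftrightarrow>
    (\<forall>i<n. \<forall>j<n. (\<Sum>k<n. cnj (U $$ (k, i)) * U $$ (k, j)) = (if i = j then 1 else 0))"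
    if U: "U \<in> carrier_mat n n"
  proof -
    have *: "(mat_adjoint U * U) $$ (i, j) = (\<Sum>k<n. cnj (U $$ (k, i)) * U $$ (k, j))"
      if "i < n" "j < n" for i j
      using U that by (simp add: mult_mat_index[of "mat_adjoint U" n n])
    show ?thesis
    proof
      assume "mat_adjoint U * U = 1\<^sub>m n"
      then show "\<forall>i<n. \<forall>j<n. (\<Sum>k<n. cnj (U $$ (k, i)) * U $$ (k, j)) = (if i = j then 1 else 0)"
        using *[symmetric] by simp
    next
      assume "\<forall>i<n. \<forall>j<n. (\<Sum>k<n. cnj (U $$ (k, i)) * U $$ (k, j)) = (if i = j then 1 else 0)"
      then show "mat_adjoint U * U = 1\<^sub>m n"
        using U by (intro eq_matI) (simp_all add: *)
    qed
  qed
  then show ?thesis by (auto simp: unitary_mat_def)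
qed

lemma unitary_carrier: "unitary_mat n U \<Longrightarrow> U \<in> carrier_mat n n"
  by (simp add: unitary_mat_def)

lemma unitary_cols:
  "unitary_mat n U \<Longrightarrow> i < n \<Longrightarrow> j < n \<Longrightarrow>
    (\<Sum>k<n. cnj (U $$ (k, i)) * U $$ (k, j)) = (if i = j then 1 else 0)"
  by (simp add: unitary_iff)

lemma unitary_right: "unitary_mat n U \<Longrightarrow> U * mat_adjoint U = 1\<^sub>m n"
  unfolding unitary_mat_def
  by (metis mat_adjoint_carrier mat_mult_left_right_inverse)

lemma unitary_adjoint: "unitary_mat n U \<Longrightarrow> unitary_mat n (mat_adjoint U)"
  using unitary_right[of n U] by (auto simp: unitary_mat_def)

lemma unitary_rows:
  assumes "unitary_mat n U" "i < n" "j < n"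
  shows "(\<Sum>k<n. U $$ (i, k) * cnj (U $$ (j, k))) = (if i = j then 1 else 0)"
  using unitary_cols[OF unitary_adjoint[OF assms(1)] assms(2,3)] unitary_carrier[OF assms(1)] assms(2,3)
  by simp

lemma unitary_mult:
  assumes "unitary_mat n U" "unitary_mat n V"
  shows "unitary_mat n (U * V)"
proof -
  have c: "U \<in> carrier_mat n n" "V \<in> carrier_mat n n" using assms by (auto simp: unitary_carrier)
  have "mat_adjoint (U * V) * (U * V) = mat_adjoint V * (mat_adjoint U * U) * V"
    using c by (simp add: mat_adjoint_mult[OF c] assoc_mult_mat[of "mat_adjoint V" n n _ n _ n]
      assoc_mult_mat[of "mat_adjoint U" n n _ n _ n])
  also have "\<dots> = 1\<^sub>m n" using assms c by (simp add: unitary_mat_def)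
  finally show ?thesis using c by (simp add: unitary_mat_def)
qed

lemma unitary_one: "unitary_mat n (1\<^sub>m n)"
  by (simp add: unitary_mat_def) (rule eq_matI, auto)

text \<open>Working with explicit eigenbases turns traces of products into double sums over pairs of
  eigenvalues. The eigenvalue function is total but only its values below \<open>n\<close> matter,
  which lets \<open>psd_obtain_spec\<close> and its variants promise sign conditions for all
  indices.\<close>

definition spec :: "nat \<Rightarrow> complex Matrix.mat \<Rightarrow> (nat \<Rightarrow> real) \<Rightarrow> complex Matrix.mat" where
  "spec n U l = U * diag_of n l * mat_adjoint U"

lemma diag_of_carrier [simp]: "diag_of n l \<in> carrier_mat n n"
  by (simp add: diag_of_def)

lemma spec_carrier [simp]: "U \<in> carrier_mat n n \<Longrightarrow> spec n U l \<in> carrier_mat n n"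
  by (simp add: spec_def)

lemma spec_index:
  assumes U: "U \<in> carrier_mat n n" and "i < n" "j < n"
  shows "spec n U l $$ (i, j) = (\<Sum>k<n. U $$ (i, k) * of_real (l k) * cnj (U $$ (j, k)))"
proof -
  have 1: "(U * diag_of n l) $$ (i, k) = U $$ (i, k) * of_real (l k)" if "k < n" for k
  proof -
    have "(U * diag_of n l) $$ (i, k) = (\<Sum>x<n. U $$ (i, x) * (if x = k then of_real (l x) else 0))"
      using U assms(2) that by (subst mult_mat_index[of _ n n _ n]) (auto simp: diag_of_def)
    also have "\<dots> = (\<Sum>x<n. if x = k then U $$ (i, x) * of_real (l x) else 0)"
      by (intro sum.cong) auto
    also have "\<dots> = U $$ (i, k) * of_real (l k)" using that by (simp add: sum.delta)
    finally show ?thesis .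
  qed
  have "spec n U l $$ (i, j) = (\<Sum>k<n. (U * diag_of n l) $$ (i, k) * mat_adjoint U $$ (k, j))"
    unfolding spec_def using assms by (subst mult_mat_index[of _ n n _ n]) auto
  also have "\<dots> = (\<Sum>k<n. U $$ (i, k) * of_real (l k) * cnj (U $$ (j, k)))"
    using assms by (intro sum.cong) (auto simp: 1)
  finally show ?thesis .
qed

lemma spec_cong: "(\<And>k. k < n \<Longrightarrow> l k = l' k) \<Longrightarrow> spec n U l = spec n U l'"
  by (auto simp: spec_def diag_of_def intro!: arg_cong2[of _ _ _ _ times] eq_matI)

lemma spec_adjoint: "U \<in> carrier_mat n n \<Longrightarrow> mat_adjoint (spec n U l) = spec n U l"
  by (rule eq_matI, use spec_carrier[of U n l] in \<open>auto simp: spec_index mult_ac simp del: spec_carrier\<close>)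

lemma spec_hermitian: "U \<in> carrier_mat n n \<Longrightarrow> hermitian_mat n (spec n U l)"
  by (simp add: hermitian_mat_def spec_adjoint)

lemma conj_spec:
  assumes "W \<in> carrier_mat n n" "U \<in> carrier_mat n n"
  shows "W * spec n U l * mat_adjoint W = spec n (W * U) l"
  using assms by (simp add: spec_def mat_adjoint_mult[OF assms] assoc_mult_mat[of _ n n _ n _ n])

lemma spec_conj:
  assumes "unitary_mat n W" "A \<in> carrier_mat n n" "mat_adjoint W * A * W = spec n U l" "U \<in> carrier_mat n n"
  shows "A = spec n (W * U) l"
proof -
  have W: "W \<in> carrier_mat n n" using assms by (simp add: unitary_carrier)
  have "W * (mat_adjoint W * A * W) * mat_adjoint W = (W * mat_adjoint W) * A * (W * mat_adjoint W)"
    using W assms(2) by (simp add: assoc_mult_mat[of _ n n _ n _ n])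
  also have "\<dots> = A" using assms unitary_right[OF assms(1)] by simp
  finally show ?thesis using assms conj_spec[OF W assms(4)] by simp
qed

text \<open>Gram-Schmidt applied to a basis starting with \<open>v\<close> keeps its head.
  \<open>corthogonal\<close> asks for orthogonality only, so the columns are normalised separately
  and \<open>c\<close> is the inverse norm of \<open>v\<close>.\<close>

lemma unitary_completion:
  fixes v :: "complex Matrix.vec"
  assumes v: "v \<in> carrier_vec n" "v \<noteq> 0\<^sub>v n"
  shows "\<exists>W c. unitary_mat n W \<and> (\<forall>i<n. W $$ (i, 0) = c * v $ i)"
proof -
  interpret cof_vec_space n "TYPE(complex)" .
  define b where "b = basis_completion v"
  note bc = basis_completion[OF v, folded b_def]
  have n0: "n \<noteq> 0" using v by (auto intro: eq_vecI)
  obtain vs where bv: "b = v # vs" by (auto simp: b_def basis_completion_def Let_def)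
  define ws where "ws = gram_schmidt n b"
  have indep: "\<not> lin_dep (set b)" using bc by auto
  from gram_schmidt_result[OF bc(2) bc(4) indep refl, folded ws_def] bc(6)
  have ws: "set ws \<subseteq> carrier_vec n" "corthogonal ws" "length ws = n" by auto
  have hdws: "hd ws = v" unfolding ws_def bv by (rule gram_schmidt_hd[OF v(1)])
  have ws0: "ws ! 0 = v" using hdws ws n0 by (metis hd_conv_nth length_0_conv)
  define N where "N j = (\<Sum>k<n. (cmod (ws ! j $ k))\<^sup>2)" for j
  have inner: "ws ! i \<bullet>c ws ! j = (\<Sum>k<n. ws ! i $ k * cnj (ws ! j $ k))" if "i < n" "j < n" for i j
  proof -
    have "ws ! i \<in> carrier_vec n" "ws ! j \<in> carrier_vec n" using ws that by auto
    then show ?thesis by (auto simp: scalar_prod_def atLeast0LessThan)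
  qed
  have NN: "ws ! j \<bullet>c ws ! j = of_real (N j)" if "j < n" for j
    using inner[OF that that] by (simp add: N_def complex_norm_square[symmetric] of_real_power[symmetric] del: of_real_power)
  have orth: "(ws ! i \<bullet>c ws ! j = 0) = (i \<noteq> j)" if "i < n" "j < n" for i j
    using ws that by (auto simp: corthogonal_def)
  have Npos: "N j > 0" if "j < n" for j
  proof -
    have "N j \<noteq> 0" using NN[OF that] orth[OF that that] by auto
    moreover have "N j \<ge> 0" unfolding N_def by (intro sum_nonneg) auto
    ultimately show ?thesis by simp
  qed
  define W where "W = Matrix.mat n n (\<lambda>(i, j). of_real (1 / sqrt (N j)) * ws ! j $ i)"
  have "unitary_mat n W"
    unfolding unitary_iff
  proof (intro conjI allI impI)
    show "W \<in> carrier_mat n n" by (simp add: W_def)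
    fix i j assume ij: "i < n" "j < n"
    have "(\<Sum>k<n. cnj (W $$ (k, i)) * W $$ (k, j))
        = (\<Sum>k<n. of_real (1 / sqrt (N i)) * of_real (1 / sqrt (N j)) * (ws ! j $ k * cnj (ws ! i $ k)))"
      using ij by (intro sum.cong) (auto simp: W_def)
    also have "\<dots> = of_real (1 / sqrt (N i)) * of_real (1 / sqrt (N j)) * (ws ! j \<bullet>c ws ! i)"
      using ij by (simp add: inner sum_distrib_left)
    also have "\<dots> = (if i = j then 1 else 0)"
    proof (cases "i = j")
      case True
      have "1 / sqrt (N i) * (1 / sqrt (N i)) * N i = 1" using Npos[OF ij(1)] by simp
      then have "complex_of_real (1 / sqrt (N i) * (1 / sqrt (N i)) * N i) = 1" by (simp only: of_real_1)
      then show ?thesis using True NN[OF ij(1)] by (simp only: of_real_mult) simp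
    next
      case False
      then show ?thesis using orth[of j i] ij by auto
    qed
    finally show "(\<Sum>k<n. cnj (W $$ (k, i)) * W $$ (k, j)) = (if i = j then 1 else 0)" .
  qed
  moreover have "\<forall>i<n. W $$ (i, 0) = of_real (1 / sqrt (N 0)) * v $ i"
    using n0 ws0 by (simp add: W_def)
  ultimately show ?thesis by blast
qed

lemma hermitian_index: "hermitian_mat n A \<Longrightarrow> i < n \<Longrightarrow> j < n \<Longrightarrow> A $$ (i, j) = cnj (A $$ (j, i))"
  unfolding hermitian_mat_def by (metis mat_adjoint_index carrier_matD)

lemma hermitian_iff:
  "hermitian_mat n A \<longleftrightarrow> A \<in> carrier_mat n n \<and> (\<forall>i<n. \<forall>j<n. A $$ (i, j) = cnj (A $$ (j, i)))"
proof
  assume h: "A \<in> carrier_mat n n \<and> (\<forall>i<n. \<forall>j<n. A $$ (i, j) = cnj (A $$ (j, i)))"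
  then have *: "mat_adjoint A $$ (i, j) = A $$ (i, j)" if "i < n" "j < n" for i j
    using that by (metis mat_adjoint_index carrier_matD)
  from h have c: "A \<in> carrier_mat n n" by blast
  then have "mat_adjoint A = A" by (intro eq_matI) (simp_all add: * del: mat_adjoint_index)
  then show "hermitian_mat n A" using h unfolding hermitian_mat_def by blast
next
  assume h: "hermitian_mat n A"
  then show "A \<in> carrier_mat n n \<and> (\<forall>i<n. \<forall>j<n. A $$ (i, j) = cnj (A $$ (j, i)))"
    by (intro conjI allI impI hermitian_index[OF h]) (use h in \<open>simp_all add: hermitian_mat_def\<close>)
qed

lemma eigenvector_exists:
  assumes A: "(A :: complex Matrix.mat) \<in> carrier_mat n n" and "n \<noteq> 0"
  shows "\<exists>v e. eigenvector A v e"
proof -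
  from char_poly_factorized[OF A] obtain as
    where as: "char_poly A = (\<Prod>a\<leftarrow>as. [:- a, 1:])" "length as = n" by auto
  with assms obtain a as' where "as = a # as'" by (cases as) auto
  with as have "poly (char_poly A) a = 0" by simp
  then show ?thesis using eigenvalue_root_char_poly[OF A] unfolding eigenvalue_def by metis
qed

text \<open>Deflation: conjugation by a unitary whose first column is an eigenvector clears the
  first column, hermiticity clears the first row and makes the eigenvalue real, and the induction
  hypothesis handles the remaining block.\<close>

theorem hermitian_spec:
  assumes "hermitian_mat n A"
  shows "\<exists>U l. unitary_mat n U \<and> A = spec n U l"
  using assms
proof (induction n arbitrary: A)
  case 0
  then have "A = spec 0 (1\<^sub>m 0) (\<lambda>_. 0)"
    by (intro eq_matI) (auto simp: hermitian_mat_def spec_def)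
  then show ?case using unitary_one by blast
next
  case (Suc n)
  let ?n = "Suc n"
  have A: "A \<in> carrier_mat ?n ?n" "mat_adjoint A = A" using Suc.prems by (auto simp: hermitian_mat_def)
  obtain v e where ev: "eigenvector A v e" using eigenvector_exists[OF A(1)] by auto
  then have v: "v \<in> carrier_vec ?n" "v \<noteq> 0\<^sub>v ?n" "A *\<^sub>v v = e \<cdot>\<^sub>v v"
    using A by (auto simp: eigenvector_def)
  obtain W c where W: "unitary_mat ?n W" and W0: "\<And>i. i < ?n \<Longrightarrow> W $$ (i, 0) = c * v $ i"
    using unitary_completion[OF v(1,2)] by blast
  have Wc: "W \<in> carrier_mat ?n ?n" using W by (rule unitary_carrier)
  define A' where "A' = mat_adjoint W * A * W"
  have A'c: "A' \<in> carrier_mat ?n ?n" using Wc A by (simp add: A'_def)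
  have A'h: "hermitian_mat ?n A'"
    unfolding hermitian_mat_def A'_def using A Wc
    by (simp add: mat_adjoint_mult[of _ ?n ?n _ ?n] assoc_mult_mat[of _ ?n ?n _ ?n _ ?n])
  have AW0: "(\<Sum>l<?n. A $$ (i, l) * W $$ (l, 0)) = e * W $$ (i, 0)" if i: "i < ?n" for i
  proof -
    have "(A *\<^sub>v v) $ i = (\<Sum>l<?n. A $$ (i, l) * v $ l)"
      using A(1) v(1) i by (auto simp: scalar_prod_def atLeast0LessThan simp del: sum.lessThan_Suc)
    then have *: "(\<Sum>l<?n. A $$ (i, l) * v $ l) = e * v $ i" using v i by simp
    have "(\<Sum>l<?n. A $$ (i, l) * W $$ (l, 0)) = c * (\<Sum>l<?n. A $$ (i, l) * v $ l)"
      unfolding sum_distrib_left by (intro sum.cong) (auto simp: W0)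
    then show ?thesis using * W0[OF i] by simp
  qed
  have A'0: "A' $$ (i, 0) = (if i = 0 then e else 0)" if i: "i < ?n" for i
  proof -
    have "A' = mat_adjoint W * (A * W)" using A Wc by (simp add: A'_def assoc_mult_mat[of _ ?n ?n _ ?n _ ?n])
    then have "A' $$ (i, 0) = (\<Sum>k<?n. mat_adjoint W $$ (i, k) * (A * W) $$ (k, 0))"
      using A Wc i by (simp only:) (subst mult_mat_index[of _ ?n ?n _ ?n], auto)
    also have "\<dots> = (\<Sum>k<?n. cnj (W $$ (k, i)) * (e * W $$ (k, 0)))"
      using A Wc i by (intro sum.cong) (auto simp: mult_mat_index[of A ?n ?n W ?n] AW0)
    also have "\<dots> = e * (\<Sum>k<?n. cnj (W $$ (k, i)) * W $$ (k, 0))"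
      by (simp add: sum_distrib_left mult_ac)
    finally show ?thesis using unitary_cols[OF W i, of 0] by simp
  qed
  have A'0': "A' $$ (0, i) = (if i = 0 then e else 0)" if i: "i < ?n" for i
  proof (cases "i = 0")
    case False
    then show ?thesis using hermitian_index[OF A'h, of 0 i] A'0[OF i] i by simp
  qed (use A'0[of 0] in simp)
  have er: "e = of_real (Re e)"
    using hermitian_index[OF A'h, of 0 0] A'0[of 0] by (metis Reals_cnj_iff of_real_Re zero_less_Suc)
  define A3 where "A3 = Matrix.mat n n (\<lambda>(i, j). A' $$ (Suc i, Suc j))"
  have "hermitian_mat n A3"
    unfolding hermitian_iff by (auto simp: A3_def intro!: hermitian_index[OF A'h])
  from Suc.IH[OF this] obtain U3 l3 where U3: "unitary_mat n U3" "A3 = spec n U3 l3" by blast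
  define U' where "U' = Matrix.mat ?n ?n (\<lambda>(i, j). case i of 0 \<Rightarrow> (if j = 0 then 1 else 0)
     | Suc i' \<Rightarrow> (case j of 0 \<Rightarrow> 0 | Suc j' \<Rightarrow> U3 $$ (i', j')))"
  define l' where "l' = (\<lambda>j. case j of 0 \<Rightarrow> Re e | Suc j' \<Rightarrow> l3 j')"
  have U'c: "U' \<in> carrier_mat ?n ?n" by (simp add: U'_def)
  have U': "unitary_mat ?n U'"
    unfolding unitary_iff
  proof (intro conjI allI impI)
    fix i j assume ij: "i < ?n" "j < ?n"
    show "(\<Sum>k<?n. cnj (U' $$ (k, i)) * U' $$ (k, j)) = (if i = j then 1 else 0)"
      using ij unitary_cols[OF U3(1), of "i - 1" "j - 1"]
      by (cases i; cases j) (auto simp: U'_def sum.lessThan_Suc_shift simp del: sum.lessThan_Suc)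
  qed (rule U'c)
  have "A' = spec ?n U' l'"
  proof (rule eq_matI)
    fix i j assume "i < dim_row (spec ?n U' l')" "j < dim_col (spec ?n U' l')"
    then have ij: "i < ?n" "j < ?n" using spec_carrier[OF U'c, of l'] by auto
    have sp: "spec ?n U' l' $$ (i, j) = U' $$ (i, 0) * of_real (Re e) * cnj (U' $$ (j, 0))
        + (\<Sum>k<n. U' $$ (i, Suc k) * of_real (l3 k) * cnj (U' $$ (j, Suc k)))"
      by (simp add: spec_index[OF U'c ij] sum.lessThan_Suc_shift l'_def)
    show "A' $$ (i, j) = spec ?n U' l' $$ (i, j)"
    proof (cases "i = 0 \<or> j = 0")
      case True
      then show ?thesis using ij er A'0 A'0' unfolding sp
        by (auto simp: U'_def split: nat.splits)
    next
      case False
      then obtain i' j' where s: "i = Suc i'" "j = Suc j'" by (metis not0_implies_Suc)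
      have "A' $$ (i, j) = A3 $$ (i', j')" using ij s by (simp add: A3_def)
      then show ?thesis using ij s U3 unfolding sp
        by (simp add: spec_index[OF unitary_carrier[OF U3(1)]] U'_def)
    qed
  qed (use A'c spec_carrier[OF U'c, of l'] in auto)
  then have "A = spec ?n (W * U') l'"
    using spec_conj[OF W A(1) _ U'c, of l'] by (simp add: A'_def)
  then show ?case using unitary_mult[OF W U'] by blast
qed

section \<open>Positive matrices, tests and matrix functions\<close>

declare index_mult_mat_vec [simp del]

lemma cmod_square_of_real: "complex_of_real ((cmod z)\<^sup>2) = z * cnj z"
  by (rule complex_norm_square)

lemma mult_one_square [simp]:
  fixes A :: "complex Matrix.mat"
  shows "A \<in> carrier_mat n n \<Longrightarrow> A * 1\<^sub>m n = A" "A \<in> carrier_mat n n \<Longrightarrow> 1\<^sub>m n * A = A"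
  by simp_all

lemma spec_dim [simp]: "dim_row (spec n U l) = dim_row U" "dim_col (spec n U l) = dim_row U"
  by (simp_all add: spec_def)

lemma mat_adjoint_minus:
  fixes A B :: "complex Matrix.mat"
  shows "A \<in> carrier_mat n m \<Longrightarrow> B \<in> carrier_mat n m \<Longrightarrow> mat_adjoint (A - B) = mat_adjoint A - mat_adjoint B"
  by (rule eq_matI) auto

text \<open>Squared overlaps of the columns of two bases. For unitaries this matrix is doubly
  stochastic, so it couples two spectra like a pair of classical distributions.\<close>

definition ovl :: "nat \<Rightarrow> complex Matrix.mat \<Rightarrow> complex Matrix.mat \<Rightarrow> nat \<Rightarrow> nat \<Rightarrow> real" where
  "ovl n U V i j = (cmod (\<Sum>k<n. cnj (U $$ (k, i)) * V $$ (k, j)))\<^sup>2"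

text \<open>The quadratic form of \<open>M\<close> at \<open>v\<close>. Vectors are plain functions
  here, which avoids carrier conditions on them.\<close>

definition qfc :: "nat \<Rightarrow> complex Matrix.mat \<Rightarrow> (nat \<Rightarrow> complex) \<Rightarrow> complex" where
  "qfc n M v = (\<Sum>x<n. \<Sum>y<n. cnj (v x) * M $$ (x, y) * v y)"

lemma ovl_nonneg [simp]: "0 \<le> ovl n U V i j"
  by (simp add: ovl_def)

lemma parseval:
  assumes "unitary_mat n V"
  shows "(\<Sum>j<n. (cmod (\<Sum>x<n. cnj (V $$ (x, j)) * w x))\<^sup>2) = (\<Sum>x<n. (cmod (w x))\<^sup>2)"
proof -
  have "complex_of_real (\<Sum>j<n. (cmod (\<Sum>x<n. cnj (V $$ (x, j)) * w x))\<^sup>2)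
      = (\<Sum>j<n. (\<Sum>x<n. cnj (V $$ (x, j)) * w x) * cnj (\<Sum>y<n. cnj (V $$ (y, j)) * w y))"
    by (simp only: of_real_sum cmod_square_of_real)
  also have "\<dots> = (\<Sum>j<n. \<Sum>x<n. \<Sum>y<n. V $$ (y, j) * cnj (V $$ (x, j)) * (w x * cnj (w y)))"
    by (simp add: sum_product mult_ac)
  also have "\<dots> = (\<Sum>x<n. \<Sum>j<n. \<Sum>y<n. V $$ (y, j) * cnj (V $$ (x, j)) * (w x * cnj (w y)))"
    by (rule sum.swap)
  also have "\<dots> = (\<Sum>x<n. \<Sum>y<n. \<Sum>j<n. V $$ (y, j) * cnj (V $$ (x, j)) * (w x * cnj (w y)))"
    by (rule sum.cong[OF refl], rule sum.swap)
  also have "\<dots> = (\<Sum>x<n. \<Sum>y<n. (if y = x then 1 else 0) * (w x * cnj (w y)))"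
    by (intro sum.cong refl) (simp only: sum_distrib_right[symmetric] unitary_rows[OF assms] lessThan_iff)
  also have "\<dots> = (\<Sum>x<n. \<Sum>y<n. if y = x then w x * cnj (w y) else 0)"
    by (intro sum.cong refl) auto
  also have "\<dots> = (\<Sum>x<n. w x * cnj (w x))" by (intro sum.cong) auto
  also have "\<dots> = complex_of_real (\<Sum>x<n. (cmod (w x))\<^sup>2)"
    by (simp only: of_real_sum cmod_square_of_real)
  finally show ?thesis by (simp only: of_real_eq_iff)
qed

lemma unitary_col_norm: "unitary_mat n U \<Longrightarrow> i < n \<Longrightarrow> (\<Sum>x<n. (cmod (U $$ (x, i)))\<^sup>2) = 1"
proof -
  assume a: "unitary_mat n U" "i < n"
  have "complex_of_real (\<Sum>x<n. (cmod (U $$ (x, i)))\<^sup>2) = (\<Sum>x<n. cnj (U $$ (x, i)) * U $$ (x, i))"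
    by (simp only: of_real_sum cmod_square_of_real mult.commute)
  then show ?thesis using unitary_cols[OF a(1) a(2) a(2)] by (metis of_real_eq_1_iff)
qed

lemma ovl_commute: "ovl n U V i j = ovl n V U j i"
proof -
  have "(\<Sum>k<n. cnj (U $$ (k, i)) * V $$ (k, j)) = cnj (\<Sum>k<n. cnj (V $$ (k, j)) * U $$ (k, i))"
    by (simp add: mult.commute)
  then show ?thesis unfolding ovl_def by (simp only: complex_mod_cnj)
qed

lemma ovl_sum_left:
  assumes "unitary_mat n U" "unitary_mat n V" "j < n"
  shows "(\<Sum>i<n. ovl n U V i j) = 1"
  unfolding ovl_def using parseval[OF assms(1), of "\<lambda>k. V $$ (k, j)"] unitary_col_norm[OF assms(2,3)] by simp

lemma ovl_sum_right:
  assumes "unitary_mat n U" "unitary_mat n V" "i < n"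
  shows "(\<Sum>j<n. ovl n U V i j) = 1"
  using ovl_sum_left[OF assms(2,1,3)] by (simp add: ovl_commute[of n U])

lemma ovl_same: "unitary_mat n U \<Longrightarrow> i < n \<Longrightarrow> j < n \<Longrightarrow> ovl n U U i j = (if i = j then 1 else 0)"
  by (simp add: ovl_def unitary_cols)

lemma mtrace_spec_mult:
  assumes U: "U \<in> carrier_mat n n" and M: "M \<in> carrier_mat n n"
  shows "mtrace (spec n U a * M) = (\<Sum>i<n. of_real (a i) * qfc n M (\<lambda>x. U $$ (x, i)))"
proof -
  have "mtrace (spec n U a * M) = (\<Sum>x<n. \<Sum>y<n. \<Sum>i<n. of_real (a i) * (cnj (U $$ (y, i)) * M $$ (y, x) * U $$ (x, i)))"
    using assms by (simp add: mtrace_mult[of _ n n] spec_index sum_distrib_left sum_distrib_right mult_ac)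
  also have "\<dots> = (\<Sum>x<n. \<Sum>i<n. \<Sum>y<n. of_real (a i) * (cnj (U $$ (y, i)) * M $$ (y, x) * U $$ (x, i)))"
    by (rule sum.cong[OF refl], rule sum.swap)
  also have "\<dots> = (\<Sum>i<n. \<Sum>x<n. \<Sum>y<n. of_real (a i) * (cnj (U $$ (y, i)) * M $$ (y, x) * U $$ (x, i)))"
    by (rule sum.swap)
  also have "\<dots> = (\<Sum>i<n. \<Sum>y<n. \<Sum>x<n. of_real (a i) * (cnj (U $$ (y, i)) * M $$ (y, x) * U $$ (x, i)))"
    by (rule sum.cong[OF refl], rule sum.swap)
  finally show ?thesis by (simp add: qfc_def sum_distrib_left)
qed

lemma qfc_spec:
  assumes V: "V \<in> carrier_mat n n"
  shows "qfc n (spec n V b) v = of_real (\<Sum>j<n. b j * (cmod (\<Sum>x<n. cnj (v x) * V $$ (x, j)))\<^sup>2)"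
proof -
  have "qfc n (spec n V b) v = (\<Sum>x<n. \<Sum>y<n. \<Sum>j<n. of_real (b j) * ((cnj (v x) * V $$ (x, j)) * (v y * cnj (V $$ (y, j)))))"
    using assms by (simp add: qfc_def spec_index sum_distrib_left sum_distrib_right mult_ac)
  also have "\<dots> = (\<Sum>x<n. \<Sum>j<n. \<Sum>y<n. of_real (b j) * ((cnj (v x) * V $$ (x, j)) * (v y * cnj (V $$ (y, j)))))"
    by (rule sum.cong[OF refl], rule sum.swap)
  also have "\<dots> = (\<Sum>j<n. \<Sum>x<n. \<Sum>y<n. of_real (b j) * ((cnj (v x) * V $$ (x, j)) * (v y * cnj (V $$ (y, j)))))"
    by (rule sum.swap)
  also have "\<dots> = (\<Sum>j<n. of_real (b j) * ((\<Sum>x<n. cnj (v x) * V $$ (x, j)) * (\<Sum>y<n. v y * cnj (V $$ (y, j)))))"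
    by (simp only: sum_distrib_left[symmetric] sum_product)
  also have "\<dots> = (\<Sum>j<n. of_real (b j) * ((\<Sum>x<n. cnj (v x) * V $$ (x, j)) * cnj (\<Sum>x<n. cnj (v x) * V $$ (x, j))))"
    by simp
  also have "\<dots> = (\<Sum>j<n. of_real (b j) * of_real ((cmod (\<Sum>x<n. cnj (v x) * V $$ (x, j)))\<^sup>2))"
    by (simp only: cmod_square_of_real)
  finally show ?thesis by simp
qed

lemma qfc_spec_col:
  assumes "V \<in> carrier_mat n n"
  shows "qfc n (spec n V b) (\<lambda>x. U $$ (x, i)) = of_real (\<Sum>j<n. b j * ovl n U V i j)"
  by (simp add: qfc_spec[OF assms] ovl_def)

lemma mtrace_spec_spec:
  assumes "U \<in> carrier_mat n n" "V \<in> carrier_mat n n"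
  shows "mtrace (spec n U a * spec n V b) = of_real (\<Sum>i<n. \<Sum>j<n. a i * b j * ovl n U V i j)"
  using assms by (simp add: mtrace_spec_mult qfc_spec_col sum_distrib_left mult_ac)

lemma spec_one: "unitary_mat n U \<Longrightarrow> spec n U (\<lambda>_. 1) = 1\<^sub>m n"
proof -
  assume U: "unitary_mat n U"
  have "diag_of n (\<lambda>_. 1) = 1\<^sub>m n" by (rule eq_matI) (auto simp: diag_of_def)
  then show ?thesis using U unitary_right[OF U] unitary_carrier[OF U] by (simp add: spec_def)
qed

lemma spec_add:
  assumes "U \<in> carrier_mat n n"
  shows "spec n U a + spec n U b = spec n U (\<lambda>i. a i + b i)"
  by (rule eq_matI, use assms in \<open>auto simp: spec_index algebra_simps sum.distrib\<close>)

lemma spec_diff: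
  assumes "U \<in> carrier_mat n n"
  shows "spec n U a - spec n U b = spec n U (\<lambda>i. a i - b i)"
  by (rule eq_matI, use assms in \<open>auto simp: spec_index algebra_simps sum_subtractf\<close>)

lemma spec_smult:
  assumes "U \<in> carrier_mat n n"
  shows "complex_of_real c \<cdot>\<^sub>m spec n U a = spec n U (\<lambda>i. c * a i)"
  by (rule eq_matI, use assms in \<open>auto simp: spec_index algebra_simps sum_distrib_left\<close>)

lemma mtrace_spec: "unitary_mat n U \<Longrightarrow> mtrace (spec n U a) = of_real (\<Sum>i<n. a i)"
proof -
  assume U: "unitary_mat n U"
  then have Uc: "U \<in> carrier_mat n n" by (rule unitary_carrier)
  have "spec n U a = spec n U a * spec n U (\<lambda>_. 1)" using spec_carrier[OF Uc] by (simp add: spec_one[OF U])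
  then have "mtrace (spec n U a) = mtrace (spec n U a * spec n U (\<lambda>_. 1))" by (rule arg_cong)
  also have "\<dots> = of_real (\<Sum>i<n. \<Sum>j<n. a i * 1 * ovl n U U i j)" by (rule mtrace_spec_spec[OF Uc Uc])
  finally show ?thesis using ovl_sum_right[OF U U] by (simp add: sum_distrib_left[symmetric])
qed

lemma spec_mult:
  assumes U: "unitary_mat n U"
  shows "spec n U a * spec n U b = spec n U (\<lambda>i. a i * b i)"
proof -
  have Uc: "U \<in> carrier_mat n n" using U by (rule unitary_carrier)
  have d: "diag_of n a * diag_of n b = diag_of n (\<lambda>i. a i * b i)"
  proof (rule eq_matI)
    fix i j assume "i < dim_row (diag_of n (\<lambda>i. a i * b i))" "j < dim_col (diag_of n (\<lambda>i. a i * b i))"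
    then have ij: "i < n" "j < n" by (auto simp: diag_of_def)
    have "(diag_of n a * diag_of n b) $$ (i, j) = (\<Sum>l<n. if l = i then (if i = j then complex_of_real (a i) * b i else 0) else 0)"
      using ij by (subst mult_mat_index[of _ n n _ n]) (auto simp: diag_of_def if_distrib[of "\<lambda>x. x * _"] cong: if_cong)
    then show "(diag_of n a * diag_of n b) $$ (i, j) = diag_of n (\<lambda>i. a i * b i) $$ (i, j)"
      using ij by (simp add: diag_of_def)
  qed (auto simp: diag_of_def)
  have "spec n U a * spec n U b = U * diag_of n a * (mat_adjoint U * U) * (diag_of n b * mat_adjoint U)"
    unfolding spec_def using Uc by (simp add: assoc_mult_mat[of _ n n _ n _ n])
  also have "\<dots> = U * (diag_of n a * diag_of n b) * mat_adjoint U"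
    using U Uc by (simp add: unitary_mat_def assoc_mult_mat[of U n n _ n _ n] assoc_mult_mat[of "diag_of n a" n n _ n _ n])
  finally show ?thesis by (simp add: d spec_def)
qed

lemma mult_vec_index:
  fixes A :: "complex Matrix.mat"
  shows "A \<in> carrier_mat n n \<Longrightarrow> v \<in> carrier_vec n \<Longrightarrow> i < n \<Longrightarrow> (A *\<^sub>v v) $ i = (\<Sum>j<n. A $$ (i, j) * v $ j)"
  by (auto simp: index_mult_mat_vec scalar_prod_def atLeast0LessThan)

lemma psd_iff: "psd_mat n A \<longleftrightarrow> hermitian_mat n A \<and> (\<forall>v. 0 \<le> Re (qfc n A v))"
proof -
  have *: "(A *\<^sub>v v) \<bullet>c v = qfc n A (\<lambda>i. v $ i)" if "A \<in> carrier_mat n n" "v \<in> carrier_vec n" for v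
  proof -
    have "(A *\<^sub>v v) \<bullet>c v = (\<Sum>i<n. (A *\<^sub>v v) $ i * cnj (v $ i))"
      using that by (simp add: scalar_prod_def atLeast0LessThan)
    also have "\<dots> = qfc n A (\<lambda>i. v $ i)"
      unfolding qfc_def using that by (intro sum.cong refl) (simp add: mult_vec_index sum_distrib_left mult_ac)
    finally show ?thesis .
  qed
  have v: "qfc n A v = qfc n A (\<lambda>i. Matrix.vec n v $ i)" for v by (simp add: qfc_def)
  show ?thesis
  proof
    assume p: "psd_mat n A"
    then have c: "A \<in> carrier_mat n n" by (simp add: psd_mat_def hermitian_mat_def)
    have "0 \<le> Re (qfc n A v)" for v
      unfolding v[of v] using p *[OF c, of "Matrix.vec n v"] vec_carrier[of n v] unfolding psd_mat_def by metis
    then show "hermitian_mat n A \<and> (\<forall>v. 0 \<le> Re (qfc n A v))" using p by (simp add: psd_mat_def)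
  next
    assume p: "hermitian_mat n A \<and> (\<forall>v. 0 \<le> Re (qfc n A v))"
    then have c: "A \<in> carrier_mat n n" by (simp add: hermitian_mat_def)
    show "psd_mat n A" using p *[OF c] by (simp add: psd_mat_def)
  qed
qed

lemma psd_carrier: "psd_mat n A \<Longrightarrow> A \<in> carrier_mat n n"
  by (simp add: psd_mat_def hermitian_mat_def)

lemma psd_spec_iff:
  assumes U: "unitary_mat n U"
  shows "psd_mat n (spec n U l) \<longleftrightarrow> (\<forall>i<n. 0 \<le> l i)"
proof
  have Uc: "U \<in> carrier_mat n n" using U by (rule unitary_carrier)
  assume p: "psd_mat n (spec n U l)"
  show "\<forall>i<n. 0 \<le> l i"
  proof (intro allI impI)
    fix i assume i: "i < n"
    have "qfc n (spec n U l) (\<lambda>x. U $$ (x, i)) = of_real (\<Sum>j<n. l j * (if i = j then 1 else 0))"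
      using i by (simp add: qfc_spec_col[OF Uc] ovl_same[OF U])
    also have "\<dots> = of_real (\<Sum>j<n. if i = j then l j else 0)"
      by (intro arg_cong[of _ _ of_real] sum.cong) auto
    also have "\<dots> = of_real (l i)" using i by simp
    finally show "0 \<le> l i" using p unfolding psd_iff by (metis Re_complex_of_real)
  qed
next
  assume "\<forall>i<n. 0 \<le> l i"
  then show "psd_mat n (spec n U l)"
    using U unfolding psd_iff by (auto simp: spec_hermitian unitary_carrier qfc_spec intro!: sum_nonneg)
qed

lemma psd_obtain_spec:
  assumes "psd_mat n A"
  obtains U l where "unitary_mat n U" "A = spec n U l" "\<And>i. 0 \<le> l i"
proof -
  obtain U l where U: "unitary_mat n U" "A = spec n U l"
    using hermitian_spec assms unfolding psd_mat_def by blast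
  have "\<forall>i<n. 0 \<le> l i" using psd_spec_iff[OF U(1)] U(2) assms by blast
  then have "A = spec n U (\<lambda>i. max 0 (l i))" unfolding U(2) by (intro spec_cong) auto
  then show ?thesis using that[OF U(1), of "\<lambda>i. max 0 (l i)"] by auto
qed

lemma test_obtain_spec:
  assumes "is_test n E"
  obtains U e where "unitary_mat n U" "E = spec n U e" "\<And>i. 0 \<le> e i" "\<And>i. e i \<le> 1"
proof -
  have p: "psd_mat n E" "psd_mat n (1\<^sub>m n - E)" using assms by (auto simp: is_test_def)
  from p(1) obtain U l where U: "unitary_mat n U" "E = spec n U l" "\<And>i. 0 \<le> l i" by (rule psd_obtain_spec) auto
  have "1\<^sub>m n - E = spec n U (\<lambda>i. 1 - l i)"
    using U unitary_carrier[OF U(1)] by (simp add: spec_one[symmetric, OF U(1)] spec_diff)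
  then have "\<forall>i<n. l i \<le> 1" using p(2) psd_spec_iff[OF U(1)] by auto
  then have "E = spec n U (\<lambda>i. min 1 (l i))" unfolding U(2) by (intro spec_cong) auto
  then show ?thesis using that[OF U(1), of "\<lambda>i. min 1 (l i)"] U by auto
qed

lemma one_minus_spec: "unitary_mat n U \<Longrightarrow> 1\<^sub>m n - spec n U e = spec n U (\<lambda>i. 1 - e i)"
  by (simp add: spec_one[symmetric] spec_diff unitary_carrier)

lemma test_specI:
  assumes "unitary_mat n U" "\<And>i. i < n \<Longrightarrow> 0 \<le> e i" "\<And>i. i < n \<Longrightarrow> e i \<le> 1"
  shows "is_test n (spec n U e)"
  using assms by (simp add: is_test_def one_minus_spec psd_spec_iff)

lemma test_one_minus: "is_test n E \<Longrightarrow> is_test n (1\<^sub>m n - E)"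
  by (elim test_obtain_spec) (auto simp: one_minus_spec intro!: test_specI)

lemma psd_trace_nonneg:
  assumes "psd_mat n A" "psd_mat n B"
  shows "0 \<le> Re (mtrace (A * B))"
proof -
  from assms(1) obtain U a where "unitary_mat n U" "A = spec n U a" "\<And>i. 0 \<le> a i" by (rule psd_obtain_spec) auto
  moreover from assms(2) obtain V b where "unitary_mat n V" "B = spec n V b" "\<And>i. 0 \<le> b i" by (rule psd_obtain_spec) auto
  ultimately show ?thesis by (simp add: mtrace_spec_spec unitary_carrier sum_nonneg)
qed

lemma mtrace_add: "A \<in> carrier_mat n n \<Longrightarrow> B \<in> carrier_mat n n \<Longrightarrow> mtrace (A + B) = mtrace A + mtrace B"
  by (simp add: mtrace_def sum.distrib)

lemma mtrace_diff: "A \<in> carrier_mat n n \<Longrightarrow> B \<in> carrier_mat n n \<Longrightarrow> mtrace (A - B) = mtrace A - mtrace B"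
  by (simp add: mtrace_def sum_subtractf)

lemma mtrace_mult_diff_right:
  assumes "A \<in> carrier_mat n n" "B \<in> carrier_mat n n" "C \<in> carrier_mat n n"
  shows "mtrace (A * (B - C)) = mtrace (A * B) - mtrace (A * C)"
  using assms by (simp add: mult_minus_distrib_mat[of _ n n] mtrace_diff[of _ n])

lemma mtrace_mult_diff_left:
  assumes "A \<in> carrier_mat n n" "B \<in> carrier_mat n n" "C \<in> carrier_mat n n"
  shows "mtrace ((A - B) * C) = mtrace (A * C) - mtrace (B * C)"
  using assms by (simp add: minus_mult_distrib_mat[of _ n n] mtrace_diff[of _ n])

lemma mtrace_mult_one_minus:
  assumes "A \<in> carrier_mat n n" "E \<in> carrier_mat n n"
  shows "mtrace (A * (1\<^sub>m n - E)) = mtrace A - mtrace (A * E)"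
  using assms by (simp add: mtrace_mult_diff_right)

text \<open>The square of the Hilbert-Schmidt norm.\<close>

definition fro :: "nat \<Rightarrow> complex Matrix.mat \<Rightarrow> real" where
  "fro n M = (\<Sum>x<n. \<Sum>y<n. (cmod (M $$ (x, y)))\<^sup>2)"

lemma fro_hermitian:
  assumes "hermitian_mat n M"
  shows "mtrace (M * M) = of_real (fro n M)"
proof -
  have M: "M \<in> carrier_mat n n" using assms by (simp add: hermitian_mat_def)
  have "mtrace (M * M) = (\<Sum>x<n. \<Sum>y<n. M $$ (x, y) * cnj (M $$ (x, y)))"
    unfolding mtrace_mult[OF M M]
    by (intro sum.cong refl arg_cong2[of _ _ _ _ times] hermitian_index[OF assms]) auto
  then show ?thesis by (simp only: fro_def of_real_sum cmod_square_of_real)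
qed

text \<open>This identity serves twice: it shows that functions of a matrix do not depend on the
  chosen eigenbasis, and it lifts scalar Lipschitz bounds to matrices.\<close>

lemma fro_spec_diff:
  assumes U: "unitary_mat n U" and V: "unitary_mat n V"
  shows "fro n (spec n U a - spec n V b) = (\<Sum>i<n. \<Sum>j<n. (a i - b j)\<^sup>2 * ovl n U V i j)"
proof -
  let ?A = "spec n U a" and ?B = "spec n V b"
  have Uc: "U \<in> carrier_mat n n" and Vc: "V \<in> carrier_mat n n" using U V by (auto intro: unitary_carrier)
  have c: "?A \<in> carrier_mat n n" "?B \<in> carrier_mat n n" using Uc Vc by auto
  have h: "hermitian_mat n (?A - ?B)"
    using c spec_adjoint[OF Uc] spec_adjoint[OF Vc] by (simp add: hermitian_mat_def mat_adjoint_minus[OF c] minus_carrier_mat)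
  have "of_real (fro n (?A - ?B)) = mtrace ((?A - ?B) * (?A - ?B))" by (rule fro_hermitian[OF h, symmetric])
  also have "\<dots> = mtrace (?A * ?A) - mtrace (?A * ?B) - (mtrace (?B * ?A) - mtrace (?B * ?B))"
    using c by (simp add: mtrace_mult_diff_left[OF c minus_carrier_mat[OF c(2)]] mtrace_mult_diff_right[OF c(1) c]
      mtrace_mult_diff_right[OF c(2) c])
  also have "\<dots> = mtrace (?A * ?A) + mtrace (?B * ?B) - 2 * mtrace (?A * ?B)"
    using mtrace_mult_commute[OF c] by simp
  also have "\<dots> = of_real ((\<Sum>i<n. (a i)\<^sup>2) + (\<Sum>j<n. (b j)\<^sup>2) - 2 * (\<Sum>i<n. \<Sum>j<n. a i * b j * ovl n U V i j))"
    by (simp add: spec_mult U V mtrace_spec mtrace_spec_spec[OF Uc Vc] power2_eq_square)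
  also have "(\<Sum>i<n. (a i)\<^sup>2) = (\<Sum>i<n. \<Sum>j<n. (a i)\<^sup>2 * ovl n U V i j)"
    by (intro sum.cong refl) (simp add: sum_distrib_left[symmetric] ovl_sum_right[OF U V])
  also have "(\<Sum>j<n. (b j)\<^sup>2) = (\<Sum>j<n. \<Sum>i<n. (b j)\<^sup>2 * ovl n U V i j)"
    by (intro sum.cong refl) (simp add: sum_distrib_left[symmetric] ovl_sum_left[OF U V])
  also have "\<dots> = (\<Sum>i<n. \<Sum>j<n. (b j)\<^sup>2 * ovl n U V i j)" by (rule sum.swap)
  finally have "fro n (?A - ?B) = (\<Sum>i<n. \<Sum>j<n. (a i)\<^sup>2 * ovl n U V i j) + (\<Sum>i<n. \<Sum>j<n. (b j)\<^sup>2 * ovl n U V i j) - 2 * (\<Sum>i<n. \<Sum>j<n. a i * b j * ovl n U V i j)"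
    by (simp only: of_real_eq_iff)
  also have "\<dots> = (\<Sum>i<n. \<Sum>j<n. (a i - b j)\<^sup>2 * ovl n U V i j)"
    unfolding sum_distrib_left sum.distrib[symmetric] sum_subtractf[symmetric]
    by (intro sum.cong refl) (simp add: power2_eq_square algebra_simps)
  finally show ?thesis .
qed

lemma fro_eq_0: "A \<in> carrier_mat n n \<Longrightarrow> B \<in> carrier_mat n n \<Longrightarrow> fro n (A - B) = 0 \<Longrightarrow> A = B"
  by (intro eq_matI) (auto simp: fro_def sum_nonneg_eq_0_iff sum_nonneg)

text \<open>Equal matrices have distance 0, so a positive overlap forces \<open>a i = b j\<close>
  and hence \<open>f (a i) = f (b j)\<close>. The distance after applying \<open>f\<close> is then 0
  as well.\<close>

lemma spec_fun_unique:
  assumes U: "unitary_mat n U" and V: "unitary_mat n V" and eq: "spec n U a = spec n V b"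
  shows "spec n U (\<lambda>i. f (a i)) = spec n V (\<lambda>i. f (b i))"
proof (rule fro_eq_0)
  have "fro n (spec n U a - spec n V b) = 0"
    unfolding eq using unitary_carrier[OF V] spec_carrier[of V n b] by (simp add: fro_def)
  then have "(\<Sum>i<n. \<Sum>j<n. (a i - b j)\<^sup>2 * ovl n U V i j) = 0" by (simp add: fro_spec_diff[OF U V])
  then have "\<And>i j. i < n \<Longrightarrow> j < n \<Longrightarrow> (a i - b j)\<^sup>2 * ovl n U V i j = 0"
    by (simp add: sum_nonneg_eq_0_iff sum_nonneg)
  then have "\<And>i j. i < n \<Longrightarrow> j < n \<Longrightarrow> (f (a i) - f (b j))\<^sup>2 * ovl n U V i j = 0" by fastforce
  then show "fro n (spec n U (\<lambda>i. f (a i)) - spec n V (\<lambda>i. f (b i))) = 0"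
    unfolding fro_spec_diff[OF U V] by (intro sum.neutral ballI) auto
qed (use unitary_carrier[OF U] unitary_carrier[OF V] in auto)

text \<open>Removes the arbitrary choice inside \<open>herm_decomp\<close>: from here on any
  eigenbasis at hand may be used.\<close>

lemma mat_fun_spec:
  assumes U: "unitary_mat n U"
  shows "mat_fun n f (spec n U l) = spec n U (\<lambda>i. f (l i))"
proof -
  have "\<exists>p. case p of (V, m) \<Rightarrow> unitary_mat n V \<and> spec n U l = V * diag_of n m * mat_adjoint V"
    using U by (intro exI[of _ "(U, l)"]) (simp add: spec_def)
  from someI_ex[OF this] obtain V m where d: "herm_decomp n (spec n U l) = (V, m)"
      and V: "unitary_mat n V" "spec n U l = spec n V m"
    unfolding herm_decomp_def spec_def by (cases "SOME (V, m). unitary_mat n V \<and> U * diag_of n l * mat_adjoint U = V * diag_of n m * mat_adjoint V") auto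
  have "mat_fun n f (spec n U l) = spec n V (\<lambda>i. f (m i))"
    unfolding mat_fun_def d by (simp add: spec_def comp_def)
  then show ?thesis using spec_fun_unique[OF U V] by simp
qed

lemma density_obtain_spec:
  assumes "density_mat n A"
  obtains U l where "unitary_mat n U" "A = spec n U l" "\<And>i. 0 \<le> l i" "(\<Sum>i<n. l i) = 1"
proof -
  from assms obtain U l where U: "unitary_mat n U" "A = spec n U l" "\<And>i. 0 \<le> l i"
    by (auto simp: density_mat_def elim: psd_obtain_spec)
  then have "complex_of_real (\<Sum>i<n. l i) = 1" using assms mtrace_spec[OF U(1), of l] by (simp add: density_mat_def)
  then show ?thesis using that U by (simp only: of_real_eq_1_iff)
qed

lemma density_carrier: "density_mat n A \<Longrightarrow> A \<in> carrier_mat n n"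
  by (simp add: density_mat_def psd_carrier)

section \<open>Relative entropy and the converse bound\<close>

definition ip :: "nat \<Rightarrow> (nat \<Rightarrow> complex) \<Rightarrow> (nat \<Rightarrow> complex) \<Rightarrow> complex" where
  "ip n u v = (\<Sum>x<n. cnj (u x) * v x)"

definition app :: "nat \<Rightarrow> complex Matrix.mat \<Rightarrow> (nat \<Rightarrow> complex) \<Rightarrow> nat \<Rightarrow> complex" where
  "app n M v x = (\<Sum>y<n. M $$ (x, y) * v y)"

abbreviation colf :: "complex Matrix.mat \<Rightarrow> nat \<Rightarrow> nat \<Rightarrow> complex" where
  "colf U i \<equiv> (\<lambda>x. U $$ (x, i))"

lemma ovl_ip: "ovl n U V i j = (cmod (ip n (colf U i) (colf V j)))\<^sup>2"
  by (simp add: ovl_def ip_def)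

lemma ip_cnj: "cnj (ip n u v) = ip n v u"
  by (simp add: ip_def mult.commute)

lemma ip_cmod_commute: "cmod (ip n u v) = cmod (ip n v u)"
  by (metis complex_mod_cnj ip_cnj)

lemma qfc_ip: "qfc n M v = ip n v (app n M v)"
  by (simp add: qfc_def ip_def app_def sum_distrib_left mult.assoc)

lemma ip_self: "ip n v v = of_real (\<Sum>x<n. (cmod (v x))\<^sup>2)"
  by (simp only: ip_def of_real_sum cmod_square_of_real mult.commute)

lemma qfc_spec_ip:
  "V \<in> carrier_mat n n \<Longrightarrow> qfc n (spec n V b) v = of_real (\<Sum>j<n. b j * (cmod (ip n (colf V j) v))\<^sup>2)"
  unfolding qfc_spec ip_cmod_commute[of n _ v] by (simp add: ip_def)

lemma parseval_ip: "unitary_mat n V \<Longrightarrow> (\<Sum>j<n. (cmod (ip n (colf V j) w))\<^sup>2) = (\<Sum>x<n. (cmod (w x))\<^sup>2)"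
  using parseval by (simp add: ip_def)

lemma app_spec:
  assumes "U \<in> carrier_mat n n" "x < n"
  shows "app n (spec n U l) v x = (\<Sum>i<n. U $$ (x, i) * (of_real (l i) * ip n (colf U i) v))"
proof -
  have "app n (spec n U l) v x = (\<Sum>y<n. \<Sum>i<n. U $$ (x, i) * (of_real (l i) * (cnj (U $$ (y, i)) * v y)))"
    using assms by (simp add: app_def spec_index sum_distrib_right) (simp add: mult_ac)
  also have "\<dots> = (\<Sum>i<n. \<Sum>y<n. U $$ (x, i) * (of_real (l i) * (cnj (U $$ (y, i)) * v y)))" by (rule sum.swap)
  finally show ?thesis by (simp add: ip_def sum_distrib_left)
qed

lemma ip_sum_right: "ip n u (\<lambda>x. \<Sum>i\<in>I. f i x) = (\<Sum>i\<in>I. ip n u (f i))"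
proof -
  have "ip n u (\<lambda>x. \<Sum>i\<in>I. f i x) = (\<Sum>x<n. \<Sum>i\<in>I. cnj (u x) * f i x)" by (simp add: ip_def sum_distrib_left)
  also have "\<dots> = (\<Sum>i\<in>I. \<Sum>x<n. cnj (u x) * f i x)" by (rule sum.swap)
  finally show ?thesis by (simp add: ip_def)
qed

lemma ip_scale_right: "ip n u (\<lambda>x. v x * c) = ip n u v * c"
  by (simp add: ip_def sum_distrib_right mult.assoc)

lemma ip_cong: "(\<And>x. x < n \<Longrightarrow> u x = u' x) \<Longrightarrow> (\<And>x. x < n \<Longrightarrow> v x = v' x) \<Longrightarrow> ip n u v = ip n u' v'"
  by (simp add: ip_def)

lemma ip_col_app_spec:
  assumes U: "unitary_mat n U" and k: "k < n"
  shows "ip n (colf U k) (app n (spec n U l) v) = of_real (l k) * ip n (colf U k) v"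
proof -
  have "ip n (colf U k) (app n (spec n U l) v)
      = ip n (colf U k) (\<lambda>x. \<Sum>i<n. U $$ (x, i) * (of_real (l i) * ip n (colf U i) v))"
    by (rule ip_cong) (simp_all add: app_spec unitary_carrier[OF U])
  also have "\<dots> = (\<Sum>i<n. ip n (colf U k) (colf U i) * (of_real (l i) * ip n (colf U i) v))"
    by (simp add: ip_sum_right ip_scale_right)
  also have "\<dots> = (\<Sum>i<n. if k = i then of_real (l i) * ip n (colf U i) v else 0)"
    using k by (intro sum.cong refl) (simp add: ip_def unitary_cols[OF U])
  finally show ?thesis using k by simp
qed

lemma app_spec_col:
  assumes V: "unitary_mat n V" and "x < n" "j < n"
  shows "app n (spec n V s) (colf V j) x = of_real (s j) * V $$ (x, j)"
proof -
  have "app n (spec n V s) (colf V j) x = (\<Sum>i<n. if i = j then V $$ (x, i) * of_real (s i) else 0)"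
    unfolding app_spec[OF unitary_carrier[OF V] assms(2)] ip_def
    using assms(3) by (intro sum.cong refl) (simp add: unitary_cols[OF V])
  then show ?thesis using assms(3) by simp
qed

lemma col_expansion:
  assumes V: "unitary_mat n V" and y: "y < n"
  shows "v y = (\<Sum>j<n. V $$ (y, j) * ip n (colf V j) v)"
proof -
  have "(\<Sum>j<n. V $$ (y, j) * ip n (colf V j) v) = app n (spec n V (\<lambda>_. 1)) v y"
    using app_spec[OF unitary_carrier[OF V] y, of "\<lambda>_. 1" v] by simp
  also have "\<dots> = (\<Sum>z<n. if y = z then v z else 0)"
    unfolding spec_one[OF V] app_def using y by (intro sum.cong refl) auto
  finally show ?thesis using y by simp
qed

lemma ip_expansion:
  assumes V: "unitary_mat n V"
  shows "ip n u v = (\<Sum>j<n. ip n u (colf V j) * ip n (colf V j) v)"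
proof -
  have "ip n u v = ip n u (\<lambda>x. \<Sum>j<n. V $$ (x, j) * ip n (colf V j) v)"
    by (rule ip_cong) (simp_all add: col_expansion[OF V, symmetric])
  then show ?thesis by (simp add: ip_sum_right ip_scale_right)
qed

text \<open>For states this is the classical relative entropy of the distributions
  \<open>r i * ovl n U V i j\<close> and \<open>s j * ovl n U V i j\<close>, provided that the first
  is absolutely continuous with respect to the second.\<close>

definition rel_val :: "nat \<Rightarrow> complex Matrix.mat \<Rightarrow> (nat \<Rightarrow> real) \<Rightarrow> complex Matrix.mat \<Rightarrow> (nat \<Rightarrow> real) \<Rightarrow> real" where
  "rel_val n U r V s = (\<Sum>i<n. r i * log_supp (r i)) - (\<Sum>i<n. \<Sum>j<n. r i * log_supp (s j) * ovl n U V i j)"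

text \<open>Inclusion of kernels becomes absolute continuity of the overlap distributions. One
  direction tests the inclusion on the columns of \<open>V\<close> with eigenvalue 0, the other
  expands a kernel vector in the basis \<open>V\<close>.\<close>

lemma support_iff:
  assumes U: "unitary_mat n U" and V: "unitary_mat n V" and r: "\<And>i. 0 \<le> r i" and s: "\<And>i. 0 \<le> s i"
  shows "(\<forall>v \<in> carrier_vec n. spec n V s *\<^sub>v v = 0\<^sub>v n \<longrightarrow> spec n U r *\<^sub>v v = 0\<^sub>v n) \<longleftrightarrow>
    (\<forall>i<n. \<forall>j<n. s j = 0 \<longrightarrow> r i * ovl n U V i j = 0)"
proof
  have Uc: "U \<in> carrier_mat n n" and Vc: "V \<in> carrier_mat n n" using U V by (auto intro: unitary_carrier)
  have z: "M *\<^sub>v v = 0\<^sub>v n \<longleftrightarrow> (\<forall>x<n. app n M (($) v) x = 0)" if "M \<in> carrier_mat n n" "v \<in> carrier_vec n" for M v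
  proof
    assume "M *\<^sub>v v = 0\<^sub>v n"
    then show "\<forall>x<n. app n M (($) v) x = 0" using mult_vec_index[OF that] by (simp add: app_def)
  next
    assume "\<forall>x<n. app n M (($) v) x = 0"
    then show "M *\<^sub>v v = 0\<^sub>v n" using that mult_vec_index[OF that] by (intro eq_vecI) (auto simp: app_def)
  qed
  {
    assume a: "\<forall>v \<in> carrier_vec n. spec n V s *\<^sub>v v = 0\<^sub>v n \<longrightarrow> spec n U r *\<^sub>v v = 0\<^sub>v n"
    show "\<forall>i<n. \<forall>j<n. s j = 0 \<longrightarrow> r i * ovl n U V i j = 0"
    proof (intro allI impI)
      fix i j assume ij: "i < n" "j < n" "s j = 0"
      let ?v = "Matrix.vec n (colf V j)"
      have eq: "app n M (($) ?v) x = app n M (colf V j) x" for M x by (simp add: app_def)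
      have "spec n V s *\<^sub>v ?v = 0\<^sub>v n"
        using ij by (subst z) (auto simp: eq app_spec_col[OF V] Vc)
      then have "spec n U r *\<^sub>v ?v = 0\<^sub>v n" using a by auto
      then have "\<forall>x<n. app n (spec n U r) (colf V j) x = 0" using z[of "spec n U r" ?v] Uc by (auto simp: eq)
      then have "qfc n (spec n U r) (colf V j) = 0" by (simp add: qfc_ip ip_def)
      then have "(\<Sum>i<n. r i * ovl n V U j i) = 0" by (simp add: qfc_spec_col[OF Uc] del: of_real_sum)
      then show "r i * ovl n U V i j = 0"
        using ij r by (subst (asm) sum_nonneg_eq_0_iff) (auto simp: ovl_commute[of n U])
    qed
  next
    assume a: "\<forall>i<n. \<forall>j<n. s j = 0 \<longrightarrow> r i * ovl n U V i j = 0"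
    show "\<forall>v \<in> carrier_vec n. spec n V s *\<^sub>v v = 0\<^sub>v n \<longrightarrow> spec n U r *\<^sub>v v = 0\<^sub>v n"
    proof (intro ballI impI)
      fix v :: "complex Matrix.vec" assume v: "v \<in> carrier_vec n" and sv: "spec n V s *\<^sub>v v = 0\<^sub>v n"
      let ?v = "($) v"
      have "\<forall>x<n. app n (spec n V s) ?v x = 0" using sv z[of "spec n V s" v] v Vc by auto
      then have "qfc n (spec n V s) ?v = 0" by (simp add: qfc_ip ip_def)
      then have "(\<Sum>j<n. s j * (cmod (ip n (colf V j) ?v))\<^sup>2) = 0" by (simp add: qfc_spec_ip[OF Vc] del: of_real_sum)
      then have j0: "s j = 0 \<or> ip n (colf V j) ?v = 0" if "j < n" for j
        using that s by (subst (asm) sum_nonneg_eq_0_iff) auto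
      have "of_real (r i) * ip n (colf U i) ?v = 0" if i: "i < n" for i
      proof -
        have "of_real (r i) * ip n (colf U i) ?v = (\<Sum>j<n. of_real (r i) * (ip n (colf U i) (colf V j) * ip n (colf V j) ?v))"
          by (subst ip_expansion[OF V]) (simp add: sum_distrib_left)
        also have "\<dots> = 0"
        proof (rule sum.neutral, rule ballI)
          fix j assume "j \<in> {..<n}"
          then show "complex_of_real (r i) * (ip n (colf U i) (colf V j) * ip n (colf V j) ?v) = 0"
            using j0[of j] a i by (auto simp: ovl_ip)
        qed
        finally show ?thesis .
      qed
      then show "spec n U r *\<^sub>v v = 0\<^sub>v n"
        using v Uc by (subst z) (auto simp: app_spec intro!: sum.neutral)
    qed
  }
qed

lemma mtrace_spec_log:
  assumes U: "unitary_mat n U" and V: "unitary_mat n V"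
  shows "Re (mtrace (spec n U r * (mat_fun n log_supp (spec n U r) - mat_fun n log_supp (spec n V s)))) = rel_val n U r V s"
proof -
  have Uc: "U \<in> carrier_mat n n" and Vc: "V \<in> carrier_mat n n" using U V by (auto intro: unitary_carrier)
  show ?thesis
    unfolding mat_fun_spec[OF U] mat_fun_spec[OF V] mtrace_mult_diff_right[OF spec_carrier[OF Uc] spec_carrier[OF Uc] spec_carrier[OF Vc]]
      spec_mult[OF U] mtrace_spec[OF U] mtrace_spec_spec[OF Uc Vc] rel_val_def by simp
qed

lemma rel_ent_spec:
  assumes U: "unitary_mat n U" and V: "unitary_mat n V" and r: "\<And>i. 0 \<le> r i" and s: "\<And>i. 0 \<le> s i"
  shows "rel_ent n (spec n U r) (spec n V s) =
    (if \<forall>i<n. \<forall>j<n. s j = 0 \<longrightarrow> r i * ovl n U V i j = 0 then ereal (rel_val n U r V s) else \<infinity>)"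
  unfolding rel_ent_def support_iff[OF assms] mtrace_spec_log[OF U V] ..

lemma mult_ln_diff_ge:
  assumes "0 < a" "0 < b" shows "a * (ln a - ln b) \<ge> a - (b::real)"
proof -
  have "ln (b / a) \<le> b / a - 1" using assms by (intro ln_le_minus_one) auto
  then have "ln b - ln a \<le> b / a - 1" using assms by (simp add: ln_div)
  then have "a * (ln b - ln a) \<le> a * (b / a - 1)" using assms by (intro mult_left_mono) auto
  then show ?thesis using assms by (simp add: algebra_simps)
qed

lemma sum_ovl_weights:
  assumes U: "unitary_mat n U" and V: "unitary_mat n V"
  shows "(\<Sum>i<n. \<Sum>j<n. r i * ovl n U V i j) = (\<Sum>i<n. r i)" "(\<Sum>i<n. \<Sum>j<n. s j * ovl n U V i j) = (\<Sum>j<n. s j)"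
proof -
  show "(\<Sum>i<n. \<Sum>j<n. r i * ovl n U V i j) = (\<Sum>i<n. r i)"
    by (intro sum.cong refl) (simp add: sum_distrib_left[symmetric] ovl_sum_right[OF U V])
  have "(\<Sum>i<n. \<Sum>j<n. s j * ovl n U V i j) = (\<Sum>j<n. \<Sum>i<n. s j * ovl n U V i j)" by (rule sum.swap)
  also have "\<dots> = (\<Sum>j<n. s j)"
    by (intro sum.cong refl) (simp add: sum_distrib_left[symmetric] ovl_sum_left[OF U V])
  finally show "(\<Sum>i<n. \<Sum>j<n. s j * ovl n U V i j) = (\<Sum>j<n. s j)" .
qed

text \<open>Klein's inequality, by averaging a (ln a - ln b) >= a - b over the overlap weights.
  Strict positivity of \<open>s\<close> matters because \<open>log_supp\<close> has value 0 at 0,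
  where the true contribution could be infinite.\<close>

lemma klein_spec:
  assumes U: "unitary_mat n U" and V: "unitary_mat n V" and r: "\<And>i. i < n \<Longrightarrow> 0 \<le> r i" and s: "\<And>i. i < n \<Longrightarrow> 0 < s i"
    and tr: "(\<Sum>i<n. r i) = (\<Sum>i<n. s i)"
  shows "(\<Sum>i<n. \<Sum>j<n. r i * log_supp (s j) * ovl n U V i j) \<le> (\<Sum>i<n. r i * log_supp (r i))"
proof -
  have "0 = (\<Sum>i<n. \<Sum>j<n. r i * ovl n U V i j) - (\<Sum>i<n. \<Sum>j<n. s j * ovl n U V i j)"
    by (simp add: sum_ovl_weights[OF U V] tr)
  also have "\<dots> = (\<Sum>i<n. \<Sum>j<n. (r i - s j) * ovl n U V i j)"
    by (simp add: sum_subtractf[symmetric] algebra_simps)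
  also have "\<dots> \<le> (\<Sum>i<n. \<Sum>j<n. r i * (log_supp (r i) - log_supp (s j)) * ovl n U V i j)"
  proof (intro sum_mono mult_right_mono)
    fix i j assume "i \<in> {..<n}" "j \<in> {..<n}"
    then show "r i - s j \<le> r i * (log_supp (r i) - log_supp (s j))"
      using r[of i] s[of j] mult_ln_diff_ge[of "r i" "s j"] by (cases "r i = 0") (auto simp: log_supp_def)
  qed auto
  also have "\<dots> = (\<Sum>i<n. \<Sum>j<n. r i * log_supp (r i) * ovl n U V i j) - (\<Sum>i<n. \<Sum>j<n. r i * log_supp (s j) * ovl n U V i j)"
    by (simp add: sum_subtractf[symmetric] algebra_simps)
  finally show ?thesis by (simp add: sum_ovl_weights[OF U V])
qed

text \<open>The square of a test is below the test, since its eigenvalues lie in [0, 1].\<close>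

lemma test_sq_le:
  assumes "is_test n F"
  shows "(\<Sum>x<n. (cmod (app n F u x))\<^sup>2) \<le> Re (qfc n F u)"
proof -
  from assms obtain Y f where Y: "unitary_mat n Y" "F = spec n Y f" "\<And>i. 0 \<le> f i" "\<And>i. f i \<le> 1" by (rule test_obtain_spec) auto
  have "(\<Sum>x<n. (cmod (app n F u x))\<^sup>2) = (\<Sum>j<n. (cmod (ip n (colf Y j) (app n F u)))\<^sup>2)"
    by (simp add: parseval_ip[OF Y(1)])
  also have "\<dots> = (\<Sum>j<n. (f j)\<^sup>2 * (cmod (ip n (colf Y j) u))\<^sup>2)"
    by (intro sum.cong refl) (simp add: Y(2) ip_col_app_spec[OF Y(1)] norm_mult power_mult_distrib)
  also have "\<dots> \<le> (\<Sum>j<n. f j * (cmod (ip n (colf Y j) u))\<^sup>2)"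
    using Y(3,4) by (intro sum_mono mult_right_mono) (simp_all add: power2_eq_square mult_left_le)
  also have "\<dots> = Re (qfc n F u)" by (simp add: Y(2) qfc_spec_ip[OF unitary_carrier[OF Y(1)]])
  finally show ?thesis .
qed

lemma ip_app_hermitian:
  assumes "hermitian_mat n E" shows "ip n u (app n E v) = cnj (ip n v (app n E u))"
proof -
  have "ip n u (app n E v) = (\<Sum>x<n. \<Sum>y<n. cnj (u x) * E $$ (x, y) * v y)"
    by (simp add: ip_def app_def sum_distrib_left mult.assoc)
  also have "\<dots> = (\<Sum>x<n. \<Sum>y<n. v y * cnj (E $$ (y, x)) * cnj (u x))"
    by (intro sum.cong refl, subst hermitian_index[OF assms]) auto
  also have "\<dots> = (\<Sum>y<n. \<Sum>x<n. v y * cnj (E $$ (y, x)) * cnj (u x))" by (rule sum.swap)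
  also have "\<dots> = cnj (ip n v (app n E u))" by (simp add: ip_def app_def sum_distrib_left mult.assoc)
  finally show ?thesis .
qed

lemma Re_mtrace_spec_mult:
  "U \<in> carrier_mat n n \<Longrightarrow> M \<in> carrier_mat n n \<Longrightarrow> Re (mtrace (spec n U a * M)) = (\<Sum>i<n. a i * Re (qfc n M (colf U i)))"
  by (simp add: mtrace_spec_mult)

lemma app_one_minus:
  assumes "E \<in> carrier_mat n n" "x < n"
  shows "app n (1\<^sub>m n - E) u x + app n E u x = u x"
proof -
  have "app n (1\<^sub>m n - E) u x + app n E u x = (\<Sum>y<n. if x = y then u y else 0)"
    unfolding app_def sum.distrib[symmetric] using assms by (intro sum.cong refl) (auto simp: algebra_simps)
  then show ?thesis using assms by simp
qed

lemma is_test_carrier: "is_test n E \<Longrightarrow> E \<in> carrier_mat n n"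
  by (simp add: is_test_def psd_carrier)

lemma norm_sq_sum_le: "(cmod (a + b))\<^sup>2 \<le> 2 * ((cmod a)\<^sup>2 + (cmod b)\<^sup>2)"
proof -
  have "(cmod (a + b))\<^sup>2 \<le> (cmod a + cmod b)\<^sup>2" by (intro power_mono norm_triangle_ineq) auto
  also have "\<dots> \<le> 2 * ((cmod a)\<^sup>2 + (cmod b)\<^sup>2)" using sum_squares_bound[of "cmod a" "cmod b"] by (simp add: power2_sum)
  finally show ?thesis .
qed

text \<open>The Nussbaum--Szkola bound: testing \<open>\<rho>\<close> against \<open>\<sigma>\<close> is at least half as hard as testing the
  classical distributions \<open>r\<^sub>i |\<langle>u\<^sub>i,v\<^sub>j\<rangle>|\<^sup>2\<close> and \<open>s\<^sub>j |\<langle>u\<^sub>i,v\<^sub>j\<rangle>|\<^sup>2\<close>.\<close>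
lemma nussbaum_szkola:
  assumes U: "unitary_mat n U" and V: "unitary_mat n V" and r: "\<And>i. 0 \<le> r i" and s: "\<And>i. 0 \<le> s i"
    and E: "is_test n E" and l: "0 \<le> l"
  shows "(\<Sum>i<n. \<Sum>j<n. min (r i) (l * s j) * ovl n U V i j) / 2
    \<le> Re (mtrace (spec n U r * (1\<^sub>m n - E))) + l * Re (mtrace (spec n V s * E))"
proof -
  let ?F = "1\<^sub>m n - E"
  have Ec: "E \<in> carrier_mat n n" and Fc: "?F \<in> carrier_mat n n" using is_test_carrier[OF E] by auto
  have Eh: "hermitian_mat n E" using E by (simp add: is_test_def psd_mat_def)
  \<comment> \<open>The identity is split as (1 - E) + E, so the overlap amplitude is
    \<open>a i j + b i j\<close>. The factor 1/2 of the bound comes from |a + b|^2 <= 2 (|a|^2 +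
    |b|^2).\<close>
  define a where "a i j = ip n (colf V j) (app n ?F (colf U i))" for i j
  define b where "b i j = ip n (colf V j) (app n E (colf U i))" for i j
  have ab: "a i j + b i j = ip n (colf V j) (colf U i)" for i j
    unfolding a_def b_def ip_def sum.distrib[symmetric]
    by (intro sum.cong refl) (simp add: distrib_left[symmetric] app_one_minus[OF Ec])
  have ov: "ovl n U V i j \<le> 2 * ((cmod (a i j))\<^sup>2 + (cmod (b i j))\<^sup>2)" for i j
    unfolding ovl_ip ip_cmod_commute[of n "colf U i"] ab[symmetric] by (rule norm_sq_sum_le)
  have A: "(\<Sum>i<n. \<Sum>j<n. r i * (cmod (a i j))\<^sup>2) \<le> Re (mtrace (spec n U r * ?F))"
    unfolding Re_mtrace_spec_mult[OF unitary_carrier[OF U] Fc] sum_distrib_left[symmetric] a_def parseval_ip[OF V]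
    using test_sq_le[OF test_one_minus[OF E]] r by (intro sum_mono mult_left_mono) auto
  have "(\<Sum>j<n. s j * (\<Sum>i<n. (cmod (b i j))\<^sup>2)) \<le> Re (mtrace (spec n V s * E))"
  proof -
    have b': "cmod (b i j) = cmod (ip n (colf U i) (app n E (colf V j)))" for i j
      unfolding b_def by (subst ip_app_hermitian[OF Eh]) simp
    show ?thesis
      unfolding Re_mtrace_spec_mult[OF unitary_carrier[OF V] Ec] b' parseval_ip[OF U]
      using test_sq_le[OF E] s by (intro sum_mono mult_left_mono) auto
  qed
  moreover have "(\<Sum>i<n. \<Sum>j<n. s j * (cmod (b i j))\<^sup>2) = (\<Sum>j<n. s j * (\<Sum>i<n. (cmod (b i j))\<^sup>2))"
    by (subst sum.swap) (simp add: sum_distrib_left)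
  ultimately have B: "l * (\<Sum>i<n. \<Sum>j<n. s j * (cmod (b i j))\<^sup>2) \<le> l * Re (mtrace (spec n V s * E))"
    using l by (simp add: mult_left_mono)
  have "(\<Sum>i<n. \<Sum>j<n. min (r i) (l * s j) * ovl n U V i j) / 2
     \<le> (\<Sum>i<n. \<Sum>j<n. r i * (cmod (a i j))\<^sup>2 + l * (s j * (cmod (b i j))\<^sup>2))"
    unfolding sum_divide_distrib
  proof (intro sum_mono)
    fix i j
    have m: "0 \<le> min (r i) (l * s j)" using r s l by auto
    have "min (r i) (l * s j) * ovl n U V i j / 2 \<le> min (r i) (l * s j) * ((cmod (a i j))\<^sup>2 + (cmod (b i j))\<^sup>2)"
      using mult_left_mono[OF ov m, of i j] by (simp add: algebra_simps)
    also have "\<dots> \<le> r i * (cmod (a i j))\<^sup>2 + (l * s j) * (cmod (b i j))\<^sup>2"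
      unfolding distrib_left by (intro add_mono mult_right_mono) auto
    finally show "min (r i) (l * s j) * ovl n U V i j / 2 \<le> r i * (cmod (a i j))\<^sup>2 + l * (s j * (cmod (b i j))\<^sup>2)"
      by (simp add: mult.assoc)
  qed
  also have "\<dots> = (\<Sum>i<n. \<Sum>j<n. r i * (cmod (a i j))\<^sup>2) + l * (\<Sum>i<n. \<Sum>j<n. s j * (cmod (b i j))\<^sup>2)"
    by (simp add: sum.distrib sum_distrib_left)
  finally show ?thesis using A B by linarith
qed

text \<open>A Markov argument for the log-likelihood ratio: a relative entropy of at most
  \<open>D\<close> leaves mass at most (D + 1) / ln l where \<open>r i > l * s j\<close>. On the
  rest \<open>min (r i) (l * s j)\<close> equals \<open>r i\<close>, and the Nussbaum-Szkola bound
  applies. The summand 1 pays for the negative part of the logarithms, which is at most the total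
  mass of \<open>s\<close>.\<close>

theorem rel_ent_converse:
  assumes rho: "density_mat n \<rho>" and sig: "density_mat n \<sigma>" and E: "is_test n E"
    and e: "Re (mtrace (\<rho> * (1\<^sub>m n - E))) \<le> e" and b: "Re (mtrace (\<sigma> * E)) \<le> b"
    and D: "rel_ent n \<rho> \<sigma> \<le> ereal D" and l: "1 < l"
  shows "(1 - (D + 1) / ln l) / 2 \<le> e + l * b"
proof -
  from rho obtain U r where U: "unitary_mat n U" "\<rho> = spec n U r" and r: "\<And>i. 0 \<le> r i" "(\<Sum>i<n. r i) = 1"
    by (rule density_obtain_spec) auto
  from sig obtain V s where V: "unitary_mat n V" "\<sigma> = spec n V s" and s: "\<And>i. 0 \<le> s i" "(\<Sum>i<n. s i) = 1"
    by (rule density_obtain_spec) auto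
  let ?o = "ovl n U V"
  have cond: "\<forall>i<n. \<forall>j<n. s j = 0 \<longrightarrow> r i * ?o i j = 0" and Dv: "rel_val n U r V s \<le> D"
    using D unfolding U(2) V(2) rel_ent_spec[OF U(1) V(1) r(1) s(1)] by (auto split: if_splits)
  have lnl: "0 < ln l" using l by simp
  \<comment> \<open>The mass of the pairs whose likelihood ratio exceeds \<open>l\<close>.\<close>
  define bad where "bad i j = (if r i > l * s j then r i * ?o i j else 0)" for i j
  have "(\<Sum>i<n. \<Sum>j<n. ln l * bad i j - s j * ?o i j) \<le> (\<Sum>i<n. \<Sum>j<n. r i * (log_supp (r i) - log_supp (s j)) * ?o i j)"
  proof (intro sum_mono)
    fix i j assume ij: "i \<in> {..<n}" "j \<in> {..<n}"
    show "ln l * bad i j - s j * ?o i j \<le> r i * (log_supp (r i) - log_supp (s j)) * ?o i j"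
    proof (cases "r i * ?o i j = 0")
      case True
      have "0 \<le> s j * ?o i j" using s by simp
      then show ?thesis using True by (auto simp: bad_def)
    next
      case False
      then have pos: "r i > 0" "?o i j > 0" "s j > 0" using cond ij r(1)[of i] s(1)[of j] ovl_nonneg[of n U V i j]
        by (auto simp: less_le)
      have ls: "log_supp (r i) = ln (r i)" "log_supp (s j) = ln (s j)" using pos by (auto simp: log_supp_def)
      show ?thesis
      proof (cases "r i > l * s j")
        case True
        have "ln (l * s j) \<le> ln (r i)" using True pos l by (subst ln_le_cancel_iff) auto
        then have "ln l \<le> ln (r i) - ln (s j)" using pos l by (simp add: ln_mult)
        then have "ln l * (r i * ?o i j) \<le> (ln (r i) - ln (s j)) * (r i * ?o i j)"
          using pos by (intro mult_right_mono) auto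
        moreover have "0 \<le> s j * ?o i j" using s by simp
        ultimately show ?thesis using True unfolding ls bad_def by (simp add: algebra_simps)
      next
        case f: False
        have "- s j \<le> r i * (ln (r i) - ln (s j))" using mult_ln_diff_ge[OF pos(1,3)] pos by linarith
        then have "- s j * ?o i j \<le> r i * (ln (r i) - ln (s j)) * ?o i j" using pos by (intro mult_right_mono) auto
        then show ?thesis using f unfolding ls bad_def by simp
      qed
    qed
  qed
  also have "\<dots> = (\<Sum>i<n. \<Sum>j<n. r i * log_supp (r i) * ?o i j) - (\<Sum>i<n. \<Sum>j<n. r i * log_supp (s j) * ?o i j)"
    by (simp add: sum_subtractf[symmetric] algebra_simps)
  also have "\<dots> = rel_val n U r V s" by (simp add: rel_val_def sum_ovl_weights[OF U(1) V(1)])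
  also have "\<dots> \<le> D" by (rule Dv)
  also have "(\<Sum>i<n. \<Sum>j<n. ln l * bad i j - s j * ?o i j) = ln l * (\<Sum>i<n. \<Sum>j<n. bad i j) - (\<Sum>i<n. \<Sum>j<n. s j * ?o i j)"
    by (simp add: sum_subtractf sum_distrib_left)
  finally have "ln l * (\<Sum>i<n. \<Sum>j<n. bad i j) \<le> D + 1" by (simp add: sum_ovl_weights[OF U(1) V(1)] s)
  then have B: "(\<Sum>i<n. \<Sum>j<n. bad i j) \<le> (D + 1) / ln l" using lnl by (simp add: field_simps)
  have "1 - (\<Sum>i<n. \<Sum>j<n. bad i j) = (\<Sum>i<n. \<Sum>j<n. r i * ?o i j - bad i j)"
    by (simp add: sum_subtractf sum_ovl_weights[OF U(1) V(1)] r)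
  also have "\<dots> \<le> (\<Sum>i<n. \<Sum>j<n. min (r i) (l * s j) * ?o i j)"
    using r s l by (intro sum_mono) (auto simp: bad_def min_def)
  finally have "(1 - (D + 1) / ln l) / 2 \<le> (\<Sum>i<n. \<Sum>j<n. min (r i) (l * s j) * ?o i j) / 2" using B by (intro divide_right_mono) linarith+
  also have "\<dots> \<le> Re (mtrace (\<rho> * (1\<^sub>m n - E))) + l * Re (mtrace (\<sigma> * E))"
    unfolding U(2) V(2) using l by (intro nussbaum_szkola[OF U(1) V(1) r(1) s(1) E]) auto
  also have "\<dots> \<le> e + l * b" using e b l by (intro add_mono mult_left_mono) auto
  finally show ?thesis .
qed

section \<open>Unions of tests and joint diagonalisation\<close>

lemma qfc_add: "A \<in> carrier_mat n n \<Longrightarrow> B \<in> carrier_mat n n \<Longrightarrow> qfc n (A + B) v = qfc n A v + qfc n B v"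
  unfolding qfc_def sum.distrib[symmetric] by (intro sum.cong refl) (auto simp: algebra_simps)

lemma qfc_one: "qfc n (1\<^sub>m n) v = of_real (\<Sum>x<n. (cmod (v x))\<^sup>2)"
proof -
  have "qfc n (1\<^sub>m n) v = (\<Sum>x<n. \<Sum>y<n. if x = y then cnj (v x) * v y else 0)"
    unfolding qfc_def by (intro sum.cong refl) auto
  then show ?thesis using ip_self[of n v] by (simp add: ip_def)
qed

lemma qfc_one_minus: "E \<in> carrier_mat n n \<Longrightarrow> qfc n (1\<^sub>m n - E) v = of_real (\<Sum>x<n. (cmod (v x))\<^sup>2) - qfc n E v"
proof -
  assume E: "E \<in> carrier_mat n n"
  have "qfc n (1\<^sub>m n - E) v + qfc n E v = qfc n (1\<^sub>m n) v"
    unfolding qfc_def sum.distrib[symmetric] using E by (intro sum.cong refl) (auto simp: algebra_simps)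
  then show ?thesis by (simp add: qfc_one algebra_simps)
qed

lemma mat_adjoint_add:
  fixes A B :: "complex Matrix.mat"
  shows "A \<in> carrier_mat n m \<Longrightarrow> B \<in> carrier_mat n m \<Longrightarrow> mat_adjoint (A + B) = mat_adjoint A + mat_adjoint B"
  by (rule eq_matI) auto

lemma hermitian_add: "hermitian_mat n A \<Longrightarrow> hermitian_mat n B \<Longrightarrow> hermitian_mat n (A + B)"
  unfolding hermitian_mat_def by (auto simp: mat_adjoint_add[of A n n B])

lemma psd_add: "psd_mat n A \<Longrightarrow> psd_mat n B \<Longrightarrow> psd_mat n (A + B)"
  using psd_carrier[of n A] psd_carrier[of n B] by (auto simp: psd_iff qfc_add hermitian_add)

lemma psd_zero: "psd_mat n (0\<^sub>m n n)"
  unfolding psd_iff hermitian_mat_def by (auto simp: qfc_def intro!: eq_matI)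

lemma mtrace_mult_add_right:
  assumes "A \<in> carrier_mat n n" "B \<in> carrier_mat n n" "C \<in> carrier_mat n n"
  shows "mtrace (A * (B + C)) = mtrace (A * B) + mtrace (A * C)"
  using assms by (simp add: mult_add_distrib_mat[of A n n B n C] mtrace_add[of _ n])

lemma ip_lincomb_left: "ip n (\<lambda>x. c * u x + d * v x) w = cnj c * ip n u w + cnj d * ip n v w"
  unfolding ip_def sum_distrib_left sum.distrib[symmetric] by (intro sum.cong refl) (simp add: algebra_simps)

lemma ip_lincomb_right: "ip n w (\<lambda>x. c * u x + d * v x) = c * ip n w u + d * ip n w v"
  unfolding ip_def sum_distrib_left sum.distrib[symmetric] by (intro sum.cong refl) (simp add: algebra_simps)

lemma app_lincomb: "app n M (\<lambda>x. c * u x + d * v x) = (\<lambda>x. c * app n M u x + d * app n M v x)"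
  unfolding app_def sum_distrib_left sum.distrib[symmetric] by (intro ext sum.cong refl) (simp add: algebra_simps)

text \<open>Cauchy-Schwarz in weighted form: expand the non-negative form of \<open>M\<close> at
  sqrt k u - v / sqrt k.\<close>

lemma psd_amgm:
  assumes M: "psd_mat n M" and k: "0 < (k::real)"
  shows "2 * Re (ip n u (app n M v)) \<le> k * Re (qfc n M u) + Re (qfc n M v) / k"
proof -
  let ?c = "complex_of_real (sqrt k)" and ?d = "- complex_of_real (1 / sqrt k)"
  have h: "hermitian_mat n M" using M by (simp add: psd_mat_def)
  have sq: "?c * ?c = of_real k" "?c * ?d = - 1" "?d * ?d = of_real (1 / k)"
    using k by (simp_all add: of_real_mult[symmetric] del: of_real_mult of_real_divide)
  have "qfc n M (\<lambda>x. ?c * u x + ?d * v x)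
    = (?c * ?c) * qfc n M u + (?c * ?d) * ip n u (app n M v) + (?c * ?d) * ip n v (app n M u) + (?d * ?d) * qfc n M v"
    unfolding qfc_ip app_lincomb ip_lincomb_left ip_lincomb_right by (simp add: algebra_simps)
  also have "\<dots> = of_real k * qfc n M u - ip n u (app n M v) - cnj (ip n u (app n M v)) + of_real (1 / k) * qfc n M v"
    unfolding sq using ip_app_hermitian[OF h, of v u] by simp
  finally have "Re (qfc n M (\<lambda>x. ?c * u x + ?d * v x)) = k * Re (qfc n M u) - 2 * Re (ip n u (app n M v)) + Re (qfc n M v) / k"
    by simp
  then show ?thesis using M unfolding psd_iff by (smt (verit))
qed

lemma psd_foldr: "\<forall>F\<in>set Fs. psd_mat n F \<Longrightarrow> psd_mat n (foldr (+) Fs (0\<^sub>m n n))"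
  by (induction Fs) (auto simp: psd_zero psd_add)

lemma psd_foldr_add:
  assumes "\<forall>F\<in>set Fs. psd_mat n F"
  shows "psd_mat n (foldr (+) Fs (0\<^sub>m n n))"
    "F \<in> set Fs \<Longrightarrow> Re (qfc n F u) \<le> Re (qfc n (foldr (+) Fs (0\<^sub>m n n)) u)"
    "M \<in> carrier_mat n n \<Longrightarrow> Re (mtrace (M * foldr (+) Fs (0\<^sub>m n n))) = (\<Sum>F\<leftarrow>Fs. Re (mtrace (M * F)))"
proof -
  show 1: "psd_mat n (foldr (+) Fs (0\<^sub>m n n))" using assms by (rule psd_foldr)
  show "F \<in> set Fs \<Longrightarrow> Re (qfc n F u) \<le> Re (qfc n (foldr (+) Fs (0\<^sub>m n n)) u)"
    using assms
  proof (induction Fs)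
    case (Cons G Fs)
    have p: "psd_mat n (foldr (+) Fs (0\<^sub>m n n))" using Cons.prems by (intro psd_foldr) auto
    have q: "0 \<le> Re (qfc n G u)" "0 \<le> Re (qfc n (foldr (+) Fs (0\<^sub>m n n)) u)" using Cons.prems p by (auto simp: psd_iff)
    have "qfc n (foldr (+) (G # Fs) (0\<^sub>m n n)) u = qfc n G u + qfc n (foldr (+) Fs (0\<^sub>m n n)) u"
      using Cons.prems p by (simp add: qfc_add psd_carrier)
    then show ?case using Cons q by auto
  qed simp
  show "M \<in> carrier_mat n n \<Longrightarrow> Re (mtrace (M * foldr (+) Fs (0\<^sub>m n n))) = (\<Sum>F\<leftarrow>Fs. Re (mtrace (M * F)))"
    using assms
  proof (induction Fs)
    case Nil
    then show ?case by (simp add: mtrace_def)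
  next
    case (Cons G Fs)
    have p: "psd_mat n (foldr (+) Fs (0\<^sub>m n n))" using Cons.prems by (intro psd_foldr) auto
    show ?case using Cons p by (simp add: mtrace_mult_add_right[OF Cons.prems(1)] psd_carrier)
  qed
qed

text \<open>A union of noncommuting tests: accept on the spectral subspace where the sum \<open>G\<close> of the tests is
  at least \<open>\<eta>\<close>. Every test \<open>F \<le> G\<close> is small on the complement, so that a state
  accepted by \<open>F\<close> has little weight there.\<close>
lemma test_union:
  assumes Fs: "\<forall>F\<in>set Fs. is_test n F" and eta: "0 < (\<eta>::real)"
  shows "\<exists>E. is_test n E \<and>
    (\<forall>F\<in>set Fs. \<forall>\<rho>. density_mat n \<rho> \<longrightarrow> Re (mtrace (\<rho> * (1\<^sub>m n - E))) \<le> 2 * \<eta> + 2 * Re (mtrace (\<rho> * (1\<^sub>m n - F)))) \<and>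
    (\<forall>\<sigma>. psd_mat n \<sigma> \<longrightarrow> Re (mtrace (\<sigma> * E)) \<le> (\<Sum>F\<leftarrow>Fs. Re (mtrace (\<sigma> * F))) / \<eta>)"
proof -
  define G where "G = foldr (+) Fs (0\<^sub>m n n)"
  have Fp: "\<forall>F\<in>set Fs. psd_mat n F" using Fs by (auto simp: is_test_def)
  have "psd_mat n G" unfolding G_def by (rule psd_foldr_add(1)[OF Fp])
  then obtain U g where U: "unitary_mat n U" "G = spec n U g" "\<And>i. 0 \<le> g i" by (rule psd_obtain_spec) auto
  have Uc: "U \<in> carrier_mat n n" using U by (simp add: unitary_carrier)
  \<comment> \<open>The indicator of the spectral subspace on which the union test rejects.\<close>
  define c where "c i = (if g i < \<eta> then 1 else (0::real))" for i
  define E where "E = spec n U (\<lambda>i. 1 - c i)"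
  have T: "1\<^sub>m n - E = spec n U c" unfolding E_def one_minus_spec[OF U(1)] by simp
  have test: "is_test n E" unfolding E_def by (rule test_specI[OF U(1)]) (auto simp: c_def)
  have I: "Re (mtrace (\<rho> * (1\<^sub>m n - E))) \<le> 2 * \<eta> + 2 * Re (mtrace (\<rho> * (1\<^sub>m n - F)))"
    if F: "F \<in> set Fs" and rho: "density_mat n \<rho>" for F \<rho>
  proof -
    have Ft: "is_test n F" and Fc: "F \<in> carrier_mat n n" using F Fs by (auto intro: is_test_carrier)
    have Fpsd: "psd_mat n F" "psd_mat n (1\<^sub>m n - F)" using Ft by (auto simp: is_test_def)
    have key: "Re (qfc n (spec n U c) v) \<le> 2 * \<eta> * (\<Sum>x<n. (cmod (v x))\<^sup>2) + 2 * Re (qfc n (1\<^sub>m n - F) v)" for v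
    proof -
      define N where "N = Re (qfc n (spec n U c) v)"
      define u where "u = app n (spec n U c) v"
      have N: "N = (\<Sum>i<n. c i * (cmod (ip n (colf U i) v))\<^sup>2)" by (simp add: N_def qfc_spec_ip[OF Uc])
      have cu: "(cmod (ip n (colf U i) u))\<^sup>2 = c i * (cmod (ip n (colf U i) v))\<^sup>2" if "i < n" for i
        unfolding u_def ip_col_app_spec[OF U(1) that] by (simp add: c_def)
      have uu: "(\<Sum>x<n. (cmod (u x))\<^sup>2) = N"
        unfolding N by (subst parseval_ip[OF U(1), symmetric], intro sum.cong refl) (simp add: cu)
      have uv: "Re (ip n u v) = N"
        using arg_cong[OF ip_cnj[of n v u], of Re] by (simp add: N_def qfc_ip u_def[symmetric])
      have Gu: "Re (qfc n G u) \<le> \<eta> * N"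
        unfolding U(2) qfc_spec_ip[OF Uc] N sum_distrib_left Re_complex_of_real
        by (intro sum_mono) (auto simp: cu c_def mult_right_mono)
      have Fu: "Re (qfc n F u) \<le> \<eta> * N" using psd_foldr_add(2)[OF Fp F, of u] Gu by (simp add: G_def)
      have Fu2: "Re (qfc n (1\<^sub>m n - F) u) \<le> N"
        using Fpsd(1) unfolding qfc_one_minus[OF Fc] by (simp add: uu psd_iff)
      have Fv: "Re (qfc n F v) \<le> (\<Sum>x<n. (cmod (v x))\<^sup>2)"
        using Fpsd(2) unfolding psd_iff qfc_one_minus[OF Fc] by (simp add: algebra_simps)
      have "Re (ip n u v) = Re (ip n u (app n F v)) + Re (ip n u (app n (1\<^sub>m n - F) v))"
      proof -
        have "ip n u v = ip n u (app n F v) + ip n u (app n (1\<^sub>m n - F) v)"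
          unfolding ip_def sum.distrib[symmetric]
          by (intro sum.cong refl) (simp add: app_one_minus[OF Fc, symmetric, of _ v] algebra_simps)
        then show ?thesis by simp
      qed
      then have "2 * N = 2 * Re (ip n u (app n F v)) + 2 * Re (ip n u (app n (1\<^sub>m n - F) v))" using uv by simp
      \<comment> \<open>The weights 1 / (2 \<eta>) and 1 / 2 make the two terms in \<open>u\<close>
        contribute at most N / 2 each. Half of the left side 2 N survives, and the factors 2 \<eta>
        and 2 of the statement are the reciprocal weights.\<close>
      also have "\<dots> \<le> (1 / (2 * \<eta>) * Re (qfc n F u) + Re (qfc n F v) / (1 / (2 * \<eta>)))
          + (1 / 2 * Re (qfc n (1\<^sub>m n - F) u) + Re (qfc n (1\<^sub>m n - F) v) / (1 / 2))"
        using eta by (intro add_mono psd_amgm Fpsd) auto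
      also have "1 / (2 * \<eta>) * Re (qfc n F u) \<le> 1 / (2 * \<eta>) * (\<eta> * N)" using Fu eta by (intro mult_left_mono) auto
      also have "Re (qfc n F v) / (1 / (2 * \<eta>)) \<le> 2 * \<eta> * (\<Sum>x<n. (cmod (v x))\<^sup>2)"
        using mult_left_mono[OF Fv, of "2 * \<eta>"] eta by (simp add: mult_ac)
      finally have "2 * N \<le> N / 2 + 2 * \<eta> * (\<Sum>x<n. (cmod (v x))\<^sup>2) + (N / 2 + 2 * Re (qfc n (1\<^sub>m n - F) v))"
        using Fu2 eta by simp
      then show ?thesis unfolding N_def[symmetric] by simp
    qed
    from rho obtain R r where R: "unitary_mat n R" "\<rho> = spec n R r" "\<And>i. 0 \<le> r i" "(\<Sum>i<n. r i) = 1"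
      by (rule density_obtain_spec) auto
    have Rc: "R \<in> carrier_mat n n" using R by (simp add: unitary_carrier)
    have "Re (mtrace (\<rho> * (1\<^sub>m n - E))) = (\<Sum>i<n. r i * Re (qfc n (spec n U c) (colf R i)))"
      unfolding T R(2) by (rule Re_mtrace_spec_mult[OF Rc spec_carrier[OF Uc]])
    also have "\<dots> \<le> (\<Sum>i<n. r i * (2 * \<eta> * 1 + 2 * Re (qfc n (1\<^sub>m n - F) (colf R i))))"
    proof (intro sum_mono mult_left_mono R(3))
      fix i assume "i \<in> {..<n}"
      then show "Re (qfc n (spec n U c) (colf R i)) \<le> 2 * \<eta> * 1 + 2 * Re (qfc n (1\<^sub>m n - F) (colf R i))"
        using key[of "colf R i"] unitary_col_norm[OF R(1), of i] by simp
    qed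
    also have "\<dots> = 2 * \<eta> * (\<Sum>i<n. r i) + 2 * (\<Sum>i<n. r i * Re (qfc n (1\<^sub>m n - F) (colf R i)))"
      by (simp add: sum_distrib_left sum.distrib algebra_simps)
    also have "(\<Sum>i<n. r i * Re (qfc n (1\<^sub>m n - F) (colf R i))) = Re (mtrace (\<rho> * (1\<^sub>m n - F)))"
      unfolding R(2) using Fc by (intro Re_mtrace_spec_mult[OF Rc, symmetric]) auto
    finally show ?thesis using R by simp
  qed
  have II: "Re (mtrace (\<sigma> * E)) \<le> (\<Sum>F\<leftarrow>Fs. Re (mtrace (\<sigma> * F))) / \<eta>" if sig: "psd_mat n \<sigma>" for \<sigma>
  proof -
    from sig obtain R r where R: "unitary_mat n R" "\<sigma> = spec n R r" "\<And>i. 0 \<le> r i" by (rule psd_obtain_spec) auto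
    have Rc: "R \<in> carrier_mat n n" using R by (simp add: unitary_carrier)
    have "Re (mtrace (\<sigma> * E)) = (\<Sum>i<n. \<Sum>j<n. r i * (1 - c j) * ovl n R U i j)"
      unfolding R(2) E_def by (simp add: mtrace_spec_spec[OF Rc Uc])
    also have "\<dots> \<le> (\<Sum>i<n. \<Sum>j<n. r i * (g j / \<eta>) * ovl n R U i j)"
      using R(3) U(3) eta by (intro sum_mono mult_right_mono mult_left_mono) (auto simp: c_def)
    also have "\<dots> = Re (mtrace (\<sigma> * G)) / \<eta>"
      unfolding R(2) U(2) by (simp add: mtrace_spec_spec[OF Rc Uc] sum_divide_distrib)
    also have "Re (mtrace (\<sigma> * G)) = (\<Sum>F\<leftarrow>Fs. Re (mtrace (\<sigma> * F)))"
      unfolding G_def using psd_foldr_add(3)[OF Fp] psd_carrier[OF sig] by simp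
    finally show ?thesis .
  qed
  show ?thesis using test I II by blast
qed

lemma spec_of_eigen:
  assumes W: "unitary_mat n W" and A: "A \<in> carrier_mat n n"
    and ev: "\<And>x j. x < n \<Longrightarrow> j < n \<Longrightarrow> app n A (colf W j) x = of_real (a j) * W $$ (x, j)"
  shows "A = spec n W a"
proof (rule eq_matI)
  have Wc: "W \<in> carrier_mat n n" using W by (rule unitary_carrier)
  fix x z assume "x < dim_row (spec n W a)" "z < dim_col (spec n W a)"
  then have xz: "x < n" "z < n" using Wc by auto
  have "A $$ (x, z) = (\<Sum>y<n. if y = z then A $$ (x, y) else 0)" using xz by simp
  also have "\<dots> = (\<Sum>y<n. \<Sum>j<n. A $$ (x, y) * (W $$ (y, j) * cnj (W $$ (z, j))))"
    using xz by (intro sum.cong refl) (auto simp: sum_distrib_left[symmetric] unitary_rows[OF W])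
  also have "\<dots> = (\<Sum>j<n. \<Sum>y<n. A $$ (x, y) * (W $$ (y, j) * cnj (W $$ (z, j))))" by (rule sum.swap)
  also have "\<dots> = (\<Sum>j<n. app n A (colf W j) x * cnj (W $$ (z, j)))"
    by (simp add: app_def sum_distrib_right mult.assoc)
  also have "\<dots> = (\<Sum>j<n. W $$ (x, j) * of_real (a j) * cnj (W $$ (z, j)))"
    using xz by (intro sum.cong refl) (simp add: ev mult_ac)
  finally show "A $$ (x, z) = spec n W a $$ (x, z)" using xz by (simp add: spec_index[OF Wc])
qed (use A unitary_carrier[OF W] in auto)

definition restr :: "(nat \<Rightarrow> real) \<Rightarrow> real \<Rightarrow> (nat \<Rightarrow> complex) \<Rightarrow> nat \<Rightarrow> complex" where
  "restr s b v = (\<lambda>x. if s x = b then v x else 0)"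

text \<open>Equivalently, \<open>A\<close> commutes with the diagonal matrix with entries
  \<open>s i\<close>.\<close>

definition blockdiag :: "nat \<Rightarrow> (nat \<Rightarrow> real) \<Rightarrow> complex Matrix.mat \<Rightarrow> bool" where
  "blockdiag n s A \<longleftrightarrow> A \<in> carrier_mat n n \<and> (\<forall>i<n. \<forall>j<n. s i \<noteq> s j \<longrightarrow> A $$ (i, j) = 0)"

text \<open>Shifting the blocks of \<open>A\<close> by multiples of 2 separates their spectra, so that each eigenvector of the
  shifted matrix lives in a single block.\<close>
lemma joint_diag:
  assumes A: "psd_mat n A" "psd_mat n (1\<^sub>m n - A)" and blk: "blockdiag n s A"
  obtains W a \<beta> where "unitary_mat n W" "A = spec n W a"
    "\<And>x j. x < n \<Longrightarrow> j < n \<Longrightarrow> W $$ (x, j) \<noteq> 0 \<Longrightarrow> s x = \<beta> j" "\<And>j. j < n \<Longrightarrow> \<beta> j \<in> s ` {..<n}"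
proof -
  have Ac: "A \<in> carrier_mat n n" using A by (simp add: psd_carrier)
  \<comment> \<open>Twice the rank of \<open>z\<close> among the values of \<open>s\<close>. The
    spectrum of \<open>A\<close> lies in [0, 1], so shifts that differ by 2 keep the blocks
    apart.\<close>
  define \<kappa> where "\<kappa> z = 2 * real (card {y \<in> s ` {..<n}. y < z})" for z
  have gap: "\<kappa> z + 2 \<le> \<kappa> z'" if "z \<in> s ` {..<n}" "z < z'" for z z'
  proof -
    have "insert z {y \<in> s ` {..<n}. y < z} \<subseteq> {y \<in> s ` {..<n}. y < z'}" using that by auto
    then have "card (insert z {y \<in> s ` {..<n}. y < z}) \<le> card {y \<in> s ` {..<n}. y < z'}" by (intro card_mono) auto
    then show ?thesis by (simp add: \<kappa>_def)
  qed
  define K where "K = A + diag_of n (\<lambda>i. \<kappa> (s i))"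
  have "hermitian_mat n (diag_of n (\<lambda>i. \<kappa> (s i)))" unfolding hermitian_mat_def by (auto simp: diag_of_def intro!: eq_matI)
  then have "hermitian_mat n K" unfolding K_def using A by (intro hermitian_add) (auto simp: psd_mat_def)
  then obtain W m where W: "unitary_mat n W" "K = spec n W m" using hermitian_spec by blast
  have AW: "app n A (colf W j) x = of_real (m j - \<kappa> (s x)) * W $$ (x, j)" if "x < n" "j < n" for x j
  proof -
    have "app n K (colf W j) x = app n A (colf W j) x + (\<Sum>y<n. if x = y then of_real (\<kappa> (s x)) * W $$ (y, j) else 0)"
      unfolding app_def K_def sum.distrib[symmetric] using that Ac
      by (intro sum.cong refl) (auto simp: diag_of_def algebra_simps)
    also have "\<dots> = app n A (colf W j) x + of_real (\<kappa> (s x)) * W $$ (x, j)" using that by simp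
    finally show ?thesis using app_spec_col[OF W(1) that, of m] W(2) by (simp add: algebra_simps)
  qed
  have bnd: "\<kappa> (s x) \<le> m j \<and> m j \<le> \<kappa> (s x) + 1" if x: "x < n" "j < n" "W $$ (x, j) \<noteq> 0" for x j
  proof -
    \<comment> \<open>The part of an eigenvector inside one block satisfies the eigenvalue equation
      of \<open>A\<close> with eigenvalue \<open>m j - \<kappa> (s x)\<close>. Its Rayleigh quotient
      confines this number to [0, 1].\<close>
    let ?w = "restr s (s x) (colf W j)"
    define N where "N = (\<Sum>y<n. (cmod (?w y))\<^sup>2)"
    have "N > 0" unfolding N_def using x by (intro sum_pos2[of _ x]) (auto simp: restr_def)
    have a: "app n A ?w z = app n A (colf W j) z" if "z < n" "s z = s x" for z
      unfolding app_def using that blk by (intro sum.cong refl) (auto simp: restr_def blockdiag_def)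
    have "cnj (?w z) * app n A ?w z = cnj (?w z) * (?w z * of_real (m j - \<kappa> (s x)))" if z: "z < n" for z
    proof (cases "s z = s x")
      case True
      then have "?w z = W $$ (z, j)" by (simp add: restr_def)
      then show ?thesis using a[OF z True] AW[OF z x(2)] True by (simp add: mult.commute)
    qed (simp add: restr_def)
    then have "qfc n A ?w = ip n ?w (\<lambda>z. ?w z * of_real (m j - \<kappa> (s x)))"
      unfolding qfc_ip ip_def by (intro sum.cong refl) simp
    also have "\<dots> = of_real (N * (m j - \<kappa> (s x)))" unfolding ip_scale_right ip_self N_def[symmetric] by simp
    finally have q: "Re (qfc n A ?w) = N * (m j - \<kappa> (s x))" by simp
    have "0 \<le> N * (m j - \<kappa> (s x))" using A(1) unfolding q[symmetric] psd_iff by blast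
    moreover have "N * (m j - \<kappa> (s x)) \<le> N * 1"
    proof -
      have "0 \<le> Re (qfc n (1\<^sub>m n - A) ?w)" using A(2) by (simp add: psd_iff)
      then show ?thesis unfolding qfc_one_minus[OF Ac] N_def[symmetric] minus_complex.sel q Re_complex_of_real by simp
    qed
    ultimately show ?thesis using \<open>N > 0\<close> by (simp add: zero_le_mult_iff)
  qed
  have same: "s x = s x'" if "x < n" "x' < n" "j < n" "W $$ (x, j) \<noteq> 0" "W $$ (x', j) \<noteq> 0" for x x' j
  proof (rule ccontr)
    assume "s x \<noteq> s x'"
    then have "s x < s x' \<or> s x' < s x" by linarith
    moreover have "s x \<in> s ` {..<n}" "s x' \<in> s ` {..<n}" using that by auto
    ultimately have "\<kappa> (s x) + 2 \<le> \<kappa> (s x') \<or> \<kappa> (s x') + 2 \<le> \<kappa> (s x)" using gap by blast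
    then show False using bnd[OF that(1,3,4)] bnd[OF that(2,3,5)] by linarith
  qed
  \<comment> \<open>Some coordinate in the support of column \<open>j\<close>; its block is the
    block of the whole column.\<close>
  define p where "p j = (SOME x. x < n \<and> W $$ (x, j) \<noteq> 0)" for j
  have p: "p j < n \<and> W $$ (p j, j) \<noteq> 0" if "j < n" for j
  proof -
    have "\<exists>x. x < n \<and> W $$ (x, j) \<noteq> 0"
    proof (rule ccontr)
      assume "\<not> ?thesis"
      then have "(\<Sum>x<n. (cmod (W $$ (x, j)))\<^sup>2) = 0" by (intro sum.neutral) auto
      then show False using unitary_col_norm[OF W(1) that] by simp
    qed
    then show ?thesis unfolding p_def by (rule someI_ex)
  qed
  have sup: "s x = s (p j)" if "x < n" "j < n" "W $$ (x, j) \<noteq> 0" for x j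
    using same[of x "p j" j] p that by auto
  have "A = spec n W (\<lambda>j. m j - \<kappa> (s (p j)))"
  proof (rule spec_of_eigen[OF W(1) Ac])
    fix x j assume xj: "x < n" "j < n"
    show "app n A (colf W j) x = of_real (m j - \<kappa> (s (p j))) * W $$ (x, j)"
      using AW[OF xj] sup[OF xj] by (cases "W $$ (x, j) = 0") auto
  qed
  then show ?thesis using that[OF W(1) _ sup] p by auto
qed

section \<open>Pinching\<close>

definition pin :: "nat \<Rightarrow> (nat \<Rightarrow> real) \<Rightarrow> complex Matrix.mat \<Rightarrow> complex Matrix.mat" where
  "pin n s M = Matrix.mat n n (\<lambda>(i, j). if s i = s j then M $$ (i, j) else 0)"

lemma pin_carrier [simp]: "pin n s M \<in> carrier_mat n n"
  by (simp add: pin_def)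

lemma pin_dim [simp]: "dim_row (pin n s M) = n" "dim_col (pin n s M) = n"
  by (simp_all add: pin_def)

lemma pin_index: "i < n \<Longrightarrow> j < n \<Longrightarrow> pin n s M $$ (i, j) = (if s i = s j then M $$ (i, j) else 0)"
  by (simp add: pin_def)

lemma pin_blockdiag: "blockdiag n s (pin n s M)"
  by (auto simp: blockdiag_def pin_index)

text \<open>Pinching is the sum of the compressions of \<open>M\<close> to the blocks of
  \<open>s\<close>. In this form positivity of the pinched matrix is immediate.\<close>

lemma qfc_pin: "qfc n (pin n s M) v = (\<Sum>b\<in>s ` {..<n}. qfc n M (restr s b v))"
proof -
  have "(\<Sum>b\<in>s ` {..<n}. qfc n M (restr s b v))
      = (\<Sum>b\<in>s ` {..<n}. \<Sum>x<n. \<Sum>y<n. cnj (restr s b v x) * M $$ (x, y) * restr s b v y)" by (simp add: qfc_def)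
  also have "\<dots> = (\<Sum>x<n. \<Sum>b\<in>s ` {..<n}. \<Sum>y<n. cnj (restr s b v x) * M $$ (x, y) * restr s b v y)" by (rule sum.swap)
  also have "\<dots> = (\<Sum>x<n. \<Sum>y<n. \<Sum>b\<in>s ` {..<n}. cnj (restr s b v x) * M $$ (x, y) * restr s b v y)"
    by (rule sum.cong[OF refl], rule sum.swap)
  also have "\<dots> = (\<Sum>x<n. \<Sum>y<n. cnj (v x) * pin n s M $$ (x, y) * v y)"
  proof (intro sum.cong refl)
    fix x y assume xy: "x \<in> {..<n}" "y \<in> {..<n}"
    have "(\<Sum>b\<in>s ` {..<n}. cnj (restr s b v x) * M $$ (x, y) * restr s b v y)
      = (\<Sum>b\<in>s ` {..<n}. if b = s x then (if s x = s y then cnj (v x) * M $$ (x, y) * v y else 0) else 0)"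
      by (intro sum.cong refl) (auto simp: restr_def)
    also have "\<dots> = cnj (v x) * pin n s M $$ (x, y) * v y" using xy by (simp add: pin_index)
    finally show "(\<Sum>b\<in>s ` {..<n}. cnj (restr s b v x) * M $$ (x, y) * restr s b v y) = cnj (v x) * pin n s M $$ (x, y) * v y" .
  qed
  finally show ?thesis by (simp add: qfc_def)
qed

lemma psd_pin:
  assumes "psd_mat n M" shows "psd_mat n (pin n s M)"
proof -
  have h: "hermitian_mat n M" using assms by (simp add: psd_mat_def)
  have "hermitian_mat n (pin n s M)"
    unfolding hermitian_iff
  proof (intro conjI allI impI)
    fix i j assume ij: "i < n" "j < n"
    show "pin n s M $$ (i, j) = cnj (pin n s M $$ (j, i))"
      using hermitian_index[OF h ij] ij by (simp add: pin_index)
  qed simp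
  then show ?thesis using assms unfolding psd_iff qfc_pin by (auto intro!: sum_nonneg)
qed

lemma density_pin: "density_mat n M \<Longrightarrow> density_mat n (pin n s M)"
proof -
  assume d: "density_mat n M"
  then have "M \<in> carrier_mat n n" by (rule density_carrier)
  then have "mtrace (pin n s M) = mtrace M" by (simp add: mtrace_def pin_index)
  then show ?thesis using d by (simp add: density_mat_def psd_pin)
qed

text \<open>In an eigenbasis of \<open>M\<close> this is Cauchy-Schwarz for a sum over the blocks,
  which explains the number of blocks as the constant.\<close>

lemma pinching_ineq:
  assumes "psd_mat n M"
  shows "Re (qfc n M v) \<le> real (card (s ` {..<n})) * Re (qfc n (pin n s M) v)"
proof -
  let ?B = "s ` {..<n}"
  from assms obtain V l where V: "unitary_mat n V" "M = spec n V l" "\<And>i. 0 \<le> l i" by (rule psd_obtain_spec) auto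
  have Vc: "V \<in> carrier_mat n n" using V by (simp add: unitary_carrier)
  have dec: "ip n u v = (\<Sum>b\<in>?B. ip n u (restr s b v))" for u
  proof -
    have "(\<Sum>b\<in>?B. restr s b v x) = v x" if "x < n" for x using that by (simp add: restr_def)
    then have "ip n u v = ip n u (\<lambda>x. \<Sum>b\<in>?B. restr s b v x)" by (intro ip_cong) auto
    then show ?thesis by (simp add: ip_sum_right)
  qed
  have "Re (qfc n M v) = (\<Sum>j<n. l j * (cmod (ip n (colf V j) v))\<^sup>2)" by (simp add: V(2) qfc_spec_ip[OF Vc])
  also have "\<dots> \<le> (\<Sum>j<n. l j * (real (card ?B) * (\<Sum>b\<in>?B. (cmod (ip n (colf V j) (restr s b v)))\<^sup>2)))"
  proof (intro sum_mono mult_left_mono V(3))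
    fix j
    have "(cmod (ip n (colf V j) v))\<^sup>2 \<le> (\<Sum>b\<in>?B. cmod (ip n (colf V j) (restr s b v)))\<^sup>2"
      unfolding dec[of "colf V j"] by (intro power_mono norm_sum) auto
    also have "\<dots> \<le> (\<Sum>b\<in>?B. (cmod (ip n (colf V j) (restr s b v)))\<^sup>2) * real (card ?B)"
      by (rule sum_squared_le_sum_of_squares)
    finally show "(cmod (ip n (colf V j) v))\<^sup>2 \<le> real (card ?B) * (\<Sum>b\<in>?B. (cmod (ip n (colf V j) (restr s b v)))\<^sup>2)"
      by (simp add: mult.commute)
  qed
  also have "\<dots> = real (card ?B) * (\<Sum>j<n. \<Sum>b\<in>?B. l j * (cmod (ip n (colf V j) (restr s b v)))\<^sup>2)"
    unfolding sum_distrib_left by (intro sum.cong refl) (simp add: mult_ac)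
  also have "(\<Sum>j<n. \<Sum>b\<in>?B. l j * (cmod (ip n (colf V j) (restr s b v)))\<^sup>2) = (\<Sum>b\<in>?B. \<Sum>j<n. l j * (cmod (ip n (colf V j) (restr s b v)))\<^sup>2)"
    by (rule sum.swap)
  also have "\<dots> = Re (qfc n (pin n s M) v)"
    unfolding qfc_pin by (simp add: V(2) qfc_spec_ip[OF Vc])
  finally show ?thesis .
qed

text \<open>The entries removed by pinching meet zero entries of \<open>B\<close>. A block-diagonal
  observable therefore cannot distinguish a state from its pinching.\<close>

lemma mtrace_pin:
  assumes "M \<in> carrier_mat n n" "blockdiag n s B"
  shows "mtrace (pin n s M * B) = mtrace (M * B)"
proof -
  have B: "B \<in> carrier_mat n n" using assms by (simp add: blockdiag_def)
  show ?thesis unfolding mtrace_mult[OF pin_carrier B] mtrace_mult[OF assms(1) B]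
    using assms(2) by (intro sum.cong refl) (auto simp: pin_index blockdiag_def)
qed

lemma blockdiag_spec:
  assumes W: "unitary_mat n W" and sup: "\<And>x j. x < n \<Longrightarrow> j < n \<Longrightarrow> W $$ (x, j) \<noteq> 0 \<Longrightarrow> s x = \<beta> j"
  shows "blockdiag n s (spec n W l)"
proof -
  have Wc: "W \<in> carrier_mat n n" using W by (rule unitary_carrier)
  have "spec n W l $$ (x, y) = 0" if "x < n" "y < n" "s x \<noteq> s y" for x y
    unfolding spec_index[OF Wc that(1,2)]
  proof (rule sum.neutral, rule ballI)
    fix k assume "k \<in> {..<n}"
    then show "W $$ (x, k) * complex_of_real (l k) * cnj (W $$ (y, k)) = 0"
      using sup[of x k] sup[of y k] that by auto
  qed
  then show ?thesis using Wc by (simp add: blockdiag_def)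
qed

lemma density_le_one: "density_mat n A \<Longrightarrow> psd_mat n (1\<^sub>m n - A)"
proof -
  assume "density_mat n A"
  then obtain U l where U: "unitary_mat n U" "A = spec n U l" "\<And>i. 0 \<le> l i" "(\<Sum>i<n. l i) = 1"
    by (rule density_obtain_spec) auto
  have "l i \<le> 1" if "i < n" for i
    using U(3,4) that member_le_sum[of i "{..<n}" l] by auto
  then show ?thesis using U by (simp add: one_minus_spec psd_spec_iff)
qed

lemma density_spec_iff:
  "unitary_mat n U \<Longrightarrow> density_mat n (spec n U l) \<longleftrightarrow> (\<forall>i<n. 0 \<le> l i) \<and> (\<Sum>i<n. l i) = 1"
  unfolding density_mat_def psd_spec_iff mtrace_spec by (auto simp del: of_real_sum)

section \<open>Negative entropy and its behaviour under pinching\<close>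

definition nent :: "nat \<Rightarrow> complex Matrix.mat \<Rightarrow> real" where
  "nent n A = Re (mtrace (A * mat_fun n log_supp A))"

lemma nent_spec: "unitary_mat n U \<Longrightarrow> nent n (spec n U a) = (\<Sum>i<n. a i * log_supp (a i))"
  by (simp add: nent_def mat_fun_spec spec_mult mtrace_spec)

lemma klein:
  assumes A: "density_mat n A" and V: "unitary_mat n V" and B: "density_mat n (spec n V b)" and b: "\<And>i. i < n \<Longrightarrow> 0 < b i"
  shows "Re (mtrace (A * mat_fun n log_supp (spec n V b))) \<le> nent n A"
proof -
  from A obtain U r where U: "unitary_mat n U" "A = spec n U r" "\<And>i. 0 \<le> r i" "(\<Sum>i<n. r i) = 1"
    by (rule density_obtain_spec) auto
  have "(\<Sum>i<n. b i) = 1" using B V by (simp add: density_spec_iff)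
  then show ?thesis
    unfolding U(2) nent_spec[OF U(1)] mat_fun_spec[OF V] mtrace_spec_spec[OF unitary_carrier[OF U(1)] unitary_carrier[OF V]]
    using klein_spec[OF U(1) V, of r b] U b by simp
qed

text \<open>The logarithm of r / q lies below its tangent at \<open>v\<close>.\<close>

lemma ln_diff_le:
  assumes "0 < r" "0 < q" "0 < (v::real)"
  shows "ln r - ln q \<le> ln v - 1 + r * (1 / q) / v"
proof -
  have "ln (r / (q * v)) \<le> r / (q * v) - 1" using assms by (intro ln_le_minus_one) auto
  then show ?thesis using assms by (simp add: ln_div ln_mult)
qed

text \<open>Operator monotonicity of the logarithm is avoided. With R the state and Q its pinching,
  the pinching inequality at the inverse of Q applied to u_i bounds \<open>r i\<close> times the
  quadratic form of that inverse at u_i by the number v of blocks. The tangent of the logarithm at v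
  then converts this linear bound into the entropy bound ln v.\<close>

lemma pinching_entropy:
  assumes U: "unitary_mat n U" and r: "\<And>i. i < n \<Longrightarrow> 0 < r i" and r1: "(\<Sum>i<n. r i) = 1"
  shows "nent n (spec n U r) - ln (real (card (s ` {..<n}))) \<le> nent n (pin n s (spec n U r))"
proof -
  let ?R = "spec n U r" and ?v = "real (card (s ` {..<n}))"
  have Uc: "U \<in> carrier_mat n n" using U by (rule unitary_carrier)
  have dR: "density_mat n ?R" using U r r1 by (auto simp: density_spec_iff less_imp_le)
  then have pR: "psd_mat n ?R" by (simp add: density_mat_def)
  have n0: "n > 0" using r1 by (cases n) auto
  have vpos: "?v > 0" using n0 by (auto simp: card_gt_0_iff lessThan_empty_iff)
  note dQ = density_pin[OF dR, of s]
  have pQ: "psd_mat n (pin n s ?R)" using dQ by (simp add: density_mat_def)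
  obtain W q \<beta> where W: "unitary_mat n W" "pin n s ?R = spec n W q"
    and sup: "\<And>x j. x < n \<Longrightarrow> j < n \<Longrightarrow> W $$ (x, j) \<noteq> 0 \<Longrightarrow> s x = \<beta> j"
    using joint_diag[OF pQ density_le_one[OF dQ] pin_blockdiag] by metis
  have Wc: "W \<in> carrier_mat n n" using W by (simp add: unitary_carrier)
  let ?o = "ovl n U W"
  have q0: "0 \<le> q j" if "j < n" for j using pQ that unfolding W(2) psd_spec_iff[OF W(1)] by simp
  \<comment> \<open>A zero eigenvalue of the pinched state would, by the pinching inequality, put a
    unit vector into the kernel of the full-rank state.\<close>
  have qpos: "0 < q j" if j: "j < n" for j
  proof (rule ccontr)
    assume "\<not> 0 < q j"
    then have qj: "q j = 0" using q0[OF j] by simp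
    have "qfc n (spec n W q) (colf W j) = 0"
      unfolding qfc_spec_col[OF Wc] using j qj by (simp add: ovl_same[OF W(1)] del: of_real_sum) (intro sum.neutral, auto)
    then have "Re (qfc n ?R (colf W j)) \<le> 0" using pinching_ineq[OF pR, of "colf W j" s] W(2) by simp
    then have "(\<Sum>i<n. r i * ovl n W U j i) \<le> 0" unfolding qfc_spec_col[OF Uc] by simp
    moreover have "0 \<le> r i * ovl n W U j i" if "i < n" for i using r[OF that] by simp
    ultimately have "\<forall>i<n. r i * ovl n W U j i = 0"
      by (metis (no_types, lifting) finite_lessThan lessThan_iff order_antisym sum_nonneg sum_nonneg_eq_0_iff)
    then have "\<forall>i<n. ovl n W U j i = 0" using r by fastforce
    then show False using ovl_sum_right[OF W(1) U j] by simp
  qed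
  \<comment> \<open>For x the inverse of the pinched state applied to u_i, both the inner product of
    u_i with x and the form of the pinched state at x equal \<open>a\<close>. So the pinching
    inequality reads r_i a^2 <= v a.\<close>
  have a: "r i * (\<Sum>j<n. ?o i j / q j) \<le> ?v" if i: "i < n" for i
  proof -
    define x where "x = app n (spec n W (\<lambda>j. 1 / q j)) (colf U i)"
    define a where "a = (\<Sum>j<n. ?o i j / q j)"
    have a0: "a \<ge> 0" unfolding a_def using qpos by (intro sum_nonneg) (auto simp: less_imp_le)
    have "Re (qfc n (spec n W q) x) = (\<Sum>j<n. q j * (cmod (ip n (colf W j) x))\<^sup>2)" by (simp add: qfc_spec_ip[OF Wc])
    also have "\<dots> = a"
      unfolding a_def x_def
    proof (intro sum.cong refl)
      fix j assume "j \<in> {..<n}"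
      then have j: "j < n" by simp
      show "q j * (cmod (ip n (colf W j) (app n (spec n W (\<lambda>j. 1 / q j)) (colf U i))))\<^sup>2 = ?o i j / q j"
        unfolding ip_col_app_spec[OF W(1) j] using qpos[OF j]
        by (simp add: norm_mult norm_divide power_divide ovl_ip ip_cmod_commute[of n "colf W j"] power2_eq_square)
    qed
    finally have Qx: "Re (qfc n (spec n W q) x) = a" .
    have "ip n (colf U i) x = of_real a"
      unfolding x_def qfc_ip[symmetric] qfc_spec_col[OF Wc] a_def by simp
    then have "r i * a\<^sup>2 = r i * (cmod (ip n (colf U i) x))\<^sup>2" using a0 by simp
    also have "\<dots> \<le> (\<Sum>k<n. r k * (cmod (ip n (colf U k) x))\<^sup>2)"
      using i r by (intro member_le_sum) (auto simp: less_imp_le)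
    also have "\<dots> = Re (qfc n ?R x)" by (simp add: qfc_spec_ip[OF Uc])
    also have "\<dots> \<le> ?v * a" using pinching_ineq[OF pR, of x s] Qx W(2) by simp
    finally have "r i * a * a \<le> ?v * a" by (simp add: power2_eq_square)
    then show ?thesis unfolding a_def[symmetric] using a0 vpos by (cases "a = 0") (auto simp: mult_le_cancel_right)
  qed
  have lnb: "ln (r i) - ln (q j) \<le> ln ?v - 1 + r i * (1 / q j) / ?v" if "i < n" "j < n" for i j
    using r[OF that(1)] qpos[OF that(2)] vpos by (rule ln_diff_le)
  have "nent n (pin n s ?R) = Re (mtrace (pin n s ?R * spec n W (\<lambda>j. log_supp (q j))))"
    unfolding nent_def W(2) mat_fun_spec[OF W(1)] ..
  also have "\<dots> = Re (mtrace (?R * spec n W (\<lambda>j. log_supp (q j))))"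
    using mtrace_pin[OF spec_carrier[OF Uc] blockdiag_spec[OF W(1) sup]] by simp
  also have "\<dots> = (\<Sum>i<n. \<Sum>j<n. r i * log_supp (q j) * ?o i j)" by (simp add: mtrace_spec_spec[OF Uc Wc])
  finally have "nent n ?R - nent n (pin n s ?R)
      = (\<Sum>i<n. \<Sum>j<n. r i * log_supp (r i) * ?o i j) - (\<Sum>i<n. \<Sum>j<n. r i * log_supp (q j) * ?o i j)"
    unfolding nent_spec[OF U] sum_ovl_weights(1)[OF U W(1), of "\<lambda>i. r i * log_supp (r i)"] by simp
  also have "\<dots> = (\<Sum>i<n. \<Sum>j<n. r i * (ln (r i) - ln (q j)) * ?o i j)"
    unfolding sum_subtractf[symmetric] using r qpos by (intro sum.cong refl) (simp add: log_supp_def algebra_simps)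
  also have "\<dots> \<le> (\<Sum>i<n. \<Sum>j<n. r i * (ln ?v - 1 + r i * (1 / q j) / ?v) * ?o i j)"
    using lnb r by (intro sum_mono mult_right_mono mult_left_mono) (auto simp: less_imp_le)
  also have "\<dots> = (\<Sum>i<n. \<Sum>j<n. (r i * (ln ?v - 1)) * ?o i j) + (\<Sum>i<n. r i / ?v * (r i * (\<Sum>j<n. ?o i j / q j)))"
    unfolding sum_distrib_left sum.distrib[symmetric] by (intro sum.cong refl) (simp add: algebra_simps)
  also have "\<dots> \<le> (\<Sum>i<n. r i * (ln ?v - 1)) + (\<Sum>i<n. r i / ?v * ?v)"
    unfolding sum_ovl_weights(1)[OF U W(1)] using a r vpos by (intro add_left_mono sum_mono mult_left_mono) (auto simp: less_imp_le)
  also have "\<dots> = ln ?v"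
    using r1 by (simp only: times_divide_eq_left nonzero_mult_div_cancel_right[OF less_imp_neq[OF vpos, symmetric]] sum_distrib_right[symmetric]) simp
  finally show ?thesis by simp
qed

text \<open>Mixing with the maximally mixed state gives all eigenvalues the lower bound \<eta> / n
  for 0 <= \<eta> <= 1 and a positive matrix \<open>A\<close>. It commutes with pinching and is
  affine in \<open>A\<close>, so convexity of a set of states is kept.\<close>

definition reg :: "nat \<Rightarrow> real \<Rightarrow> complex Matrix.mat \<Rightarrow> complex Matrix.mat" where
  "reg n \<eta> A = complex_of_real (1 - \<eta>) \<cdot>\<^sub>m A + complex_of_real (\<eta> / real n) \<cdot>\<^sub>m 1\<^sub>m n"

lemma reg_carrier [simp]: "A \<in> carrier_mat n n \<Longrightarrow> reg n \<eta> A \<in> carrier_mat n n"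
  by (simp add: reg_def)

lemma reg_index: "A \<in> carrier_mat n n \<Longrightarrow> i < n \<Longrightarrow> j < n \<Longrightarrow>
    reg n \<eta> A $$ (i, j) = of_real (1 - \<eta>) * A $$ (i, j) + (if i = j then of_real (\<eta> / real n) else 0)"
  by (simp add: reg_def)

lemma reg_dim [simp]: "dim_row (reg n \<eta> A) = n" "dim_col (reg n \<eta> A) = n"
  by (simp_all add: reg_def)

lemma reg_spec:
  assumes U: "unitary_mat n U"
  shows "reg n \<eta> (spec n U a) = spec n U (\<lambda>i. (1 - \<eta>) * a i + \<eta> / real n)"
proof -
  have Uc: "U \<in> carrier_mat n n" using U by (rule unitary_carrier)
  show ?thesis unfolding reg_def spec_one[OF U, symmetric] spec_smult[OF Uc] spec_add[OF Uc] by simp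
qed

lemma pin_reg: "A \<in> carrier_mat n n \<Longrightarrow> pin n s (reg n \<eta> A) = reg n \<eta> (pin n s A)"
  by (rule eq_matI) (auto simp: pin_index reg_index)

lemma density_reg:
  assumes "density_mat n A" "0 \<le> \<eta>" "\<eta> \<le> 1"
  shows "density_mat n (reg n \<eta> A)"
proof -
  from assms(1) obtain U l where U: "unitary_mat n U" "A = spec n U l" "\<And>i. 0 \<le> l i" "(\<Sum>i<n. l i) = 1"
    by (rule density_obtain_spec) auto
  have "n > 0" using U(4) by (cases n) auto
  then show ?thesis
    unfolding U(2) reg_spec[OF U(1)] density_spec_iff[OF U(1)] using U(3,4) assms
    by (auto simp: sum.distrib sum_distrib_left[symmetric])
qed

lemma mtrace_mult_diag:
  assumes "M \<in> carrier_mat n n"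
  shows "mtrace (M * spec n (1\<^sub>m n) l) = (\<Sum>i<n. M $$ (i, i) * of_real (l i))"
proof -
  have q: "qfc n M (colf (1\<^sub>m n) i) = M $$ (i, i)" if "i < n" for i
  proof -
    have "qfc n M (colf (1\<^sub>m n) i) = (\<Sum>x<n. \<Sum>y<n. if x = i \<and> y = i then M $$ (x, y) else 0)"
      unfolding qfc_def using that by (intro sum.cong refl) auto
    also have "\<dots> = (\<Sum>x<n. if x = i then (\<Sum>y<n. if y = i then M $$ (x, y) else 0) else 0)"
      by (intro sum.cong refl) auto
    finally show ?thesis using that by simp
  qed
  have "mtrace (M * spec n (1\<^sub>m n) l) = mtrace (spec n (1\<^sub>m n) l * M)"
    using assms by (intro mtrace_mult_commute) auto
  also have "\<dots> = (\<Sum>i<n. of_real (l i) * M $$ (i, i))"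
    using assms by (simp add: mtrace_spec_mult q)
  finally show ?thesis by (simp add: mult.commute)
qed

section \<open>The single-block observable\<close>

text \<open>Sequential compactness for entrywise limits, stated for the n by n entries only.\<close>

definition seqcomp :: "nat \<Rightarrow> complex Matrix.mat set \<Rightarrow> bool" where
  "seqcomp n S \<longleftrightarrow> (\<forall>f. (\<forall>j. f j \<in> S) \<longrightarrow> (\<exists>\<rho>\<in>S. \<exists>\<phi>. strict_mono (\<phi>::nat \<Rightarrow> nat) \<and>
     (\<forall>x<n. \<forall>y<n. (\<lambda>j. f (\<phi> j) $$ (x, y)) \<longlonglongrightarrow> \<rho> $$ (x, y))))"

definition convmat :: "complex Matrix.mat set \<Rightarrow> bool" where
  "convmat S \<longleftrightarrow> (\<forall>A\<in>S. \<forall>B\<in>S. \<forall>t. 0 \<le> t \<and> t \<le> 1 \<longrightarrow> complex_of_real (1 - t) \<cdot>\<^sub>m A + complex_of_real t \<cdot>\<^sub>m B \<in> S)"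

lemma psd_diag_nonneg:
  assumes "psd_mat n A" "i < n" shows "0 \<le> Re (A $$ (i, i))"
proof -
  have A: "A \<in> carrier_mat n n" using assms by (simp add: psd_carrier)
  have "psd_mat n (spec n (1\<^sub>m n) (\<lambda>k. if k = i then 1 else 0))" by (simp add: psd_spec_iff unitary_one)
  then have "0 \<le> Re (\<Sum>k<n. A $$ (k, k) * of_real (if k = i then 1 else 0))"
    using psd_trace_nonneg[OF assms(1)] mtrace_mult_diag[OF A] by metis
  also have "(\<Sum>k<n. A $$ (k, k) * of_real (if k = i then 1 else 0)) = (\<Sum>k<n. if k = i then A $$ (k, k) else 0)"
    by (intro sum.cong refl) auto
  also have "\<dots> = A $$ (i, i)" using assms by simp
  finally show ?thesis .
qed

text \<open>Lower semicontinuity along a vanishing regularisation. Klein's inequality replaces the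
  entropy of the moving states by a linear functional built from the fixed limit state, which
  converges entrywise. Only after that limit is the auxiliary regularisation \<open>c\<close>
  removed.\<close>

lemma rel_ent_lsc:
  assumes n: "0 < n" and s: "\<And>i. 0 \<le> s i" "\<And>i. s i \<le> 1"
    and R: "\<And>j. density_mat n (R j)" and rho: "density_mat n \<rho>"
    and lim: "\<And>x y. x < n \<Longrightarrow> y < n \<Longrightarrow> (\<lambda>j. R j $$ (x, y)) \<longlonglongrightarrow> \<rho> $$ (x, y)"
    and eta: "\<And>j. 0 < \<eta> j" "\<And>j. \<eta> j < 1" "\<eta> \<longlonglongrightarrow> 0"
    and le: "\<And>j. nent n (reg n (\<eta> j) (R j)) - (\<Sum>i<n. Re (reg n (\<eta> j) (R j) $$ (i, i)) * ln ((1 - \<eta> j) * s i + \<eta> j / real n)) \<le> z"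
  shows "rel_ent n \<rho> (spec n (1\<^sub>m n) s) \<le> ereal z"
proof -
  from rho obtain U r where U: "unitary_mat n U" "\<rho> = spec n U r" "\<And>i. 0 \<le> r i" "(\<Sum>i<n. r i) = 1"
    by (rule density_obtain_spec) auto
  have Uc: "U \<in> carrier_mat n n" using U by (simp add: unitary_carrier)
  have Rc: "R j \<in> carrier_mat n n" for j using R by (simp add: density_carrier)
  have rc: "\<rho> \<in> carrier_mat n n" using rho by (simp add: density_carrier)
  let ?G = "\<lambda>j. reg n (\<eta> j) (R j)"
  define th where "th j i = (1 - \<eta> j) * s i + \<eta> j / real n" for j i
  have th: "0 < th j i" "th j i \<le> 1" for j i
  proof -
    have "0 < \<eta> j / real n" using eta(1) n by simp
    moreover have "0 \<le> (1 - \<eta> j) * s i" using eta(2)[of j] s(1)[of i] by (intro mult_nonneg_nonneg) auto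
    ultimately show "0 < th j i" by (simp add: th_def)
    have "(1 - \<eta> j) * s i \<le> (1 - \<eta> j) * 1" using eta(2)[of j] s(2) by (intro mult_left_mono) auto
    moreover have "\<eta> j / real n \<le> \<eta> j" using n eta(1)[of j] by (simp add: divide_le_eq)
    ultimately show "th j i \<le> 1" by (simp add: th_def)
  qed
  have G: "density_mat n (?G j)" for j using R eta by (intro density_reg) (auto simp: less_imp_le)
  have Gc: "?G j \<in> carrier_mat n n" for j by (simp add: Rc)
  have Glim: "(\<lambda>j. ?G j $$ (x, y)) \<longlonglongrightarrow> \<rho> $$ (x, y)" if "x < n" "y < n" for x y
  proof -
    have e: "(\<lambda>j. complex_of_real (1 - \<eta> j)) \<longlonglongrightarrow> of_real (1 - 0)" by (intro tendsto_of_real tendsto_diff tendsto_const eta(3))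
    have f: "(\<lambda>j. complex_of_real (\<eta> j / real n)) \<longlonglongrightarrow> of_real (0 / real n)" using n by (intro tendsto_of_real tendsto_divide tendsto_const eta(3)) auto
    have "(\<lambda>j. of_real (1 - \<eta> j) * R j $$ (x, y)) \<longlonglongrightarrow> \<rho> $$ (x, y)"
      using tendsto_mult[OF e lim[OF that]] by simp
    then show ?thesis using that tendsto_add[OF _ f, of "\<lambda>j. of_real (1 - \<eta> j) * R j $$ (x, y)" "\<rho> $$ (x, y)"]
      by (cases "x = y") (simp_all add: reg_index[OF Rc])
  qed
  define m where "m j i = Re (?G j $$ (i, i))" for j i
  have m0: "0 \<le> m j i" if "i < n" for j i
    unfolding m_def using G that by (intro psd_diag_nonneg) (auto simp: density_mat_def)
  have mlim: "(\<lambda>j. m j i) \<longlonglongrightarrow> Re (\<rho> $$ (i, i))" if "i < n" for i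
    unfolding m_def by (intro tendsto_Re Glim that)
  \<comment> \<open>The logarithm of the regularised limit state. It is finite for
    \<open>0 < c < 1\<close> and does not depend on \<open>j\<close>, so traces against it
    converge.\<close>
  define L where "L c = mat_fun n log_supp (reg n c \<rho>)" for c
  have Ls: "L c = spec n U (\<lambda>i. log_supp ((1 - c) * r i + c / real n))" for c
    unfolding L_def U(2) reg_spec[OF U(1)] mat_fun_spec[OF U(1)] ..
  have Lc: "L c \<in> carrier_mat n n" for c unfolding Ls by (rule spec_carrier[OF Uc])
  have kl: "Re (mtrace (?G j * L c)) \<le> nent n (?G j)" if c: "0 < c" "c < 1" for j c
  proof -
    have "density_mat n (reg n c \<rho>)" using rho c by (intro density_reg) auto
    moreover have "0 < (1 - c) * r i + c / real n" for i
    proof -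
      have "0 \<le> (1 - c) * r i" using c U(3)[of i] by (intro mult_nonneg_nonneg) auto
      moreover have "0 < c / real n" using c n by simp
      ultimately show ?thesis by simp
    qed
    ultimately show ?thesis
      unfolding L_def U(2) reg_spec[OF U(1)] by (intro klein[OF G U(1)]) auto
  qed
  have trlim: "(\<lambda>j. Re (mtrace (?G j * L c))) \<longlonglongrightarrow> Re (mtrace (\<rho> * L c))" for c
    unfolding mtrace_mult[OF Gc Lc] mtrace_mult[OF rc Lc]
    by (intro tendsto_Re tendsto_sum tendsto_mult Glim tendsto_const) auto
  have le': "Re (mtrace (?G j * L c)) + (\<Sum>i<n. m j i * (- ln (th j i))) \<le> z" if "0 < c" "c < 1" for j c
    using kl[OF that, of j] le[of j] by (simp add: m_def th_def sum_negf)
  have pos: "0 \<le> m j i * (- ln (th j i))" if "i < n" for j i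
    using m0[OF that] th[of j i] by (intro mult_nonneg_nonneg) auto
  \<comment> \<open>If the limit had weight where \<open>s i = 0\<close>, the summand with - ln
    (\<eta> / n) would diverge. The other diagonal terms are non-negative because \<open>th\<close>
    is at most 1, and the trace term converges, contradicting the bound \<open>z\<close>.\<close>
  have supp: "Re (\<rho> $$ (i, i)) = 0" if i: "i < n" "s i = 0" for i
  proof (rule ccontr)
    assume ne: "Re (\<rho> $$ (i, i)) \<noteq> 0"
    have "0 \<le> Re (\<rho> $$ (i, i))" using rho i by (intro psd_diag_nonneg) (auto simp: density_mat_def)
    then have p: "0 < Re (\<rho> $$ (i, i))" using ne by simp
    have "filterlim (\<lambda>j. \<eta> j / real n) (at_right 0) sequentially"
      using eta(1) n tendsto_divide[OF eta(3) tendsto_const[of "real n"]] by (intro tendsto_imp_filterlim_at_right) auto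
    then have "filterlim (\<lambda>j. - ln (\<eta> j / real n)) at_top sequentially"
      using filterlim_compose[OF ln_at_0] by (simp add: filterlim_uminus_at_top)
    then have "filterlim (\<lambda>j. m j i * (- ln (\<eta> j / real n))) at_top sequentially"
      by (rule filterlim_tendsto_pos_mult_at_top[OF mlim[OF i(1)] p])
    then have "filterlim (\<lambda>j. Re (mtrace (?G j * L (1/2))) + m j i * (- ln (\<eta> j / real n))) at_top sequentially"
      by (rule filterlim_tendsto_add_at_top[OF trlim])
    then have "eventually (\<lambda>j. z < Re (mtrace (?G j * L (1/2))) + m j i * (- ln (\<eta> j / real n))) sequentially"
      by (simp add: filterlim_at_top_dense)
    then obtain j where j: "z < Re (mtrace (?G j * L (1/2))) + m j i * (- ln (\<eta> j / real n))"
      using eventually_happens'[OF sequentially_bot] by blast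
    have "m j i * (- ln (th j i)) \<le> (\<Sum>i<n. m j i * (- ln (th j i)))"
      using i pos by (intro member_le_sum) auto
    then show False using j le'[of "1/2" j] i by (simp add: th_def)
  qed
  define C where "C = (\<Sum>i<n. if 0 < s i then Re (\<rho> $$ (i, i)) * ln (s i) else 0)"
  have b: "Re (mtrace (\<rho> * L c)) - C \<le> z" if c: "0 < c" "c < 1" for c
  proof (rule LIMSEQ_le_const2)
    have "(\<lambda>j. th j i) \<longlonglongrightarrow> (1 - 0) * s i + 0 / real n" for i
      unfolding th_def using n by (intro tendsto_intros eta(3)) auto
    then have "(\<lambda>j. ln (th j i)) \<longlonglongrightarrow> ln (s i)" if "0 < s i" for i
      using that tendsto_ln[of "\<lambda>j. th j i" "s i"] by auto
    then show "(\<lambda>j. Re (mtrace (?G j * L c)) - (\<Sum>i<n. if 0 < s i then m j i * ln (th j i) else 0)) \<longlonglongrightarrow> Re (mtrace (\<rho> * L c)) - C"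
      unfolding C_def by (intro tendsto_diff trlim tendsto_sum) (auto intro!: tendsto_mult mlim)
    have "Re (mtrace (?G j * L c)) - (\<Sum>i<n. if 0 < s i then m j i * ln (th j i) else 0) \<le> z" for j
    proof -
      have "- (\<Sum>i<n. if 0 < s i then m j i * ln (th j i) else 0) \<le> (\<Sum>i<n. m j i * (- ln (th j i)))"
        unfolding sum_negf[symmetric] using pos by (intro sum_mono) (auto simp: )
      then show ?thesis using le'[OF c, of j] by linarith
    qed
    then show "\<exists>N. \<forall>j\<ge>N. Re (mtrace (?G j * L c)) - (\<Sum>i<n. if 0 < s i then m j i * ln (th j i) else 0) \<le> z" by blast
  qed
  \<comment> \<open>Only the part (1 - c) r_i of the regularised eigenvalue is used, so passing from
    \<open>L c\<close> to the true logarithm costs - ln (1 - c). The later choice of c as 1 - exp (-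
    e) makes this exactly e.\<close>
  have cc: "nent n \<rho> + ln (1 - c) \<le> Re (mtrace (\<rho> * L c))" if c: "0 < c" "c < 1" for c
  proof -
    have "nent n \<rho> + ln (1 - c) = (\<Sum>i<n. r i * (log_supp (r i) + ln (1 - c)))"
      unfolding U(2) nent_spec[OF U(1)] by (simp add: distrib_left sum.distrib sum_distrib_right[symmetric] U(4))
    also have "\<dots> \<le> (\<Sum>i<n. r i * log_supp ((1 - c) * r i + c / real n))"
    proof (intro sum_mono)
      fix i
      show "r i * (log_supp (r i) + ln (1 - c)) \<le> r i * log_supp ((1 - c) * r i + c / real n)"
      proof (cases "r i = 0")
        case False
        then have ri: "0 < r i" using U(3)[of i] by simp
        have p: "0 < (1 - c) * r i" using ri c by simp
        have "ln (r i) + ln (1 - c) = ln ((1 - c) * r i)" using ri c by (simp add: ln_mult)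
        also have "\<dots> \<le> ln ((1 - c) * r i + c / real n)" using p c n by (subst ln_le_cancel_iff) (auto intro: add_pos_nonneg)
        finally have "log_supp (r i) + ln (1 - c) \<le> log_supp ((1 - c) * r i + c / real n)"
          using ri p c n by (auto simp: log_supp_def add_pos_nonneg)
        then show ?thesis using ri by (intro mult_left_mono) auto
      qed simp
    qed
    also have "\<dots> = Re (mtrace (\<rho> * L c))" unfolding Ls U(2) spec_mult[OF U(1)] mtrace_spec[OF U(1)] by simp
    finally show ?thesis .
  qed
  have fin: "nent n \<rho> - C \<le> z"
  proof (rule field_le_epsilon)
    fix e :: real assume e: "0 < e"
    let ?c = "1 - exp (- e)"
    have c: "0 < ?c" "?c < 1" using e by auto
    show "nent n \<rho> - C \<le> z + e" using b[OF c] cc[OF c] by simp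
  qed
  have diag: "Re (\<rho> $$ (j, j)) = (\<Sum>i<n. r i * ovl n U (1\<^sub>m n) i j)" if "j < n" for j
  proof -
    have q: "qfc n \<rho> (colf (1\<^sub>m n) j) = (\<Sum>x<n. if x = j then (\<Sum>y<n. if y = j then \<rho> $$ (x, y) else 0) else 0)"
    proof -
      have "qfc n \<rho> (colf (1\<^sub>m n) j) = (\<Sum>x<n. \<Sum>y<n. if x = j \<and> y = j then \<rho> $$ (x, y) else 0)"
        unfolding qfc_def using that by (intro sum.cong refl) auto
      also have "\<dots> = (\<Sum>x<n. if x = j then (\<Sum>y<n. if y = j then \<rho> $$ (x, y) else 0) else 0)"
        by (intro sum.cong refl) auto
      finally show ?thesis .
    qed
    have "\<rho> $$ (j, j) = qfc n \<rho> (colf (1\<^sub>m n) j)" using that unfolding q by simp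
    also have "\<dots> = of_real (\<Sum>i<n. r i * ovl n (1\<^sub>m n) U j i)" unfolding U(2) by (rule qfc_spec_col[OF Uc])
    finally show ?thesis by (simp add: ovl_commute[of n U] del: of_real_sum)
  qed
  have cond: "\<forall>i<n. \<forall>j<n. s j = 0 \<longrightarrow> r i * ovl n U (1\<^sub>m n) i j = 0"
  proof (intro allI impI)
    fix i j assume ij: "i < n" "j < n" "s j = 0"
    then have "(\<Sum>i<n. r i * ovl n U (1\<^sub>m n) i j) = 0" using diag[OF ij(2)] supp[OF ij(2,3)] by simp
    then show "r i * ovl n U (1\<^sub>m n) i j = 0" using U(3) ij by (subst (asm) sum_nonneg_eq_0_iff) auto
  qed
  have "(\<Sum>i<n. \<Sum>j<n. r i * log_supp (s j) * ovl n U (1\<^sub>m n) i j) = (\<Sum>j<n. \<Sum>i<n. r i * log_supp (s j) * ovl n U (1\<^sub>m n) i j)"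
    by (rule sum.swap)
  also have "\<dots> = C"
    unfolding C_def
  proof (intro sum.cong refl)
    fix j assume "j \<in> {..<n}"
    have "(\<Sum>i<n. r i * log_supp (s j) * ovl n U (1\<^sub>m n) i j) = Re (\<rho> $$ (j, j)) * log_supp (s j)"
      unfolding diag[OF \<open>j \<in> {..<n}\<close>[unfolded lessThan_iff]] sum_distrib_right by (intro sum.cong refl) simp
    then show "(\<Sum>i<n. r i * log_supp (s j) * ovl n U (1\<^sub>m n) i j) = (if 0 < s j then Re (\<rho> $$ (j, j)) * ln (s j) else 0)"
      by (simp add: log_supp_def)
  qed
  finally have "rel_val n U r (1\<^sub>m n) s = nent n \<rho> - C" unfolding rel_val_def U(2) nent_spec[OF U(1)] by simp
  then show ?thesis unfolding U(2) rel_ent_spec[OF U(1) unitary_one U(3) s(1)] using cond fin U(2) by simp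
qed

text \<open>The scalar logarithm is Lipschitz with constant 1 / c above \<open>c\<close>, and
  \<open>fro_spec_diff\<close> transfers this to the Hilbert-Schmidt norm pair by pair of
  eigenvalues.\<close>

lemma fro_log_le:
  assumes U: "unitary_mat n U" and V: "unitary_mat n V" and c: "0 < c"
    and a: "\<And>i. i < n \<Longrightarrow> c \<le> a i" and b: "\<And>i. i < n \<Longrightarrow> c \<le> b i"
  shows "fro n (mat_fun n log_supp (spec n U a) - mat_fun n log_supp (spec n V b)) \<le> fro n (spec n U a - spec n V b) / c\<^sup>2"
proof -
  have lip: "(ln x - ln y)\<^sup>2 \<le> (x - y)\<^sup>2 / c\<^sup>2" if "c \<le> x" "c \<le> y" for x y
  proof -
    have pos: "0 < x" "0 < y" using that c by auto
    have h: "ln u - ln w \<le> \<bar>u - w\<bar> / c" if uw: "c \<le> u" "c \<le> w" for u w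
    proof -
      have p: "0 < u" "0 < w" using uw c by auto
      have "ln u - ln w = ln (u / w)" using p by (simp add: ln_div)
      also have "\<dots> \<le> u / w - 1" using p by (intro ln_le_minus_one) auto
      also have "\<dots> = (u - w) / w" using p by (simp add: field_simps)
      also have "\<dots> \<le> \<bar>u - w\<bar> / w" using p by (intro divide_right_mono) auto
      also have "\<dots> \<le> \<bar>u - w\<bar> / c" using uw c by (intro divide_left_mono) auto
      finally show ?thesis .
    qed
    have "\<bar>ln x - ln y\<bar> \<le> \<bar>x - y\<bar> / c" using h[OF that] h[OF that(2,1)] by (simp add: abs_minus_commute abs_le_iff)
    then have "\<bar>ln x - ln y\<bar>\<^sup>2 \<le> (\<bar>x - y\<bar> / c)\<^sup>2" by (intro power_mono) auto
    then show ?thesis by (simp add: power_divide)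
  qed
  show ?thesis
    unfolding mat_fun_spec[OF U] mat_fun_spec[OF V] fro_spec_diff[OF U V] sum_divide_distrib
  proof (intro sum_mono)
    fix i j assume ij: "i \<in> {..<n}" "j \<in> {..<n}"
    then have ls: "log_supp (a i) = ln (a i)" "log_supp (b j) = ln (b j)" using a[of i] b[of j] c by (auto simp: log_supp_def)
    show "(log_supp (a i) - log_supp (b j))\<^sup>2 * ovl n U V i j \<le> (a i - b j)\<^sup>2 * ovl n U V i j / c\<^sup>2"
      unfolding ls using mult_right_mono[OF lip[of "a i" "b j"], of "ovl n U V i j"] a[of i] b[of j] ij by simp
  qed
qed

lemma cmod_le_fro: "x < n \<Longrightarrow> y < n \<Longrightarrow> cmod (M $$ (x, y)) \<le> sqrt (fro n M)"
proof -
  assume xy: "x < n" "y < n"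
  have "(cmod (M $$ (x, y)))\<^sup>2 \<le> (\<Sum>y<n. (cmod (M $$ (x, y)))\<^sup>2)" using xy by (intro member_le_sum) auto
  also have "\<dots> \<le> fro n M" unfolding fro_def using xy by (intro member_le_sum[where f="\<lambda>x. \<Sum>y<n. (cmod (M $$ (x, y)))\<^sup>2"]) (auto intro!: sum_nonneg)
  finally show ?thesis by (simp add: real_le_rsqrt)
qed

lemma density_entry_le: "density_mat n A \<Longrightarrow> x < n \<Longrightarrow> y < n \<Longrightarrow> cmod (A $$ (x, y)) \<le> 1"
proof -
  assume d: "density_mat n A" and xy: "x < n" "y < n"
  then obtain U l where U: "unitary_mat n U" "A = spec n U l" "\<And>i. 0 \<le> l i" "(\<Sum>i<n. l i) = 1"
    by (elim density_obtain_spec) auto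
  have "of_real (fro n A) = mtrace (A * A)" unfolding U(2) by (rule fro_hermitian[OF spec_hermitian[OF unitary_carrier[OF U(1)]], symmetric])
  also have "\<dots> = of_real (\<Sum>i<n. l i * l i)" using U by (simp add: spec_mult mtrace_spec)
  finally have "fro n A = (\<Sum>i<n. l i * l i)" by (simp only: of_real_eq_iff)
  also have "\<dots> \<le> (\<Sum>i<n. l i * 1)"
    using U(3,4) member_le_sum[of _ "{..<n}" l] by (intro sum_mono mult_left_mono) auto
  finally have "sqrt (fro n A) \<le> 1" using U(4) by simp
  then show ?thesis using cmod_le_fro[OF xy, of A] by linarith
qed

text \<open>A crude entrywise estimate. It is applied at a fixed dimension, so the factor n^2 does
  no harm.\<close>

lemma mtrace_density_le_fro:
  assumes "density_mat n A" "M \<in> carrier_mat n n"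
  shows "\<bar>Re (mtrace (A * M))\<bar> \<le> real n * real n * sqrt (fro n M)"
proof -
  have "\<bar>Re (mtrace (A * M))\<bar> \<le> cmod (mtrace (A * M))" by (rule abs_Re_le_cmod)
  also have "\<dots> \<le> (\<Sum>x<n. \<Sum>y<n. cmod (A $$ (x, y) * M $$ (y, x)))"
    unfolding mtrace_mult[OF density_carrier[OF assms(1)] assms(2)] by (intro order.trans[OF norm_sum] sum_mono norm_sum)
  also have "\<dots> \<le> (\<Sum>x<n. \<Sum>y<n. 1 * sqrt (fro n M))"
    unfolding norm_mult using assms by (intro sum_mono mult_mono density_entry_le cmod_le_fro) auto
  finally show ?thesis by simp
qed


lemma mtrace_lincomb:
  assumes "A \<in> carrier_mat n n" "B \<in> carrier_mat n n" "M \<in> carrier_mat n n"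
  shows "mtrace ((complex_of_real p \<cdot>\<^sub>m A + complex_of_real q \<cdot>\<^sub>m B) * M) = of_real p * mtrace (A * M) + of_real q * mtrace (B * M)"
proof -
  have c: "complex_of_real p \<cdot>\<^sub>m A + complex_of_real q \<cdot>\<^sub>m B \<in> carrier_mat n n" using assms by simp
  show ?thesis
    unfolding mtrace_mult[OF c assms(3)] mtrace_mult[OF assms(1,3)] mtrace_mult[OF assms(2,3)] sum_distrib_left sum.distrib[symmetric]
    using assms by (intro sum.cong refl) (simp add: algebra_simps)
qed

lemma fro_smult: "M \<in> carrier_mat n n \<Longrightarrow> fro n (complex_of_real t \<cdot>\<^sub>m M) = t\<^sup>2 * fro n M"
  unfolding fro_def sum_distrib_left by (intro sum.cong refl) (simp add: norm_mult power_mult_distrib)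

text \<open>A near-minimiser of the relative entropy on a convex set satisfies an approximate Pythagorean inequality:
  moving a little towards \<open>\<rho>\<close> cannot decrease the relative entropy, and by Klein's inequality the change is
  controlled by the linear functional \<open>log Q\<^sub>* - T\<close>.\<close>
lemma approx_minimizer:
  assumes n: "0 < n" and c: "0 < c" and S: "S \<noteq> {}"
    and Q: "\<And>\<rho>. \<rho> \<in> S \<Longrightarrow> density_mat n (Q \<rho>)"
    and Qc: "\<And>\<rho>. \<rho> \<in> S \<Longrightarrow> \<exists>U a. unitary_mat n U \<and> Q \<rho> = spec n U a \<and> (\<forall>i<n. c \<le> a i)"
    and conv: "\<And>A B t. A \<in> S \<Longrightarrow> B \<in> S \<Longrightarrow> 0 \<le> t \<Longrightarrow> t \<le> 1 \<Longrightarrow>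
      \<exists>C\<in>S. Q C = complex_of_real (1 - t) \<cdot>\<^sub>m Q A + complex_of_real t \<cdot>\<^sub>m Q B"
    and T: "T \<in> carrier_mat n n"
    and ge: "\<And>\<rho>. \<rho> \<in> S \<Longrightarrow> y \<le> nent n (Q \<rho>) - Re (mtrace (Q \<rho> * T))" and d: "0 < \<delta>"
  shows "\<exists>m\<in>S. \<forall>\<rho>\<in>S. y - \<delta> \<le> Re (mtrace (Q \<rho> * (mat_fun n log_supp (Q m) - T)))"
proof -
  define g where "g \<rho> = nent n (Q \<rho>) - Re (mtrace (Q \<rho> * T))" for \<rho>
  \<comment> \<open>A step \<open>t\<close> moves the state by at most 2 n t in Hilbert-Schmidt
    norm, hence its logarithm by 2 n t / c, hence a trace against a state by n^2 times that, which
    is K t.\<close>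
  define K where "K = 2 * real n ^ 3 / c"
  have K: "0 < K" using n c by (simp add: K_def)
  \<comment> \<open>The minimiser is taken up to t^2, which leaves t after division by the step.
    Replacing the logarithm at the moved point by the one at the minimiser costs K t twice. So (1 +
    2 K) t must not exceed \<delta>.\<close>
  define t where "t = min (1/2) (\<delta> / (1 + 2 * K))"
  have t: "0 < t" "t \<le> 1" "(1 + 2 * K) * t \<le> \<delta>"
  proof -
    show "0 < t" "t \<le> 1" using d K by (auto simp: t_def)
    have "(1 + 2 * K) * t \<le> (1 + 2 * K) * (\<delta> / (1 + 2 * K))" using K by (intro mult_left_mono) (auto simp: t_def)
    then show "(1 + 2 * K) * t \<le> \<delta>" using K by simp
  qed
  have bdd: "bdd_below (g ` S)" using ge by (auto simp: g_def intro!: bdd_belowI2[of _ y])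
  have "Inf (g ` S) < Inf (g ` S) + t\<^sup>2" using t by simp
  then obtain m where m: "m \<in> S" "g m < Inf (g ` S) + t\<^sup>2"
    using cInf_lessD[of "g ` S"] S by blast
  have "y - \<delta> \<le> Re (mtrace (Q \<rho> * (mat_fun n log_supp (Q m) - T)))" if r: "\<rho> \<in> S" for \<rho>
  proof -
    obtain C where C: "C \<in> S" "Q C = complex_of_real (1 - t) \<cdot>\<^sub>m Q m + complex_of_real t \<cdot>\<^sub>m Q \<rho>"
      using conv[OF m(1) r, of t] t by auto
    obtain U a where U: "unitary_mat n U" "Q C = spec n U a" "\<And>i. i < n \<Longrightarrow> c \<le> a i" using Qc[OF C(1)] by blast
    obtain V b where V: "unitary_mat n V" "Q m = spec n V b" "\<And>i. i < n \<Longrightarrow> c \<le> b i" using Qc[OF m(1)] by blast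
    define L where "L = mat_fun n log_supp (Q C)"
    define L0 where "L0 = mat_fun n log_supp (Q m)"
    have Lc: "L \<in> carrier_mat n n" "L0 \<in> carrier_mat n n"
      unfolding L_def L0_def U(2) V(2) mat_fun_spec[OF U(1)] mat_fun_spec[OF V(1)] by (simp_all add: unitary_carrier U V)
    have qc: "Q \<rho> \<in> carrier_mat n n" if "\<rho> \<in> S" for \<rho> using Q[OF that] by (rule density_carrier)
    have "fro n (Q C - Q m) \<le> (2 * real n * t)\<^sup>2"
    proof -
      have eq: "Q C - Q m = complex_of_real t \<cdot>\<^sub>m (Q \<rho> - Q m)"
        unfolding C(2) using qc[OF r] qc[OF m(1)] by (intro eq_matI) (auto simp: algebra_simps)
      have "fro n (Q \<rho> - Q m) \<le> (\<Sum>x<n. \<Sum>y<n. 2\<^sup>2)"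
        unfolding fro_def
      proof (intro sum_mono power_mono)
        fix x y assume xy: "x \<in> {..<n}" "y \<in> {..<n}"
        then have "cmod ((Q \<rho> - Q m) $$ (x, y)) \<le> cmod (Q \<rho> $$ (x, y)) + cmod (Q m $$ (x, y))"
          using qc[OF r] qc[OF m(1)] by (simp add: norm_triangle_ineq4)
        then show "cmod ((Q \<rho> - Q m) $$ (x, y)) \<le> 2"
          using density_entry_le[OF Q[OF r], of x y] density_entry_le[OF Q[OF m(1)], of x y] xy by simp
      qed auto
      also have "\<dots> = (2 * real n)\<^sup>2" by (simp add: power2_eq_square)
      finally have "t\<^sup>2 * fro n (Q \<rho> - Q m) \<le> t\<^sup>2 * (2 * real n)\<^sup>2" by (intro mult_left_mono) auto
      moreover have "Q \<rho> - Q m \<in> carrier_mat n n" using qc[OF m(1)] by (simp add: minus_carrier_mat)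
      ultimately show ?thesis unfolding eq by (simp add: fro_smult power_mult_distrib mult_ac)
    qed
    then have "fro n (Q C - Q m) / c\<^sup>2 \<le> (2 * real n * t)\<^sup>2 / c\<^sup>2" by (intro divide_right_mono) auto
    moreover have "fro n (L - L0) \<le> fro n (Q C - Q m) / c\<^sup>2"
      unfolding L_def L0_def U(2) V(2) by (rule fro_log_le[OF U(1) V(1) c U(3) V(3)])
    ultimately have "fro n (L - L0) \<le> (2 * real n * t / c)\<^sup>2" by (simp add: power_divide)
    then have "sqrt (fro n (L - L0)) \<le> 2 * real n * t / c" using n c t by (intro real_le_lsqrt) auto
    then have "real n * real n * sqrt (fro n (L - L0)) \<le> real n * real n * (2 * real n * t / c)" by (intro mult_left_mono) auto
    then have kb: "real n * real n * sqrt (fro n (L - L0)) \<le> K * t" by (simp add: K_def power3_eq_cube mult_ac)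
    have kdiff: "\<bar>Re (mtrace (Q x * L)) - Re (mtrace (Q x * L0))\<bar> \<le> K * t" if "x \<in> S" for x
    proof -
      have "L - L0 \<in> carrier_mat n n" using Lc by (simp add: minus_carrier_mat)
      then show ?thesis using mtrace_density_le_fro[OF Q[OF that], of "L - L0"] kb
        by (simp add: mtrace_mult_diff_right[OF qc[OF that] Lc])
    qed
    have kl: "Re (mtrace (Q m * L)) \<le> nent n (Q m)"
      unfolding L_def U(2) using U(2) Q[OF C(1)] U(3) c by (intro klein[OF Q[OF m(1)] U(1)]) force+
    have "nent n (Q C) = (1 - t) * Re (mtrace (Q m * L)) + t * Re (mtrace (Q \<rho> * L))"
      unfolding nent_def L_def[symmetric] unfolding C(2) mtrace_lincomb[OF qc[OF m(1)] qc[OF r] Lc(1)] by simp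
    moreover have "Re (mtrace (Q C * T)) = (1 - t) * Re (mtrace (Q m * T)) + t * Re (mtrace (Q \<rho> * T))"
      unfolding C(2) mtrace_lincomb[OF qc[OF m(1)] qc[OF r] T] by simp
    moreover have "g m - t\<^sup>2 \<le> g C" using m(2) cInf_lower[OF _ bdd, of "g C"] C(1) by auto
    ultimately have "t * (Re (mtrace (Q m * L)) - Re (mtrace (Q m * T)) - t) \<le> t * (Re (mtrace (Q \<rho> * L)) - Re (mtrace (Q \<rho> * T)))"
      using kl by (simp add: g_def power2_eq_square algebra_simps)
    then have "Re (mtrace (Q m * L)) - Re (mtrace (Q m * T)) - t \<le> Re (mtrace (Q \<rho> * L)) - Re (mtrace (Q \<rho> * T))"
      using t by simp
    moreover have "nent n (Q m) = Re (mtrace (Q m * L0))" by (simp add: nent_def L0_def)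
    moreover have "y \<le> nent n (Q m) - Re (mtrace (Q m * T))" by (rule ge[OF m(1)])
    ultimately have "y - (t + K * t + K * t) \<le> Re (mtrace (Q \<rho> * L0)) - Re (mtrace (Q \<rho> * T))"
      using kdiff[OF m(1)] kdiff[OF r] by linarith
    moreover have "t + K * t + K * t \<le> \<delta>" using t(3) by (simp add: algebra_simps)
    ultimately show ?thesis using mtrace_mult_diff_right[OF qc[OF r] Lc(2) T] by (simp add: L0_def)
  qed
  then show ?thesis using m(1) by blast
qed


lemma app_diag: "x < n \<Longrightarrow> app n (spec n (1\<^sub>m n) l) v x = of_real (l x) * v x"
proof -
  assume x: "x < n"
  have i: "ip n (colf (1\<^sub>m n) i) v = v i" if "i < n" for i
  proof -
    have "ip n (colf (1\<^sub>m n) i) v = (\<Sum>k<n. if k = i then v k else 0)"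
      unfolding ip_def using that by (intro sum.cong refl) auto
    then show ?thesis using that by simp
  qed
  have "app n (spec n (1\<^sub>m n) l) v x = (\<Sum>i<n. if i = x then of_real (l i) * v i else 0)"
    unfolding app_spec[OF one_carrier_mat x] using x by (intro sum.cong refl) (auto simp: i)
  then show ?thesis using x by simp
qed

lemma blockdiag_diag: "blockdiag n s (spec n (1\<^sub>m n) (\<lambda>i. f (s i)))"
  by (rule blockdiag_spec[OF unitary_one, where \<beta>=s]) (auto split: if_splits)

text \<open>With a diagonal alternative, pinching only deletes entries. The observable is the
  logarithm of a near-minimising pinched and regularised state minus that of the regularised
  alternative, shifted by ln (1 - \<eta>). Near-minimality makes it large on all of
  \<open>S\<close>, and commutation with the alternative makes its exponential moment a sum of
  eigenvalues.\<close>

lemma block_observable_diag: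
  assumes n: "0 < n" and s: "\<And>i. 0 \<le> s i" "\<And>i. s i \<le> 1"
    and S: "S \<noteq> {}" "convmat S" "seqcomp n S" "\<And>\<rho>. \<rho> \<in> S \<Longrightarrow> density_mat n \<rho>"
    and gt: "\<And>\<rho>. \<rho> \<in> S \<Longrightarrow> ereal (y + ln (real (card (s ` {..<n})))) < rel_ent n \<rho> (spec n (1\<^sub>m n) s)"
    and d: "0 < \<delta>"
  shows "\<exists>W x. unitary_mat n W \<and> Re (mtrace (spec n (1\<^sub>m n) s * spec n W (\<lambda>j. exp (x j)))) \<le> 1 \<and>
    (\<forall>\<rho>\<in>S. y - \<delta> \<le> Re (mtrace (\<rho> * spec n W x)))"
proof -
  let ?lv = "ln (real (card (s ` {..<n})))"
  define N where "N = real n"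
  have N: "N > 0" using n by (simp add: N_def)
  define y' where "y' = y - \<delta> / 3"
  \<comment> \<open>This expression is the final lower bound on the expectation of the observable:
    \<eta> ln (N / \<eta>) pays for the identity part of the regularised state, the division undoes
    the factor 1 - \<eta>, and the last term is the shift. Its limit y' lies strictly above y -
    \<delta>.\<close>
  have "((\<lambda>\<eta>. (y' - \<eta> * ln (N / \<eta>)) / (1 - \<eta>) + ln (1 - \<eta>)) \<longlongrightarrow> y') (at_right 0)"
    using N by real_asymp
  then have "eventually (\<lambda>\<eta>. y - \<delta> < (y' - \<eta> * ln (N / \<eta>)) / (1 - \<eta>) + ln (1 - \<eta>)) (at_right 0)"
    by (rule order_tendstoD(1)) (use d in \<open>simp add: y'_def\<close>)
  then obtain e0 where e0: "0 < e0" "\<And>\<eta>. 0 < \<eta> \<Longrightarrow> \<eta> < e0 \<Longrightarrow> y - \<delta> < (y' - \<eta> * ln (N / \<eta>)) / (1 - \<eta>) + ln (1 - \<eta>)"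
    unfolding eventually_at_right_field by auto
  define e1 where "e1 = min e0 1"
  have e1: "0 < e1" "e1 \<le> e0" "e1 \<le> 1" using e0 by (auto simp: e1_def)
  define h where "h \<eta> \<rho> = nent n (reg n \<eta> \<rho>) - (\<Sum>i<n. Re (reg n \<eta> \<rho> $$ (i, i)) * ln ((1 - \<eta>) * s i + \<eta> / real n))" for \<eta> \<rho>
  \<comment> \<open>One weight \<eta> has to work for all of \<open>S\<close>. Otherwise
    counterexamples with \<eta> tending to 0 accumulate at some state of \<open>S\<close>, and
    \<open>rel_ent_lsc\<close> bounds its relative entropy against the hypothesis
    \<open>gt\<close>.\<close>
  have "\<exists>\<eta>. 0 < \<eta> \<and> \<eta> < e1 \<and> (\<forall>\<rho>\<in>S. y + ?lv \<le> h \<eta> \<rho>)"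
  proof (rule ccontr)
    assume "\<not> ?thesis"
    then have ex: "\<exists>\<rho>\<in>S. h \<eta> \<rho> < y + ?lv" if "0 < \<eta>" "\<eta> < e1" for \<eta> using that by (meson not_le)
    define e where "e j = e1 / (real j + 2)" for j :: nat
    have e: "0 < e j" "e j < e1" for j using e1 by (auto simp: e_def divide_less_eq)
    then have "\<forall>j. \<exists>\<rho>. \<rho> \<in> S \<and> h (e j) \<rho> < y + ?lv" using ex by blast
    then obtain f where f: "\<And>j. f j \<in> S" "\<And>j. h (e j) (f j) < y + ?lv" by metis
    then obtain \<rho> \<phi> where p: "\<rho> \<in> S" "strict_mono (\<phi>::nat \<Rightarrow> nat)"
      "\<And>x y. x < n \<Longrightarrow> y < n \<Longrightarrow> (\<lambda>j. f (\<phi> j) $$ (x, y)) \<longlonglongrightarrow> \<rho> $$ (x, y)"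
      using S(3) unfolding seqcomp_def by meson
    have "e \<longlonglongrightarrow> 0" unfolding e_def by real_asymp
    then have elim: "(\<lambda>j. e (\<phi> j)) \<longlonglongrightarrow> 0" using LIMSEQ_subseq_LIMSEQ[OF _ p(2)] by (simp add: o_def)
    have "rel_ent n \<rho> (spec n (1\<^sub>m n) s) \<le> ereal (y + ?lv)"
    proof (rule rel_ent_lsc[OF n s, where R="\<lambda>j. f (\<phi> j)" and \<eta>="\<lambda>j. e (\<phi> j)"])
      show "e (\<phi> j) < 1" for j using e(2)[of "\<phi> j"] e1 by linarith
      show "nent n (reg n (e (\<phi> j)) (f (\<phi> j))) - (\<Sum>i<n. Re (reg n (e (\<phi> j)) (f (\<phi> j)) $$ (i, i)) *
          ln ((1 - e (\<phi> j)) * s i + e (\<phi> j) / real n)) \<le> y + ?lv" for j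
        using f(2)[of "\<phi> j"] by (simp add: h_def)
    qed (use f S(4) p e elim in auto)
    then show False using gt[OF p(1)] by simp
  qed
  then obtain \<eta> where eta: "0 < \<eta>" "\<eta> < e1" and h: "\<And>\<rho>. \<rho> \<in> S \<Longrightarrow> y + ?lv \<le> h \<eta> \<rho>" by blast
  have eta1: "\<eta> < 1" using eta e1 by simp
  define th where "th z = (1 - \<eta>) * z + \<eta> / N" for z
  have th: "0 < th z" "\<eta> / N \<le> th z" "(1 - \<eta>) * z \<le> th z" if "0 \<le> z" for z
  proof -
    have "0 < \<eta> / N" "0 \<le> (1 - \<eta>) * z" using eta eta1 N that by auto
    then show "0 < th z" "\<eta> / N \<le> th z" "(1 - \<eta>) * z \<le> th z" by (auto simp: th_def)
  qed
  define T where "T = spec n (1\<^sub>m n) (\<lambda>i. ln (th (s i)))"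
  have Tc: "T \<in> carrier_mat n n" by (simp add: T_def)
  define Q where "Q \<rho> = reg n \<eta> (pin n s \<rho>)" for \<rho>
  have dQ: "density_mat n (Q \<rho>)" if "\<rho> \<in> S" for \<rho>
    unfolding Q_def using S(4)[OF that] eta eta1 by (intro density_reg density_pin) auto
  have "\<exists>m\<in>S. \<forall>\<rho>\<in>S. y - \<delta> / 3 \<le> Re (mtrace (Q \<rho> * (mat_fun n log_supp (Q m) - T)))"
  proof (rule approx_minimizer[OF n _ S(1) dQ, where c="\<eta> / N"])
    show "0 < \<eta> / N" using eta N by simp
    show "T \<in> carrier_mat n n" by (rule Tc)
    show "0 < \<delta> / 3" using d by simp
    show "\<exists>U a. unitary_mat n U \<and> Q \<rho> = spec n U a \<and> (\<forall>i<n. \<eta> / N \<le> a i)" if r: "\<rho> \<in> S" for \<rho>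
    proof -
      obtain U l where U: "unitary_mat n U" "pin n s \<rho> = spec n U l" "\<And>i. 0 \<le> l i"
        using density_pin[OF S(4)[OF r], of s] by (rule density_obtain_spec) auto
      have "Q \<rho> = spec n U (\<lambda>i. th (l i))" unfolding Q_def U(2) reg_spec[OF U(1)] th_def N_def ..
      then show ?thesis using U(1) th(2)[OF U(3)] by blast
    qed
    show "\<exists>C\<in>S. Q C = complex_of_real (1 - t) \<cdot>\<^sub>m Q A + complex_of_real t \<cdot>\<^sub>m Q B"
      if "A \<in> S" "B \<in> S" "0 \<le> t" "t \<le> 1" for A B t
    proof
      let ?C = "complex_of_real (1 - t) \<cdot>\<^sub>m A + complex_of_real t \<cdot>\<^sub>m B"
      show "?C \<in> S" using S(2) that by (auto simp: convmat_def)
      have c: "A \<in> carrier_mat n n" "B \<in> carrier_mat n n" using S(4) that by (auto simp: density_carrier)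
      show "Q ?C = complex_of_real (1 - t) \<cdot>\<^sub>m Q A + complex_of_real t \<cdot>\<^sub>m Q B"
        unfolding Q_def using c by (intro eq_matI) (auto simp: reg_index pin_index algebra_simps)
    qed
    show "y \<le> nent n (Q \<rho>) - Re (mtrace (Q \<rho> * T))" if r: "\<rho> \<in> S" for \<rho>
    proof -
      obtain U l where U: "unitary_mat n U" "\<rho> = spec n U l" "\<And>i. 0 \<le> l i" "(\<Sum>i<n. l i) = 1"
        using S(4)[OF r] by (rule density_obtain_spec) auto
      have rc: "\<rho> \<in> carrier_mat n n" using S(4)[OF r] by (rule density_carrier)
      have rg: "reg n \<eta> \<rho> = spec n U (\<lambda>i. th (l i))" unfolding U(2) reg_spec[OF U(1)] th_def N_def ..
      have s1: "(\<Sum>i<n. th (l i)) = 1" using U(4) N by (simp add: th_def sum.distrib sum_distrib_left[symmetric] N_def)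
      have 1: "nent n (reg n \<eta> \<rho>) - ?lv \<le> nent n (Q \<rho>)"
        unfolding Q_def pin_reg[OF rc, symmetric] rg by (rule pinching_entropy[OF U(1) _ s1]) (rule th(1)[OF U(3)])
      have "mtrace (Q \<rho> * T) = mtrace (reg n \<eta> \<rho> * T)"
        unfolding Q_def pin_reg[OF rc, symmetric] T_def using rc by (intro mtrace_pin blockdiag_diag) auto
      also have "\<dots> = (\<Sum>i<n. reg n \<eta> \<rho> $$ (i, i) * of_real (ln (th (s i))))"
        unfolding T_def using rc by (intro mtrace_mult_diag) auto
      finally have 2: "Re (mtrace (Q \<rho> * T)) = (\<Sum>i<n. Re (reg n \<eta> \<rho> $$ (i, i)) * ln (th (s i)))" by simp
      show ?thesis using h[OF r] 1 unfolding 2 h_def th_def N_def by linarith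
    qed
  qed auto
  then obtain m where m: "m \<in> S" "\<And>\<rho>. \<rho> \<in> S \<Longrightarrow> y' \<le> Re (mtrace (Q \<rho> * (mat_fun n log_supp (Q m) - T)))"
    unfolding y'_def by blast
  have dm: "density_mat n (pin n s m)" using S(4)[OF m(1)] by (rule density_pin)
  have pm: "psd_mat n (pin n s m)" using dm by (simp add: density_mat_def)
  obtain W q \<beta> where W: "unitary_mat n W" "pin n s m = spec n W q"
    and sup: "\<And>x j. x < n \<Longrightarrow> j < n \<Longrightarrow> W $$ (x, j) \<noteq> 0 \<Longrightarrow> s x = \<beta> j" and bim: "\<And>j. j < n \<Longrightarrow> \<beta> j \<in> s ` {..<n}"
    using joint_diag[OF pm density_le_one[OF dm] pin_blockdiag] by metis
  have Wc: "W \<in> carrier_mat n n" using W by (simp add: unitary_carrier)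
  have b0: "0 \<le> \<beta> j" if "j < n" for j using bim[OF that] s(1) by auto
  have q: "0 \<le> q j" if "j < n" for j using pm that unfolding W(2) psd_spec_iff[OF W(1)] by simp
  have q1: "(\<Sum>j<n. q j) = 1" using dm unfolding W(2) density_spec_iff[OF W(1)] by simp
  \<comment> \<open>Each column of \<open>W\<close> lives in one block of \<open>s\<close>, so
    \<open>W\<close> diagonalises functions of the alternative together with the pinched
    minimiser.\<close>
  have diagW: "spec n (1\<^sub>m n) (\<lambda>i. f (s i)) = spec n W (\<lambda>j. f (\<beta> j))" for f
  proof (rule spec_of_eigen[OF W(1)])
    fix x j assume xj: "x < n" "j < n"
    show "app n (spec n (1\<^sub>m n) (\<lambda>i. f (s i))) (colf W j) x = complex_of_real (f (\<beta> j)) * W $$ (x, j)"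
      using sup[OF xj] by (cases "W $$ (x, j) = 0") (auto simp: app_diag xj)
  qed simp
  define a where "a j = th (q j)" for j
  have a1: "(\<Sum>j<n. a j) = 1" using q1 N by (simp add: a_def th_def sum.distrib sum_distrib_left[symmetric] N_def)
  have a0: "0 < a j" if "j < n" for j unfolding a_def using th(1)[OF q[OF that]] .
  have a_le: "a j \<le> 1" if "j < n" for j
    using member_le_sum[of j "{..<n}" a] that a0 a1 by (auto simp: less_imp_le)
  have Qm: "Q m = spec n W a" unfolding Q_def W(2) reg_spec[OF W(1)] a_def th_def N_def ..
  define x0 where "x0 j = ln (a j) - ln (th (\<beta> j))" for j
  have X0: "mat_fun n log_supp (Q m) - T = spec n W x0"
    unfolding Qm mat_fun_spec[OF W(1)] T_def diagW[of "\<lambda>z. ln (th z)"] spec_diff[OF Wc]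
    by (rule spec_cong) (simp add: x0_def log_supp_def a0)
  \<comment> \<open>The shift compensates for the regularised eigenvalue being only known to be at
    least (1 - \<eta>) \<beta>_j. With it, \<beta>_j exp (x_j) is at most a_j, and the a_j sum to
    1.\<close>
  define x where "x j = x0 j + ln (1 - \<eta>)" for j
  have "Re (mtrace (spec n (1\<^sub>m n) s * spec n W (\<lambda>j. exp (x j)))) = (\<Sum>j<n. \<beta> j * exp (x j))"
    using diagW[of "\<lambda>z. z"] by (simp add: spec_mult[OF W(1)] mtrace_spec[OF W(1)])
  also have "\<dots> \<le> (\<Sum>j<n. a j)"
  proof (intro sum_mono)
    fix j assume "j \<in> {..<n}"
    then have j: "j < n" by simp
    have "exp (x j) = a j / th (\<beta> j) * (1 - \<eta>)"
      using a0[OF j] th(1)[OF b0[OF j]] eta1 by (simp add: x_def x0_def exp_add exp_diff)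
    then have "\<beta> j * exp (x j) = a j * ((1 - \<eta>) * \<beta> j / th (\<beta> j))" by simp
    also have "\<dots> \<le> a j * 1" using th(1,3)[OF b0[OF j]] a0[OF j] by (intro mult_left_mono) (auto simp: divide_le_eq)
    finally show "\<beta> j * exp (x j) \<le> a j" by simp
  qed
  finally have II: "Re (mtrace (spec n (1\<^sub>m n) s * spec n W (\<lambda>j. exp (x j)))) \<le> 1" using a1 by simp
  \<comment> \<open>Needed to remove the identity part of the regularised states: its contribution
    \<eta> / N times this trace is at most \<eta> ln (N / \<eta>).\<close>
  have trX0: "Re (mtrace (spec n W x0)) \<le> N * ln (N / \<eta>)"
  proof -
    have "Re (mtrace (spec n W x0)) = (\<Sum>j<n. x0 j)" by (simp add: mtrace_spec[OF W(1)])
    also have "\<dots> \<le> (\<Sum>j<n. ln (N / \<eta>))"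
    proof (intro sum_mono)
      fix j assume "j \<in> {..<n}"
      then have j: "j < n" by simp
      have "ln (a j) \<le> 0" using a0[OF j] a_le[OF j] by simp
      moreover have "ln (\<eta> / N) \<le> ln (th (\<beta> j))" using th[OF b0[OF j]] eta N by (subst ln_le_cancel_iff) auto
      moreover have "ln (\<eta> / N) = - ln (N / \<eta>)" using eta N by (simp add: ln_div)
      ultimately show "x0 j \<le> ln (N / \<eta>)" by (simp add: x0_def)
    qed
    finally show ?thesis by (simp add: N_def)
  qed
  have I: "y - \<delta> \<le> Re (mtrace (\<rho> * spec n W x))" if r: "\<rho> \<in> S" for \<rho>
  proof -
    have rc: "\<rho> \<in> carrier_mat n n" using S(4)[OF r] by (rule density_carrier)
    have X0c: "spec n W x0 \<in> carrier_mat n n" by (rule spec_carrier[OF Wc])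
    have "Re (mtrace (Q \<rho> * spec n W x0)) = (1 - \<eta>) * Re (mtrace (pin n s \<rho> * spec n W x0)) + \<eta> / N * Re (mtrace (spec n W x0))"
      unfolding Q_def reg_def N_def mtrace_lincomb[OF pin_carrier one_carrier_mat X0c] using X0c by (simp del: of_real_divide)
    also have "mtrace (pin n s \<rho> * spec n W x0) = mtrace (\<rho> * spec n W x0)"
      by (rule mtrace_pin[OF rc blockdiag_spec[OF W(1) sup]])
    finally have "y' \<le> (1 - \<eta>) * Re (mtrace (\<rho> * spec n W x0)) + \<eta> / N * Re (mtrace (spec n W x0))"
      using m(2)[OF r] unfolding X0 by simp
    also have "\<eta> / N * Re (mtrace (spec n W x0)) \<le> \<eta> / N * (N * ln (N / \<eta>))"
      using trX0 eta N by (intro mult_left_mono) auto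
    also have "\<dots> = \<eta> * ln (N / \<eta>)" using N by simp
    finally have "y' - \<eta> * ln (N / \<eta>) \<le> (1 - \<eta>) * Re (mtrace (\<rho> * spec n W x0))" by simp
    then have 1: "(y' - \<eta> * ln (N / \<eta>)) / (1 - \<eta>) \<le> Re (mtrace (\<rho> * spec n W x0))"
      using eta1 by (simp add: divide_le_eq mult.commute)
    have "spec n W x = spec n W x0 + complex_of_real (ln (1 - \<eta>)) \<cdot>\<^sub>m 1\<^sub>m n"
      unfolding spec_one[OF W(1), symmetric] spec_smult[OF Wc] spec_add[OF Wc] by (rule spec_cong) (simp add: x_def)
    moreover have "mtrace (\<rho> * (complex_of_real (ln (1 - \<eta>)) \<cdot>\<^sub>m 1\<^sub>m n)) = of_real (ln (1 - \<eta>))"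
      using rc S(4)[OF r] by (simp add: mult_smult_distrib[of _ n n _ n] density_mat_def) (simp add: mtrace_def sum_distrib_left[symmetric])
    ultimately have "Re (mtrace (\<rho> * spec n W x)) = Re (mtrace (\<rho> * spec n W x0)) + ln (1 - \<eta>)"
      using mtrace_mult_add_right[OF rc X0c, of "complex_of_real (ln (1 - \<eta>)) \<cdot>\<^sub>m 1\<^sub>m n"] by simp
    then show ?thesis using 1 e0(2)[of \<eta>] eta e1 by linarith
  qed
  show ?thesis using W(1) II I by blast
qed

text \<open>The observable \<open>X\<close> below yields the single-block test: \<open>X\<close> is large on all of \<open>S\<close> while \<open>e\<^sup>X\<close> has
  \<open>\<tau>\<close>-expectation at most 1. The loss \<open>ln v\<close> comes from pinching along the \<open>v\<close> distinct eigenvalues of \<open>\<tau>\<close>.\<close>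
theorem block_observable:
  assumes n: "0 < n" and V: "unitary_mat n V" and tau: "density_mat n (spec n V s)"
    and S: "S \<noteq> {}" "convmat S" "seqcomp n S" "\<And>\<rho>. \<rho> \<in> S \<Longrightarrow> density_mat n \<rho>"
    and gt: "\<And>\<rho>. \<rho> \<in> S \<Longrightarrow> ereal (y + ln (real (card (s ` {..<n})))) < rel_ent n \<rho> (spec n V s)"
    and d: "0 < \<delta>"
  shows "\<exists>W x. unitary_mat n W \<and> Re (mtrace (spec n V s * spec n W (\<lambda>j. exp (x j)))) \<le> 1 \<and>
    (\<forall>\<rho>\<in>S. y - \<delta> \<le> Re (mtrace (\<rho> * spec n W x)))"
proof -
  have Vc: "V \<in> carrier_mat n n" using V by (rule unitary_carrier)
  \<comment> \<open>Zero beyond the dimension, so that the bounds required at all indices by the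
    diagonal case hold.\<close>
  define s' where "s' i = (if i < n then s i else 0)" for i
  have eq: "spec n V s = spec n V s'" by (rule spec_cong) (simp add: s'_def)
  have s: "\<forall>i<n. 0 \<le> s i" "(\<Sum>i<n. s i) = 1" using tau unfolding density_spec_iff[OF V] by auto
  have s': "0 \<le> s' i" "s' i \<le> 1" for i
    using s member_le_sum[of i "{..<n}" s] by (auto simp: s'_def)
  have im: "s' ` {..<n} = s ` {..<n}" by (auto simp: s'_def)
  \<comment> \<open>Rotation into the eigenbasis of the alternative. The observable found there is
    carried back by the basis \<open>V * W\<close>.\<close>
  define J where "J M = mat_adjoint V * M * V" for M
  have Jc: "J M \<in> carrier_mat n n" if "M \<in> carrier_mat n n" for M using that Vc by (simp add: J_def)
  have adV: "unitary_mat n (mat_adjoint V)" by (rule unitary_adjoint[OF V])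
  have Jspec: "J (spec n U l) = spec n (mat_adjoint V * U) l" if "U \<in> carrier_mat n n" for U l
    using conj_spec[OF unitary_carrier[OF adV] that, of l] by (simp add: J_def)
  have ov: "ovl n (mat_adjoint V * U) (1\<^sub>m n) i j = ovl n U V i j" if "U \<in> carrier_mat n n" "i < n" "j < n" for U i j
  proof -
    have "(\<Sum>k<n. cnj ((mat_adjoint V * U) $$ (k, i)) * (1\<^sub>m n) $$ (k, j)) = (\<Sum>k<n. if k = j then cnj ((mat_adjoint V * U) $$ (k, i)) else 0)"
      using that by (intro sum.cong refl) auto
    also have "\<dots> = cnj ((mat_adjoint V * U) $$ (j, i))" using that by simp
    also have "\<dots> = (\<Sum>k<n. cnj (U $$ (k, i)) * V $$ (k, j))"
      using that Vc by (simp add: mult_mat_index[of "mat_adjoint V" n n U n] mult.commute)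
    finally show ?thesis by (simp add: ovl_def)
  qed
  have dJ: "density_mat n (J \<rho>)" and relJ: "rel_ent n (J \<rho>) (spec n (1\<^sub>m n) s') = rel_ent n \<rho> (spec n V s')"
    if r: "\<rho> \<in> S" for \<rho>
  proof -
    obtain U l where U: "unitary_mat n U" "\<rho> = spec n U l" "\<And>i. 0 \<le> l i" "(\<Sum>i<n. l i) = 1"
      using S(4)[OF r] by (rule density_obtain_spec) auto
    have Uc: "U \<in> carrier_mat n n" using U by (simp add: unitary_carrier)
    have VU: "unitary_mat n (mat_adjoint V * U)" by (rule unitary_mult[OF adV U(1)])
    show "density_mat n (J \<rho>)" unfolding U(2) Jspec[OF Uc] density_spec_iff[OF VU] using U by simp
    show "rel_ent n (J \<rho>) (spec n (1\<^sub>m n) s') = rel_ent n \<rho> (spec n V s')"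
      unfolding U(2) Jspec[OF Uc] rel_ent_spec[OF VU unitary_one U(3) s'(1)] rel_ent_spec[OF U(1) V U(3) s'(1)]
      by (simp add: rel_val_def ov[OF Uc])
  qed
  have Jconv: "convmat (J ` S)"
    unfolding convmat_def
  proof (intro ballI allI impI)
    fix A B t assume "A \<in> J ` S" "B \<in> J ` S" and t: "0 \<le> t \<and> t \<le> (1::real)"
    then obtain A0 B0 where AB: "A0 \<in> S" "B0 \<in> S" "A = J A0" "B = J B0" by auto
    then have c: "A0 \<in> carrier_mat n n" "B0 \<in> carrier_mat n n" using S(4) by (auto simp: density_carrier)
    have aV: "mat_adjoint V \<in> carrier_mat n n" using Vc by simp
    have "J (complex_of_real (1 - t) \<cdot>\<^sub>m A0 + complex_of_real t \<cdot>\<^sub>m B0) = complex_of_real (1 - t) \<cdot>\<^sub>m A + complex_of_real t \<cdot>\<^sub>m B"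
    proof -
      let ?p = "complex_of_real (1 - t)" and ?q = "complex_of_real t"
      have "mat_adjoint V * (?p \<cdot>\<^sub>m A0 + ?q \<cdot>\<^sub>m B0) = mat_adjoint V * (?p \<cdot>\<^sub>m A0) + mat_adjoint V * (?q \<cdot>\<^sub>m B0)"
        using c aV by (intro mult_add_distrib_mat[of _ n n _ n]) auto
      also have "\<dots> = ?p \<cdot>\<^sub>m (mat_adjoint V * A0) + ?q \<cdot>\<^sub>m (mat_adjoint V * B0)"
        using mult_smult_distrib[OF aV c(1)] mult_smult_distrib[OF aV c(2)] by simp
      finally have "J (?p \<cdot>\<^sub>m A0 + ?q \<cdot>\<^sub>m B0) = (?p \<cdot>\<^sub>m (mat_adjoint V * A0)) * V + (?q \<cdot>\<^sub>m (mat_adjoint V * B0)) * V"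
        unfolding J_def using c aV Vc by (simp only:) (intro add_mult_distrib_mat[of _ n n _ _ n], auto)
      moreover have "(?p \<cdot>\<^sub>m (mat_adjoint V * A0)) * V = ?p \<cdot>\<^sub>m J A0" "(?q \<cdot>\<^sub>m (mat_adjoint V * B0)) * V = ?q \<cdot>\<^sub>m J B0"
        unfolding J_def using c aV Vc by (auto intro!: mult_smult_assoc_mat[of _ n n _ n])
      ultimately show ?thesis unfolding AB by (simp only:)
    qed
    moreover have "complex_of_real (1 - t) \<cdot>\<^sub>m A0 + complex_of_real t \<cdot>\<^sub>m B0 \<in> S"
      using S(2) AB t unfolding convmat_def by blast
    ultimately show "complex_of_real (1 - t) \<cdot>\<^sub>m A + complex_of_real t \<cdot>\<^sub>m B \<in> J ` S" by (metis imageI)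
  qed
  have Jseq: "seqcomp n (J ` S)"
    unfolding seqcomp_def
  proof (intro allI impI)
    fix f :: "nat \<Rightarrow> complex Matrix.mat" assume "\<forall>j. f j \<in> J ` S"
    then have "\<forall>j. \<exists>g. g \<in> S \<and> f j = J g" by auto
    then obtain g where g: "\<And>j. g j \<in> S" "\<And>j. f j = J (g j)" by metis
    then obtain \<rho> \<phi> where p: "\<rho> \<in> S" "strict_mono (\<phi>::nat \<Rightarrow> nat)"
      "\<And>x y. x < n \<Longrightarrow> y < n \<Longrightarrow> (\<lambda>j. g (\<phi> j) $$ (x, y)) \<longlonglongrightarrow> \<rho> $$ (x, y)"
      using S(3) unfolding seqcomp_def by meson
    have Jidx: "J M $$ (x, y) = (\<Sum>l<n. (\<Sum>k<n. cnj (V $$ (k, x)) * M $$ (k, l)) * V $$ (l, y))"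
      if "M \<in> carrier_mat n n" "x < n" "y < n" for M x y
      unfolding J_def using that Vc
      by (simp add: mult_mat_index[of "mat_adjoint V * M" n n V n] mult_mat_index[of "mat_adjoint V" n n M n])
    have c: "g j \<in> carrier_mat n n" "\<rho> \<in> carrier_mat n n" for j using S(4) g(1) p(1) by (auto simp: density_carrier)
    have "(\<lambda>j. f (\<phi> j) $$ (x, y)) \<longlonglongrightarrow> J \<rho> $$ (x, y)" if "x < n" "y < n" for x y
      unfolding g(2) Jidx[OF c(1) that] Jidx[OF c(2) that] using that by (intro tendsto_intros p(3)) auto
    then show "\<exists>\<rho>\<in>J ` S. \<exists>\<phi>. strict_mono (\<phi>::nat \<Rightarrow> nat) \<and> (\<forall>x<n. \<forall>y<n. (\<lambda>j. f (\<phi> j) $$ (x, y)) \<longlonglongrightarrow> \<rho> $$ (x, y))"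
      using p(1,2) by blast
  qed
  have "\<exists>W x. unitary_mat n W \<and> Re (mtrace (spec n (1\<^sub>m n) s' * spec n W (\<lambda>j. exp (x j)))) \<le> 1 \<and>
    (\<forall>\<rho>\<in>J ` S. y - \<delta> \<le> Re (mtrace (\<rho> * spec n W x)))"
  proof (rule block_observable_diag[OF n s' _ Jconv Jseq _ _ d])
    show "ereal (y + ln (real (card (s' ` {..<n})))) < rel_ent n \<rho> (spec n (1\<^sub>m n) s')" if "\<rho> \<in> J ` S" for \<rho>
      using that gt unfolding im eq by (auto simp: relJ)
  qed (use S(1) dJ in auto)
  then obtain W x where W: "unitary_mat n W" "Re (mtrace (spec n (1\<^sub>m n) s' * spec n W (\<lambda>j. exp (x j)))) \<le> 1"
    "\<And>\<rho>. \<rho> \<in> S \<Longrightarrow> y - \<delta> \<le> Re (mtrace (J \<rho> * spec n W x))" by blast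
  have Wc: "W \<in> carrier_mat n n" using W by (simp add: unitary_carrier)
  have tr: "mtrace (J M * spec n W l) = mtrace (M * spec n (V * W) l)" if "M \<in> carrier_mat n n" for M l
  proof -
    have "mtrace (M * spec n (V * W) l) = mtrace (M * (V * spec n W l * mat_adjoint V))"
      by (simp add: conj_spec[OF Vc Wc])
    also have "\<dots> = mtrace ((M * V * spec n W l) * mat_adjoint V)"
      using that Vc Wc by (simp add: assoc_mult_mat[of _ n n _ n _ n])
    also have "\<dots> = mtrace (mat_adjoint V * (M * V * spec n W l))"
      using that Vc Wc by (intro mtrace_mult_commute[of _ n n]) auto
    also have "mat_adjoint V * (M * V * spec n W l) = J M * spec n W l"
      unfolding J_def using that Vc Wc by (simp add: assoc_mult_mat[of _ n n _ n _ n])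
    finally show ?thesis by simp
  qed
  have "J (spec n V s) = spec n (1\<^sub>m n) s'" unfolding eq Jspec[OF Vc] using V by (simp add: unitary_mat_def)
  then show ?thesis
    using W tr[OF spec_carrier[OF Vc]] tr[OF density_carrier[OF S(4)]] unitary_mult[OF V W(1)] by metis
qed

section \<open>Tensor powers and permutation invariance\<close>

lemma sum_div_mod:
  fixes f :: "nat \<Rightarrow> nat \<Rightarrow> 'a::comm_monoid_add"
  shows "(\<Sum>k<a * b. f (k div b) (k mod b)) = (\<Sum>x<a. \<Sum>y<b. f x y)"
proof (cases "b = 0")
  case False
  have "(\<Sum>x<a. \<Sum>y<b. f x y) = (\<Sum>(x, y)\<in>{..<a} \<times> {..<b}. f x y)" by (simp add: sum.cartesian_product)
  also have "\<dots> = (\<Sum>k<a * b. f (k div b) (k mod b))"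
  proof (rule sum.reindex_bij_witness[where i = "\<lambda>k. (k div b, k mod b)" and j = "\<lambda>(x, y). x * b + y"], goal_cases)
    case (1 p)
    then show ?case using False by (auto simp: div_mult_self3 div_add1_eq)
  next
    case (2 p)
    obtain x y where p: "p = (x, y)" by (cases p)
    then have xy: "x < a" "y < b" using 2 by auto
    have "x * b + y < x * b + b" using xy by simp
    also have "\<dots> = (x + 1) * b" by simp
    also have "\<dots> \<le> a * b" using xy by (intro mult_right_mono) auto
    finally show ?case using p by simp
  qed (use False in \<open>auto simp: less_mult_imp_div_less\<close>)
  finally show ?thesis by simp
qed simp

lemma kron_carrier: "A \<in> carrier_mat a a \<Longrightarrow> B \<in> carrier_mat b b \<Longrightarrow> kron A B \<in> carrier_mat (a * b) (a * b)"
  by (simp add: kron_def)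

lemma kron_dim [simp]: "dim_row (kron A B) = dim_row A * dim_row B" "dim_col (kron A B) = dim_col A * dim_col B"
  by (simp_all add: kron_def)

lemma kron_index:
  "A \<in> carrier_mat a a \<Longrightarrow> B \<in> carrier_mat b b \<Longrightarrow> i < a * b \<Longrightarrow> j < a * b \<Longrightarrow>
    kron A B $$ (i, j) = A $$ (i div b, j div b) * B $$ (i mod b, j mod b)"
  by (simp add: kron_def)

lemma div_mod_less: "(i::nat) < a * b \<Longrightarrow> i div b < a \<and> i mod b < b"
  by (metis less_mult_imp_div_less mod_less_divisor mult_0_right not_gr_zero not_less_zero)

lemma kron_mult:
  assumes c: "A \<in> carrier_mat a a" "C \<in> carrier_mat a a" "B \<in> carrier_mat b b" "D \<in> carrier_mat b b"
  shows "kron A B * kron C D = kron (A * C) (B * D)"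
proof (rule eq_matI)
  fix i j assume "i < dim_row (kron (A * C) (B * D))" "j < dim_col (kron (A * C) (B * D))"
  then have ij: "i < a * b" "j < a * b" using c by auto
  have m: "i div b < a" "i mod b < b" "j div b < a" "j mod b < b" using div_mod_less ij by auto
  have "(kron A B * kron C D) $$ (i, j) = (\<Sum>k<a * b. kron A B $$ (i, k) * kron C D $$ (k, j))"
    using ij kron_carrier[OF c(1,3)] kron_carrier[OF c(2,4)] by (subst mult_mat_index) auto
  also have "\<dots> = (\<Sum>k<a * b. (\<lambda>x y. A $$ (i div b, x) * C $$ (x, j div b) * (B $$ (i mod b, y) * D $$ (y, j mod b))) (k div b) (k mod b))"
    using c ij by (intro sum.cong refl) (simp add: kron_index[of _ a _ b])
  also have "\<dots> = (\<Sum>x<a. \<Sum>y<b. A $$ (i div b, x) * C $$ (x, j div b) * (B $$ (i mod b, y) * D $$ (y, j mod b)))"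
    by (rule sum_div_mod)
  also have "\<dots> = kron (A * C) (B * D) $$ (i, j)"
    using c m ij by (simp add: kron_index[of "A * C" a "B * D" b] mult_mat_index[of A a a C a] mult_mat_index[of B b b D b] sum_product)
  finally show "(kron A B * kron C D) $$ (i, j) = kron (A * C) (B * D) $$ (i, j)" .
qed (use c in auto)

lemma kron_adjoint:
  assumes c: "A \<in> carrier_mat a a" "B \<in> carrier_mat b b"
  shows "mat_adjoint (kron A B) = kron (mat_adjoint A) (mat_adjoint B)"
proof (rule eq_matI)
  fix i j assume "i < dim_row (kron (mat_adjoint A) (mat_adjoint B))" "j < dim_col (kron (mat_adjoint A) (mat_adjoint B))"
  then have ij: "i < a * b" "j < a * b" using c by auto
  have m: "i div b < a" "i mod b < b" "j div b < a" "j mod b < b" using div_mod_less ij by auto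
  show "mat_adjoint (kron A B) $$ (i, j) = kron (mat_adjoint A) (mat_adjoint B) $$ (i, j)"
    using c ij m by (simp add: kron_index[of _ a _ b])
qed (use c in auto)

lemma kron_one: "kron (1\<^sub>m a) (1\<^sub>m b) = 1\<^sub>m (a * b)"
proof (rule eq_matI)
  fix i j assume "i < dim_row (1\<^sub>m (a * b))" "j < dim_col (1\<^sub>m (a * b))"
  then have ij: "i < a * b" "j < a * b" by auto
  have m: "i div b < a" "i mod b < b" "j div b < a" "j mod b < b" using div_mod_less ij by auto
  have "i = j \<longleftrightarrow> i div b = j div b \<and> i mod b = j mod b" by (metis div_mult_mod_eq)
  then show "kron (1\<^sub>m a) (1\<^sub>m b) $$ (i, j) = (1\<^sub>m (a * b) :: complex Matrix.mat) $$ (i, j)"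
    using ij m by (simp add: kron_index[of _ a _ b])
qed auto

lemma kron_unitary:
  assumes U: "unitary_mat a U" and V: "unitary_mat b V"
  shows "unitary_mat (a * b) (kron U V)"
proof -
  have c: "U \<in> carrier_mat a a" "V \<in> carrier_mat b b" using assms by (auto intro: unitary_carrier)
  have "mat_adjoint (kron U V) * kron U V = kron (mat_adjoint U * U) (mat_adjoint V * V)"
    using c by (simp add: kron_adjoint[OF c] kron_mult[of _ a _ _ b])
  then show ?thesis using U V by (simp add: unitary_mat_def kron_one kron_carrier)
qed

lemma kron_diag: "kron (diag_of a l) (diag_of b m) = diag_of (a * b) (\<lambda>k. l (k div b) * m (k mod b))"
proof (rule eq_matI)
  fix i j assume "i < dim_row (diag_of (a * b) (\<lambda>k. l (k div b) * m (k mod b)))" "j < dim_col (diag_of (a * b) (\<lambda>k. l (k div b) * m (k mod b)))"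
  then have ij: "i < a * b" "j < a * b" by (auto simp: diag_of_def)
  have mm: "i div b < a" "i mod b < b" "j div b < a" "j mod b < b" using div_mod_less ij by auto
  have "i = j \<longleftrightarrow> i div b = j div b \<and> i mod b = j mod b" by (metis div_mult_mod_eq)
  then show "kron (diag_of a l) (diag_of b m) $$ (i, j) = diag_of (a * b) (\<lambda>k. l (k div b) * m (k mod b)) $$ (i, j)"
    using ij mm by (simp add: kron_index[of _ a _ b]) (simp add: diag_of_def)
qed (auto simp: diag_of_def)

lemma kron_spec:
  assumes c: "U \<in> carrier_mat a a" "V \<in> carrier_mat b b"
  shows "kron (spec a U l) (spec b V m) = spec (a * b) (kron U V) (\<lambda>k. l (k div b) * m (k mod b))"
proof -
  have "kron (spec a U l) (spec b V m) = kron (U * diag_of a l) (V * diag_of b m) * kron (mat_adjoint U) (mat_adjoint V)"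
    unfolding spec_def using c by (simp add: kron_mult[of _ a _ _ b])
  also have "kron (U * diag_of a l) (V * diag_of b m) = kron U V * kron (diag_of a l) (diag_of b m)"
    using c by (simp add: kron_mult[of _ a _ _ b])
  finally show ?thesis unfolding spec_def kron_diag kron_adjoint[OF c] .
qed

lemma kron_mtrace:
  assumes "A \<in> carrier_mat a a" "B \<in> carrier_mat b b"
  shows "mtrace (kron A B) = mtrace A * mtrace B"
proof -
  have "mtrace (kron A B) = (\<Sum>k<a * b. (\<lambda>x y. A $$ (x, x) * B $$ (y, y)) (k div b) (k mod b))"
    using assms by (simp add: mtrace_def kron_index)
  also have "\<dots> = (\<Sum>x<a. \<Sum>y<b. A $$ (x, x) * B $$ (y, y))" by (rule sum_div_mod)
  finally show ?thesis using assms by (simp add: mtrace_def sum_product)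
qed

lemma kron_psd:
  assumes "psd_mat a A" "psd_mat b B" shows "psd_mat (a * b) (kron A B)"
proof -
  from assms(1) obtain U l where U: "unitary_mat a U" "A = spec a U l" "\<And>i. 0 \<le> l i" by (rule psd_obtain_spec) auto
  from assms(2) obtain V m where V: "unitary_mat b V" "B = spec b V m" "\<And>i. 0 \<le> m i" by (rule psd_obtain_spec) auto
  show ?thesis
    unfolding U(2) V(2) kron_spec[OF unitary_carrier[OF U(1)] unitary_carrier[OF V(1)]] psd_spec_iff[OF kron_unitary[OF U(1) V(1)]]
    using U(3) V(3) by simp
qed

lemma kron_density: "density_mat a A \<Longrightarrow> density_mat b B \<Longrightarrow> density_mat (a * b) (kron A B)"
  by (auto simp: density_mat_def kron_psd kron_mtrace[OF psd_carrier psd_carrier])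

lemma kron_assoc:
  assumes c: "A \<in> carrier_mat a a" "B \<in> carrier_mat b b" "C \<in> carrier_mat c c"
  shows "kron (kron A B) C = kron A (kron B C)"
proof (rule eq_matI)
  fix i j assume "i < dim_row (kron A (kron B C))" "j < dim_col (kron A (kron B C))"
  then have ij: "i < a * b * c" "j < a * b * c" "i < a * (b * c)" "j < a * (b * c)" using c by (auto simp: mult.assoc)
  have dm: "k div c div b = k div (b * c)" "k mod (b * c) div c = k div c mod b" "k mod (b * c) mod c = k mod c" for k
  proof -
    show "k div c div b = k div (b * c)" by (metis div_mult2_eq mult.commute)
    have e: "k mod (b * c) = c * (k div c mod b) + k mod c" using mod_mult2_eq[of k c b] by (simp add: mult.commute)
    show "k mod (b * c) mod c = k mod c" unfolding e by simp
    show "k mod (b * c) div c = k div c mod b" unfolding e by (cases "c = 0") auto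
  qed
  have 1: "kron (kron A B) C $$ (i, j) = kron A B $$ (i div c, j div c) * C $$ (i mod c, j mod c)"
    using kron_index[OF kron_carrier[OF c(1,2)] c(3) ij(1,2)] .
  have "i div c < a * b" "j div c < a * b" using div_mod_less ij by auto
  then have 2: "kron A B $$ (i div c, j div c) = A $$ (i div c div b, j div c div b) * B $$ (i div c mod b, j div c mod b)"
    by (rule kron_index[OF c(1,2)])
  have 3: "kron A (kron B C) $$ (i, j) = A $$ (i div (b * c), j div (b * c)) * kron B C $$ (i mod (b * c), j mod (b * c))"
    using kron_index[OF c(1) kron_carrier[OF c(2,3)] ij(3,4)] .
  have "i mod (b * c) < b * c" "j mod (b * c) < b * c" using div_mod_less ij by auto
  then have 4: "kron B C $$ (i mod (b * c), j mod (b * c)) = B $$ (i mod (b * c) div c, j mod (b * c) div c) * C $$ (i mod (b * c) mod c, j mod (b * c) mod c)"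
    by (rule kron_index[OF c(2,3)])
  show "kron (kron A B) C $$ (i, j) = kron A (kron B C) $$ (i, j)" unfolding 1 2 3 4 dm by simp
qed (use c in auto)

lemma kron_one_left: "kron (1\<^sub>m 1) M = M"
  by (rule eq_matI) (auto simp: kron_def)

lemma tensor_list_Nil [simp]: "tensor_list [] = 1\<^sub>m 1" and tensor_list_Cons [simp]: "tensor_list (M # Ms) = kron M (tensor_list Ms)"
  by (simp_all add: tensor_list_def)

lemma tensor_list_carrier: "\<forall>M\<in>set Ms. M \<in> carrier_mat d d \<Longrightarrow> tensor_list Ms \<in> carrier_mat (d ^ length Ms) (d ^ length Ms)"
  by (induction Ms) (auto simp: kron_carrier)

lemma tensor_list_append:
  assumes "\<forall>M\<in>set xs. M \<in> carrier_mat d d" "\<forall>M\<in>set ys. M \<in> carrier_mat d d"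
  shows "tensor_list (xs @ ys) = kron (tensor_list xs) (tensor_list ys)"
  using assms(1)
proof (induction xs)
  case Nil
  show ?case using kron_one_left[of "tensor_list ys"] by simp
next
  case (Cons M xs)
  then show ?case using kron_assoc[of M d "tensor_list xs" "d ^ length xs" "tensor_list ys" "d ^ length ys"]
      tensor_list_carrier[of xs d] tensor_list_carrier[OF assms(2)] by simp
qed

lemma tensor_list_density: "\<forall>M\<in>set Ms. density_mat d M \<Longrightarrow> density_mat (d ^ length Ms) (tensor_list Ms)"
proof (induction Ms)
  case Nil
  have "1\<^sub>m 1 = spec 1 (1\<^sub>m 1) (\<lambda>_. 1)" by (simp add: spec_one[OF unitary_one])
  then show ?case using density_spec_iff[OF unitary_one[of 1], of "\<lambda>_. 1"] by simp
next
  case (Cons M Ms)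
  then show ?case by (simp add: kron_density)
qed

section \<open>Indices of tensor products as words of base-d digits\<close>

fun digs :: "nat \<Rightarrow> nat \<Rightarrow> nat \<Rightarrow> nat list" where
  "digs d 0 i = []"
| "digs d (Suc n) i = (i div d ^ n) # digs d n (i mod d ^ n)"

lemma length_digs [simp]: "length (digs d n i) = n"
  by (induction n arbitrary: i) auto

lemma digs_range: "i < d ^ n \<Longrightarrow> set (digs d n i) \<subseteq> {..<d}"
proof (induction n arbitrary: i)
  case (Suc n)
  then have "i div d ^ n < d" "i mod d ^ n < d ^ n" using div_mod_less[of i d "d ^ n"] by auto
  then show ?case using Suc.IH by auto
qed simp

lemma digs_inj: "i < d ^ n \<Longrightarrow> j < d ^ n \<Longrightarrow> digs d n i = digs d n j \<Longrightarrow> i = j"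
proof (induction n arbitrary: i j)
  case (Suc n)
  then have "i mod d ^ n < d ^ n" "j mod d ^ n < d ^ n" using div_mod_less[of _ d "d ^ n"] by auto
  then have "i mod d ^ n = j mod d ^ n" using Suc by auto
  moreover have "i div d ^ n = j div d ^ n" using Suc.prems by simp
  ultimately show ?case by (metis div_mult_mod_eq)
qed simp

lemma digs_bij: "bij_betw (digs d n) {..<d ^ n} {xs. set xs \<subseteq> {..<d} \<and> length xs = n}"
  unfolding bij_betw_def
proof (rule conjI)
  show inj: "inj_on (digs d n) {..<d ^ n}" using digs_inj by (auto simp: inj_on_def)
  have sub: "digs d n ` {..<d ^ n} \<subseteq> {xs. set xs \<subseteq> {..<d} \<and> length xs = n}" using digs_range by fastforce
  have "card {xs. set xs \<subseteq> {..<d} \<and> length xs = n} = d ^ n" using card_lists_length_eq[of "{..<d}" n] by simp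
  moreover have "card (digs d n ` {..<d ^ n}) = d ^ n" using inj by (simp add: card_image)
  ultimately show "digs d n ` {..<d ^ n} = {xs. set xs \<subseteq> {..<d} \<and> length xs = n}"
    using sub finite_lists_length_eq[of "{..<d}" n] by (intro card_subset_eq) auto
qed

text \<open>The first factor belongs to the most significant digit because \<open>kron\<close>
  splits an index by div and mod. This product formula reduces statements about tensor products to
  words.\<close>

lemma tensor_list_index:
  assumes "\<forall>M\<in>set Ms. M \<in> carrier_mat d d" "i < d ^ length Ms" "j < d ^ length Ms"
  shows "tensor_list Ms $$ (i, j) = (\<Prod>k<length Ms. (Ms ! k) $$ (digs d (length Ms) i ! k, digs d (length Ms) j ! k))"
  using assms
proof (induction Ms arbitrary: i j)
  case (Cons M Ms)
  let ?n = "length Ms"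
  have c: "M \<in> carrier_mat d d" "tensor_list Ms \<in> carrier_mat (d ^ ?n) (d ^ ?n)" using Cons.prems tensor_list_carrier[of Ms d] by auto
  have m: "i mod d ^ ?n < d ^ ?n" "j mod d ^ ?n < d ^ ?n" using Cons.prems div_mod_less[of _ d "d ^ ?n"] by auto
  have "tensor_list (M # Ms) $$ (i, j) = M $$ (i div d ^ ?n, j div d ^ ?n) * tensor_list Ms $$ (i mod d ^ ?n, j mod d ^ ?n)"
    using Cons.prems kron_index[OF c, of i j] by simp
  also have "tensor_list Ms $$ (i mod d ^ ?n, j mod d ^ ?n)
     = (\<Prod>k<?n. (Ms ! k) $$ (digs d ?n (i mod d ^ ?n) ! k, digs d ?n (j mod d ^ ?n) ! k))"
    using Cons.prems m by (intro Cons.IH) auto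
  finally show ?case by (simp add: prod.lessThan_Suc_shift del: prod.lessThan_Suc)
qed simp

section \<open>Permutations of tensor factors\<close>

definition pidx :: "nat \<Rightarrow> nat \<Rightarrow> (nat \<Rightarrow> nat) \<Rightarrow> nat \<Rightarrow> nat" where
  "pidx d n p i = inv_into {..<d ^ n} (digs d n) (permute_list p (digs d n i))"

lemma pidx:
  assumes p: "p permutes {..<n}" and i: "i < d ^ n"
  shows "pidx d n p i < d ^ n" "digs d n (pidx d n p i) = permute_list p (digs d n i)"
proof -
  have "permute_list p (digs d n i) \<in> {xs. set xs \<subseteq> {..<d} \<and> length xs = n}"
    using digs_range[OF i] p by simp
  then have im: "permute_list p (digs d n i) \<in> digs d n ` {..<d ^ n}" using digs_bij[of d n] by (simp add: bij_betw_def)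
  show "digs d n (pidx d n p i) = permute_list p (digs d n i)" unfolding pidx_def by (rule f_inv_into_f[OF im])
  show "pidx d n p i < d ^ n" unfolding pidx_def using inv_into_into[OF im] by simp
qed

lemma pidx_inv:
  assumes p: "p permutes {..<n}" and i: "i < d ^ n"
  shows "pidx d n p (pidx d n (inv_into UNIV p) i) = i" "pidx d n (inv_into UNIV p) (pidx d n p i) = i"
proof -
  have ip: "inv_into UNIV p permutes {..<n}" using p by (rule permutes_inv)
  have "digs d n (pidx d n p (pidx d n (inv_into UNIV p) i)) = permute_list (inv_into UNIV p \<circ> p) (digs d n i)"
    using pidx[OF p] pidx[OF ip] i p by (simp add: permute_list_compose)
  then show "pidx d n p (pidx d n (inv_into UNIV p) i) = i"
    using permutes_inv_o(2)[OF p] pidx[OF p] pidx[OF ip] i by (intro digs_inj[of _ d n]) auto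
  have "digs d n (pidx d n (inv_into UNIV p) (pidx d n p i)) = permute_list (p \<circ> inv_into UNIV p) (digs d n i)"
    using pidx[OF p] pidx[OF ip] i ip by (simp add: permute_list_compose)
  then show "pidx d n (inv_into UNIV p) (pidx d n p i) = i"
    using permutes_inv_o(1)[OF p] pidx[OF p] pidx[OF ip] i by (intro digs_inj[of _ d n]) auto
qed

lemma pidx_bij:
  assumes p: "p permutes {..<n}" shows "bij_betw (pidx d n p) {..<d ^ n} {..<d ^ n}"
  by (rule bij_betw_byWitness[where f' = "pidx d n (inv_into UNIV p)"])
    (use pidx_inv[OF p] pidx[OF p] pidx[OF permutes_inv[OF p]] in auto)

text \<open>Conjugation by a permutation unitary, written as a relabelling of entries.\<close>

definition pmat :: "nat \<Rightarrow> nat \<Rightarrow> (nat \<Rightarrow> nat) \<Rightarrow> complex Matrix.mat \<Rightarrow> complex Matrix.mat" where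
  "pmat d n p M = Matrix.mat (d ^ n) (d ^ n) (\<lambda>(i, j). M $$ (pidx d n p i, pidx d n p j))"

lemma pmat_carrier [simp]: "pmat d n p M \<in> carrier_mat (d ^ n) (d ^ n)"
  by (simp add: pmat_def)

lemma pmat_index: "i < d ^ n \<Longrightarrow> j < d ^ n \<Longrightarrow> pmat d n p M $$ (i, j) = M $$ (pidx d n p i, pidx d n p j)"
  by (simp add: pmat_def)

lemma pmat_mtrace:
  assumes p: "p permutes {..<n}" and c: "A \<in> carrier_mat (d ^ n) (d ^ n)" "B \<in> carrier_mat (d ^ n) (d ^ n)"
  shows "mtrace (pmat d n p A * pmat d n p B) = mtrace (A * B)"
proof -
  have "mtrace (pmat d n p A * pmat d n p B)
      = (\<Sum>i<d ^ n. \<Sum>j<d ^ n. A $$ (pidx d n p i, pidx d n p j) * B $$ (pidx d n p j, pidx d n p i))"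
    by (simp add: mtrace_mult[OF pmat_carrier pmat_carrier] pmat_index)
  also have "\<dots> = (\<Sum>i<d ^ n. \<Sum>j<d ^ n. A $$ (pidx d n p i, j) * B $$ (j, pidx d n p i))"
    by (rule sum.cong[OF refl], rule sum.reindex_bij_betw[OF pidx_bij[OF p]])
  also have "\<dots> = (\<Sum>i<d ^ n. \<Sum>j<d ^ n. A $$ (i, j) * B $$ (j, i))"
    by (rule sum.reindex_bij_betw[OF pidx_bij[OF p]])
  finally show ?thesis by (simp add: mtrace_mult[OF c])
qed

lemma qfc_pmat:
  assumes p: "p permutes {..<n}"
  shows "qfc (d ^ n) (pmat d n p M) v = qfc (d ^ n) M (\<lambda>i. v (pidx d n (inv_into UNIV p) i))"
proof -
  let ?f = "\<lambda>i j. cnj (v (pidx d n (inv_into UNIV p) i)) * M $$ (i, j) * v (pidx d n (inv_into UNIV p) j)"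
  have "qfc (d ^ n) (pmat d n p M) v = (\<Sum>i<d ^ n. \<Sum>j<d ^ n. ?f (pidx d n p i) (pidx d n p j))"
    unfolding qfc_def by (intro sum.cong refl) (simp add: pmat_index pidx_inv[OF p])
  also have "\<dots> = (\<Sum>i<d ^ n. \<Sum>j<d ^ n. ?f (pidx d n p i) j)"
    by (rule sum.cong[OF refl], rule sum.reindex_bij_betw[OF pidx_bij[OF p]])
  also have "\<dots> = (\<Sum>i<d ^ n. \<Sum>j<d ^ n. ?f i j)" by (rule sum.reindex_bij_betw[OF pidx_bij[OF p]])
  finally show ?thesis by (simp add: qfc_def)
qed

text \<open>The inverse permutation appears because relabelling the digits by \<open>p\<close> is
  undone by reindexing the product over positions.\<close>

lemma pmat_tensor_list:
  assumes p: "p permutes {..<length Ms}" and c: "\<forall>M\<in>set Ms. M \<in> carrier_mat d d"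
  shows "pmat d (length Ms) p (tensor_list Ms) = tensor_list (permute_list (inv_into UNIV p) Ms)"
proof (rule eq_matI)
  let ?n = "length Ms" and ?Ns = "permute_list (inv_into UNIV p) Ms"
  have ip: "inv_into UNIV p permutes {..<?n}" using p by (rule permutes_inv)
  have cN: "\<forall>M\<in>set ?Ns. M \<in> carrier_mat d d" using c set_permute_list[OF ip] by simp
  have tN: "tensor_list ?Ns \<in> carrier_mat (d ^ ?n) (d ^ ?n)" using tensor_list_carrier[OF cN] by simp
  show "dim_row (pmat d ?n p (tensor_list Ms)) = dim_row (tensor_list ?Ns)" "dim_col (pmat d ?n p (tensor_list Ms)) = dim_col (tensor_list ?Ns)"
    using tN by (auto simp: pmat_def)
  fix i j assume "i < dim_row (tensor_list ?Ns)" "j < dim_col (tensor_list ?Ns)"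
  then have ij: "i < d ^ ?n" "j < d ^ ?n" using tN by auto
  let ?g = "\<lambda>k. (Ms ! inv_into UNIV p k) $$ (digs d ?n i ! k, digs d ?n j ! k)"
  have "pmat d ?n p (tensor_list Ms) $$ (i, j) = (\<Prod>k<?n. (Ms ! k) $$ (digs d ?n (pidx d ?n p i) ! k, digs d ?n (pidx d ?n p j) ! k))"
    unfolding pmat_index[OF ij] using pidx[OF p] ij by (intro tensor_list_index[OF c]) auto
  also have "\<dots> = (\<Prod>k<?n. ?g (p k))"
  proof (intro prod.cong refl)
    fix k assume "k \<in> {..<?n}"
    then show "(Ms ! k) $$ (digs d ?n (pidx d ?n p i) ! k, digs d ?n (pidx d ?n p j) ! k) = ?g (p k)"
      using pidx(2)[OF p] ij p by (simp add: permute_list_nth permutes_inverses)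
  qed
  also have "\<dots> = (\<Prod>k<?n. ?g k)" using prod.permute[OF p, of ?g] by (simp add: o_def)
  also have "\<dots> = (\<Prod>k<?n. (?Ns ! k) $$ (digs d ?n i ! k, digs d ?n j ! k))"
    using ip by (intro prod.cong refl) (simp add: permute_list_nth)
  also have "\<dots> = tensor_list ?Ns $$ (i, j)" using tensor_list_index[OF cN] ij by simp
  finally show "pmat d ?n p (tensor_list Ms) $$ (i, j) = tensor_list ?Ns $$ (i, j)" .
qed

definition perm_inv :: "nat \<Rightarrow> nat \<Rightarrow> complex Matrix.mat \<Rightarrow> bool" where
  "perm_inv d n M \<longleftrightarrow> M \<in> carrier_mat (d ^ n) (d ^ n) \<and>
    (\<forall>p. p permutes {..<n} \<longrightarrow> (\<forall>i<d ^ n. \<forall>j<d ^ n. M $$ (pidx d n p i, pidx d n p j) = M $$ (i, j)))"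

lemma perm_inv_tpow:
  assumes "A \<in> carrier_mat d d" shows "perm_inv d n (tpow n A)"
proof -
  let ?Ms = "replicate n A"
  have c: "\<forall>M\<in>set ?Ms. M \<in> carrier_mat d d" using assms by simp
  have "tpow n A $$ (pidx d n p i, pidx d n p j) = tpow n A $$ (i, j)" if p: "p permutes {..<n}" and ij: "i < d ^ n" "j < d ^ n" for p i j
  proof -
    have "permute_list (inv_into UNIV p) ?Ms = ?Ms"
    proof (rule nth_equalityI)
      fix i assume "i < length (permute_list (inv_into UNIV p) ?Ms)"
      then have i: "i < n" by simp
      then have "inv_into UNIV p i < n" using permutes_in_image[OF permutes_inv[OF p], of i] by simp
      then show "permute_list (inv_into UNIV p) ?Ms ! i = ?Ms ! i" using i permutes_inv[OF p] by (simp add: permute_list_nth)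
    qed simp
    then have "pmat d n p (tpow n A) = tpow n A" using pmat_tensor_list[of p ?Ms d] p c by (simp add: tpow_def)
    then show ?thesis using pmat_index[OF ij, of p "tpow n A"] by simp
  qed
  moreover have "tpow n A \<in> carrier_mat (d ^ n) (d ^ n)" unfolding tpow_def using tensor_list_carrier[OF c] by simp
  ultimately show ?thesis by (simp add: perm_inv_def)
qed

lemma perm_inv_mult:
  assumes "perm_inv d n A" "perm_inv d n B" shows "perm_inv d n (A * B)"
proof -
  have c: "A \<in> carrier_mat (d ^ n) (d ^ n)" "B \<in> carrier_mat (d ^ n) (d ^ n)" using assms by (auto simp: perm_inv_def)
  have "(A * B) $$ (pidx d n p i, pidx d n p j) = (A * B) $$ (i, j)" if p: "p permutes {..<n}" and ij: "i < d ^ n" "j < d ^ n" for p i j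
  proof -
    have "(A * B) $$ (pidx d n p i, pidx d n p j) = (\<Sum>l<d ^ n. A $$ (pidx d n p i, l) * B $$ (l, pidx d n p j))"
      using c pidx[OF p] ij by (intro mult_mat_index) auto
    also have "\<dots> = (\<Sum>l<d ^ n. A $$ (pidx d n p i, pidx d n p l) * B $$ (pidx d n p l, pidx d n p j))"
      by (rule sum.reindex_bij_betw[OF pidx_bij[OF p], symmetric])
    also have "\<dots> = (\<Sum>l<d ^ n. A $$ (i, l) * B $$ (l, j))"
      using assms p ij by (intro sum.cong refl) (simp add: perm_inv_def)
    also have "\<dots> = (A * B) $$ (i, j)" using c ij by (intro mult_mat_index[symmetric]) auto
    finally show ?thesis .
  qed
  then show ?thesis using c by (simp add: perm_inv_def)
qed

lemma perm_inv_one: "perm_inv d n (1\<^sub>m (d ^ n))"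
proof -
  have "pidx d n p i = pidx d n p j \<longleftrightarrow> i = j" if "p permutes {..<n}" "i < d ^ n" "j < d ^ n" for p i j
    using pidx_inv(2)[of p n] that by metis
  then show ?thesis using pidx(1)[of _ n] by (simp add: perm_inv_def)
qed

text \<open>An entry of an invariant matrix depends only on the multiset of the n digit pairs at its
  row and column. There are d^2 kinds of pairs, each with a count between 0 and n, which gives the
  polynomial bound. This is the source of all polynomial factors in the universal mixture.\<close>

lemma perm_inv_representatives:
  obtains R where "R \<subseteq> {..<d ^ n} \<times> {..<d ^ n}" "card R \<le> (n + 1) ^ (d * d)"
    "\<And>i j. i < d ^ n \<Longrightarrow> j < d ^ n \<Longrightarrow> \<exists>(i', j')\<in>R. \<forall>M. perm_inv d n M \<longrightarrow> M $$ (i, j) = M $$ (i', j')"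
proof -
  let ?I = "{..<d ^ n} \<times> {..<d ^ n}"
  define key where "key = (\<lambda>(i, j). mset (zip (digs d n i) (digs d n j)))"
  define R where "R = inv_into ?I key ` (key ` ?I)"
  have sub: "R \<subseteq> ?I" unfolding R_def by (rule image_subsetI, rule inv_into_into)
  let ?P = "{..<d} \<times> {..<d}"
  have key_sub: "set_mset (key q) \<subseteq> ?P" "size (key q) = n" if "q \<in> ?I" for q
  proof -
    obtain i j where q: "q = (i, j)" by (cases q)
    have "set (zip (digs d n i) (digs d n j)) \<subseteq> set (digs d n i) \<times> set (digs d n j)" by (auto dest: set_zip_leftD set_zip_rightD)
    then show "set_mset (key q) \<subseteq> ?P" using digs_range[of i d n] digs_range[of j d n] that q by (auto simp: key_def)
    show "size (key q) = n" by (simp add: key_def q)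
  qed
  have "inj_on (\<lambda>m. restrict (count m) ?P) (key ` ?I)"
  proof (rule inj_onI)
    fix m m' assume m: "m \<in> key ` ?I" "m' \<in> key ` ?I" and eq: "restrict (count m) ?P = restrict (count m') ?P"
    show "m = m'"
    proof (rule multiset_eqI)
      fix x
      show "count m x = count m' x"
      proof (cases "x \<in> ?P")
        case True
        then show ?thesis using fun_cong[OF eq, of x] by simp
      next
        case False
        then have "x \<notin># m" "x \<notin># m'" using m key_sub(1) by blast+
        then show ?thesis by (simp add: not_in_iff)
      qed
    qed
  qed
  moreover have "(\<lambda>m. restrict (count m) ?P) ` (key ` ?I) \<subseteq> ?P \<rightarrow>\<^sub>E {..n}"
  proof (rule image_subsetI)
    fix m assume "m \<in> key ` ?I"
    then have sz: "size m = n" using key_sub(2) by auto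
    have "count m x \<le> n" for x using count_le_size[of m x] sz by simp
    then show "restrict (count m) ?P \<in> ?P \<rightarrow>\<^sub>E {..n}" by auto
  qed
  ultimately have "card (key ` ?I) \<le> card (?P \<rightarrow>\<^sub>E {..n})" by (intro card_inj_on_le finite_PiE) auto
  also have "\<dots> = (n + 1) ^ (d * d)" by (simp add: card_PiE card_cartesian_product)
  finally have "card (key ` ?I) \<le> (n + 1) ^ (d * d)" .
  moreover have "card R \<le> card (key ` ?I)" unfolding R_def by (intro card_image_le) auto
  ultimately have cR: "card R \<le> (n + 1) ^ (d * d)" by linarith
  have "\<exists>(i', j')\<in>R. \<forall>M. perm_inv d n M \<longrightarrow> M $$ (i, j) = M $$ (i', j')" if ij: "i < d ^ n" "j < d ^ n" for i j
  proof -
    have q: "(i, j) \<in> ?I" using ij by simp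
    define r where "r = inv_into ?I key (key (i, j))"
    have r: "r \<in> R" "key r = key (i, j)" unfolding r_def R_def using q by (auto intro: f_inv_into_f)
    obtain i' j' where r': "r = (i', j')" by (cases r)
    have ij': "i' < d ^ n" "j' < d ^ n" using r r' sub by auto
    have "mset (zip (digs d n i) (digs d n j)) = mset (zip (digs d n i') (digs d n j'))" using r(2) r' by (simp add: key_def)
    then obtain p where p: "p permutes {..<n}" "permute_list p (zip (digs d n i') (digs d n j')) = zip (digs d n i) (digs d n j)"
      using mset_eq_permutation[of "zip (digs d n i) (digs d n j)" "zip (digs d n i') (digs d n j')"] by auto
    have "zip (permute_list p (digs d n i')) (permute_list p (digs d n j')) = zip (digs d n i) (digs d n j)"
      using p by (simp add: permute_list_zip)
    then have "permute_list p (digs d n i') = digs d n i" "permute_list p (digs d n j') = digs d n j"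
      by (metis length_digs length_permute_list map_fst_zip map_snd_zip)+
    then have "pidx d n p i' = i" "pidx d n p j' = j"
      using pidx[OF p(1)] ij ij' by (auto intro: digs_inj[of _ d n])
    then show ?thesis using r r' p(1) ij' by (auto simp: perm_inv_def intro!: bexI[of _ "(i', j')"])
  qed
  then show ?thesis using that[OF sub cR] by blast
qed

section \<open>Caratheodory bounds and barycentric spanners\<close>

text \<open>More points than coordinates are dependent, by elimination. Points are families over an
  arbitrary index set, so that repeated points count separately.\<close>

lemma linear_dependency:
  fixes f :: "'i \<Rightarrow> 'k \<Rightarrow> real"
  assumes "finite K" "finite I" "card K < card I"
  shows "\<exists>c. (\<exists>i\<in>I. c i \<noteq> 0) \<and> (\<forall>k\<in>K. (\<Sum>i\<in>I. c i * f i k) = 0)"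
  using assms
proof (induction K arbitrary: I f rule: finite_induct)
  case empty
  then obtain i where "i \<in> I" by fastforce
  then show ?case by (intro exI[of _ "\<lambda>_. 1"]) auto
next
  case (insert k0 K)
  show ?case
  proof (cases "\<forall>i\<in>I. f i k0 = 0")
    case True
    obtain c where "\<exists>i\<in>I. c i \<noteq> 0" "\<forall>k\<in>K. (\<Sum>i\<in>I. c i * f i k) = 0"
      using insert.IH[of I f] insert.prems insert.hyps by auto
    then show ?thesis using True by (intro exI[of _ c]) auto
  next
    case False
    then obtain a where a: "a \<in> I" "f a k0 \<noteq> 0" by auto
    \<comment> \<open>Eliminates coordinate \<open>k0\<close> with pivot \<open>a\<close>; the
      coefficient of the pivot is reconstructed afterwards in \<open>c'\<close>.\<close>
    define g where "g i k = f i k - f i k0 / f a k0 * f a k" for i k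
    have "card K < card (I - {a})" using insert.prems insert.hyps a by simp
    then obtain c where c: "\<exists>i\<in>I - {a}. c i \<noteq> 0" "\<forall>k\<in>K. (\<Sum>i\<in>I - {a}. c i * g i k) = 0"
      using insert.IH[of "I - {a}" g] insert.prems by auto
    define S where "S = (\<Sum>i\<in>I - {a}. c i * f i k0)"
    define c' where "c' = (\<lambda>i. if i = a then - S / f a k0 else c i)"
    have split: "(\<Sum>i\<in>I. c' i * f i k) = - S / f a k0 * f a k + (\<Sum>i\<in>I - {a}. c i * f i k)" for k
      using a insert.prems by (subst sum.remove[of _ a]) (auto simp: c'_def intro!: sum.cong)
    have "(\<Sum>i\<in>I. c' i * f i k) = 0" if "k \<in> insert k0 K" for k
    proof (cases "k = k0")
      case True
      then show ?thesis unfolding split using a by (simp add: S_def)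
    next
      case False
      then have "(\<Sum>i\<in>I - {a}. c i * g i k) = 0" using c(2) that by auto
      moreover have "(\<Sum>i\<in>I - {a}. c i * g i k) = (\<Sum>i\<in>I - {a}. c i * f i k) - S / f a k0 * f a k"
        unfolding g_def S_def sum_divide_distrib sum_distrib_right sum_subtractf[symmetric]
        by (intro sum.cong refl) (simp add: algebra_simps)
      ultimately show ?thesis unfolding split by simp
    qed
    moreover have "\<exists>i\<in>I. c' i \<noteq> 0" using c(1) by (auto simp: c'_def)
    ultimately show ?thesis by blast
  qed
qed

text \<open>Caratheodory's reduction: moving along an affine dependency until the first weight
  vanishes drops one point.\<close>

lemma caratheodory_coords:
  fixes p :: "'i \<Rightarrow> 'k \<Rightarrow> real"
  assumes "finite K" "finite I" "\<forall>i\<in>I. 0 \<le> c i" "sum c I = 1"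
  shows "\<exists>J\<subseteq>I. \<exists>c'. card J \<le> card K + 1 \<and> (\<forall>i\<in>J. 0 \<le> c' i) \<and> sum c' J = 1 \<and>
    (\<forall>k\<in>K. (\<Sum>i\<in>J. c' i * p i k) = (\<Sum>i\<in>I. c i * p i k))"
  using assms(2-)
proof (induction "card I" arbitrary: I c rule: less_induct)
  case less
  show ?case
  proof (cases "card I \<le> card K + 1")
    case True
    then show ?thesis using less.prems by blast
  next
    case False
    \<comment> \<open>The additional coordinate \<open>None\<close> with constant value 1 forces the
      dependency to have coefficient sum 0, so total weight is preserved.\<close>
    define f where "f i k = (case k of None \<Rightarrow> 1 | Some k \<Rightarrow> p i k)" for i k
    have "card (insert None (Some ` K)) < card I" using False assms(1) by (simp add: card_insert_if card_image)
    then obtain e where e: "\<exists>i\<in>I. e i \<noteq> 0" "\<forall>k\<in>insert None (Some ` K). (\<Sum>i\<in>I. e i * f i k) = 0"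
      using linear_dependency[of "insert None (Some ` K)" I f] assms(1) less.prems by auto
    have e0: "sum e I = 0" and ek: "\<And>k. k \<in> K \<Longrightarrow> (\<Sum>i\<in>I. e i * p i k) = 0" using e(2) by (auto simp: f_def)
    have "\<exists>i\<in>I. e i > 0"
    proof (rule ccontr)
      assume "\<not> ?thesis"
      then have "\<forall>i\<in>I. 0 \<le> - e i" by force
      moreover have "(\<Sum>i\<in>I. - e i) = 0" using e0 by (simp add: sum_negf)
      ultimately have "\<forall>i\<in>I. - e i = 0" using less.prems(1) by (simp add: sum_nonneg_eq_0_iff)
      then show False using e(1) by auto
    qed
    define P where "P = {i \<in> I. e i > 0}"
    have P: "finite P" "P \<noteq> {}" using \<open>\<exists>i\<in>I. e i > 0\<close> less.prems by (auto simp: P_def)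
    \<comment> \<open>The largest step that keeps all weights non-negative; it makes the weight at
      the minimising index vanish.\<close>
    define t where "t = Min ((\<lambda>i. c i / e i) ` P)"
    have "t \<in> (\<lambda>i. c i / e i) ` P" unfolding t_def using P by (intro Min_in) auto
    then obtain a where a: "a \<in> I" "e a > 0" "t = c a / e a" by (auto simp: P_def)
    have t0: "0 \<le> t" using a less.prems(2) by auto
    have nn: "0 \<le> c i - t * e i" if "i \<in> I" for i
    proof (cases "e i > 0")
      case True
      then have "t \<le> c i / e i" unfolding t_def using P that by (intro Min_le) (auto simp: P_def)
      then show ?thesis using True by (simp add: field_simps)
    next
      case False
      then have "t * e i \<le> 0" using t0 by (simp add: mult_nonneg_nonpos)
      moreover have "0 \<le> c i" using less.prems(2) that by auto
      ultimately show ?thesis by linarith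
    qed
    have za: "c a - t * e a = 0" using a by simp
    define c1 where "c1 i = c i - t * e i" for i
    have rem: "(\<Sum>i\<in>I - {a}. c1 i * q i) = (\<Sum>i\<in>I. c i * q i) - t * (\<Sum>i\<in>I. e i * q i)" for q
    proof -
      have "(\<Sum>i\<in>I. c1 i * q i) = (\<Sum>i\<in>I - {a}. c1 i * q i)"
        using a less.prems(1) za by (subst sum.remove[of _ a]) (auto simp: c1_def)
      moreover have "(\<Sum>i\<in>I. c1 i * q i) = (\<Sum>i\<in>I. c i * q i) - t * (\<Sum>i\<in>I. e i * q i)"
        unfolding c1_def sum_distrib_left sum_subtractf[symmetric] by (intro sum.cong refl) (simp add: algebra_simps)
      ultimately show ?thesis by simp
    qed
    have s1: "sum c1 (I - {a}) = 1" using rem[of "\<lambda>_. 1"] e0 less.prems(3) by simp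
    have card: "card (I - {a}) < card I" using less.prems(1) a(1) by (rule card_Diff1_less)
    from less.hyps[OF card _ _ s1] nn less.prems(1)
    obtain J c' where J: "J \<subseteq> I - {a}" "card J \<le> card K + 1" "\<forall>i\<in>J. 0 \<le> c' i" "sum c' J = 1"
      "\<forall>k\<in>K. (\<Sum>i\<in>J. c' i * p i k) = (\<Sum>i\<in>I - {a}. c1 i * p i k)" by (auto simp: c1_def)
    have "\<forall>k\<in>K. (\<Sum>i\<in>J. c' i * p i k) = (\<Sum>i\<in>I. c i * p i k)" using J(5) rem ek by simp
    then show ?thesis using J by (intro exI[of _ J]) auto
  qed
qed

text \<open>Padding with weight 0 makes the number of summands the same for every point of the hull,
  so that sequences of convex combinations can be compared slot by slot in the compactness
  argument.\<close>

lemma caratheodory_padded: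
  fixes p :: "'i \<Rightarrow> 'k \<Rightarrow> real"
  assumes K: "finite K" and I: "finite I" "\<forall>i\<in>I. 0 \<le> c i" "sum c I = 1"
  shows "\<exists>x w. (\<forall>j. x j \<in> I) \<and> (\<forall>j. 0 \<le> w j) \<and> (\<Sum>j<card K + 1. w j) = 1 \<and>
    (\<forall>k\<in>K. (\<Sum>j<card K + 1. w j * p (x j) k) = (\<Sum>i\<in>I. c i * p i k))"
proof -
  obtain J c' where J: "J \<subseteq> I" "card J \<le> card K + 1" "\<forall>i\<in>J. 0 \<le> c' i" "sum c' J = 1"
    "\<forall>k\<in>K. (\<Sum>i\<in>J. c' i * p i k) = (\<Sum>i\<in>I. c i * p i k)"
    using caratheodory_coords[OF K I, of p] by blast
  have fJ: "finite J" using J I finite_subset by blast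
  then obtain h where h: "bij_betw h {0..<card J} J" using ex_bij_betw_nat_finite by blast
  have hb: "bij_betw h {..<card J} J" using h by (simp add: atLeast0LessThan)
  have "J \<noteq> {}" using J(4) by auto
  then obtain a where a: "a \<in> J" by blast
  define x where "x j = (if j < card J then h j else a)" for j
  define w where "w j = (if j < card J then c' (h j) else 0)" for j
  have hj: "h j \<in> J" if "j < card J" for j using hb that by (auto simp: bij_betw_def)
  have sum: "(\<Sum>j<card K + 1. w j * q (x j)) = (\<Sum>i\<in>J. c' i * q i)" for q
  proof -
    have "(\<Sum>j<card K + 1. w j * q (x j)) = (\<Sum>j<card J. w j * q (x j))"
      using J(2) by (intro sum.mono_neutral_right) (auto simp: w_def)
    also have "\<dots> = (\<Sum>j<card J. c' (h j) * q (h j))" by (intro sum.cong refl) (auto simp: w_def x_def)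
    also have "\<dots> = (\<Sum>i\<in>J. c' i * q i)" by (rule sum.reindex_bij_betw[OF hb])
    finally show ?thesis .
  qed
  have "(\<Sum>j<card K + 1. w j) = 1" using sum[of "\<lambda>_. 1"] J(4) by simp
  moreover have "x j \<in> I" "0 \<le> w j" for j using hj J a by (auto simp: x_def w_def)
  moreover have "\<forall>k\<in>K. (\<Sum>j<card K + 1. w j * p (x j) k) = (\<Sum>i\<in>I. c i * p i k)"
    using J(5) sum[of "\<lambda>i. p i k" for k] by metis
  ultimately show ?thesis by blast
qed

section \<open>Existence of barycentric spanners\<close>

definition pts_mat :: "('a \<Rightarrow> 'k \<Rightarrow> real) \<Rightarrow> 'a list \<Rightarrow> 'k list \<Rightarrow> real Matrix.mat" where
  "pts_mat f xs ks = Matrix.mat (length ks) (length xs) (\<lambda>(j, i). f (xs ! i) (ks ! j))"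

lemma pts_mat_carrier: "length xs = r \<Longrightarrow> length ks = r \<Longrightarrow> pts_mat f xs ks \<in> carrier_mat r r"
  by (simp add: pts_mat_def)

lemma pts_mat_mult_vec:
  assumes "length xs = r" "length ks = r" "v \<in> carrier_vec r" "j < r"
  shows "(pts_mat f xs ks *\<^sub>v v) $ j = (\<Sum>i<r. v $ i * f (xs ! i) (ks ! j))"
  using assms by (auto simp: pts_mat_def index_mult_mat_vec scalar_prod_def atLeast0LessThan mult.commute intro!: sum.cong)

text \<open>The Leibniz formula; it is only used to see that the supremum of the minors is
  finite.\<close>

lemma det_bound:
  fixes A :: "real Matrix.mat"
  assumes A: "A \<in> carrier_mat r r" and B: "\<And>i j. i < r \<Longrightarrow> j < r \<Longrightarrow> \<bar>A $$ (i, j)\<bar> \<le> B"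
  shows "\<bar>Determinant.det A\<bar> \<le> fact r * B ^ r"
proof -
  have "\<bar>Determinant.det A\<bar> \<le> (\<Sum>p | p permutes {0..<r}. \<bar>signof p * (\<Prod>i = 0..<r. A $$ (i, p i))\<bar>)"
    unfolding det_def'[OF A] by (rule sum_abs)
  also have "\<dots> \<le> (\<Sum>p | p permutes {0..<r}. B ^ r)"
  proof (intro sum_mono)
    fix p assume "p \<in> {p. p permutes {0..<r}}"
    then have p: "p permutes {0..<r}" by simp
    have "\<bar>signof p * (\<Prod>i = 0..<r. A $$ (i, p i))\<bar> = (\<Prod>i = 0..<r. \<bar>A $$ (i, p i)\<bar>)"
      by (simp add: abs_mult abs_prod sign_def)
    also have "\<dots> \<le> (\<Prod>i = 0..<r. B)"
    proof (intro prod_mono conjI)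
      fix i assume "i \<in> {0..<r}"
      then have "p i < r" "i < r" using permutes_in_image[OF p, of i] by auto
      then show "\<bar>A $$ (i, p i)\<bar> \<le> B" using B by simp
    qed simp
    finally show "\<bar>signof p * (\<Prod>i = 0..<r. A $$ (i, p i))\<bar> \<le> B ^ r" by simp
  qed
  also have "\<dots> = fact r * B ^ r" by (simp add: card_permutations)
  finally show ?thesis .
qed

text \<open>Barycentric spanner: choose a nonvanishing minor of maximal size whose modulus is, for the chosen rows,
  within a factor 2 of the supremum. Cramer's rule bounds all coordinates by 2.\<close>
lemma barycentric_spanner:
  fixes f :: "'a \<Rightarrow> 'k \<Rightarrow> real"
  assumes K: "finite K" and bnd: "\<And>x k. x \<in> X \<Longrightarrow> k \<in> K \<Longrightarrow> \<bar>f x k\<bar> \<le> B"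
  shows "\<exists>xs. set xs \<subseteq> X \<and> length xs \<le> card K \<and>
    (\<forall>x\<in>X. \<exists>c. (\<forall>i<length xs. \<bar>c i\<bar> \<le> 2) \<and> (\<forall>k\<in>K. f x k = (\<Sum>i<length xs. c i * f (xs ! i) k)))"
proof -
  define P where "P r \<longleftrightarrow> (\<exists>xs ks. length xs = r \<and> length ks = r \<and> set xs \<subseteq> X \<and> set ks \<subseteq> K \<and> Determinant.det (pts_mat f xs ks) \<noteq> 0)" for r
  have "P 0" unfolding P_def by (intro exI[of _ "[]"]) (simp add: pts_mat_def)
  have Pb: "r \<le> card K" if Pr': "P r" for r
  proof (rule ccontr)
    assume r: "\<not> r \<le> card K"
    obtain xs ks where x: "length xs = r" "length ks = r" "set xs \<subseteq> X" "set ks \<subseteq> K" "Determinant.det (pts_mat f xs ks) \<noteq> 0"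
      using Pr' by (auto simp: P_def)
    obtain c where c: "\<exists>i\<in>{..<r}. c i \<noteq> 0" "\<forall>k\<in>K. (\<Sum>i<r. c i * f (xs ! i) k) = 0"
      using linear_dependency[OF K, of "{..<r}" "\<lambda>i. f (xs ! i)"] r by auto
    let ?v = "Matrix.vec r c"
    have "pts_mat f xs ks *\<^sub>v ?v = 0\<^sub>v r"
    proof (rule eq_vecI)
      fix j assume "j < dim_vec (0\<^sub>v r :: real Matrix.vec)"
      then have j: "j < r" by simp
      then have "ks ! j \<in> K" using x by auto
      then show "(pts_mat f xs ks *\<^sub>v ?v) $ j = (0\<^sub>v r) $ j"
        using c(2) j pts_mat_mult_vec[OF x(1,2) vec_carrier j] by simp
    qed (use x in \<open>simp add: pts_mat_def\<close>)
    moreover have "?v \<noteq> 0\<^sub>v r" using c(1) by (metis index_vec index_zero_vec(1) lessThan_iff)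
    ultimately show False using det_0_iff_vec_prod_zero[OF pts_mat_carrier[OF x(1,2)]] x(5) vec_carrier by metis
  qed
  define r where "r = (GREATEST r. P r)"
  have Pr: "P r" unfolding r_def using \<open>P 0\<close> Pb by (rule GreatestI_nat)
  have Pmax: "\<not> P (Suc r)" using Greatest_le_nat[of P "Suc r" "card K"] Pb unfolding r_def[symmetric] by auto
  obtain xs0 ks where x0: "length xs0 = r" "length ks = r" "set xs0 \<subseteq> X" "set ks \<subseteq> K" "Determinant.det (pts_mat f xs0 ks) \<noteq> 0"
    using Pr by (auto simp: P_def)
  \<comment> \<open>The rows \<open>ks\<close> stay fixed while the points vary. A supremum replaces
    a maximum because the points range over an arbitrary set, and half of it is always
    exceeded.\<close>
  define V where "V = {\<bar>Determinant.det (pts_mat f xs ks)\<bar> | xs. length xs = r \<and> set xs \<subseteq> X}"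
  have bV: "bdd_above V"
  proof (rule bdd_aboveI[of _ "fact r * B ^ r"])
    fix v assume "v \<in> V"
    then obtain xs where xs: "v = \<bar>Determinant.det (pts_mat f xs ks)\<bar>" "length xs = r" "set xs \<subseteq> X" by (auto simp: V_def)
    have "\<bar>pts_mat f xs ks $$ (j, i)\<bar> \<le> B" if "j < r" "i < r" for i j
    proof -
      have "xs ! i \<in> X" "ks ! j \<in> K" using xs x0 that by auto
      then show ?thesis using bnd that xs x0 by (simp add: pts_mat_def)
    qed
    then show "v \<le> fact r * B ^ r" unfolding xs(1) by (intro det_bound pts_mat_carrier xs x0) auto
  qed
  have in0: "\<bar>Determinant.det (pts_mat f xs0 ks)\<bar> \<in> V" using x0 by (auto simp: V_def)
  have "0 < Sup V" using cSup_upper[OF in0 bV] x0(5) by linarith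
  then have "Sup V / 2 < Sup V" by simp
  then obtain v where "v \<in> V" "Sup V / 2 < v" using less_cSupD[of V] in0 by blast
  then obtain xs where xs: "length xs = r" "set xs \<subseteq> X" "Sup V / 2 < \<bar>Determinant.det (pts_mat f xs ks)\<bar>" by (auto simp: V_def)
  let ?M = "pts_mat f xs ks"
  have M: "?M \<in> carrier_mat r r" by (rule pts_mat_carrier[OF xs(1) x0(2)])
  have dM: "Determinant.det ?M \<noteq> 0" using xs(3) \<open>0 < Sup V\<close> by auto
  have inj: "v = w" if "v \<in> carrier_vec r" "w \<in> carrier_vec r" "?M *\<^sub>v v = ?M *\<^sub>v w" for v w
  proof -
    have "?M *\<^sub>v (v - w) = 0\<^sub>v r" using that M by (simp add: mult_minus_distrib_mat_vec)
    then have "v - w = 0\<^sub>v r" using det_0_iff_vec_prod_zero[OF M] dM that by (metis minus_carrier_vec)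
    show "v = w"
    proof (rule eq_vecI)
      fix i assume "i < dim_vec w"
      then have "(v - w) $ i = 0" using \<open>v - w = 0\<^sub>v r\<close> that by auto
      then show "v $ i = w $ i" using that \<open>i < dim_vec w\<close> by auto
    qed (use that in auto)
  qed
  \<comment> \<open>The bordered minor with one more row and column vanishes by maximality of
    \<open>r\<close>. Its kernel vector has a nonzero last entry since the chosen minor is
    invertible, so \<open>x\<close> can be solved for. At this point the coefficients may still
    depend on \<open>k\<close>.\<close>
  have sol: "\<exists>c. c \<in> carrier_vec r \<and> (\<forall>j<r. f x (ks ! j) = (\<Sum>i<r. c $ i * f (xs ! i) (ks ! j))) \<and> f x k = (\<Sum>i<r. c $ i * f (xs ! i) k)"
    if x: "x \<in> X" and k: "k \<in> K" for x k
  proof -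
    let ?N = "pts_mat f (xs @ [x]) (ks @ [k])"
    have l: "length (xs @ [x]) = Suc r" "length (ks @ [k]) = Suc r" using xs x0 by auto
    have N: "?N \<in> carrier_mat (Suc r) (Suc r)" by (rule pts_mat_carrier[OF l])
    have "Determinant.det ?N = 0"
    proof (rule ccontr)
      assume "Determinant.det ?N \<noteq> 0"
      then have "P (Suc r)" unfolding P_def using l xs x0 x k by (intro exI[of _ "xs @ [x]"] exI[of _ "ks @ [k]"]) auto
      then show False using Pmax by simp
    qed
    then obtain v where v: "v \<in> carrier_vec (Suc r)" "v \<noteq> 0\<^sub>v (Suc r)" "?N *\<^sub>v v = 0\<^sub>v (Suc r)"
      using det_0_iff_vec_prod_zero[OF N] by auto
    have eq: "(\<Sum>i<r. v $ i * f (xs ! i) ((ks @ [k]) ! j)) + v $ r * f x ((ks @ [k]) ! j) = 0" if "j < Suc r" for j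
    proof -
      have "(?N *\<^sub>v v) $ j = (\<Sum>i<Suc r. v $ i * f ((xs @ [x]) ! i) ((ks @ [k]) ! j))"
        by (rule pts_mat_mult_vec[OF l v(1) that])
      also have "\<dots> = (\<Sum>i<r. v $ i * f (xs ! i) ((ks @ [k]) ! j)) + v $ r * f x ((ks @ [k]) ! j)"
        using xs by (simp add: sum.lessThan_Suc nth_append)
      finally show ?thesis using v(3) that by simp
    qed
    have vr: "v $ r \<noteq> 0"
    proof
      assume z: "v $ r = 0"
      let ?w = "Matrix.vec r (($) v)"
      have "?M *\<^sub>v ?w = 0\<^sub>v r"
      proof (rule eq_vecI)
        fix j assume "j < dim_vec (0\<^sub>v r :: real Matrix.vec)"
        then have j: "j < r" by simp
        show "(?M *\<^sub>v ?w) $ j = (0\<^sub>v r) $ j"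
          using eq[of j] z j x0 pts_mat_mult_vec[OF xs(1) x0(2) vec_carrier j] by (simp add: nth_append)
      qed (use x0 in \<open>simp add: pts_mat_def\<close>)
      then have "?w = 0\<^sub>v r" using det_0_iff_vec_prod_zero[OF M] dM vec_carrier by metis
      then have "v $ i = 0" if "i < r" for i using that by (metis index_vec index_zero_vec(1))
      then have "v = 0\<^sub>v (Suc r)" using z v(1) by (intro eq_vecI) (auto simp: less_Suc_eq)
      then show False using v(2) by simp
    qed
    define c where "c = Matrix.vec r (\<lambda>i. - v $ i / v $ r)"
    have "f x ((ks @ [k]) ! j) = (\<Sum>i<r. c $ i * f (xs ! i) ((ks @ [k]) ! j))" if "j < Suc r" for j
    proof -
      have "(\<Sum>i<r. c $ i * f (xs ! i) ((ks @ [k]) ! j)) = - (\<Sum>i<r. v $ i * f (xs ! i) ((ks @ [k]) ! j)) / v $ r"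
        unfolding sum_negf[symmetric] sum_divide_distrib by (intro sum.cong refl) (simp add: c_def)
      then have "v $ r * (\<Sum>i<r. c $ i * f (xs ! i) ((ks @ [k]) ! j)) = - (\<Sum>i<r. v $ i * f (xs ! i) ((ks @ [k]) ! j))"
        using vr by simp
      also have "\<dots> = v $ r * f x ((ks @ [k]) ! j)" using eq[OF that] by linarith
      finally show ?thesis using vr by simp
    qed
    note this' = this
    have "f x (ks ! j) = (\<Sum>i<r. c $ i * f (xs ! i) (ks ! j))" if "j < r" for j
      using this'[of j] that x0 by (simp add: nth_append)
    moreover have "f x k = (\<Sum>i<r. c $ i * f (xs ! i) k)" using this'[of r] x0 by (simp add: nth_append)
    moreover have "c \<in> carrier_vec r" by (simp add: c_def)
    ultimately show ?thesis by blast
  qed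
  have fin: "\<exists>c. (\<forall>i<r. \<bar>c i\<bar> \<le> 2) \<and> (\<forall>k\<in>K. f x k = (\<Sum>i<r. c i * f (xs ! i) k))" if x: "x \<in> X" for x
  proof (cases "K = {}")
    case True
    then show ?thesis by (intro exI[of _ "\<lambda>_. 0"]) auto
  next
    case False
    then obtain k0 where k0: "k0 \<in> K" by blast
    obtain c where c: "c \<in> carrier_vec r" "\<And>j. j < r \<Longrightarrow> f x (ks ! j) = (\<Sum>i<r. c $ i * f (xs ! i) (ks ! j))"
      using sol[OF x k0] by blast
    have Mc: "(?M *\<^sub>v c) $ j = f x (ks ! j)" if "j < r" for j
      using pts_mat_mult_vec[OF xs(1) x0(2) c(1) that] c(2)[OF that] by simp
    \<comment> \<open>Invertibility of the chosen minor makes the coefficients unique, hence the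
      same for every coordinate.\<close>
    have all: "f x k = (\<Sum>i<r. c $ i * f (xs ! i) k)" if k: "k \<in> K" for k
    proof -
      obtain c' where c': "c' \<in> carrier_vec r" "\<And>j. j < r \<Longrightarrow> f x (ks ! j) = (\<Sum>i<r. c' $ i * f (xs ! i) (ks ! j))"
        "f x k = (\<Sum>i<r. c' $ i * f (xs ! i) k)" using sol[OF x k] by blast
      have "?M *\<^sub>v c = ?M *\<^sub>v c'"
      proof (rule eq_vecI)
        fix j assume "j < dim_vec (?M *\<^sub>v c')"
        then have "j < r" using M by auto
        then show "(?M *\<^sub>v c) $ j = (?M *\<^sub>v c') $ j"
          using Mc pts_mat_mult_vec[OF xs(1) x0(2) c'(1)] c'(2) by simp
      qed simp
      then show ?thesis using inj[OF c(1) c'(1)] c'(3) by simp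
    qed
    have "\<bar>c $ i\<bar> \<le> 2" if i: "i < r" for i
    proof -
      have "replace_col ?M (?M *\<^sub>v c) i = pts_mat f (xs[i := x]) ks"
      proof (rule eq_matI)
        fix j l assume "j < dim_row (pts_mat f (xs[i := x]) ks)" "l < dim_col (pts_mat f (xs[i := x]) ks)"
        then have "j < r" "l < r" using xs x0 by (auto simp: pts_mat_def)
        then show "replace_col ?M (?M *\<^sub>v c) i $$ (j, l) = pts_mat f (xs[i := x]) ks $$ (j, l)"
          using M Mc xs x0 by (auto simp: replace_col_def pts_mat_def[of f "xs[i := x]"]) (auto simp: pts_mat_def)
      qed (use xs x0 in \<open>auto simp: replace_col_def pts_mat_def\<close>)
      then have "Determinant.det (pts_mat f (xs[i := x]) ks) = c $ i * Determinant.det ?M"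
        using cramer_lemma_mat[OF M c(1) i] by simp
      moreover have "\<bar>Determinant.det (pts_mat f (xs[i := x]) ks)\<bar> \<le> Sup V"
      proof (rule cSup_upper[OF _ bV])
        have "set (xs[i := x]) \<subseteq> X" using xs x set_update_subset_insert[of xs i x] by blast
        then show "\<bar>Determinant.det (pts_mat f (xs[i := x]) ks)\<bar> \<in> V"
          unfolding V_def using xs by (intro CollectI exI[of _ "xs[i := x]"]) auto
      qed
      ultimately have "\<bar>c $ i\<bar> * \<bar>Determinant.det ?M\<bar> \<le> 2 * \<bar>Determinant.det ?M\<bar>" using xs(3) by (simp add: abs_mult)
      then show ?thesis using dM by simp
    qed
    then show ?thesis using all by (intro exI[of _ "\<lambda>i. c $ i"]) auto
  qed
  show ?thesis using xs(1,2) Pb[OF Pr] fin by (intro exI[of _ xs]) auto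
qed

section \<open>Counting eigenvalues of permutation-invariant matrices\<close>

lemma spec_zero:
  assumes V: "unitary_mat n V" and z: "\<And>x y. x < n \<Longrightarrow> y < n \<Longrightarrow> spec n V l $$ (x, y) = 0" and j: "j < n"
  shows "l j = 0"
proof (rule ccontr)
  assume "l j \<noteq> 0"
  have "V $$ (x, j) = 0" if x: "x < n" for x
    using app_spec_col[OF V x j, of l] z[OF x] \<open>l j \<noteq> 0\<close> by (simp add: app_def)
  then show False using unitary_col_norm[OF V j] by simp
qed

text \<open>The powers of a permutation-invariant matrix live in a space of polynomial dimension, so a polynomial of
  that degree annihilates all its eigenvalues.\<close>
lemma perm_inv_eigenvalue_count:
  assumes V: "unitary_mat (d ^ n) V" and tau: "perm_inv d n (spec (d ^ n) V s)"
  shows "card (s ` {..<d ^ n}) \<le> 2 * (n + 1) ^ (d * d)"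
proof -
  let ?D = "d ^ n"
  have Vc: "V \<in> carrier_mat ?D ?D" using V by (rule unitary_carrier)
  obtain R where R: "R \<subseteq> {..<?D} \<times> {..<?D}" "card R \<le> (n + 1) ^ (d * d)"
    "\<And>i j. i < ?D \<Longrightarrow> j < ?D \<Longrightarrow> \<exists>(i', j')\<in>R. \<forall>M. perm_inv d n M \<longrightarrow> M $$ (i, j) = M $$ (i', j')"
    using perm_inv_representatives by blast
  have fR: "finite R" using R(1) finite_subset by blast
  define M where "M i = spec ?D V (\<lambda>j. s j ^ i)" for i :: nat
  have Minv: "perm_inv d n (M i)" for i
  proof (induction i)
    case 0
    show ?case using perm_inv_one spec_one[OF V] by (simp add: M_def)
  next
    case (Suc i)
    have "M (Suc i) = spec ?D V s * M i" unfolding M_def spec_mult[OF V] by simp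
    then show ?case using perm_inv_mult[OF tau Suc] by simp
  qed
  let ?K = "R \<times> (UNIV :: bool set)"
  \<comment> \<open>One more power than there are real coordinates, two for each representative
    entry, so the powers from 0 on satisfy a linear relation.\<close>
  define m where "m = Suc (card ?K)"
  define f where "f i k = (if snd k then Re (M i $$ fst k) else Im (M i $$ fst k))" for i k
  obtain c where c: "\<exists>i\<in>{..<m}. c i \<noteq> 0" "\<forall>k\<in>?K. (\<Sum>i<m. c i * f i k) = 0"
    using linear_dependency[of ?K "{..<m}" f] fR by (auto simp: m_def)
  define p where "p = (\<Sum>i<m. monom (c i) i)"
  have co: "coeff p i = c i" if "i < m" for i
  proof -
    have "coeff p i = (\<Sum>k<m. if k = i then c k else 0)"
      unfolding p_def coeff_sum by (intro sum.cong refl) auto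
    then show ?thesis using that by simp
  qed
  have p0: "p \<noteq> 0" using c(1) co by (metis coeff_0 lessThan_iff)
  have deg: "degree p \<le> card ?K"
  proof (rule degree_le, intro allI impI)
    fix i assume "card ?K < i"
    then have "m \<le> i" by (simp add: m_def)
    then show "coeff p i = 0" unfolding p_def coeff_sum by (intro sum.neutral) auto
  qed
  have poly: "poly p z = (\<Sum>i<m. c i * z ^ i)" for z by (simp add: p_def poly_sum poly_monom)
  have zero: "spec ?D V (\<lambda>j. poly p (s j)) $$ (x, y) = 0" if xy: "x < ?D" "y < ?D" for x y
  proof -
    obtain x' y' where r: "(x', y') \<in> R" "\<And>M. perm_inv d n M \<Longrightarrow> M $$ (x, y) = M $$ (x', y')" using R(3)[OF xy] by blast
    have "spec ?D V (\<lambda>j. poly p (s j)) $$ (x, y) = (\<Sum>k<?D. \<Sum>i<m. of_real (c i) * (V $$ (x, k) * of_real (s k ^ i) * cnj (V $$ (y, k))))"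
      unfolding spec_index[OF Vc xy] poly
      by (intro sum.cong refl) (simp add: sum_distrib_left sum_distrib_right mult_ac)
    also have "\<dots> = (\<Sum>i<m. \<Sum>k<?D. of_real (c i) * (V $$ (x, k) * of_real (s k ^ i) * cnj (V $$ (y, k))))" by (rule sum.swap)
    also have "\<dots> = (\<Sum>i<m. of_real (c i) * M i $$ (x, y))"
      unfolding M_def spec_index[OF Vc xy] by (simp add: sum_distrib_left)
    also have "\<dots> = (\<Sum>i<m. of_real (c i) * M i $$ (x', y'))" using r(2)[OF Minv] by simp
    also have "\<dots> = 0"
    proof (rule complex_eqI)
      show "Re (\<Sum>i<m. of_real (c i) * M i $$ (x', y')) = Re 0"
        using bspec[OF c(2), of "((x', y'), True)"] r(1) by (simp add: f_def)
      show "Im (\<Sum>i<m. of_real (c i) * M i $$ (x', y')) = Im 0"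
        using bspec[OF c(2), of "((x', y'), False)"] r(1) by (simp add: f_def)
    qed
    finally show ?thesis .
  qed
  have "s ` {..<?D} \<subseteq> {z. poly p z = 0}" using spec_zero[OF V zero] by auto
  then have "card (s ` {..<?D}) \<le> card {z. poly p z = 0}" using poly_roots_finite[OF p0] by (intro card_mono) auto
  also have "\<dots> \<le> degree p" by (rule card_poly_roots_bound[OF p0])
  also have "\<dots> \<le> card ?K" by (rule deg)
  also have "\<dots> = 2 * card R" by (simp add: card_cartesian_product)
  also have "\<dots> \<le> 2 * (n + 1) ^ (d * d)" using R(2) by simp
  finally show ?thesis .
qed

section \<open>Convex hulls and compactness of sets of states\<close>

lemma foldr_smult_add_index:
  assumes "length cs = length Ms" "\<forall>M\<in>set Ms. M \<in> carrier_mat N N"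
  shows "foldr (+) (map2 (\<lambda>c A. complex_of_real c \<cdot>\<^sub>m A) cs Ms) (0\<^sub>m N N) \<in> carrier_mat N N"
    "x < N \<Longrightarrow> y < N \<Longrightarrow> foldr (+) (map2 (\<lambda>c A. complex_of_real c \<cdot>\<^sub>m A) cs Ms) (0\<^sub>m N N) $$ (x, y)
      = (\<Sum>l<length cs. of_real (cs ! l) * (Ms ! l) $$ (x, y))"
proof -
  show c: "foldr (+) (map2 (\<lambda>c A. complex_of_real c \<cdot>\<^sub>m A) cs Ms) (0\<^sub>m N N) \<in> carrier_mat N N"
    using assms by (induction cs Ms rule: list_induct2) auto
  show "x < N \<Longrightarrow> y < N \<Longrightarrow> foldr (+) (map2 (\<lambda>c A. complex_of_real c \<cdot>\<^sub>m A) cs Ms) (0\<^sub>m N N) $$ (x, y)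
      = (\<Sum>l<length cs. of_real (cs ! l) * (Ms ! l) $$ (x, y))"
    using assms
  proof (induction cs Ms rule: list_induct2)
    case (Cons c cs M Ms)
    have "foldr (+) (map2 (\<lambda>c A. complex_of_real c \<cdot>\<^sub>m A) cs Ms) (0\<^sub>m N N) \<in> carrier_mat N N"
      using Cons.hyps Cons.prems by (induction cs Ms rule: list_induct2) auto
    then show ?case using Cons by (auto simp: sum.lessThan_Suc_shift)
  qed simp
qed

text \<open>Trades the lists in \<open>mat_co\<close> for finite sums of entries, the form in which
  convex combinations are handled below.\<close>

lemma mat_co_iff:
  assumes S: "S \<subseteq> carrier_mat N N"
  shows "M \<in> mat_co N S \<longleftrightarrow> M \<in> carrier_mat N N \<and> (\<exists>(m::nat) c P. (\<forall>l<m. 0 \<le> c l \<and> P l \<in> S) \<and> (\<Sum>l<m. c l) = 1 \<and>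
    (\<forall>x<N. \<forall>y<N. M $$ (x, y) = (\<Sum>l<m. complex_of_real (c l) * P l $$ (x, y))))" (is "_ \<longleftrightarrow> ?R")
proof
  assume "M \<in> mat_co N S"
  then obtain cs Ms where c: "length cs = length Ms" "Ms \<noteq> []" "set Ms \<subseteq> S" "\<forall>c\<in>set cs. 0 \<le> c" "sum_list cs = 1"
    "M = foldr (+) (map2 (\<lambda>c A. complex_of_real c \<cdot>\<^sub>m A) cs Ms) (0\<^sub>m N N)" by (auto simp: mat_co_def)
  have Mc: "\<forall>M\<in>set Ms. M \<in> carrier_mat N N" using c S by auto
  have "(\<Sum>l<length cs. cs ! l) = 1" using c(5) by (simp add: sum_list_sum_nth atLeast0LessThan)
  moreover have "\<forall>l<length cs. 0 \<le> cs ! l \<and> Ms ! l \<in> S" using c by auto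
  ultimately show ?R using foldr_smult_add_index[OF c(1) Mc] unfolding c(6)
    by (intro conjI, simp) (rule exI[of _ "length cs"], rule exI[of _ "(!) cs"], rule exI[of _ "(!) Ms"], simp)
next
  assume ?R
  then obtain m :: nat and c P where M: "M \<in> carrier_mat N N" and P: "\<forall>l<m. 0 \<le> c l \<and> P l \<in> S" and s: "(\<Sum>l<m. c l) = 1"
    and e: "\<forall>x<N. \<forall>y<N. M $$ (x, y) = (\<Sum>l<m. complex_of_real (c l) * P l $$ (x, y))" by blast
  let ?cs = "map c [0..<m]" and ?Ms = "map P [0..<m]"
  have Mc: "\<forall>M\<in>set ?Ms. M \<in> carrier_mat N N" using P S by auto
  have "M = foldr (+) (map2 (\<lambda>c A. complex_of_real c \<cdot>\<^sub>m A) ?cs ?Ms) (0\<^sub>m N N)"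
  proof (rule eq_matI)
    have fc: "foldr (+) (map2 (\<lambda>c A. complex_of_real c \<cdot>\<^sub>m A) ?cs ?Ms) (0\<^sub>m N N) \<in> carrier_mat N N"
      by (rule foldr_smult_add_index(1)[OF _ Mc]) simp
    then show "dim_row M = dim_row (foldr (+) (map2 (\<lambda>c A. complex_of_real c \<cdot>\<^sub>m A) ?cs ?Ms) (0\<^sub>m N N))"
      "dim_col M = dim_col (foldr (+) (map2 (\<lambda>c A. complex_of_real c \<cdot>\<^sub>m A) ?cs ?Ms) (0\<^sub>m N N))" using M by auto
    fix x y assume "x < dim_row (foldr (+) (map2 (\<lambda>c A. complex_of_real c \<cdot>\<^sub>m A) ?cs ?Ms) (0\<^sub>m N N))"
      "y < dim_col (foldr (+) (map2 (\<lambda>c A. complex_of_real c \<cdot>\<^sub>m A) ?cs ?Ms) (0\<^sub>m N N))"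
    then have xy: "x < N" "y < N" using fc by auto
    show "M $$ (x, y) = foldr (+) (map2 (\<lambda>c A. complex_of_real c \<cdot>\<^sub>m A) ?cs ?Ms) (0\<^sub>m N N) $$ (x, y)"
      using foldr_smult_add_index(2)[OF _ Mc xy, of ?cs] e xy by simp
  qed
  moreover have "sum_list ?cs = 1" using s by (simp add: sum_list_sum_nth atLeast0LessThan)
  moreover have "?Ms \<noteq> []" using s by (cases m) auto
  ultimately show "M \<in> mat_co N S" unfolding mat_co_def using P
    by (intro CollectI exI[of _ ?cs] exI[of _ ?Ms]) auto
qed

lemma mtrace_sum_left:
  fixes m :: nat
  assumes "M \<in> carrier_mat N N" "\<And>l. l < m \<Longrightarrow> P l \<in> carrier_mat N N" "Z \<in> carrier_mat N N"
    and e: "\<And>x y. x < N \<Longrightarrow> y < N \<Longrightarrow> M $$ (x, y) = (\<Sum>l<m. complex_of_real (c l) * P l $$ (x, y))"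
  shows "Re (mtrace (M * Z)) = (\<Sum>l<m. c l * Re (mtrace (P l * Z)))"
proof -
  have "mtrace (M * Z) = (\<Sum>x<N. \<Sum>y<N. \<Sum>l<m. of_real (c l) * (P l $$ (x, y) * Z $$ (y, x)))"
    unfolding mtrace_mult[OF assms(1,3)] by (intro sum.cong refl) (simp add: e sum_distrib_right mult.assoc)
  also have "\<dots> = (\<Sum>x<N. \<Sum>l<m. \<Sum>y<N. of_real (c l) * (P l $$ (x, y) * Z $$ (y, x)))"
    by (rule sum.cong[OF refl], rule sum.swap)
  also have "\<dots> = (\<Sum>l<m. \<Sum>x<N. \<Sum>y<N. of_real (c l) * (P l $$ (x, y) * Z $$ (y, x)))" by (rule sum.swap)
  also have "\<dots> = (\<Sum>l<m. of_real (c l) * mtrace (P l * Z))"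
    by (intro sum.cong refl) (simp add: mtrace_mult[OF assms(2,3)] sum_distrib_left)
  finally show ?thesis by simp
qed

lemma qfc_sum:
  fixes m :: nat
  assumes e: "\<And>x y. x < N \<Longrightarrow> y < N \<Longrightarrow> M $$ (x, y) = (\<Sum>l<m. complex_of_real (c l) * P l $$ (x, y))"
  shows "qfc N M v = (\<Sum>l<m. of_real (c l) * qfc N (P l) v)"
proof -
  have "qfc N M v = (\<Sum>x<N. \<Sum>y<N. \<Sum>l<m. of_real (c l) * (cnj (v x) * P l $$ (x, y) * v y))"
    unfolding qfc_def by (intro sum.cong refl) (simp add: e sum_distrib_right sum_distrib_left mult_ac)
  also have "\<dots> = (\<Sum>x<N. \<Sum>l<m. \<Sum>y<N. of_real (c l) * (cnj (v x) * P l $$ (x, y) * v y))"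
    by (rule sum.cong[OF refl], rule sum.swap)
  also have "\<dots> = (\<Sum>l<m. \<Sum>x<N. \<Sum>y<N. of_real (c l) * (cnj (v x) * P l $$ (x, y) * v y))" by (rule sum.swap)
  finally show ?thesis by (simp add: qfc_def sum_distrib_left)
qed

lemma density_sum:
  fixes m :: nat
  assumes M: "M \<in> carrier_mat N N" and P: "\<And>l. l < m \<Longrightarrow> density_mat N (P l)" and c: "\<And>l. l < m \<Longrightarrow> 0 \<le> c l" "(\<Sum>l<m. c l) = 1"
    and e: "\<And>x y. x < N \<Longrightarrow> y < N \<Longrightarrow> M $$ (x, y) = (\<Sum>l<m. complex_of_real (c l) * P l $$ (x, y))"
  shows "density_mat N M"
proof -
  have h: "hermitian_mat N (P l)" if "l < m" for l using P[OF that] by (simp add: density_mat_def psd_mat_def)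
  have "hermitian_mat N M"
    unfolding hermitian_iff
  proof (intro conjI allI impI M)
    fix i j assume ij: "i < N" "j < N"
    have "M $$ (i, j) = (\<Sum>l<m. complex_of_real (c l) * cnj (P l $$ (j, i)))"
      unfolding e[OF ij] by (intro sum.cong refl) (simp add: hermitian_index[OF h ij])
    then show "M $$ (i, j) = cnj (M $$ (j, i))" unfolding e[OF ij(2,1)] by simp
  qed
  moreover have "0 \<le> Re (qfc N M v)" for v
  proof -
    have "qfc N M v = (\<Sum>l<m. of_real (c l) * qfc N (P l) v)" by (rule qfc_sum) (rule e)
    then show ?thesis using P c by (auto simp: density_mat_def psd_iff intro!: sum_nonneg)
  qed
  moreover have "mtrace M = 1"
  proof -
    have "mtrace M = (\<Sum>x<N. \<Sum>l<m. complex_of_real (c l) * P l $$ (x, x))" using M by (simp add: mtrace_def e)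
    also have "\<dots> = (\<Sum>l<m. \<Sum>x<N. complex_of_real (c l) * P l $$ (x, x))" by (rule sum.swap)
    also have "\<dots> = (\<Sum>l<m. complex_of_real (c l) * mtrace (P l))"
      by (intro sum.cong refl) (simp add: mtrace_def sum_distrib_left carrier_matD(1)[OF density_carrier[OF P]])
    also have "\<dots> = (\<Sum>l<m. complex_of_real (c l))" using P by (intro sum.cong refl) (simp add: density_mat_def)
    finally show ?thesis using c(2) by (metis of_real_1 of_real_sum)
  qed
  ultimately show ?thesis by (simp add: density_mat_def psd_iff)
qed

lemma mat_co_I:
  fixes m :: nat
  assumes "S \<subseteq> carrier_mat N N" "M \<in> carrier_mat N N" "\<And>l. l < m \<Longrightarrow> 0 \<le> c l" "\<And>l. l < m \<Longrightarrow> P l \<in> S" "(\<Sum>l<m. c l) = 1"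
    "\<And>x y. x < N \<Longrightarrow> y < N \<Longrightarrow> M $$ (x, y) = (\<Sum>l<m. complex_of_real (c l) * P l $$ (x, y))"
  shows "M \<in> mat_co N S"
  unfolding mat_co_iff[OF assms(1)]
  by (rule conjI[OF assms(2)], rule exI[of _ m], rule exI[of _ c], rule exI[of _ P]) (simp add: assms)

lemma mat_co_E:
  assumes "S \<subseteq> carrier_mat N N" "M \<in> mat_co N S"
  obtains m :: nat and c P where "M \<in> carrier_mat N N" "\<forall>l<m. 0 \<le> c l \<and> P l \<in> S" "(\<Sum>l<m. c l) = 1"
    "\<forall>x<N. \<forall>y<N. M $$ (x, y) = (\<Sum>l<m. complex_of_real (c l) * P l $$ (x, y))"
  using assms(2) unfolding mat_co_iff[OF assms(1)] by (elim conjE exE) (rule that)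

lemma mat_co_density:
  assumes "\<And>A. A \<in> S \<Longrightarrow> density_mat N A" "M \<in> mat_co N S" shows "density_mat N M"
proof -
  have S: "S \<subseteq> carrier_mat N N" using assms(1) density_carrier by blast
  obtain m :: nat and c P where M: "M \<in> carrier_mat N N" and P: "\<forall>l<m. 0 \<le> c l \<and> P l \<in> S" and s: "(\<Sum>l<m. c l) = 1"
    and e: "\<forall>x<N. \<forall>y<N. M $$ (x, y) = (\<Sum>l<m. complex_of_real (c l) * P l $$ (x, y))"
    by (rule mat_co_E[OF S assms(2)])
  show ?thesis
  proof (rule density_sum[OF M _ _ s])
    show "density_mat N (P l)" if "l < m" for l using P assms(1) that by blast
    show "0 \<le> c l" if "l < m" for l using P that by blast
    show "M $$ (x, y) = (\<Sum>l<m. complex_of_real (c l) * P l $$ (x, y))" if "x < N" "y < N" for x y using e that by blast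
  qed
qed

lemma mat_co_self: "S \<subseteq> carrier_mat N N \<Longrightarrow> A \<in> S \<Longrightarrow> A \<in> mat_co N S"
  by (rule mat_co_I[of _ _ _ 1 "\<lambda>_. 1" "\<lambda>_. A"]) (auto simp: sum.lessThan_Suc)

lemma mat_co_trace_le:
  assumes S: "S \<subseteq> carrier_mat N N" and M: "M \<in> mat_co N S" and Z: "Z \<in> carrier_mat N N"
    and le: "\<And>A. A \<in> S \<Longrightarrow> Re (mtrace (A * Z)) \<le> b"
  shows "Re (mtrace (M * Z)) \<le> b"
proof -
  obtain m :: nat and c P where Mc: "M \<in> carrier_mat N N" and P: "\<forall>l<m. 0 \<le> c l \<and> P l \<in> S" and s: "(\<Sum>l<m. c l) = 1"
    and e: "\<forall>x<N. \<forall>y<N. M $$ (x, y) = (\<Sum>l<m. complex_of_real (c l) * P l $$ (x, y))"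
    by (rule mat_co_E[OF S M])
  have "Re (mtrace (M * Z)) = (\<Sum>l<m. c l * Re (mtrace (P l * Z)))"
    using P S e by (intro mtrace_sum_left[OF Mc _ Z]) auto
  also have "\<dots> \<le> (\<Sum>l<m. c l * b)" using P le by (intro sum_mono mult_left_mono) auto
  finally show ?thesis using s by (simp add: sum_distrib_right[symmetric])
qed

lemma convmat_mat_co:
  assumes S: "S \<subseteq> carrier_mat N N" shows "convmat (mat_co N S)"
  unfolding convmat_def
proof (intro ballI allI impI)
  fix A B and t :: real assume A: "A \<in> mat_co N S" and B: "B \<in> mat_co N S" and t: "0 \<le> t \<and> t \<le> 1"
  obtain m :: nat and c P where Ac: "A \<in> carrier_mat N N" and P: "\<forall>l<m. 0 \<le> c l \<and> P l \<in> S" and s: "(\<Sum>l<m. c l) = 1"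
    and e: "\<forall>x<N. \<forall>y<N. A $$ (x, y) = (\<Sum>l<m. complex_of_real (c l) * P l $$ (x, y))"
    by (rule mat_co_E[OF S A])
  obtain m' :: nat and c' P' where Bc: "B \<in> carrier_mat N N" and P': "\<forall>l<m'. 0 \<le> c' l \<and> P' l \<in> S" and s': "(\<Sum>l<m'. c' l) = 1"
    and e': "\<forall>x<N. \<forall>y<N. B $$ (x, y) = (\<Sum>l<m'. complex_of_real (c' l) * P' l $$ (x, y))"
    by (rule mat_co_E[OF S B])
  define C where "C l = (if l < m then (1 - t) * c l else t * c' (l - m))" for l
  define Q where "Q l = (if l < m then P l else P' (l - m))" for l
  have split: "(\<Sum>l<m + m'. g l) = (\<Sum>l<m. g l) + (\<Sum>l<m'. g (l + m))" for g :: "nat \<Rightarrow> 'b::comm_monoid_add"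
    by (induction m') (simp_all add: sum.lessThan_Suc add.assoc add.commute[of m])
  have "(\<Sum>l<m + m'. C l) = 1"
    unfolding split using s s' by (simp add: C_def sum_distrib_left[symmetric])
  moreover have "\<forall>l<m + m'. 0 \<le> C l \<and> Q l \<in> S" using P P' t by (auto simp: C_def Q_def)
  moreover have "(complex_of_real (1 - t) \<cdot>\<^sub>m A + complex_of_real t \<cdot>\<^sub>m B) $$ (x, y) = (\<Sum>l<m + m'. complex_of_real (C l) * Q l $$ (x, y))"
    if "x < N" "y < N" for x y
    unfolding split using that Ac Bc e e' by (simp add: C_def Q_def sum_distrib_left mult.assoc)
  moreover have "complex_of_real (1 - t) \<cdot>\<^sub>m A + complex_of_real t \<cdot>\<^sub>m B \<in> carrier_mat N N" using Ac Bc by simp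
  ultimately show "complex_of_real (1 - t) \<cdot>\<^sub>m A + complex_of_real t \<cdot>\<^sub>m B \<in> mat_co N S"
    by (intro mat_co_I[OF S, where m="m + m'" and c=C and P=Q]) auto
qed

lemma finite_subseq:
  fixes g :: "'i \<Rightarrow> nat \<Rightarrow> 'a::metric_space"
  assumes "finite I" "compact K" "\<And>i j. i \<in> I \<Longrightarrow> g i j \<in> K"
  shows "\<exists>\<phi> l. strict_mono (\<phi>::nat \<Rightarrow> nat) \<and> (\<forall>i\<in>I. l i \<in> K \<and> (\<lambda>j. g i (\<phi> j)) \<longlonglongrightarrow> l i)"
  using assms(1,3)
proof (induction I rule: finite_induct)
  case empty
  show ?case by (intro exI[of _ id]) (auto simp: strict_mono_def)
next
  case (insert a I)
  then obtain \<phi> l where p: "strict_mono (\<phi>::nat \<Rightarrow> nat)" "\<forall>i\<in>I. l i \<in> K \<and> (\<lambda>j. g i (\<phi> j)) \<longlonglongrightarrow> l i" by auto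
  have "\<forall>j. g a (\<phi> j) \<in> K" using insert.prems by auto
  then obtain b r where b: "b \<in> K" "strict_mono (r::nat \<Rightarrow> nat)" "((\<lambda>j. g a (\<phi> j)) \<circ> r) \<longlonglongrightarrow> b"
    using assms(2) unfolding compact_def by (metis (no_types, lifting))
  have "(\<lambda>j. g i (\<phi> (r j))) \<longlonglongrightarrow> l i" if "i \<in> I" for i
    using LIMSEQ_subseq_LIMSEQ[OF _ b(2)] p(2) that by (fastforce simp: o_def)
  then show ?case
    using b p insert.hyps strict_mono_o[OF p(1) b(2)] by (intro exI[of _ "\<phi> \<circ> r"] exI[of _ "l(a := b)"]) (auto simp: o_def)
qed

section \<open>Compactness of state spaces and of hulls of product states\<close>

lemma idx_bij: "bij_betw (idx :: nat \<Rightarrow> 'd::finite) {..<CARD('d)} UNIV"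
proof -
  have "\<exists>f :: nat \<Rightarrow> 'd. bij_betw f {0..<CARD('d)} UNIV" using ex_bij_betw_nat_finite[of "UNIV :: 'd set"] by simp
  then show ?thesis unfolding idx_def atLeast0LessThan by (rule someI_ex)
qed

lemma to_mat_carrier [simp]: "to_mat (\<sigma> :: complex^'d::finite^'d) \<in> carrier_mat CARD('d) CARD('d)"
  by (simp add: to_mat_def)

lemma to_mat_index: "i < CARD('d) \<Longrightarrow> j < CARD('d) \<Longrightarrow> to_mat (\<sigma> :: complex^'d::finite^'d) $$ (i, j) = \<sigma> $ idx i $ idx j"
  by (simp add: to_mat_def)

lemma dens_density: "\<sigma> \<in> dens \<Longrightarrow> density_mat CARD('d) (to_mat (\<sigma> :: complex^'d::finite^'d))"
  by (simp add: dens_def)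

lemma dens_bounded: "bounded (dens :: (complex^'d::finite^'d) set)"
proof -
  have nv: "norm x \<le> (\<Sum>i\<in>UNIV. norm (x $ i))" for x :: "'b::real_normed_vector^'d"
    unfolding norm_vec_def by (rule L2_set_le_sum) auto
  have ent: "cmod (\<sigma> $ a $ b) \<le> 1" if s: "\<sigma> \<in> dens" for \<sigma> :: "complex^'d^'d" and a b
  proof -
    obtain i j where ij: "i < CARD('d)" "j < CARD('d)" "a = idx i" "b = idx j"
      using idx_bij[where 'd='d] unfolding bij_betw_def by (metis UNIV_I imageE lessThan_iff)
    then show ?thesis using density_entry_le[OF dens_density[OF s] ij(1,2)] by (simp add: to_mat_index)
  qed
  have "norm \<sigma> \<le> (\<Sum>i\<in>(UNIV::'d set). \<Sum>j\<in>(UNIV::'d set). 1)" if "\<sigma> \<in> dens" for \<sigma> :: "complex^'d^'d"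
    by (rule order.trans[OF nv], rule sum_mono, rule order.trans[OF nv], rule sum_mono, rule ent[OF that])
  then show ?thesis unfolding bounded_iff by blast
qed

lemma dens_compact: "A \<subseteq> dens \<Longrightarrow> closed A \<Longrightarrow> compact (A :: (complex^'d::finite^'d) set)"
  using bounded_subset[OF dens_bounded] by (simp add: compact_eq_bounded_closed)

lemma to_mat_lincomb:
  "to_mat (a *\<^sub>R x + b *\<^sub>R y :: complex^'d::finite^'d) = complex_of_real a \<cdot>\<^sub>m to_mat x + complex_of_real b \<cdot>\<^sub>m to_mat y"
proof (rule eq_matI)
  fix i j assume "i < dim_row (complex_of_real a \<cdot>\<^sub>m to_mat x + complex_of_real b \<cdot>\<^sub>m to_mat y)"
    "j < dim_col (complex_of_real a \<cdot>\<^sub>m to_mat x + complex_of_real b \<cdot>\<^sub>m to_mat y)"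
  then have ij: "i < CARD('d)" "j < CARD('d)" by (auto simp: to_mat_def)
  then show "to_mat (a *\<^sub>R x + b *\<^sub>R y) $$ (i, j) = (complex_of_real a \<cdot>\<^sub>m to_mat x + complex_of_real b \<cdot>\<^sub>m to_mat y) $$ (i, j)"
    by (simp add: to_mat_def) (simp add: scaleR_conv_of_real)
qed (simp_all add: to_mat_def)

lemma dens_convex: "convex (dens :: (complex^'d::finite^'d) set)"
proof (rule convexI)
  fix x y :: "complex^'d^'d" and u v :: real assume xy: "x \<in> dens" "y \<in> dens" and uv: "0 \<le> u" "0 \<le> v" "u + v = 1"
  let ?c = "\<lambda>l::nat. if l = 0 then u else v" and ?P = "\<lambda>l::nat. if l = 0 then to_mat x else to_mat y"
  have "density_mat CARD('d) (to_mat (u *\<^sub>R x + v *\<^sub>R y))"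
  proof (rule density_sum[where m=2 and c="?c" and P="?P"])
    show "density_mat CARD('d) (?P l)" for l using xy dens_density by auto
    show "(\<Sum>l<2. ?c l) = 1" using uv by (simp add: numeral_2_eq_2 sum.lessThan_Suc)
    fix i j assume "i < CARD('d)" "j < CARD('d)"
    then show "to_mat (u *\<^sub>R x + v *\<^sub>R y) $$ (i, j) = (\<Sum>l<2. complex_of_real (?c l) * ?P l $$ (i, j))"
      unfolding to_mat_lincomb by (simp add: numeral_2_eq_2 sum.lessThan_Suc) (simp add: to_mat_def)
  qed (use uv in auto)
  then show "u *\<^sub>R x + v *\<^sub>R y \<in> dens" by (simp add: dens_def)
qed

lemma tensor_to_mat_carrier: "tensor_list (map to_mat (ss :: (complex^'d::finite^'d) list)) \<in> carrier_mat (CARD('d) ^ length ss) (CARD('d) ^ length ss)"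
  using tensor_list_carrier[of "map to_mat ss" "CARD('d)"] by auto

lemma tensor_to_mat_density: "set ss \<subseteq> dens \<Longrightarrow> density_mat (CARD('d) ^ length ss) (tensor_list (map to_mat (ss :: (complex^'d::finite^'d) list)))"
  using tensor_list_density[of "map to_mat ss" "CARD('d)"] dens_density by auto

lemma digs_nth: "i < d ^ n \<Longrightarrow> k < n \<Longrightarrow> digs d n i ! k < d"
  using digs_range[of i d n] nth_mem[of k "digs d n i"] by (auto simp: subset_iff)

lemma tensor_to_mat_index:
  fixes ss :: "(complex^'d::finite^'d) list"
  assumes "i < CARD('d) ^ length ss" "j < CARD('d) ^ length ss"
  shows "tensor_list (map to_mat ss) $$ (i, j) =
    (\<Prod>k<length ss. ss ! k $ idx (digs CARD('d) (length ss) i ! k) $ idx (digs CARD('d) (length ss) j ! k))"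
proof -
  have c: "\<forall>M\<in>set (map to_mat ss). M \<in> carrier_mat CARD('d) CARD('d)" by auto
  have "tensor_list (map to_mat ss) $$ (i, j) = (\<Prod>k<length ss. (map to_mat ss ! k) $$ (digs CARD('d) (length ss) i ! k, digs CARD('d) (length ss) j ! k))"
    using tensor_list_index[OF c] assms by simp
  also have "\<dots> = (\<Prod>k<length ss. ss ! k $ idx (digs CARD('d) (length ss) i ! k) $ idx (digs CARD('d) (length ss) j ! k))"
  proof (intro prod.cong refl)
    fix k assume k: "k \<in> {..<length ss}"
    have "digs CARD('d) (length ss) i ! k < CARD('d)" "digs CARD('d) (length ss) j ! k < CARD('d)"
      using digs_nth[OF assms(1)] digs_nth[OF assms(2)] k by auto
    then show "(map to_mat ss ! k) $$ (digs CARD('d) (length ss) i ! k, digs CARD('d) (length ss) j ! k)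
       = ss ! k $ idx (digs CARD('d) (length ss) i ! k) $ idx (digs CARD('d) (length ss) j ! k)"
      using k by (simp add: to_mat_index)
  qed
  finally show ?thesis .
qed

lemma av_seq_density: "A \<subseteq> dens \<Longrightarrow> M \<in> av_seq A n \<Longrightarrow> density_mat (CARD('d) ^ n) M" for A :: "(complex^'d::finite^'d) set"
  unfolding av_seq_def using tensor_to_mat_density by blast

text \<open>Caratheodory bounds the number of product states in a convex combination independently
  of the sequence index. A subsequence then converges in finitely many weights and finitely many
  tensor factors, each of which ranges over a compact set.\<close>

lemma seqcomp_mat_co_av:
  fixes A :: "(complex^'d::finite^'d) set"
  assumes A: "A \<subseteq> dens" "compact A"
  shows "seqcomp (CARD('d) ^ n) (mat_co (CARD('d) ^ n) (av_seq A n))"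
  unfolding seqcomp_def
proof (intro allI impI)
  let ?N = "CARD('d) ^ n"
  have Sc: "av_seq A n \<subseteq> carrier_mat ?N ?N" using av_seq_density[OF A(1)] density_carrier by blast
  fix f :: "nat \<Rightarrow> complex Matrix.mat" assume f: "\<forall>j. f j \<in> mat_co ?N (av_seq A n)"
  let ?K = "({..<?N} \<times> {..<?N}) \<times> (UNIV :: bool set)"
  \<comment> \<open>Real and imaginary parts of all entries are the coordinates; one more summand
    than coordinates suffices.\<close>
  define L where "L = card ?K + 1"
  define Q where "Q j w ss \<longleftrightarrow> (\<forall>l. 0 \<le> w l) \<and> (\<Sum>l<L. w l) = 1 \<and> (\<forall>l. length (ss l) = n \<and> set (ss l) \<subseteq> A) \<and>
    (\<forall>x<?N. \<forall>y<?N. f j $$ (x, y) = (\<Sum>l<L. complex_of_real (w l) * tensor_list (map to_mat (ss l)) $$ (x, y)))" for j w ss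
  have "\<exists>w ss. Q j w ss" for j
  proof -
    obtain m :: nat and c P where P: "\<forall>l<m. 0 \<le> c l \<and> P l \<in> av_seq A n" and s: "(\<Sum>l<m. c l) = 1"
      and e: "\<forall>x<?N. \<forall>y<?N. f j $$ (x, y) = (\<Sum>l<m. complex_of_real (c l) * P l $$ (x, y))"
      by (rule mat_co_E[OF Sc f[rule_format, of j]])
    define q where "q l k = (if snd k then Re (P l $$ fst k) else Im (P l $$ fst k))" for l k
    have "\<exists>z w. (\<forall>l. z l \<in> {..<m}) \<and> (\<forall>l. 0 \<le> w l) \<and> (\<Sum>l<card ?K + 1. w l) = 1 \<and>
      (\<forall>k\<in>?K. (\<Sum>l<card ?K + 1. w l * q (z l) k) = (\<Sum>i<m. c i * q i k))"
      by (rule caratheodory_padded) (use P s in auto)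
    then obtain z w where z: "\<forall>l. z l \<in> {..<m}" "\<forall>l. 0 \<le> w l" "(\<Sum>l<L. w l) = 1"
      "\<forall>k\<in>?K. (\<Sum>l<L. w l * q (z l) k) = (\<Sum>i<m. c i * q i k)"
      unfolding L_def by blast
    have "\<forall>l. \<exists>ss. length ss = n \<and> set ss \<subseteq> A \<and> P (z l) = tensor_list (map to_mat ss)"
      using P z(1) unfolding av_seq_def by blast
    then obtain ss where ss: "\<And>l. length (ss l) = n \<and> set (ss l) \<subseteq> A \<and> P (z l) = tensor_list (map to_mat (ss l))" by metis
    have "f j $$ (x, y) = (\<Sum>l<L. complex_of_real (w l) * P (z l) $$ (x, y))" if "x < ?N" "y < ?N" for x y
    proof (rule complex_eqI)
      show "Re (f j $$ (x, y)) = Re (\<Sum>l<L. complex_of_real (w l) * P (z l) $$ (x, y))"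
        using bspec[OF z(4), of "((x, y), True)"] that e by (simp add: q_def)
      show "Im (f j $$ (x, y)) = Im (\<Sum>l<L. complex_of_real (w l) * P (z l) $$ (x, y))"
        using bspec[OF z(4), of "((x, y), False)"] that e by (simp add: q_def)
    qed
    then show ?thesis unfolding Q_def using z ss by (intro exI[of _ w] exI[of _ ss]) auto
  qed
  then have "\<forall>j. \<exists>p. Q j (fst p) (snd p)" by simp
  from choice[OF this] obtain p where "\<forall>j. Q j (fst (p j)) (snd (p j))" ..
  then have Qj: "Q j (fst (p j)) (snd (p j))" for j by blast
  define w where "w j = fst (p j)" for j
  define ss where "ss j = snd (p j)" for j
  have w: "\<And>j l. 0 \<le> w j l" "\<And>j. (\<Sum>l<L. w j l) = 1" and ss: "\<And>j l. length (ss j l) = n" "\<And>j l. set (ss j l) \<subseteq> A"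
    and e: "\<And>j x y. x < ?N \<Longrightarrow> y < ?N \<Longrightarrow> f j $$ (x, y) = (\<Sum>l<L. complex_of_real (w j l) * tensor_list (map to_mat (ss j l)) $$ (x, y))"
    using Qj unfolding Q_def w_def ss_def by blast+
  have w1: "w j l \<le> 1" if "l < L" for j l using member_le_sum[of l "{..<L}" "w j"] w that by auto
  have "\<exists>\<phi> w0. strict_mono (\<phi>::nat \<Rightarrow> nat) \<and> (\<forall>l\<in>{..<L}. w0 l \<in> {0..1::real} \<and> (\<lambda>j. w (\<phi> j) l) \<longlonglongrightarrow> w0 l)"
    by (rule finite_subseq[where g="\<lambda>l j. w j l"]) (use w w1 in auto)
  then obtain \<phi> w0 where p: "strict_mono (\<phi>::nat \<Rightarrow> nat)" "\<And>l. l < L \<Longrightarrow> w0 l \<in> {0..1} \<and> (\<lambda>j. w (\<phi> j) l) \<longlonglongrightarrow> w0 l"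
    unfolding Ball_def lessThan_iff by blast
  obtain \<psi> r0 where q: "strict_mono (\<psi>::nat \<Rightarrow> nat)"
    "\<And>l k. l < L \<Longrightarrow> k < n \<Longrightarrow> r0 (l, k) \<in> A \<and> (\<lambda>j. ss (\<phi> (\<psi> j)) l ! k) \<longlonglongrightarrow> r0 (l, k)"
  proof -
    have "ss (\<phi> j) l ! k \<in> A" if "k < n" for j l k using ss(1)[of "\<phi> j" l] ss(2)[of "\<phi> j" l] that by auto
    then have "\<exists>\<psi> r0. strict_mono (\<psi>::nat \<Rightarrow> nat) \<and> (\<forall>i\<in>{..<L} \<times> {..<n}. r0 i \<in> A \<and> (\<lambda>j. ss (\<phi> (\<psi> j)) (fst i) ! snd i) \<longlonglongrightarrow> r0 i)"
      by (intro finite_subseq[OF _ A(2), of "{..<L} \<times> {..<n}" "\<lambda>i j. ss (\<phi> j) (fst i) ! snd i"]) auto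
    then show ?thesis using that by force
  qed
  define R where "R l = map (\<lambda>k. r0 (l, k)) [0..<n]" for l
  have R: "length (R l) = n" "l < L \<Longrightarrow> set (R l) \<subseteq> A" for l using q(2) by (auto simp: R_def)
  define M where "M = Matrix.mat ?N ?N (\<lambda>(x, y). \<Sum>l<L. complex_of_real (w0 l) * tensor_list (map to_mat (R l)) $$ (x, y))"
  have wlim: "(\<lambda>j. w (\<phi> (\<psi> j)) l) \<longlonglongrightarrow> w0 l" if "l < L" for l
    using LIMSEQ_subseq_LIMSEQ[OF _ q(1)] p(2)[OF that] by (fastforce simp: o_def)
  have "(\<lambda>j. f (\<phi> (\<psi> j)) $$ (x, y)) \<longlonglongrightarrow> M $$ (x, y)" if xy: "x < ?N" "y < ?N" for x y
  proof -
    have "(\<lambda>j. tensor_list (map to_mat (ss (\<phi> (\<psi> j)) l)) $$ (x, y)) \<longlonglongrightarrow> tensor_list (map to_mat (R l)) $$ (x, y)" if l: "l < L" for l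
    proof -
      have "tensor_list (map to_mat (ss (\<phi> (\<psi> j)) l)) $$ (x, y)
        = (\<Prod>k<n. ss (\<phi> (\<psi> j)) l ! k $ idx (digs CARD('d) n x ! k) $ idx (digs CARD('d) n y ! k))" for j
        using tensor_to_mat_index[of x "ss (\<phi> (\<psi> j)) l" y] ss(1) xy by simp
      moreover have "tensor_list (map to_mat (R l)) $$ (x, y) = (\<Prod>k<n. r0 (l, k) $ idx (digs CARD('d) n x ! k) $ idx (digs CARD('d) n y ! k))"
        using tensor_to_mat_index[of x "R l" y] R(1) xy by (simp add: R_def)
      moreover have "(\<lambda>j. \<Prod>k<n. ss (\<phi> (\<psi> j)) l ! k $ idx (digs CARD('d) n x ! k) $ idx (digs CARD('d) n y ! k))
          \<longlonglongrightarrow> (\<Prod>k<n. r0 (l, k) $ idx (digs CARD('d) n x ! k) $ idx (digs CARD('d) n y ! k))"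
        using q(2)[OF l] by (intro tendsto_prod tendsto_vec_nth) auto
      ultimately show ?thesis by simp
    qed
    then show ?thesis unfolding e[OF xy] using xy wlim by (auto simp: M_def intro!: tendsto_sum tendsto_mult tendsto_of_real)
  qed
  moreover have "M \<in> mat_co ?N (av_seq A n)"
  proof (rule mat_co_I[OF Sc, where m=L and c=w0 and P="\<lambda>l. tensor_list (map to_mat (R l))"])
    show "M \<in> carrier_mat ?N ?N" by (simp add: M_def)
    show "0 \<le> w0 l" if "l < L" for l using p(2)[OF that] by auto
    show "tensor_list (map to_mat (R l)) \<in> av_seq A n" if "l < L" for l unfolding av_seq_def using R that by blast
    have "(\<lambda>j. \<Sum>l<L. w (\<phi> (\<psi> j)) l) \<longlonglongrightarrow> (\<Sum>l<L. w0 l)" by (intro tendsto_sum) (auto intro: wlim)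
    then show "(\<Sum>l<L. w0 l) = 1" unfolding w(2) using LIMSEQ_unique tendsto_const by blast
    show "M $$ (x, y) = (\<Sum>l<L. complex_of_real (w0 l) * tensor_list (map to_mat (R l)) $$ (x, y))" if "x < ?N" "y < ?N" for x y
      using that by (simp add: M_def)
  qed
  ultimately show "\<exists>\<rho>\<in>mat_co ?N (av_seq A n). \<exists>\<phi>. strict_mono (\<phi>::nat \<Rightarrow> nat) \<and> (\<forall>x<?N. \<forall>y<?N. (\<lambda>j. f (\<phi> j) $$ (x, y)) \<longlonglongrightarrow> \<rho> $$ (x, y))"
    using strict_mono_o[OF p(1) q(1)] by (intro bexI[of _ M] exI[of _ "\<phi> \<circ> \<psi>"]) auto
qed

section \<open>Universal mixtures of i.i.d. states\<close>

lemma tpow_to_mat: "tpow n (to_mat \<sigma>) = tensor_list (map to_mat (replicate n \<sigma>))"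
  by (simp add: tpow_def)

lemma tpow_carrier [simp]: "tpow n (to_mat (\<sigma> :: complex^'d::finite^'d)) \<in> carrier_mat (CARD('d) ^ n) (CARD('d) ^ n)"
  using tensor_to_mat_carrier[of "replicate n \<sigma>"] by (simp add: tpow_to_mat)

lemma tpow_density: "\<sigma> \<in> dens \<Longrightarrow> density_mat (CARD('d) ^ n) (tpow n (to_mat (\<sigma> :: complex^'d::finite^'d)))"
  using tensor_to_mat_density[of "replicate n \<sigma>"] by (simp add: tpow_to_mat set_replicate_conv_if)

lemma tpow_index:
  assumes "i < CARD('d) ^ n" "j < CARD('d) ^ n"
  shows "tpow n (to_mat (\<sigma> :: complex^'d::finite^'d)) $$ (i, j) = (\<Prod>k<n. \<sigma> $ idx (digs CARD('d) n i ! k) $ idx (digs CARD('d) n j ! k))"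
  using tensor_to_mat_index[of i "replicate n \<sigma>" j] assms by (simp add: tpow_to_mat)

lemma tpow_entry_continuous:
  assumes "i < CARD('d) ^ n" "j < CARD('d) ^ n"
  shows "continuous_on UNIV (\<lambda>\<sigma> :: complex^'d::finite^'d. tpow n (to_mat \<sigma>) $$ (i, j))"
  unfolding tpow_index[OF assms] by (intro continuous_intros)

lemma tpow_trace_continuous:
  assumes "Z \<in> carrier_mat (CARD('d) ^ n) (CARD('d) ^ n)"
  shows "continuous_on UNIV (\<lambda>\<sigma> :: complex^'d::finite^'d. Re (mtrace (tpow n (to_mat \<sigma>) * Z)))"
  unfolding mtrace_mult[OF tpow_carrier assms]
  by (intro continuous_on_Re continuous_on_sum continuous_on_mult continuous_on_const tpow_entry_continuous) auto

lemma prob_onD: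
  fixes f :: "complex^'d::finite^'d \<Rightarrow> 'b::topological_space"
  assumes "\<mu> \<in> prob_on C"
  shows "prob_space \<mu>" "space \<mu> = C" "continuous_on UNIV f \<Longrightarrow> f \<in> borel_measurable \<mu>"
proof -
  have s: "sets \<mu> = sets (restrict_space borel C)" using assms by (simp add: prob_on_def)
  show "prob_space \<mu>" using assms by (simp add: prob_on_def)
  show "space \<mu> = C" using sets_eq_imp_space_eq[OF s] by (simp add: space_restrict_space)
  assume "continuous_on UNIV f"
  then have "f \<in> borel_measurable borel" by (rule borel_measurable_continuous_onI)
  then have "f \<in> borel_measurable (restrict_space borel C)" by (rule measurable_restrict_space1)
  then show "f \<in> borel_measurable \<mu>" using measurable_cong_sets[OF s refl] by blast
qed

context
  fixes \<mu> :: "(complex^'d::finite^'d) measure" and C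
  assumes mu: "\<mu> \<in> prob_on C" and C: "C \<subseteq> dens"
begin

lemma entry_integrable:
  assumes "i < CARD('d) ^ n" "j < CARD('d) ^ n"
  shows "integrable \<mu> (\<lambda>\<sigma>. tpow n (to_mat \<sigma>) $$ (i, j))"
proof -
  interpret prob_space \<mu> using prob_onD(1)[OF mu] .
  have "AE \<sigma> in \<mu>. norm (tpow n (to_mat \<sigma>) $$ (i, j)) \<le> 1"
    using prob_onD(2)[OF mu] C assms by (intro AE_I2) (auto intro!: density_entry_le tpow_density)
  then show ?thesis by (rule integrable_const_bound) (rule prob_onD(3)[OF mu tpow_entry_continuous[OF assms]])
qed

lemma mixture_index:
  "i < CARD('d) ^ n \<Longrightarrow> j < CARD('d) ^ n \<Longrightarrow> mixture n \<mu> $$ (i, j) = (\<integral>\<sigma>. tpow n (to_mat \<sigma>) $$ (i, j) \<partial>\<mu>)"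
  by (simp add: mixture_def)

lemma mixture_carrier: "mixture n \<mu> \<in> carrier_mat (CARD('d) ^ n) (CARD('d) ^ n)"
  by (simp add: mixture_def)

text \<open>All linear functionals of the mixture pass through the integral; traces and quadratic
  forms are special cases.\<close>

lemma mixture_lin:
  "(\<Sum>i<CARD('d) ^ n. \<Sum>j<CARD('d) ^ n. mixture n \<mu> $$ (i, j) * w i j)
    = (\<integral>\<sigma>. (\<Sum>i<CARD('d) ^ n. \<Sum>j<CARD('d) ^ n. tpow n (to_mat \<sigma>) $$ (i, j) * w i j) \<partial>\<mu>)"
  "integrable \<mu> (\<lambda>\<sigma>. \<Sum>i<CARD('d) ^ n. \<Sum>j<CARD('d) ^ n. tpow n (to_mat \<sigma>) $$ (i, j) * w i j)"
proof -
  have int: "integrable \<mu> (\<lambda>\<sigma>. tpow n (to_mat \<sigma>) $$ (i, j) * w i j)" if "i \<in> {..<CARD('d) ^ n}" "j \<in> {..<CARD('d) ^ n}" for i j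
    using entry_integrable that by (intro integrable_mult_left) auto
  show "integrable \<mu> (\<lambda>\<sigma>. \<Sum>i<CARD('d) ^ n. \<Sum>j<CARD('d) ^ n. tpow n (to_mat \<sigma>) $$ (i, j) * w i j)"
    using int by (intro Bochner_Integration.integrable_sum) auto
  have "(\<integral>\<sigma>. (\<Sum>i<CARD('d) ^ n. \<Sum>j<CARD('d) ^ n. tpow n (to_mat \<sigma>) $$ (i, j) * w i j) \<partial>\<mu>)
     = (\<Sum>i<CARD('d) ^ n. \<Sum>j<CARD('d) ^ n. (\<integral>\<sigma>. tpow n (to_mat \<sigma>) $$ (i, j) * w i j \<partial>\<mu>))"
    using int by (subst Bochner_Integration.integral_sum, force)
      (intro sum.cong refl, subst Bochner_Integration.integral_sum, auto)
  also have "\<dots> = (\<Sum>i<CARD('d) ^ n. \<Sum>j<CARD('d) ^ n. mixture n \<mu> $$ (i, j) * w i j)"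
    by (intro sum.cong refl) (simp add: mixture_index)
  finally show "(\<Sum>i<CARD('d) ^ n. \<Sum>j<CARD('d) ^ n. mixture n \<mu> $$ (i, j) * w i j)
    = (\<integral>\<sigma>. (\<Sum>i<CARD('d) ^ n. \<Sum>j<CARD('d) ^ n. tpow n (to_mat \<sigma>) $$ (i, j) * w i j) \<partial>\<mu>)" by simp
qed

lemma mixture_trace:
  assumes Z: "Z \<in> carrier_mat (CARD('d) ^ n) (CARD('d) ^ n)"
  shows "Re (mtrace (mixture n \<mu> * Z)) = (\<integral>\<sigma>. Re (mtrace (tpow n (to_mat \<sigma>) * Z)) \<partial>\<mu>)"
    "integrable \<mu> (\<lambda>\<sigma>. Re (mtrace (tpow n (to_mat \<sigma>) * Z)))"
proof -
  note l = mixture_lin[of n "\<lambda>i j. Z $$ (j, i)"]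
  show "Re (mtrace (mixture n \<mu> * Z)) = (\<integral>\<sigma>. Re (mtrace (tpow n (to_mat \<sigma>) * Z)) \<partial>\<mu>)"
    unfolding mtrace_mult[OF mixture_carrier Z] mtrace_mult[OF tpow_carrier Z] l(1)
    by (rule integral_bounded_linear[OF bounded_linear_Re l(2), symmetric])
  show "integrable \<mu> (\<lambda>\<sigma>. Re (mtrace (tpow n (to_mat \<sigma>) * Z)))"
    unfolding mtrace_mult[OF tpow_carrier Z] by (rule integrable_bounded_linear[OF bounded_linear_Re l(2)])
qed

lemma mixture_qfc: "Re (qfc (CARD('d) ^ n) (mixture n \<mu>) v) = (\<integral>\<sigma>. Re (qfc (CARD('d) ^ n) (tpow n (to_mat \<sigma>)) v) \<partial>\<mu>)"
proof -
  have q: "qfc (CARD('d) ^ n) M v = (\<Sum>i<CARD('d) ^ n. \<Sum>j<CARD('d) ^ n. M $$ (i, j) * (cnj (v i) * v j))" for M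
    by (simp add: qfc_def mult_ac)
  show ?thesis unfolding q mixture_lin(1)
    by (rule integral_bounded_linear[OF bounded_linear_Re mixture_lin(2), symmetric])
qed

lemma mixture_density: "density_mat (CARD('d) ^ n) (mixture n \<mu>)"
proof -
  interpret prob_space \<mu> using prob_onD(1)[OF mu] .
  let ?N = "CARD('d) ^ n"
  have d: "density_mat ?N (tpow n (to_mat \<sigma>))" if "\<sigma> \<in> space \<mu>" for \<sigma>
    using that prob_onD(2)[OF mu] C by (intro tpow_density) auto
  have "hermitian_mat ?N (mixture n \<mu>)"
    unfolding hermitian_iff
  proof (intro conjI allI impI mixture_carrier)
    fix i j assume ij: "i < ?N" "j < ?N"
    have "mixture n \<mu> $$ (i, j) = (\<integral>\<sigma>. cnj (tpow n (to_mat \<sigma>) $$ (j, i)) \<partial>\<mu>)"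
      unfolding mixture_index[OF ij] using d ij
      by (intro Bochner_Integration.integral_cong refl hermitian_index[of ?N]) (auto simp: density_mat_def psd_mat_def)
    also have "\<dots> = cnj (mixture n \<mu> $$ (j, i))" unfolding mixture_index[OF ij(2,1)]
      by (rule integral_bounded_linear[OF bounded_linear_cnj entry_integrable[OF ij(2,1)]])
    finally show "mixture n \<mu> $$ (i, j) = cnj (mixture n \<mu> $$ (j, i))" .
  qed
  moreover have "0 \<le> Re (qfc ?N (mixture n \<mu>) v)" for v
    unfolding mixture_qfc using d by (intro Bochner_Integration.integral_nonneg) (auto simp: density_mat_def psd_iff)
  moreover have "mtrace (mixture n \<mu>) = 1"
  proof -
    have "mtrace (mixture n \<mu>) = (\<Sum>i<?N. \<integral>\<sigma>. tpow n (to_mat \<sigma>) $$ (i, i) \<partial>\<mu>)"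
      using mixture_carrier[of n] by (simp add: mtrace_def mixture_index)
    also have "\<dots> = (\<integral>\<sigma>. (\<Sum>i<?N. tpow n (to_mat \<sigma>) $$ (i, i)) \<partial>\<mu>)"
      by (intro Bochner_Integration.integral_sum[symmetric] entry_integrable) auto
    also have "\<dots> = (\<integral>\<sigma>. 1 \<partial>\<mu>)"
    proof (intro Bochner_Integration.integral_cong refl)
      fix \<sigma> assume "\<sigma> \<in> space \<mu>"
      then have "mtrace (tpow n (to_mat \<sigma>)) = 1" using d by (simp add: density_mat_def)
      moreover have "dim_row (tpow n (to_mat \<sigma>)) = ?N" using tpow_carrier[of n \<sigma>] by (rule carrier_matD(1))
      ultimately show "(\<Sum>i<?N. tpow n (to_mat \<sigma>) $$ (i, i)) = 1" by (simp add: mtrace_def)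
    qed
    finally show ?thesis using prob_space by simp
  qed
  ultimately show ?thesis by (simp add: density_mat_def psd_iff)
qed

text \<open>Inherited from the i.i.d. states. It bounds the number of distinct eigenvalues
  polynomially, and with it the cost of pinching along the mixture.\<close>

lemma mixture_perm_inv: "perm_inv CARD('d) n (mixture n \<mu>)"
proof -
  have "mixture n \<mu> $$ (pidx CARD('d) n p i, pidx CARD('d) n p j) = mixture n \<mu> $$ (i, j)"
    if p: "p permutes {..<n}" and ij: "i < CARD('d) ^ n" "j < CARD('d) ^ n" for p i j
  proof -
    have "tpow n (to_mat \<sigma>) $$ (pidx CARD('d) n p i, pidx CARD('d) n p j) = tpow n (to_mat \<sigma>) $$ (i, j)" for \<sigma> :: "complex^'d^'d"
      using perm_inv_tpow[OF to_mat_carrier, of n \<sigma>] p ij unfolding perm_inv_def by blast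
    then show ?thesis using pidx(1)[OF p ij(1)] pidx(1)[OF p ij(2)] ij by (simp add: mixture_index)
  qed
  then show ?thesis by (simp add: perm_inv_def mixture_carrier)
qed

end

section \<open>Construction of the universal measure\<close>

lemma poly_decay_pmf:
  obtains q :: "nat pmf" where "\<And>n. pmf q n = 1 / ((real n + 1) * (real n + 2))"
proof -
  let ?f = "\<lambda>n::nat. 1 / ((real n + 1) * (real n + 2))"
  have "(\<lambda>n. 1 / (real n + 1)) \<longlonglongrightarrow> 0" by real_asymp
  from telescope_sums'[OF this] have "(\<lambda>n. 1 / (real n + 1) - 1 / (real (Suc n) + 1)) sums 1" by simp
  moreover have "1 / (real n + 1) - 1 / (real (Suc n) + 1) = ?f n" for n by (simp add: field_simps)
  ultimately have "?f sums 1" by simp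
  then have "(\<Sum>n. ennreal (?f n)) = ennreal 1" by (intro suminf_ennreal_eq) auto
  then have "(\<integral>\<^sup>+ n. ennreal (?f n) \<partial>count_space UNIV) = 1" by (simp add: nn_integral_count_space_nat)
  then have "pmf (embed_pmf ?f) n = ?f n" for n by (intro pmf_embed_pmf) auto
  then show ?thesis using that by blast
qed

text \<open>Bounds both the number of real coordinates of an invariant matrix, hence the size of a
  spanner, and the number of distinct eigenvalues of such a matrix.\<close>

definition spanner_dim :: "nat \<Rightarrow> nat \<Rightarrow> nat" where
  "spanner_dim d n = 2 * (n + 1) ^ (d * d)"

text \<open>The factors are the coefficient bound 2 times the size of the spanner, the inverse
  weight of level n, and the inverse weight of the last slot used on that level. The weights 1 / ((n
  + 1) (n + 2)) sum to 1 and decay only polynomially, so the logarithm of this constant is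
  sublinear.\<close>

definition univ_const :: "nat \<Rightarrow> nat \<Rightarrow> real" where
  "univ_const d n = 2 * real (spanner_dim d n) * ((real n + 1) * (real n + 2)) * ((real (spanner_dim d n) + 1) * (real (spanner_dim d n) + 2))"

text \<open>The spanner is taken in the real coordinates given by representative entries.
  Coefficients may be negative, but traces against positive matrices are non-negative, so every
  coefficient may be raised to 2.\<close>

lemma iid_spanner:
  fixes B :: "(complex^'d::finite^'d) set"
  assumes B: "B \<subseteq> dens"
  shows "\<exists>xs. set xs \<subseteq> B \<and> length xs \<le> spanner_dim CARD('d) n \<and>
    (\<forall>\<sigma>\<in>B. \<forall>Z. psd_mat (CARD('d) ^ n) Z \<longrightarrow>
       Re (mtrace (tpow n (to_mat \<sigma>) * Z)) \<le> (\<Sum>l<length xs. 2 * Re (mtrace (tpow n (to_mat (xs ! l)) * Z))))"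
proof -
  let ?N = "CARD('d) ^ n"
  obtain R where R: "R \<subseteq> {..<?N} \<times> {..<?N}" "card R \<le> (n + 1) ^ (CARD('d) * CARD('d))"
    "\<And>i j. i < ?N \<Longrightarrow> j < ?N \<Longrightarrow> \<exists>(i', j')\<in>R. \<forall>M. perm_inv CARD('d) n M \<longrightarrow> M $$ (i, j) = M $$ (i', j')"
    using perm_inv_representatives by blast
  have fR: "finite R" using R(1) finite_subset by blast
  let ?K = "R \<times> (UNIV :: bool set)"
  define f where "f \<sigma> k = (if snd k then Re (tpow n (to_mat \<sigma>) $$ fst k) else Im (tpow n (to_mat \<sigma>) $$ fst k))"
    for \<sigma> :: "complex^'d^'d" and k
  have bnd: "\<bar>f \<sigma> k\<bar> \<le> 1" if sB: "\<sigma> \<in> B" and kK: "k \<in> ?K" for \<sigma> k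
  proof -
    obtain i j where ij: "fst k = (i, j)" "i < ?N" "j < ?N" using kK R(1) by (cases k) auto
    have "\<sigma> \<in> dens" using sB B by blast
    from density_entry_le[OF tpow_density[OF this, of n] ij(2,3)] have "cmod (tpow n (to_mat \<sigma>) $$ (i, j)) \<le> 1" .
    then show ?thesis using abs_Re_le_cmod[of "tpow n (to_mat \<sigma>) $$ (i, j)"] abs_Im_le_cmod[of "tpow n (to_mat \<sigma>) $$ (i, j)"]
      unfolding f_def ij(1) by (cases "snd k") auto
  qed
  obtain xs where xs: "set xs \<subseteq> B" "length xs \<le> card ?K"
    and sp: "\<And>\<sigma>. \<sigma> \<in> B \<Longrightarrow> \<exists>c. (\<forall>i<length xs. \<bar>c i\<bar> \<le> 2) \<and> (\<forall>k\<in>?K. f \<sigma> k = (\<Sum>i<length xs. c i * f (xs ! i) k))"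
    using barycentric_spanner[of ?K B f 1] bnd fR by auto
  have "length xs \<le> spanner_dim CARD('d) n" using xs(2) R(2) by (simp add: spanner_dim_def card_cartesian_product)
  moreover have "Re (mtrace (tpow n (to_mat \<sigma>) * Z)) \<le> (\<Sum>l<length xs. 2 * Re (mtrace (tpow n (to_mat (xs ! l)) * Z)))"
    if s: "\<sigma> \<in> B" and Z: "psd_mat ?N Z" for \<sigma> Z
  proof -
    obtain c where c: "\<forall>i<length xs. \<bar>c i\<bar> \<le> 2" "\<forall>k\<in>?K. f \<sigma> k = (\<Sum>i<length xs. c i * f (xs ! i) k)" using sp[OF s] by blast
    have e: "tpow n (to_mat \<sigma>) $$ (i, j) = (\<Sum>l<length xs. complex_of_real (c l) * tpow n (to_mat (xs ! l)) $$ (i, j))"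
      if ij: "i < ?N" "j < ?N" for i j
    proof -
      obtain i' j' where r: "(i', j') \<in> R" "\<And>M. perm_inv CARD('d) n M \<Longrightarrow> M $$ (i, j) = M $$ (i', j')" using R(3)[OF ij] by blast
      have r': "tpow n (to_mat \<tau>) $$ (i, j) = tpow n (to_mat \<tau>) $$ (i', j')" for \<tau> :: "complex^'d^'d"
        by (intro r(2) perm_inv_tpow) simp
      show ?thesis unfolding r'
      proof (rule complex_eqI)
        show "Re (tpow n (to_mat \<sigma>) $$ (i', j')) = Re (\<Sum>l<length xs. complex_of_real (c l) * tpow n (to_mat (xs ! l)) $$ (i', j'))"
          using bspec[OF c(2), of "((i', j'), True)"] r(1) by (simp add: f_def)
        show "Im (tpow n (to_mat \<sigma>) $$ (i', j')) = Im (\<Sum>l<length xs. complex_of_real (c l) * tpow n (to_mat (xs ! l)) $$ (i', j'))"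
          using bspec[OF c(2), of "((i', j'), False)"] r(1) by (simp add: f_def)
      qed
    qed
    have "Re (mtrace (tpow n (to_mat \<sigma>) * Z)) = (\<Sum>l<length xs. c l * Re (mtrace (tpow n (to_mat (xs ! l)) * Z)))"
      by (rule mtrace_sum_left[OF tpow_carrier tpow_carrier psd_carrier[OF Z]]) (rule e)
    also have "\<dots> \<le> (\<Sum>l<length xs. 2 * Re (mtrace (tpow n (to_mat (xs ! l)) * Z)))"
    proof (intro sum_mono mult_right_mono)
      fix l assume l: "l \<in> {..<length xs}"
      then show "c l \<le> 2" using c(1) by (auto simp: abs_le_iff)
      have "xs ! l \<in> dens" using l xs(1) B nth_mem[of l xs] by blast
      then show "0 \<le> Re (mtrace (tpow n (to_mat (xs ! l)) * Z))"
        using tpow_density Z by (intro psd_trace_nonneg[of ?N]) (auto simp: density_mat_def)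
    qed
    finally show ?thesis .
  qed
  ultimately show ?thesis using xs(1) by blast
qed

text \<open>One measure serves all n: it places weight on slot i of the spanner of level n according
  to a product of two polynomially decaying laws. Each level only needs its own atoms, since the
  remaining part of the mixture contributes non-negatively.\<close>

theorem universal_measure:
  fixes B :: "(complex^'d::finite^'d) set"
  assumes B: "B \<subseteq> dens" "B \<noteq> {}"
  shows "\<exists>\<mu>\<in>prob_on B. \<forall>n. \<forall>\<sigma>\<in>B. \<forall>Z. psd_mat (CARD('d) ^ n) Z \<longrightarrow>
    Re (mtrace (tpow n (to_mat \<sigma>) * Z)) \<le> univ_const CARD('d) n * Re (mtrace (mixture n \<mu> * Z))"
proof -
  obtain q :: "nat pmf" where q: "\<And>n. pmf q n = 1 / ((real n + 1) * (real n + 2))" using poly_decay_pmf by metis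
  obtain b0 where b0: "b0 \<in> B" using B by blast
  define good where "good n xs \<longleftrightarrow> set xs \<subseteq> B \<and> length xs \<le> spanner_dim CARD('d) n \<and>
    (\<forall>\<sigma>\<in>B. \<forall>Z. psd_mat (CARD('d) ^ n) Z \<longrightarrow>
       Re (mtrace (tpow n (to_mat \<sigma>) * Z)) \<le> (\<Sum>l<length xs. 2 * Re (mtrace (tpow n (to_mat (xs ! l)) * Z))))" for n xs
  have "\<forall>n. \<exists>xs. good n xs" unfolding good_def using iid_spanner[OF B(1)] by blast
  then obtain X where X: "\<And>n. good n (X n)" using choice[of good] by blast
  \<comment> \<open>Slots beyond the end of a spanner get the default \<open>b0\<close>, which keeps
    the total mass 1.\<close>
  define g where "g = (\<lambda>(n, i). if i < length (X n) then X n ! i else b0)"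
  have gB: "g p \<in> B" for p using X[of "fst p"] b0 by (auto simp: g_def good_def split: prod.splits)
  define P where "P = pair_pmf q q"
  define \<mu> where "\<mu> = distr (measure_pmf P) (restrict_space borel B) g"
  have gm: "g \<in> measurable (measure_pmf P) (restrict_space borel B)" using gB by (auto simp: space_restrict_space)
  have mu: "\<mu> \<in> prob_on B"
    unfolding prob_on_def \<mu>_def using gm by (auto intro!: measure_pmf.prob_space_distr)
  have "Re (mtrace (tpow n (to_mat \<sigma>) * Z)) \<le> univ_const CARD('d) n * Re (mtrace (mixture n \<mu> * Z))"
    if s: "\<sigma> \<in> B" and Z: "psd_mat (CARD('d) ^ n) Z" for n \<sigma> Z
  proof -
    let ?h = "\<lambda>\<sigma>. Re (mtrace (tpow n (to_mat \<sigma>) * Z))"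
    have Zc: "Z \<in> carrier_mat (CARD('d) ^ n) (CARD('d) ^ n)" using Z by (rule psd_carrier)
    have h0: "0 \<le> ?h \<tau>" if "\<tau> \<in> B" for \<tau>
    proof -
      have "psd_mat (CARD('d) ^ n) (tpow n (to_mat \<tau>))" using that B tpow_density[of \<tau> n] by (auto simp: density_mat_def)
      then show ?thesis using Z by (rule psd_trace_nonneg)
    qed
    define H where "H = Re (mtrace (mixture n \<mu> * Z))"
    have hm: "?h \<in> borel_measurable (restrict_space borel B)"
      by (intro measurable_restrict_space1 borel_measurable_continuous_onI tpow_trace_continuous[OF Zc])
    have Hint: "H = (\<integral>p. ?h (g p) \<partial>measure_pmf P)"
      unfolding H_def mixture_trace(1)[OF mu B(1) Zc] unfolding \<mu>_def by (rule integral_distr[OF gm hm])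
    have int: "integrable (measure_pmf P) (\<lambda>p. ?h (g p))"
      using mixture_trace(2)[OF mu B(1) Zc] unfolding \<mu>_def using integrable_distr_eq[OF gm hm] by blast
    have H0: "0 \<le> H" unfolding Hint using h0 gB by (intro Bochner_Integration.integral_nonneg) auto
    \<comment> \<open>All integrands are non-negative, so the integral dominates the contribution of
      any single atom.\<close>
    have atom: "pmf P p * ?h (g p) \<le> H" for p
    proof -
      have "pmf P p * ?h (g p) = (\<integral>x. ?h (g p) * indicator {p} x \<partial>measure_pmf P)"
        by (simp add: measure_pmf_single mult.commute)
      also have "\<dots> \<le> (\<integral>x. ?h (g x) \<partial>measure_pmf P)"
      proof (rule integral_mono[OF _ int])
        show "integrable (measure_pmf P) (\<lambda>x. ?h (g p) * indicator {p} x)"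
          by (rule measure_pmf.integrable_const_bound[where B="\<bar>?h (g p)\<bar>"]) (auto simp: indicator_def)
        show "?h (g p) * indicator {p} x \<le> ?h (g x)" for x using h0[OF gB[of x]] by (auto simp: indicator_def)
      qed
      finally show ?thesis using Hint by simp
    qed
    let ?S = "real (spanner_dim CARD('d) n)"
    have each: "?h (X n ! l) \<le> (real n + 1) * (real n + 2) * ((?S + 1) * (?S + 2)) * H" if l: "l < length (X n)" for l
    proof -
      have lS: "real l \<le> ?S" using X[of n] l by (simp add: good_def)
      have "pmf P (n, l) * ?h (X n ! l) \<le> H" using atom[of "(n, l)"] l by (simp add: g_def)
      then have "?h (X n ! l) \<le> (real n + 1) * (real n + 2) * ((real l + 1) * (real l + 2)) * H"
      proof -
        define a where "a = (real n + 1) * (real n + 2)"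
        define b where "b = (real l + 1) * (real l + 2)"
        have ab: "0 < a" "0 < b" by (auto simp: a_def b_def)
        have "1 / a * (1 / b) * ?h (X n ! l) \<le> H"
          using \<open>pmf P (n, l) * ?h (X n ! l) \<le> H\<close> unfolding P_def pmf_pair q a_def b_def .
        then have "?h (X n ! l) \<le> a * b * H" using ab by (simp add: divide_le_eq mult_ac)
        then show ?thesis by (simp only: a_def b_def)
      qed
      also have "\<dots> \<le> (real n + 1) * (real n + 2) * ((?S + 1) * (?S + 2)) * H"
        using lS H0 by (intro mult_right_mono mult_left_mono mult_mono) auto
      finally show ?thesis .
    qed
    have "?h \<sigma> \<le> (\<Sum>l<length (X n). 2 * ?h (X n ! l))" using X[of n] s Z by (simp add: good_def)
    also have "\<dots> \<le> (\<Sum>l<length (X n). 2 * ((real n + 1) * (real n + 2) * ((?S + 1) * (?S + 2)) * H))"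
      using each by (intro sum_mono mult_left_mono) auto
    also have "\<dots> = real (length (X n)) * (2 * ((real n + 1) * (real n + 2) * ((?S + 1) * (?S + 2)) * H))" by simp
    also have "\<dots> \<le> ?S * (2 * ((real n + 1) * (real n + 2) * ((?S + 1) * (?S + 2)) * H))"
      using X[of n] H0 by (intro mult_right_mono) (auto simp: good_def)
    also have "\<dots> = univ_const CARD('d) n * H" by (simp add: univ_const_def)
    finally show ?thesis by (simp add: H_def)
  qed
  then show ?thesis using mu by blast
qed

lemma univ_const_pos: "0 < univ_const d n"
  unfolding univ_const_def spanner_dim_def by (intro mult_pos_pos add_nonneg_pos) auto

text \<open>With S for \<open>spanner_dim\<close>, the product of the two constants is at most 12
  S^4 (n + 2)^2, and S is at most 2 (n + 2)^m. This gives 192 (n + 2)^(4 m + 2), whose logarithm is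
  o(n).\<close>

lemma univ_loss_subexponential:
  "(\<lambda>n. (ln (univ_const d n) + ln (real (spanner_dim d n))) / real n) \<longlonglongrightarrow> 0"
proof -
  define m where "m = d * d"
  have l0: "(\<lambda>n::nat. ln (real n + 2) / real n) \<longlonglongrightarrow> 0" by real_asymp
  have l1: "(\<lambda>n::nat. ln 192 / real n) \<longlonglongrightarrow> 0" by real_asymp
  have lim: "(\<lambda>n::nat. ln 192 / real n + real (4 * m + 2) * (ln (real n + 2) / real n)) \<longlonglongrightarrow> 0"
    using tendsto_add[OF l1 tendsto_mult[OF tendsto_const[of "real (4 * m + 2)"] l0]] by simp
  show ?thesis
  proof (rule tendsto_sandwich[OF _ _ tendsto_const lim])
    have S1: "1 \<le> real (spanner_dim d n)" for n
    proof -
      have "(1::nat) \<le> 2 * (n + 1) ^ (d * d)" by (simp add: Suc_le_eq)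
      then show ?thesis unfolding spanner_dim_def by (metis of_nat_1 of_nat_le_iff)
    qed
    let ?S = "\<lambda>n. real (spanner_dim d n)"
    have up: "univ_const d n * ?S n \<le> 192 * (real n + 2) ^ (4 * m + 2)" and lo: "1 \<le> univ_const d n" for n
    proof -
      have s: "?S n \<le> 2 * (real n + 2) ^ m"
        unfolding spanner_dim_def m_def by (simp add: power_mono)
      have "univ_const d n * ?S n = (2 * ?S n) * ((real n + 1) * (real n + 2)) * ((?S n + 1) * (?S n + 2)) * ?S n"
        by (simp add: univ_const_def)
      also have "\<dots> \<le> (2 * ?S n) * ((real n + 2) * (real n + 2)) * ((2 * ?S n) * (3 * ?S n)) * ?S n"
        using S1[of n] by (intro mult_mono mult_nonneg_nonneg) auto
      also have "\<dots> = 12 * ?S n ^ 4 * (real n + 2) ^ 2" by (simp add: power2_eq_square power4_eq_xxxx)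
      also have "\<dots> \<le> 12 * (2 * (real n + 2) ^ m) ^ 4 * (real n + 2) ^ 2"
        using s S1[of n] by (intro mult_mono power_mono) auto
      also have "\<dots> = 192 * (real n + 2) ^ (4 * m + 2)"
        by (simp add: power_mult_distrib power_mult[symmetric] power_add mult.commute[of m] power2_eq_square)
      finally show "univ_const d n * ?S n \<le> 192 * (real n + 2) ^ (4 * m + 2)" .
      have "1 * 1 * (1 * 1) * (1 * 1) \<le> 2 * ?S n * ((real n + 1) * (real n + 2)) * ((?S n + 1) * (?S n + 2))"
        using S1[of n] by (intro mult_mono mult_nonneg_nonneg) auto
      then show "1 \<le> univ_const d n" by (simp add: univ_const_def)
    qed
    have "0 \<le> (ln (univ_const d n) + ln (?S n)) / real n" for n
      using lo[of n] S1[of n] by (intro divide_nonneg_nonneg add_nonneg_nonneg) auto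
    then show "eventually (\<lambda>n. 0 \<le> (ln (univ_const d n) + ln (?S n)) / real n) sequentially" by simp
    have "(ln (univ_const d n) + ln (?S n)) / real n \<le> ln 192 / real n + real (4 * m + 2) * (ln (real n + 2) / real n)" for n
    proof -
      have "ln (univ_const d n) + ln (?S n) = ln (univ_const d n * ?S n)"
        using univ_const_pos[of d n] S1[of n] by (subst ln_mult) auto
      also have "\<dots> \<le> ln (192 * (real n + 2) ^ (4 * m + 2))"
        using up[of n] univ_const_pos[of d n] S1[of n] by (subst ln_le_cancel_iff) (auto intro!: mult_pos_pos)
      also have "\<dots> = ln 192 + real (4 * m + 2) * ln (real n + 2)"
      proof -
        have "ln ((real n + 2) ^ (4 * m + 2)) = real (4 * m + 2) * ln (real n + 2)" by (rule ln_realpow)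
        moreover have "ln (192 * (real n + 2) ^ (4 * m + 2)) = ln 192 + ln ((real n + 2) ^ (4 * m + 2))"
          by (rule ln_mult_pos) (auto simp del: power_Suc)
        ultimately show ?thesis by simp
      qed
      finally have "(ln (univ_const d n) + ln (?S n)) / real n \<le> (ln 192 + real (4 * m + 2) * ln (real n + 2)) / real n"
        by (intro divide_right_mono) auto
      then show ?thesis by (simp add: add_divide_distrib)
    qed
    then show "eventually (\<lambda>n. (ln (univ_const d n) + ln (?S n)) / real n \<le> ln 192 / real n + real (4 * m + 2) * (ln (real n + 2) / real n)) sequentially"
      by simp
  qed
qed

section \<open>Achievable exponents\<close>

text \<open>An exponent reached eventually for every error level. Statements about tests are easier
  in this form than through \<open>beta\<close>, \<open>liminf\<close> and \<open>Lim\<close>; the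
  link is \<open>ach_imp_le_stein\<close> and \<open>less_stein_imp_ach\<close>.\<close>

definition ach :: "nat \<Rightarrow> (nat \<Rightarrow> complex Matrix.mat set) \<Rightarrow> (nat \<Rightarrow> complex Matrix.mat set) \<Rightarrow> real \<Rightarrow> bool" where
  "ach d A B x \<longleftrightarrow> (\<forall>\<epsilon>>0. eventually (\<lambda>n. \<exists>E. is_test (d ^ n) E \<and>
     (\<forall>\<rho>\<in>A n. Re (mtrace (\<rho> * (1\<^sub>m (d ^ n) - E))) \<le> \<epsilon>) \<and>
     (\<forall>\<sigma>\<in>B n. Re (mtrace (\<sigma> * E)) \<le> exp (- (real n * x)))) sequentially)"

lemma test_trace_bounds:
  assumes "density_mat N \<sigma>" "is_test N E"
  shows "0 \<le> Re (mtrace (\<sigma> * E))" "Re (mtrace (\<sigma> * E)) \<le> 1"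
    "Re (mtrace (\<sigma> * (1\<^sub>m N - E))) = 1 - Re (mtrace (\<sigma> * E))"
proof -
  have p: "psd_mat N \<sigma>" "psd_mat N E" "psd_mat N (1\<^sub>m N - E)" "mtrace \<sigma> = 1"
    using assms by (auto simp: density_mat_def is_test_def)
  show "0 \<le> Re (mtrace (\<sigma> * E))" by (rule psd_trace_nonneg[OF p(1,2)])
  show e: "Re (mtrace (\<sigma> * (1\<^sub>m N - E))) = 1 - Re (mtrace (\<sigma> * E))"
    using p(4) by (simp add: mtrace_mult_one_minus[OF psd_carrier[OF p(1)] psd_carrier[OF p(2)]])
  show "Re (mtrace (\<sigma> * E)) \<le> 1" using psd_trace_nonneg[OF p(1,3)] e by simp
qed

lemma test_one: "is_test N (1\<^sub>m N)"
  using test_specI[OF unitary_one, of N "\<lambda>_. 1"] by (simp add: spec_one[OF unitary_one])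

context
  fixes d :: nat and A B :: "nat \<Rightarrow> complex Matrix.mat set"
  assumes A: "\<And>n. A n \<noteq> {}" "\<And>n \<rho>. \<rho> \<in> A n \<Longrightarrow> density_mat (d ^ n) \<rho>"
    and B: "\<And>n. B n \<noteq> {}" "\<And>n \<sigma>. \<sigma> \<in> B n \<Longrightarrow> density_mat (d ^ n) \<sigma>"
begin

definition sA :: "nat \<Rightarrow> complex Matrix.mat \<Rightarrow> real" where
  "sA n E = Sup {Re (mtrace (\<rho> * (1\<^sub>m (d ^ n) - E))) | \<rho>. \<rho> \<in> A n}"

definition sB :: "nat \<Rightarrow> complex Matrix.mat \<Rightarrow> real" where
  "sB n E = Sup {Re (mtrace (\<sigma> * E)) | \<sigma>. \<sigma> \<in> B n}"

lemma sA_le_iff: "is_test (d ^ n) E \<Longrightarrow> sA n E \<le> e \<longleftrightarrow> (\<forall>\<rho>\<in>A n. Re (mtrace (\<rho> * (1\<^sub>m (d ^ n) - E))) \<le> e)"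
proof -
  assume E: "is_test (d ^ n) E"
  have "bdd_above {Re (mtrace (\<rho> * (1\<^sub>m (d ^ n) - E))) | \<rho>. \<rho> \<in> A n}"
    using test_trace_bounds(2)[OF A(2) test_one_minus[OF E]] by (intro bdd_aboveI[of _ 1]) auto
  then show ?thesis unfolding sA_def using A(1)[of n] by (subst cSup_le_iff) auto
qed

lemma sB_le_iff: "is_test (d ^ n) E \<Longrightarrow> sB n E \<le> e \<longleftrightarrow> (\<forall>\<sigma>\<in>B n. Re (mtrace (\<sigma> * E)) \<le> e)"
proof -
  assume E: "is_test (d ^ n) E"
  have "bdd_above {Re (mtrace (\<sigma> * E)) | \<sigma>. \<sigma> \<in> B n}"
    using test_trace_bounds(2)[OF B(2) E] by (intro bdd_aboveI[of _ 1]) auto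
  then show ?thesis unfolding sB_def using B(1)[of n] by (subst cSup_le_iff) auto
qed

lemma sB_nonneg: "is_test (d ^ n) E \<Longrightarrow> 0 \<le> sB n E"
proof -
  assume E: "is_test (d ^ n) E"
  obtain \<sigma> where s: "\<sigma> \<in> B n" using B(1)[of n] by blast
  have "Re (mtrace (\<sigma> * E)) \<le> sB n E" using sB_le_iff[OF E, of "sB n E"] s by blast
  then show ?thesis using test_trace_bounds(1)[OF B(2)[OF s] E] by linarith
qed

lemma beta_alt: "beta (d ^ n) e (A n) (B n) = Inf (sB n ` {E. is_test (d ^ n) E \<and> sA n E \<le> e})"
  unfolding beta_def sA_def sB_def by (rule arg_cong[of _ _ Inf]) auto

text \<open>The trivial test keeps the infimum in \<open>beta\<close> away from the empty set, where
  its value would be meaningless.\<close>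

lemma feasible_one: "0 \<le> e \<Longrightarrow> 1\<^sub>m (d ^ n) \<in> {E. is_test (d ^ n) E \<and> sA n E \<le> e}"
proof -
  assume e: "0 \<le> e"
  have "Re (mtrace (\<rho> * (1\<^sub>m (d ^ n) - 1\<^sub>m (d ^ n)))) \<le> e" if "\<rho> \<in> A n" for \<rho>
    using test_trace_bounds(3)[OF A(2)[OF that] test_one] A(2)[OF that] e density_carrier[OF A(2)[OF that]]
    by (simp add: density_mat_def)
  then show ?thesis using sA_le_iff[OF test_one] test_one by auto
qed

lemma beta_bdd: "bdd_below (sB n ` {E. is_test (d ^ n) E \<and> sA n E \<le> e})"
  using sB_nonneg by (intro bdd_belowI[of _ 0]) auto

lemma beta_antimono: "0 \<le> e \<Longrightarrow> e \<le> e' \<Longrightarrow> beta (d ^ n) e' (A n) (B n) \<le> beta (d ^ n) e (A n) (B n)"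
  unfolding beta_alt using feasible_one[of e n] beta_bdd[of n e'] by (intro cInf_superset_mono) auto

definition rate :: "real \<Rightarrow> ereal" where
  "rate e = liminf (\<lambda>n. ereal (1 / real n) * neg_ln (beta (d ^ n) e (A n) (B n)))"

lemma neg_ln_antimono: "b \<le> b' \<Longrightarrow> neg_ln b' \<le> neg_ln b"
  by (auto simp: neg_ln_def)

lemma rate_mono: "0 \<le> e \<Longrightarrow> e \<le> e' \<Longrightarrow> rate e \<le> rate e'"
  unfolding rate_def
  by (intro Liminf_mono always_eventually allI ereal_mult_left_mono neg_ln_antimono beta_antimono) auto

text \<open>The rate is monotone in the error level, so its right limit at 0 is an infimum; in
  particular \<open>Lim\<close> in \<open>stein\<close> is a genuine limit.\<close>

lemma stein_eq_INF: "stein d A B = (INF e\<in>{0<..}. rate e)"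
proof -
  have "(rate \<longlongrightarrow> (INF e\<in>{0<..}. rate e)) (at_right 0)"
  proof (rule order_tendstoI)
    fix a assume a: "a < (INF e\<in>{0<..}. rate e)"
    have "a < rate e" if "0 < e" for e using a that by (meson INF_lower greaterThan_iff order_less_le_trans)
    then show "eventually (\<lambda>e. a < rate e) (at_right 0)" unfolding eventually_at_right_field by (intro exI[of _ 1]) auto
  next
    fix a assume "(INF e\<in>{0<..}. rate e) < a"
    then obtain e0 where e0: "0 < e0" "rate e0 < a" unfolding INF_less_iff by auto
    have "rate e < a" if "0 < e" "e < e0" for e using rate_mono[of e e0] e0 that by auto
    then show "eventually (\<lambda>e. rate e < a) (at_right 0)" unfolding eventually_at_right_field using e0 by (intro exI[of _ e0]) auto
  qed
  then show ?thesis unfolding stein_def rate_def[symmetric] by (intro tendsto_Lim) auto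
qed

lemma ach_imp_le_stein:
  assumes "ach d A B x" shows "ereal x \<le> stein d A B"
  unfolding stein_eq_INF
proof (rule INF_greatest)
  fix e :: real assume "e \<in> {0<..}"
  then have e: "0 < e" by simp
  have "eventually (\<lambda>n. ereal x \<le> ereal (1 / real n) * neg_ln (beta (d ^ n) e (A n) (B n))) sequentially"
    using assms[unfolded ach_def, rule_format, OF e] eventually_gt_at_top[of 0]
  proof eventually_elim
    case (elim n)
    then obtain E where E: "is_test (d ^ n) E" "\<forall>\<rho>\<in>A n. Re (mtrace (\<rho> * (1\<^sub>m (d ^ n) - E))) \<le> e"
      "\<forall>\<sigma>\<in>B n. Re (mtrace (\<sigma> * E)) \<le> exp (- (real n * x))" by blast
    have "beta (d ^ n) e (A n) (B n) \<le> sB n E"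
      unfolding beta_alt using E sA_le_iff[OF E(1)] by (intro cInf_lower beta_bdd) auto
    also have "\<dots> \<le> exp (- (real n * x))" using E sB_le_iff[OF E(1)] by auto
    finally have b: "beta (d ^ n) e (A n) (B n) \<le> exp (- (real n * x))" .
    have "ereal (real n * x) \<le> neg_ln (beta (d ^ n) e (A n) (B n))"
    proof (cases "beta (d ^ n) e (A n) (B n) \<le> 0")
      case False
      then have "ln (beta (d ^ n) e (A n) (B n)) \<le> ln (exp (- (real n * x)))" using b by (subst ln_le_cancel_iff) auto
      then show ?thesis using False by (simp add: neg_ln_def)
    qed (simp add: neg_ln_def)
    then have "ereal (1 / real n) * ereal (real n * x) \<le> ereal (1 / real n) * neg_ln (beta (d ^ n) e (A n) (B n))"
      by (intro ereal_mult_left_mono) auto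
    then show ?case using elim by simp
  qed
  then show "ereal x \<le> rate e" unfolding rate_def by (rule Liminf_bounded)
qed

text \<open>The infimum in \<open>beta\<close> need not be attained. The strict inequality leaves
  room for an actual test with the required error.\<close>

lemma less_stein_imp_ach:
  assumes x: "ereal x < stein d A B" shows "ach d A B x"
  unfolding ach_def
proof (intro allI impI)
  fix e :: real assume e: "0 < e"
  have "stein d A B \<le> rate e" unfolding stein_eq_INF using e by (intro INF_lower) auto
  then have "ereal x < rate e" using x by simp
  then have "eventually (\<lambda>n. ereal x < ereal (1 / real n) * neg_ln (beta (d ^ n) e (A n) (B n))) sequentially"
    unfolding rate_def by (rule less_LiminfD)
  then show "eventually (\<lambda>n. \<exists>E. is_test (d ^ n) E \<and> (\<forall>\<rho>\<in>A n. Re (mtrace (\<rho> * (1\<^sub>m (d ^ n) - E))) \<le> e) \<and>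
     (\<forall>\<sigma>\<in>B n. Re (mtrace (\<sigma> * E)) \<le> exp (- (real n * x)))) sequentially"
    using eventually_gt_at_top[of 0]
  proof eventually_elim
    case (elim n)
    let ?b = "beta (d ^ n) e (A n) (B n)"
    have "?b < exp (- (real n * x))"
    proof (cases "?b \<le> 0")
      case True
      then show ?thesis by (smt (verit) exp_gt_zero)
    next
      case False
      then have "x < - ln ?b / real n" using elim by (simp add: neg_ln_def)
      then have "real n * x < - ln ?b" using elim(2) by (simp add: field_simps)
      then have "ln ?b < - (real n * x)" by simp
      then have "exp (ln ?b) < exp (- (real n * x))" by (simp only: exp_less_cancel_iff)
      then show ?thesis using False by simp
    qed
    then obtain E where E: "is_test (d ^ n) E" "sA n E \<le> e" "sB n E < exp (- (real n * x))"
      unfolding beta_alt using cInf_lessD[of "sB n ` {E. is_test (d ^ n) E \<and> sA n E \<le> e}"] feasible_one[of e n] e by auto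
    then show ?case using sA_le_iff[OF E(1), of e] sB_le_iff[OF E(1), of "exp (- (real n * x))"]
      by (intro exI[of _ E]) auto
  qed
qed

end

lemma ach_mono:
  assumes "ach d A B x" "\<And>n. A' n \<subseteq> A n" "\<And>n. B' n \<subseteq> B n" "y \<le> x"
  shows "ach d A' B' y"
  unfolding ach_def
proof (intro allI impI)
  fix e :: real assume "0 < e"
  from assms(1)[unfolded ach_def, rule_format, OF this]
  show "eventually (\<lambda>n. \<exists>E. is_test (d ^ n) E \<and> (\<forall>\<rho>\<in>A' n. Re (mtrace (\<rho> * (1\<^sub>m (d ^ n) - E))) \<le> e) \<and>
     (\<forall>\<sigma>\<in>B' n. Re (mtrace (\<sigma> * E)) \<le> exp (- (real n * y)))) sequentially"
  proof eventually_elim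
    case (elim n)
    then obtain E where E: "is_test (d ^ n) E" "\<forall>\<rho>\<in>A n. Re (mtrace (\<rho> * (1\<^sub>m (d ^ n) - E))) \<le> e"
      "\<forall>\<sigma>\<in>B n. Re (mtrace (\<sigma> * E)) \<le> exp (- (real n * x))" by blast
    have "exp (- (real n * x)) \<le> exp (- (real n * y))" using assms(4) by (simp add: mult_left_mono)
    then show ?case using E assms(2,3) by (intro exI[of _ E]) (meson order.trans subsetD)
  qed
qed

text \<open>The union test multiplies the second error by a constant independent of n, which any
  loss of exponent absorbs.\<close>

lemma ach_union:
  assumes I: "finite I" "\<And>i. i \<in> I \<Longrightarrow> ach d (A i) B x" and y: "y < x"
    and A: "\<And>i n \<rho>. i \<in> I \<Longrightarrow> \<rho> \<in> A i n \<Longrightarrow> density_mat (d ^ n) \<rho>" and B: "\<And>n \<sigma>. \<sigma> \<in> B n \<Longrightarrow> density_mat (d ^ n) \<sigma>"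
  shows "ach d (\<lambda>n. \<Union>i\<in>I. A i n) B y"
  unfolding ach_def
proof (intro allI impI)
  fix e :: real assume e: "0 < e"
  obtain il where il: "set il = I" using finite_list[OF I(1)] by blast
  have ev: "eventually (\<lambda>n. \<forall>i\<in>I. \<exists>E. is_test (d ^ n) E \<and> (\<forall>\<rho>\<in>A i n. Re (mtrace (\<rho> * (1\<^sub>m (d ^ n) - E))) \<le> e / 4) \<and>
     (\<forall>\<sigma>\<in>B n. Re (mtrace (\<sigma> * E)) \<le> exp (- (real n * x)))) sequentially"
  proof (rule eventually_ball_finite[OF I(1)], rule ballI)
    fix i assume "i \<in> I"
    from I(2)[OF this, unfolded ach_def, rule_format, of "e / 4"] e
    show "eventually (\<lambda>n. \<exists>E. is_test (d ^ n) E \<and> (\<forall>\<rho>\<in>A i n. Re (mtrace (\<rho> * (1\<^sub>m (d ^ n) - E))) \<le> e / 4) \<and>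
      (\<forall>\<sigma>\<in>B n. Re (mtrace (\<sigma> * E)) \<le> exp (- (real n * x)))) sequentially" by simp
  qed
  have "filterlim (\<lambda>n. real n * (x - y)) at_top sequentially"
    using y by (intro filterlim_at_top_mult_tendsto_pos[OF tendsto_const _ filterlim_real_sequentially]) auto
  \<comment> \<open>The summand 1 keeps the argument of the logarithm positive for an empty
    list.\<close>
  then have "eventually (\<lambda>n. ln (real (length il) * 4 / e + 1) \<le> real n * (x - y)) sequentially"
    by (simp add: filterlim_at_top)
  with ev show "eventually (\<lambda>n. \<exists>E. is_test (d ^ n) E \<and> (\<forall>\<rho>\<in>(\<Union>i\<in>I. A i n). Re (mtrace (\<rho> * (1\<^sub>m (d ^ n) - E))) \<le> e) \<and>
     (\<forall>\<sigma>\<in>B n. Re (mtrace (\<sigma> * E)) \<le> exp (- (real n * y)))) sequentially"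
  proof eventually_elim
    case (elim n)
    then obtain F where F: "\<And>i. i \<in> I \<Longrightarrow> is_test (d ^ n) (F i)" "\<And>i \<rho>. i \<in> I \<Longrightarrow> \<rho> \<in> A i n \<Longrightarrow> Re (mtrace (\<rho> * (1\<^sub>m (d ^ n) - F i))) \<le> e / 4"
      "\<And>i \<sigma>. i \<in> I \<Longrightarrow> \<sigma> \<in> B n \<Longrightarrow> Re (mtrace (\<sigma> * F i)) \<le> exp (- (real n * x))" by metis
    have "\<forall>G\<in>set (map F il). is_test (d ^ n) G" using F(1) il by auto
    \<comment> \<open>Threshold and individual errors are e / 4 each, so the first error is at most
      2 (e / 4) + 2 (e / 4) = e.\<close>
    from test_union[OF this, of "e / 4"] e obtain E where E: "is_test (d ^ n) E"
      "\<forall>G\<in>set (map F il). \<forall>\<rho>. density_mat (d ^ n) \<rho> \<longrightarrow> Re (mtrace (\<rho> * (1\<^sub>m (d ^ n) - E))) \<le> 2 * (e / 4) + 2 * Re (mtrace (\<rho> * (1\<^sub>m (d ^ n) - G)))"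
      "\<forall>\<sigma>. psd_mat (d ^ n) \<sigma> \<longrightarrow> Re (mtrace (\<sigma> * E)) \<le> (\<Sum>G\<leftarrow>map F il. Re (mtrace (\<sigma> * G))) / (e / 4)" by auto
    have 1: "Re (mtrace (\<rho> * (1\<^sub>m (d ^ n) - E))) \<le> e" if i: "i \<in> I" and r: "\<rho> \<in> A i n" for i \<rho>
    proof -
      have "Re (mtrace (\<rho> * (1\<^sub>m (d ^ n) - E))) \<le> 2 * (e / 4) + 2 * Re (mtrace (\<rho> * (1\<^sub>m (d ^ n) - F i)))"
        using E(2) A[OF i r] i il by auto
      then show ?thesis using F(2)[OF i r] by simp
    qed
    have 2: "Re (mtrace (\<sigma> * E)) \<le> exp (- (real n * y))" if s: "\<sigma> \<in> B n" for \<sigma>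
    proof -
      have "(\<Sum>G\<leftarrow>map F il. Re (mtrace (\<sigma> * G))) \<le> (\<Sum>G\<leftarrow>map F il. exp (- (real n * x)))"
        using F(3) s il by (intro sum_list_mono) auto
      also have "\<dots> = real (length il) * exp (- (real n * x))" by (simp add: sum_list_triv)
      finally have "(\<Sum>G\<leftarrow>map F il. Re (mtrace (\<sigma> * G))) / (e / 4) \<le> real (length il) * exp (- (real n * x)) / (e / 4)"
        using e by (intro divide_right_mono) auto
      moreover have "Re (mtrace (\<sigma> * E)) \<le> (\<Sum>G\<leftarrow>map F il. Re (mtrace (\<sigma> * G))) / (e / 4)"
        using E(3) B[OF s] by (auto simp: density_mat_def)
      moreover have "real (length il) * exp (- (real n * x)) / (e / 4) \<le> exp (- (real n * y))"
      proof -
        have p: "0 < real (length il) * 4 / e + 1" using e by (intro add_nonneg_pos) auto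
        have "real (length il) * 4 / e + 1 \<le> exp (real n * (x - y))"
          using elim(2) p by (metis exp_ln exp_le_cancel_iff)
        then have "(real (length il) * 4 / e) * exp (- (real n * x)) \<le> exp (real n * (x - y)) * exp (- (real n * x))"
          by (intro mult_right_mono) auto
        also have "\<dots> = exp (- (real n * y))" by (simp add: exp_add[symmetric] algebra_simps)
        finally show ?thesis using e by (simp add: mult_ac)
      qed
      ultimately show ?thesis by linarith
    qed
    show ?case using E(1) 1 2 by blast
  qed
qed

lemma rel_ent_nonneg:
  assumes rho: "density_mat n \<rho>" and sig: "density_mat n \<sigma>" shows "0 \<le> rel_ent n \<rho> \<sigma>"
proof -
  from rho obtain U r where U: "unitary_mat n U" "\<rho> = spec n U r" and r: "\<And>i. 0 \<le> r i" "(\<Sum>i<n. r i) = 1"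
    by (rule density_obtain_spec) auto
  from sig obtain V s where V: "unitary_mat n V" "\<sigma> = spec n V s" and s: "\<And>i. 0 \<le> s i" "(\<Sum>i<n. s i) = 1"
    by (rule density_obtain_spec) auto
  let ?o = "ovl n U V"
  have "0 \<le> rel_val n U r V s" if cond: "\<forall>i<n. \<forall>j<n. s j = 0 \<longrightarrow> r i * ?o i j = 0"
  proof -
    have "0 = (\<Sum>i<n. \<Sum>j<n. r i * ?o i j) - (\<Sum>i<n. \<Sum>j<n. s j * ?o i j)"
      by (simp add: sum_ovl_weights[OF U(1) V(1)] r s)
    also have "\<dots> = (\<Sum>i<n. \<Sum>j<n. (r i - s j) * ?o i j)" by (simp add: sum_subtractf[symmetric] algebra_simps)
    also have "\<dots> \<le> (\<Sum>i<n. \<Sum>j<n. r i * (log_supp (r i) - log_supp (s j)) * ?o i j)"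
    proof (intro sum_mono)
      fix i j assume ij: "i \<in> {..<n}" "j \<in> {..<n}"
      show "(r i - s j) * ?o i j \<le> r i * (log_supp (r i) - log_supp (s j)) * ?o i j"
      proof (cases "r i * ?o i j = 0")
        case True
        then show ?thesis using s(1)[of j] ovl_nonneg[of n U V i j] by (auto simp: algebra_simps)
      next
        case False
        then have pos: "r i > 0" "?o i j > 0" "s j > 0" using cond ij r(1)[of i] s(1)[of j] ovl_nonneg[of n U V i j]
          by (auto simp: less_le)
        then show ?thesis using mult_ln_diff_ge[OF pos(1,3)] by (intro mult_right_mono) (auto simp: log_supp_def)
      qed
    qed
    also have "\<dots> = (\<Sum>i<n. \<Sum>j<n. r i * log_supp (r i) * ?o i j) - (\<Sum>i<n. \<Sum>j<n. r i * log_supp (s j) * ?o i j)"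
      by (simp add: sum_subtractf[symmetric] algebra_simps)
    finally show ?thesis by (simp add: rel_val_def sum_ovl_weights[OF U(1) V(1)])
  qed
  then show ?thesis unfolding U(2) V(2) rel_ent_spec[OF U(1) V(1) r(1) s(1)] by auto
qed

text \<open>The converse for exponents. First errors are affine in the state, so a test for
  \<open>A\<close> also serves its hull. For \<open>x <= 0\<close> non-negativity of the relative
  entropy suffices; otherwise the single-test bound is used with a likelihood threshold growing like
  exp (n x).\<close>

theorem ach_le_liminf_rel_ent:
  assumes ach: "ach d A B x"
    and A: "\<And>n \<rho>. \<rho> \<in> A n \<Longrightarrow> density_mat (d ^ n) \<rho>" and R: "\<And>n. R n \<subseteq> mat_co (d ^ n) (A n)"
    and S: "\<And>n. density_mat (d ^ n) (S n)"
    and dom: "\<And>n E b. is_test (d ^ n) E \<Longrightarrow> (\<forall>\<sigma>\<in>B n. Re (mtrace (\<sigma> * E)) \<le> b) \<Longrightarrow> Re (mtrace (S n * E)) \<le> b"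
  shows "ereal x \<le> liminf (\<lambda>n. ereal (1 / real n) * (INF \<rho>\<in>R n. rel_ent (d ^ n) \<rho> (S n)))"
proof (cases "x \<le> 0")
  case True
  have "0 \<le> ereal (1 / real n) * (INF \<rho>\<in>R n. rel_ent (d ^ n) \<rho> (S n))" for n
  proof (intro ereal_0_le_mult INF_greatest)
    fix \<rho> assume "\<rho> \<in> R n"
    then have "\<rho> \<in> mat_co (d ^ n) (A n)" using R by blast
    then have "density_mat (d ^ n) \<rho>" by (rule mat_co_density[rotated]) (rule A)
    then show "0 \<le> rel_ent (d ^ n) \<rho> (S n)" by (rule rel_ent_nonneg[OF _ S])
  qed simp
  then have "ereal 0 \<le> liminf (\<lambda>n. ereal (1 / real n) * (INF \<rho>\<in>R n. rel_ent (d ^ n) \<rho> (S n)))"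
    by (intro Liminf_bounded always_eventually) (auto simp: zero_ereal_def)
  then show ?thesis using True by (meson ereal_less_eq(3) order.trans)
next
  case False
  then have x: "0 < x" by simp
  have key: "ereal ((1 - 4 * e) * x) \<le> liminf (\<lambda>n. ereal (1 / real n) * (INF \<rho>\<in>R n. rel_ent (d ^ n) \<rho> (S n)))"
    if e: "0 < e" "e < 1 / 4" for e
  proof -
    define g where "g n = (1 - 4 * e) * (x + ln e / real n) - 1 / real n" for n :: nat
    have glim: "g \<longlonglongrightarrow> (1 - 4 * e) * (x + 0) - 0"
      unfolding g_def by (intro tendsto_intros)
    have "filterlim (\<lambda>n. real n * x) at_top sequentially"
      using x by (intro filterlim_at_top_mult_tendsto_pos[OF tendsto_const _ filterlim_real_sequentially]) auto
    then have ev: "eventually (\<lambda>n. - ln e + 1 \<le> real n * x) sequentially" by (simp add: filterlim_at_top)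
    have "eventually (\<lambda>n. ereal (g n) \<le> ereal (1 / real n) * (INF \<rho>\<in>R n. rel_ent (d ^ n) \<rho> (S n))) sequentially"
      using ach[unfolded ach_def, rule_format, OF e(1)] ev eventually_gt_at_top[of 0]
    proof eventually_elim
      case (elim n)
      then obtain E where E: "is_test (d ^ n) E" "\<forall>\<rho>\<in>A n. Re (mtrace (\<rho> * (1\<^sub>m (d ^ n) - E))) \<le> e"
        "\<forall>\<sigma>\<in>B n. Re (mtrace (\<sigma> * E)) \<le> exp (- (real n * x))" by blast
      \<comment> \<open>Chosen to balance the errors: l times the second error is at most e. The
        bound becomes (1 - (D + 1) / ln l) / 2 <= 2 e, which produces the factor 1 - 4 e.\<close>
      define l where "l = e * exp (real n * x)"
      have lnl: "ln l = ln e + real n * x" unfolding l_def using e by (simp add: ln_mult)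
      have "exp 0 < exp (ln l)" using lnl elim(2) by (subst exp_less_cancel_iff) linarith
      then have l1: "1 < l" using e by (simp add: l_def)
      have "ereal (real n * g n) \<le> (INF \<rho>\<in>R n. rel_ent (d ^ n) \<rho> (S n))"
      proof (rule INF_greatest)
        fix \<rho> assume "\<rho> \<in> R n"
        then have rho: "\<rho> \<in> mat_co (d ^ n) (A n)" using R by blast
        have Sc: "A n \<subseteq> carrier_mat (d ^ n) (d ^ n)" using A density_carrier by blast
        have d: "density_mat (d ^ n) \<rho>" using rho by (rule mat_co_density[rotated]) (rule A)
        have Ec: "1\<^sub>m (d ^ n) - E \<in> carrier_mat (d ^ n) (d ^ n)" using is_test_carrier[OF E(1)] by (simp add: minus_carrier_mat)
        have t1: "Re (mtrace (\<rho> * (1\<^sub>m (d ^ n) - E))) \<le> e" using E(2) by (intro mat_co_trace_le[OF Sc rho Ec]) auto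
        have t2: "Re (mtrace (S n * E)) \<le> exp (- (real n * x))" using dom E by blast
        show "ereal (real n * g n) \<le> rel_ent (d ^ n) \<rho> (S n)"
        proof (cases "rel_ent (d ^ n) \<rho> (S n)")
          case (real D)
          have "(1 - (D + 1) / ln l) / 2 \<le> e + l * exp (- (real n * x))"
            by (rule rel_ent_converse[OF d S E(1) t1 t2 _ l1]) (simp add: real)
          also have "l * exp (- (real n * x)) = e" by (simp add: l_def exp_minus)
          finally have "1 - 4 * e \<le> (D + 1) / ln l" by simp
          then have "(1 - 4 * e) * ln l \<le> D + 1" using l1 by (simp add: le_divide_eq)
          then have "(1 - 4 * e) * (ln e + real n * x) - 1 \<le> D" unfolding lnl by simp
          moreover have "real n * g n = (1 - 4 * e) * (ln e + real n * x) - 1"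
            using elim(3) by (simp add: g_def field_simps)
          ultimately show ?thesis using real by simp
        next
          case MInf
          then show ?thesis using rel_ent_nonneg[OF d S[of n]] by simp
        qed simp
      qed
      then have "ereal (1 / real n) * ereal (real n * g n) \<le> ereal (1 / real n) * (INF \<rho>\<in>R n. rel_ent (d ^ n) \<rho> (S n))"
        by (intro ereal_mult_left_mono) auto
      then show ?case using elim(3) by simp
    qed
    then have "liminf (\<lambda>n. ereal (g n)) \<le> liminf (\<lambda>n. ereal (1 / real n) * (INF \<rho>\<in>R n. rel_ent (d ^ n) \<rho> (S n)))"
      by (rule Liminf_mono)
    moreover have "liminf (\<lambda>n. ereal (g n)) = ereal ((1 - 4 * e) * x)"
      using glim by (intro lim_imp_Liminf) (auto simp: tendsto_ereal)
    ultimately show ?thesis by simp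
  qed
  show ?thesis
  proof (rule dense_le)
    fix z assume z: "z < ereal x"
    show "z \<le> liminf (\<lambda>n. ereal (1 / real n) * (INF \<rho>\<in>R n. rel_ent (d ^ n) \<rho> (S n)))"
    proof (cases z)
      case (real w)
      have wx: "w < x" using z real by simp
      \<comment> \<open>Makes (1 - 4 e) x at least w, while staying below 1 / 4.\<close>
      define e where "e = min (1 / 8) ((x - w) / (4 * x))"
      have e: "0 < e" "e < 1 / 4" using x wx by (auto simp: e_def)
      have "4 * e * x \<le> 4 * ((x - w) / (4 * x)) * x" using x by (intro mult_right_mono mult_left_mono) (auto simp: e_def)
      also have "4 * ((x - w) / (4 * x)) * x = x - w" using x by simp
      finally have "w \<le> (1 - 4 * e) * x" by (simp add: algebra_simps)
      then show ?thesis using key[OF e] real by (meson ereal_less_eq(3) order.trans)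
    qed (use z in auto)
  qed
qed

section \<open>Chernoff bounds for block observables\<close>

text \<open>The trace is a classical expectation of \<open>b\<close>. That it is real allows
  \<open>Re\<close> to be taken factor by factor in products of such traces.\<close>

lemma mtrace_density_spec:
  assumes "density_mat N A" "V \<in> carrier_mat N N"
  shows "mtrace (A * spec N V b) = of_real (\<Sum>j<N. Re (qfc N A (colf V j)) * b j)" "Im (mtrace (A * spec N V b)) = 0"
proof -
  from assms(1) obtain U l where U: "unitary_mat N U" "A = spec N U l" by (rule density_obtain_spec) auto
  have "mtrace (A * spec N V b) = mtrace (spec N V b * A)" using density_carrier[OF assms(1)] assms(2) by (intro mtrace_mult_commute[of _ N N]) auto
  also have "\<dots> = (\<Sum>j<N. of_real (b j) * qfc N A (colf V j))" using assms density_carrier by (intro mtrace_spec_mult) blast+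
  also have "\<dots> = of_real (\<Sum>j<N. Re (qfc N A (colf V j)) * b j)"
    unfolding U(2) qfc_spec_col[OF unitary_carrier[OF U(1)]] by (simp add: mult.commute)
  finally show "mtrace (A * spec N V b) = of_real (\<Sum>j<N. Re (qfc N A (colf V j)) * b j)" .
  then show "Im (mtrace (A * spec N V b)) = 0" by simp
qed

lemma density_col_weights:
  assumes A: "density_mat N A" and V: "unitary_mat N V"
  shows "0 \<le> Re (qfc N A (colf V j))" "(\<Sum>j<N. Re (qfc N A (colf V j))) = 1"
proof -
  show "0 \<le> Re (qfc N A (colf V j))" using A by (auto simp: density_mat_def psd_iff)
  have "mtrace (A * spec N V (\<lambda>_. 1)) = 1" using A density_carrier[OF A] by (simp add: spec_one[OF V] density_mat_def)
  then have "complex_of_real (\<Sum>j<N. Re (qfc N A (colf V j)) * 1) = 1"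
    unfolding mtrace_density_spec(1)[OF A unitary_carrier[OF V]] .
  then show "(\<Sum>j<N. Re (qfc N A (colf V j))) = 1" by (simp only: of_real_eq_1_iff mult_1_right)
qed

lemma exp_quadratic_bound: "\<bar>u\<bar> \<le> 1 \<Longrightarrow> exp u \<le> 1 + u + u\<^sup>2" for u :: real
proof (cases "0 \<le> u")
  case True
  assume "\<bar>u\<bar> \<le> 1"
  then show ?thesis using True exp_bound[of u] by simp
next
  case False
  define v where "v = - u"
  have v: "0 < v" using False by (simp add: v_def)
  have "exp v \<ge> 1 + v" by (rule exp_ge_add_one_self)
  then have "exp (- v) \<le> 1 / (1 + v)" using v by (simp add: exp_minus field_simps)
  also have "\<dots> \<le> 1 - v + v\<^sup>2"
  proof -
    have "1 \<le> (1 - v + v\<^sup>2) * (1 + v)" using v by (simp add: algebra_simps power2_eq_square)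
    then show ?thesis using v by (simp add: divide_le_eq)
  qed
  finally show ?thesis by (simp add: v_def)
qed

text \<open>A uniform Chernoff parameter: \<open>s\<close> depends on the observable and \<delta>
  only, not on the state or on \<open>c\<close>, so the same \<open>s\<close> works for all blocks
  and all null states.\<close>

lemma chernoff_block:
  assumes W: "unitary_mat N W" and d: "0 < \<delta>"
  obtains s where "0 < s" "\<And>\<rho> c. density_mat N \<rho> \<Longrightarrow> c + \<delta> \<le> Re (mtrace (\<rho> * spec N W x)) \<Longrightarrow>
    Re (mtrace (\<rho> * spec N W (\<lambda>i. exp (- s * x i)))) \<le> exp (- s * c - s * \<delta> / 2)"
proof -
  define M where "M = 1 + (\<Sum>i<N. \<bar>x i\<bar>)"
  have M: "1 \<le> M" "\<And>i. i < N \<Longrightarrow> \<bar>x i\<bar> \<le> M"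
  proof -
    show "1 \<le> M" by (simp add: M_def sum_nonneg)
    show "\<bar>x i\<bar> \<le> M" if "i < N" for i using member_le_sum[of i "{..<N}" "\<lambda>i. \<bar>x i\<bar>"] that by (simp add: M_def)
  qed
  \<comment> \<open>The first bound keeps the exponents in [-1, 1], where the quadratic estimate
    holds. The second lets the quadratic term use up at most half of \<delta>.\<close>
  define s where "s = min (1 / M) (\<delta> / (2 * M\<^sup>2))"
  have s: "0 < s" "s * M \<le> 1" "s * M\<^sup>2 \<le> \<delta> / 2"
  proof -
    show "0 < s" using M d by (auto simp: s_def)
    have "s * M \<le> 1 / M * M" using M by (intro mult_right_mono) (auto simp: s_def)
    then show "s * M \<le> 1" using M by simp
    have "s * M\<^sup>2 \<le> \<delta> / (2 * M\<^sup>2) * M\<^sup>2" by (intro mult_right_mono) (auto simp: s_def)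
    then show "s * M\<^sup>2 \<le> \<delta> / 2" using M by (simp add: field_simps)
  qed
  have "Re (mtrace (\<rho> * spec N W (\<lambda>i. exp (- s * x i)))) \<le> exp (- s * c - s * \<delta> / 2)"
    if r: "density_mat N \<rho>" and c: "c + \<delta> \<le> Re (mtrace (\<rho> * spec N W x))" for \<rho> c
  proof -
    define p where "p j = Re (qfc N \<rho> (colf W j))" for j
    have p: "0 \<le> p j" "(\<Sum>j<N. p j) = 1" for j using density_col_weights[OF r W] by (auto simp: p_def)
    have tr: "Re (mtrace (\<rho> * spec N W b)) = (\<Sum>j<N. p j * b j)" for b
      unfolding mtrace_density_spec(1)[OF r unitary_carrier[OF W]] p_def by simp
    have "(\<Sum>j<N. p j * exp (- s * x j)) \<le> (\<Sum>j<N. p j * (1 - s * x j + s\<^sup>2 * M\<^sup>2))"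
    proof (intro sum_mono mult_left_mono p)
      fix j assume "j \<in> {..<N}"
      then have xj: "\<bar>x j\<bar> \<le> M" using M by simp
      have "\<bar>- s * x j\<bar> \<le> s * M" using xj s by (simp add: abs_mult)
      then have "exp (- s * x j) \<le> 1 + (- s * x j) + (- s * x j)\<^sup>2" using s by (intro exp_quadratic_bound) linarith
      also have "(- s * x j)\<^sup>2 = s\<^sup>2 * \<bar>x j\<bar>\<^sup>2" by (simp add: power_mult_distrib)
      also have "\<dots> \<le> s\<^sup>2 * M\<^sup>2" using xj by (intro mult_left_mono power_mono) auto
      finally show "exp (- s * x j) \<le> 1 - s * x j + s\<^sup>2 * M\<^sup>2" by simp
    qed
    also have "\<dots> = (1 + s\<^sup>2 * M\<^sup>2) * (\<Sum>j<N. p j) - s * (\<Sum>j<N. p j * x j)"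
      unfolding sum_distrib_left sum_subtractf[symmetric] by (intro sum.cong refl) (simp add: algebra_simps)
    also have "\<dots> \<le> 1 + s * (s * M\<^sup>2) - s * (c + \<delta>)"
      using c s(1) unfolding tr p(2) by (simp add: power2_eq_square mult.assoc mult_left_mono)
    also have "\<dots> \<le> 1 + s * (\<delta> / 2) - s * (c + \<delta>)" using s by (intro diff_right_mono add_left_mono mult_left_mono) auto
    also have "\<dots> = 1 + (- s * c - s * \<delta> / 2)" by (simp add: algebra_simps)
    also have "\<dots> \<le> exp (- s * c - s * \<delta> / 2)" by (rule exp_ge_add_one_self)
    finally show ?thesis unfolding tr .
  qed
  then show ?thesis using that[OF s(1)] by blast
qed

text \<open>The product observable over m blocks, equal to 1 on the r left-over factors. The same
  eigenbasis and eigenvalues \<open>g\<close> serve every power \<open>t\<close>, because both the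
  moment of order 1 on the alternative and a negative moment on the null hypothesis are needed for
  one test.\<close>

lemma block_power:
  assumes W: "unitary_mat (d ^ k) W"
  shows "\<exists>U g. unitary_mat (d ^ (k * m + r)) U \<and> (\<forall>i. 0 < g i) \<and>
    (\<forall>t c Ms. (\<forall>M\<in>set Ms. density_mat d M) \<and> length Ms = k * m + r \<and>
      (\<forall>j<m. Re (mtrace (tensor_list (take k (drop (k * j) Ms)) * spec (d ^ k) W (\<lambda>i. exp (t * x i)))) \<le> c) \<longrightarrow>
      Re (mtrace (tensor_list Ms * spec (d ^ (k * m + r)) U (\<lambda>i. g i powr t))) \<le> c ^ m)"
proof (induction m)
  case 0
  have "Re (mtrace (tensor_list Ms * spec (d ^ r) (1\<^sub>m (d ^ r)) (\<lambda>i. 1 powr t))) \<le> 1"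
    if "\<forall>M\<in>set Ms. density_mat d M" "length Ms = r" for Ms t
    using tensor_list_density[OF that(1)] density_carrier[OF tensor_list_density[OF that(1)]] that(2)
    by (simp add: spec_one[OF unitary_one] density_mat_def)
  then show ?case by (intro exI[of _ "1\<^sub>m (d ^ r)"] exI[of _ "\<lambda>_. 1"]) (simp add: unitary_one)
next
  case (Suc m)
  then obtain U g where U: "unitary_mat (d ^ (k * m + r)) U" "\<And>i. 0 < g i"
    and IH: "\<And>t c Ms. (\<forall>M\<in>set Ms. density_mat d M) \<Longrightarrow> length Ms = k * m + r \<Longrightarrow>
      (\<And>j. j < m \<Longrightarrow> Re (mtrace (tensor_list (take k (drop (k * j) Ms)) * spec (d ^ k) W (\<lambda>i. exp (t * x i)))) \<le> c) \<Longrightarrow>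
      Re (mtrace (tensor_list Ms * spec (d ^ (k * m + r)) U (\<lambda>i. g i powr t))) \<le> c ^ m" by blast
  let ?a = "d ^ k" and ?b = "d ^ (k * m + r)"
  have ab: "d ^ (k * Suc m + r) = ?a * ?b" by (simp add: power_add)
  define g' where "g' i = exp (x (i div ?b)) * g (i mod ?b)" for i
  have Wc: "W \<in> carrier_mat ?a ?a" and Uc: "U \<in> carrier_mat ?b ?b" using W U by (auto intro: unitary_carrier)
  have "Re (mtrace (tensor_list Ms * spec (?a * ?b) (kron W U) (\<lambda>i. g' i powr t))) \<le> c ^ Suc m"
    if Ms: "\<forall>M\<in>set Ms. density_mat d M" "length Ms = k * Suc m + r"
      and le: "\<And>j. j < Suc m \<Longrightarrow> Re (mtrace (tensor_list (take k (drop (k * j) Ms)) * spec (d ^ k) W (\<lambda>i. exp (t * x i)))) \<le> c" for t c Ms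
  proof -
    let ?X = "take k Ms" and ?Y = "drop k Ms"
    have dX: "\<forall>M\<in>set ?X. density_mat d M" and dY: "\<forall>M\<in>set ?Y. density_mat d M"
      using Ms(1) by (auto dest: in_set_takeD in_set_dropD)
    have lX: "length ?X = k" and lY: "length ?Y = k * m + r" using Ms(2) by auto
    have tX: "density_mat ?a (tensor_list ?X)" and tY: "density_mat ?b (tensor_list ?Y)"
      using tensor_list_density[OF dX] tensor_list_density[OF dY] lX lY by auto
    have "tensor_list Ms = kron (tensor_list ?X) (tensor_list ?Y)"
      using tensor_list_append[of ?X d ?Y] dX dY density_carrier by auto
    moreover have "spec (?a * ?b) (kron W U) (\<lambda>i. g' i powr t) = kron (spec ?a W (\<lambda>i. exp (t * x i))) (spec ?b U (\<lambda>i. g i powr t))"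
      unfolding kron_spec[OF Wc Uc] g'_def using U(2)
      by (intro spec_cong) (simp add: powr_mult exp_powr_real mult.commute less_imp_le)
    ultimately have "mtrace (tensor_list Ms * spec (?a * ?b) (kron W U) (\<lambda>i. g' i powr t))
       = mtrace (tensor_list ?X * spec ?a W (\<lambda>i. exp (t * x i))) * mtrace (tensor_list ?Y * spec ?b U (\<lambda>i. g i powr t))"
      using kron_mult[OF density_carrier[OF tX] spec_carrier[OF Wc] density_carrier[OF tY] spec_carrier[OF Uc]]
        kron_mtrace[of "tensor_list ?X * spec ?a W (\<lambda>i. exp (t * x i))" ?a "tensor_list ?Y * spec ?b U (\<lambda>i. g i powr t)" ?b]
        density_carrier[OF tX] density_carrier[OF tY] Wc Uc by simp
    then have "Re (mtrace (tensor_list Ms * spec (?a * ?b) (kron W U) (\<lambda>i. g' i powr t)))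
       = Re (mtrace (tensor_list ?X * spec ?a W (\<lambda>i. exp (t * x i)))) * Re (mtrace (tensor_list ?Y * spec ?b U (\<lambda>i. g i powr t)))"
      using mtrace_density_spec(2)[OF tX Wc] mtrace_density_spec(2)[OF tY Uc] by simp
    also have "\<dots> \<le> c * c ^ m"
    proof (rule mult_mono)
      show 1: "Re (mtrace (tensor_list ?X * spec ?a W (\<lambda>i. exp (t * x i)))) \<le> c" using le[of 0] by simp
      have "psd_mat ?a (spec ?a W (\<lambda>i. exp (t * x i)))" using W by (simp add: psd_spec_iff)
      then have "0 \<le> Re (mtrace (tensor_list ?X * spec ?a W (\<lambda>i. exp (t * x i))))"
        using tX by (intro psd_trace_nonneg) (auto simp: density_mat_def)
      then show "0 \<le> c" using 1 by linarith
      show "Re (mtrace (tensor_list ?Y * spec ?b U (\<lambda>i. g i powr t))) \<le> c ^ m"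
      proof (rule IH[OF dY lY])
        fix j assume "j < m"
        then show "Re (mtrace (tensor_list (take k (drop (k * j) ?Y)) * spec (d ^ k) W (\<lambda>i. exp (t * x i)))) \<le> c"
          using le[of "Suc j"] by (simp add: add.commute)
      qed
      have "psd_mat ?b (spec ?b U (\<lambda>i. g i powr t))" using U by (simp add: psd_spec_iff)
      then show "0 \<le> Re (mtrace (tensor_list ?Y * spec ?b U (\<lambda>i. g i powr t)))"
        using tY by (intro psd_trace_nonneg) (auto simp: density_mat_def)
    qed
    finally show ?thesis by simp
  qed
  moreover have "unitary_mat (?a * ?b) (kron W U)" by (rule kron_unitary[OF W U(1)])
  moreover have "0 < g' i" for i using U(2) by (simp add: g'_def)
  ultimately show ?case unfolding ab by (intro exI[of _ "kron W U"] exI[of _ g']) blast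
qed

text \<open>The test compares the product observable with its typical size on the null hypothesis.
  States are given as lists of factors so that they can be cut into blocks; different blocks may
  carry different states.\<close>

theorem block_ach:
  assumes k: "0 < k" and W: "unitary_mat (d ^ k) W" and dl: "0 < \<delta>" and C: "0 < C" and y: "real k * y < c - ln C"
    and LA: "\<And>n Ms. Ms \<in> LA n \<Longrightarrow> length Ms = n \<and> (\<forall>M\<in>set Ms. density_mat d M) \<and>
      (\<forall>j. k * Suc j \<le> n \<longrightarrow> c + \<delta> \<le> Re (mtrace (tensor_list (take k (drop (k * j) Ms)) * spec (d ^ k) W x)))"
    and LB: "\<And>n Ms. Ms \<in> LB n \<Longrightarrow> length Ms = n \<and> (\<forall>M\<in>set Ms. density_mat d M) \<and>
      (\<forall>j. k * Suc j \<le> n \<longrightarrow> Re (mtrace (tensor_list (take k (drop (k * j) Ms)) * spec (d ^ k) W (\<lambda>i. exp (x i)))) \<le> C)"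
  shows "ach d (\<lambda>n. tensor_list ` LA n) (\<lambda>n. tensor_list ` LB n) y"
  unfolding ach_def
proof (intro allI impI)
  fix e :: real assume e: "0 < e"
  obtain s where s: "0 < s" "\<And>\<rho> c. density_mat (d ^ k) \<rho> \<Longrightarrow> c + \<delta> \<le> Re (mtrace (\<rho> * spec (d ^ k) W x)) \<Longrightarrow>
    Re (mtrace (\<rho> * spec (d ^ k) W (\<lambda>i. exp (- s * x i)))) \<le> exp (- s * c - s * \<delta> / 2)"
    using chernoff_block[OF W dl, of x] by blast
  define z where "z = c - ln C"
  have divlim: "filterlim (\<lambda>n. n div k) at_top sequentially"
    unfolding filterlim_at_top
  proof
    fix Z :: nat
    show "eventually (\<lambda>n. Z \<le> n div k) sequentially"
      using eventually_ge_at_top[of "Z * k"] by eventually_elim (use k in \<open>simp add: less_eq_div_iff_mult_less_eq\<close>)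
  qed
  have "filterlim (\<lambda>n. real (n div k) * (s * \<delta> / 2)) at_top sequentially"
    using s dl by (intro filterlim_at_top_mult_tendsto_pos[OF tendsto_const _ filterlim_compose[OF filterlim_real_sequentially divlim]]) auto
  then have ev1: "eventually (\<lambda>n. - ln e \<le> real (n div k) * (s * \<delta> / 2)) sequentially" unfolding filterlim_at_top by blast
  have "filterlim (\<lambda>n. real n * (z / real k - y)) at_top sequentially"
    using y k by (intro filterlim_at_top_mult_tendsto_pos[OF tendsto_const _ filterlim_real_sequentially]) (auto simp: z_def field_simps)
  \<comment> \<open>Fewer than k factors are left over, so replacing n / k by the number of blocks
    costs at most \<bar>z\<bar>.\<close>
  then have ev2: "eventually (\<lambda>n. \<bar>z\<bar> \<le> real n * (z / real k - y)) sequentially" unfolding filterlim_at_top by blast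
  from ev1 ev2 show "eventually (\<lambda>n. \<exists>E. is_test (d ^ n) E \<and> (\<forall>\<rho>\<in>tensor_list ` LA n. Re (mtrace (\<rho> * (1\<^sub>m (d ^ n) - E))) \<le> e) \<and>
     (\<forall>\<sigma>\<in>tensor_list ` LB n. Re (mtrace (\<sigma> * E)) \<le> exp (- (real n * y)))) sequentially"
  proof eventually_elim
    case (elim n)
    define m where "m = n div k"
    define r where "r = n mod k"
    have n: "n = k * m + r" by (simp add: m_def r_def)
    have jm: "k * Suc j \<le> n" if "j < m" for j
    proof -
      have "k * Suc j \<le> k * m" using that by (intro mult_left_mono) auto
      then show ?thesis using n by simp
    qed
    obtain U g where U: "unitary_mat (d ^ n) U" "\<And>i. 0 < g i"
      and pow: "\<And>t c Ms. (\<forall>M\<in>set Ms. density_mat d M) \<Longrightarrow> length Ms = n \<Longrightarrow>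
      (\<And>j. j < m \<Longrightarrow> Re (mtrace (tensor_list (take k (drop (k * j) Ms)) * spec (d ^ k) W (\<lambda>i. exp (t * x i)))) \<le> c) \<Longrightarrow>
      Re (mtrace (tensor_list Ms * spec (d ^ n) U (\<lambda>i. g i powr t))) \<le> c ^ m"
      using block_power[OF W, of m r x] unfolding n[symmetric] by blast
    have Uc: "U \<in> carrier_mat (d ^ n) (d ^ n)" using U by (simp add: unitary_carrier)
    \<comment> \<open>Accept where the product of the exponentiated observables reaches exp (m c).
      Markov's inequality bounds the first error with the power -s and the second with the power
      1.\<close>
    define b where "b i = (if exp (real m * c) \<le> g i then 1 else (0::real))" for i
    define E where "E = spec (d ^ n) U b"
    have E: "is_test (d ^ n) E" unfolding E_def by (rule test_specI[OF U(1)]) (auto simp: b_def)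
    have trle: "Re (mtrace (tensor_list Ms * spec (d ^ n) U f)) \<le> K * Re (mtrace (tensor_list Ms * spec (d ^ n) U h))"
      if Ms: "length Ms = n" "\<forall>M\<in>set Ms. density_mat d M" and fh: "\<And>i. f i \<le> K * h i" for Ms f h K
    proof -
      have t: "density_mat (d ^ n) (tensor_list Ms)" using tensor_list_density[OF Ms(2)] Ms(1) by simp
      show ?thesis
        unfolding mtrace_density_spec(1)[OF t Uc] Re_complex_of_real sum_distrib_left
      proof (intro sum_mono)
        fix j
        show "Re (qfc (d ^ n) (tensor_list Ms) (colf U j)) * f j \<le> K * (Re (qfc (d ^ n) (tensor_list Ms) (colf U j)) * h j)"
          using mult_left_mono[OF fh density_col_weights(1)[OF t U(1)], of j] by (simp add: mult_ac)
      qed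
    qed
    have I: "Re (mtrace (tensor_list Ms * (1\<^sub>m (d ^ n) - E))) \<le> e" if "Ms \<in> LA n" for Ms
    proof -
      note A = LA[OF that]
      have dens: "\<forall>M\<in>set Ms. density_mat d M" and len: "length Ms = n" using A by auto
      have blk: "Re (mtrace (tensor_list (take k (drop (k * j) Ms)) * spec (d ^ k) W (\<lambda>i. exp (- s * x i)))) \<le> exp (- s * c - s * \<delta> / 2)"
        if j: "j < m" for j
      proof (rule s(2))
        have "\<forall>M\<in>set (take k (drop (k * j) Ms)). density_mat d M" using dens by (auto dest: in_set_takeD in_set_dropD)
        moreover have "length (take k (drop (k * j) Ms)) = k" using jm[OF j] len by simp
        ultimately show "density_mat (d ^ k) (tensor_list (take k (drop (k * j) Ms)))"
          using tensor_list_density[of "take k (drop (k * j) Ms)" d] by simp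
        show "c + \<delta> \<le> Re (mtrace (tensor_list (take k (drop (k * j) Ms)) * spec (d ^ k) W x))" using A jm[OF j] by blast
      qed
      have F: "1\<^sub>m (d ^ n) - E = spec (d ^ n) U (\<lambda>i. 1 - b i)" unfolding E_def by (rule one_minus_spec[OF U(1)])
      have "Re (mtrace (tensor_list Ms * (1\<^sub>m (d ^ n) - E))) \<le> exp (s * (real m * c)) * Re (mtrace (tensor_list Ms * spec (d ^ n) U (\<lambda>i. g i powr (- s))))"
        unfolding F
      proof (rule trle[OF len dens])
        fix i
        show "1 - b i \<le> exp (s * (real m * c)) * g i powr (- s)"
        proof (cases "exp (real m * c) \<le> g i")
          case False
          have "g i powr s \<le> exp (real m * c) powr s" using False U(2)[of i] s(1) by (intro powr_mono2) auto
          also have "\<dots> = exp (s * (real m * c))" by (simp add: exp_powr_real mult.commute)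
          finally have "1 \<le> exp (s * (real m * c)) / g i powr s" using U(2)[of i] by (simp add: le_divide_eq)
          then show ?thesis using False by (simp add: b_def powr_minus divide_inverse)
        qed (simp add: b_def)
      qed
      also have "\<dots> \<le> exp (s * (real m * c)) * exp (- s * c - s * \<delta> / 2) ^ m"
        by (intro mult_left_mono pow dens len blk) auto
      also have "\<dots> = exp (- (real m * (s * \<delta> / 2)))"
        by (simp add: exp_of_nat_mult[symmetric] exp_add[symmetric] algebra_simps)
      also have "\<dots> \<le> exp (ln e)" using elim(1) by (subst exp_le_cancel_iff) (simp add: m_def)
      also have "\<dots> = e" using e by simp
      finally show ?thesis .
    qed
    have II: "Re (mtrace (tensor_list Ms * E)) \<le> exp (- (real n * y))" if "Ms \<in> LB n" for Ms
    proof -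
      note B = LB[OF that]
      have dens: "\<forall>M\<in>set Ms. density_mat d M" and len: "length Ms = n" using B by auto
      have blk: "Re (mtrace (tensor_list (take k (drop (k * j) Ms)) * spec (d ^ k) W (\<lambda>i. exp (1 * x i)))) \<le> C"
        if j: "j < m" for j using B jm[OF j] by simp
      have "Re (mtrace (tensor_list Ms * E)) \<le> exp (- (real m * c)) * Re (mtrace (tensor_list Ms * spec (d ^ n) U (\<lambda>i. g i powr 1)))"
        unfolding E_def
      proof (rule trle[OF len dens])
        fix i
        show "b i \<le> exp (- (real m * c)) * g i powr 1"
          using U(2)[of i] by (auto simp: b_def exp_minus field_simps)
      qed
      also have "\<dots> \<le> exp (- (real m * c)) * C ^ m" by (intro mult_left_mono pow dens len blk) auto
      also have "\<dots> = exp (- (real m * z))"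
      proof -
        have "C ^ m = exp (real m * ln C)" using C by (simp add: exp_of_nat_mult)
        then show ?thesis by (simp add: z_def exp_add[symmetric] algebra_simps)
      qed
      also have "\<dots> \<le> exp (- (real n * y))"
      proof (subst exp_le_cancel_iff)
        have "real n * z / real k - real m * z = real r / real k * z"
          using k n by (simp add: field_simps)
        also have "\<dots> \<le> 1 * \<bar>z\<bar>"
        proof -
          have "real r / real k \<le> 1" using k by (simp add: r_def less_imp_le)
          then have "real r / real k * \<bar>z\<bar> \<le> 1 * \<bar>z\<bar>" by (intro mult_right_mono) auto
          moreover have "real r / real k * z \<le> real r / real k * \<bar>z\<bar>" by (intro mult_left_mono) auto
          ultimately show ?thesis by (rule order.trans[rotated])
        qed
        finally show "- (real m * z) \<le> - (real n * y)" using elim(2) by (simp add: algebra_simps)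
      qed
      finally show ?thesis .
    qed
    show ?case using E I II by blast
  qed
qed

section \<open>Stein exponents for i.i.d. alternatives\<close>

lemma ereal_le_realI:
  assumes "\<And>x. ereal x < a \<Longrightarrow> ereal x \<le> b" shows "a \<le> b"
proof (rule dense_le)
  fix z assume "z < a"
  then show "z \<le> b" using assms by (cases z) auto
qed

text \<open>The cost in the exponent of one block: the first term for passing from the mixture to
  single i.i.d. states, the second for pinching.\<close>

definition loss :: "nat \<Rightarrow> nat \<Rightarrow> real" where
  "loss d n = ln (univ_const d n) + ln (real (spanner_dim d n))"

definition universal :: "(complex^'d::finite^'d) set \<Rightarrow> (complex^'d^'d) measure \<Rightarrow> bool" where
  "universal B \<mu> \<longleftrightarrow> \<mu> \<in> prob_on B \<and> (\<forall>n. \<forall>\<sigma>\<in>B. \<forall>Z. psd_mat (CARD('d) ^ n) Z \<longrightarrow>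
    Re (mtrace (tpow n (to_mat \<sigma>) * Z)) \<le> univ_const CARD('d) n * Re (mtrace (mixture n \<mu> * Z)))"

text \<open>The moment bound 1 under the mixture becomes \<open>univ_const\<close> under each i.i.d.
  state by universality. Adding ln \<open>univ_const\<close> to the demanded expectation makes up
  for it, so the net gain per block stays at \<open>z\<close>.\<close>

lemma block_observable_mixture:
  fixes B :: "(complex^'d::finite^'d) set"
  defines "d \<equiv> CARD('d)"
  assumes B: "B \<subseteq> dens" and mu: "universal B \<mu>"
    and S: "S \<noteq> {}" "convmat S" "seqcomp (d ^ k) S" "\<And>\<rho>. \<rho> \<in> S \<Longrightarrow> density_mat (d ^ k) \<rho>"
    and gt: "\<And>\<rho>. \<rho> \<in> S \<Longrightarrow> ereal (z + loss d k) < rel_ent (d ^ k) \<rho> (mixture k \<mu>)" and dl: "0 < \<delta>"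
  shows "\<exists>W x. unitary_mat (d ^ k) W \<and>
    (\<forall>\<sigma>\<in>B. Re (mtrace (tpow k (to_mat \<sigma>) * spec (d ^ k) W (\<lambda>i. exp (x i)))) \<le> univ_const d k) \<and>
    (\<forall>\<rho>\<in>S. z + ln (univ_const d k) - \<delta> \<le> Re (mtrace (\<rho> * spec (d ^ k) W x)))"
proof -
  have mp: "\<mu> \<in> prob_on B" using mu by (simp add: universal_def)
  have dpos: "0 < d ^ k" by (simp add: d_def)
  have tau: "density_mat (d ^ k) (mixture k \<mu>)" unfolding d_def by (rule mixture_density[OF mp B])
  then obtain V s where V: "unitary_mat (d ^ k) V" "mixture k \<mu> = spec (d ^ k) V s" by (rule density_obtain_spec) auto
  have "card (s ` {..<d ^ k}) \<le> spanner_dim d k"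
    unfolding spanner_dim_def using mixture_perm_inv[OF mp B, of k] V unfolding d_def
    by (intro perm_inv_eigenvalue_count) auto
  moreover have "0 < card (s ` {..<d ^ k})" using dpos by (auto simp: card_gt_0_iff lessThan_empty_iff)
  ultimately have lv: "ln (real (card (s ` {..<d ^ k}))) \<le> ln (real (spanner_dim d k))" by (subst ln_le_cancel_iff) auto
  have "\<exists>W x. unitary_mat (d ^ k) W \<and> Re (mtrace (spec (d ^ k) V s * spec (d ^ k) W (\<lambda>j. exp (x j)))) \<le> 1 \<and>
    (\<forall>\<rho>\<in>S. (z + ln (univ_const d k)) - \<delta> \<le> Re (mtrace (\<rho> * spec (d ^ k) W x)))"
  proof (rule block_observable[OF dpos V(1) _ S _ dl])
    show "density_mat (d ^ k) (spec (d ^ k) V s)" using tau V(2) by simp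
    fix \<rho> assume "\<rho> \<in> S"
    then have "ereal (z + loss d k) < rel_ent (d ^ k) \<rho> (spec (d ^ k) V s)" using gt V(2) by simp
    moreover have "ereal (z + ln (univ_const d k) + ln (real (card (s ` {..<d ^ k})))) \<le> ereal (z + loss d k)"
      using lv by (simp add: loss_def)
    ultimately show "ereal (z + ln (univ_const d k) + ln (real (card (s ` {..<d ^ k})))) < rel_ent (d ^ k) \<rho> (spec (d ^ k) V s)"
      by (rule order.strict_trans1[rotated])
  qed
  then obtain W x where W: "unitary_mat (d ^ k) W" "Re (mtrace (mixture k \<mu> * spec (d ^ k) W (\<lambda>j. exp (x j)))) \<le> 1"
    "\<forall>\<rho>\<in>S. (z + ln (univ_const d k)) - \<delta> \<le> Re (mtrace (\<rho> * spec (d ^ k) W x))" unfolding V(2) by blast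
  have p: "psd_mat (d ^ k) (spec (d ^ k) W (\<lambda>i. exp (x i)))" using W(1) by (simp add: psd_spec_iff)
  have "Re (mtrace (tpow k (to_mat \<sigma>) * spec (d ^ k) W (\<lambda>i. exp (x i)))) \<le> univ_const d k" if s: "\<sigma> \<in> B" for \<sigma>
  proof -
    have "Re (mtrace (tpow k (to_mat \<sigma>) * spec (d ^ k) W (\<lambda>i. exp (x i))))
        \<le> univ_const d k * Re (mtrace (mixture k \<mu> * spec (d ^ k) W (\<lambda>i. exp (x i))))"
      using mu s p unfolding universal_def d_def by blast
    also have "\<dots> \<le> univ_const d k * 1" using W(2) univ_const_pos[of d k] by (intro mult_left_mono) auto
    finally show ?thesis by simp
  qed
  then show ?thesis using W(1,3) by blast
qed

lemma iid_seq_tensor: "iid_seq F n = tensor_list ` ((\<lambda>\<sigma>. replicate n (to_mat \<sigma>)) ` F)"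
  by (auto simp: iid_seq_def tpow_def)

lemma av_seq_tensor: "av_seq F n = tensor_list ` {map to_mat ss | ss. length ss = n \<and> set ss \<subseteq> F}"
  unfolding av_seq_def by blast

lemma iid_seq_density: "F \<subseteq> dens \<Longrightarrow> \<rho> \<in> iid_seq F n \<Longrightarrow> density_mat (CARD('d) ^ n) \<rho>" for F :: "(complex^'d::finite^'d) set"
  using tpow_density by (auto simp: iid_seq_def)

lemma replicate_block: "k * Suc j \<le> n \<Longrightarrow> take k (drop (k * j) (replicate n a)) = replicate k a"
  by (simp add: min_def)

lemma iid_list_blocks:
  fixes F :: "(complex^'d::finite^'d) set"
  assumes "F \<subseteq> dens" "Ms \<in> (\<lambda>\<sigma>. replicate n (to_mat \<sigma>)) ` F" "\<And>\<sigma>. \<sigma> \<in> F \<Longrightarrow> P (tpow k (to_mat \<sigma>))"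
  shows "length Ms = n \<and> (\<forall>M\<in>set Ms. density_mat CARD('d) M) \<and> (\<forall>j. k * Suc j \<le> n \<longrightarrow> P (tensor_list (take k (drop (k * j) Ms))))"
  using assms by (auto intro!: dens_density[OF subsetD[of F]] simp: replicate_block tpow_def set_replicate_conv_if split: if_splits simp del: mult_Suc_right take_replicate drop_replicate)

text \<open>The expectation of the block observable is continuous in the state, so an observable
  built for one \<rho>0 also works on a neighbourhood. This is what compactness needs later.\<close>

lemma iid_local_ach:
  fixes B :: "(complex^'d::finite^'d) set" and \<rho>0 :: "complex^'d^'d"
  defines "d \<equiv> CARD('d)"
  assumes B: "B \<subseteq> dens" and mu: "universal B \<mu>" and k: "0 < k" and r0: "\<rho>0 \<in> dens"
    and gt: "ereal (real k * z + loss d k) < rel_ent (d ^ k) (tpow k (to_mat \<rho>0)) (mixture k \<mu>)" and y: "y < z"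
  shows "\<exists>U. open U \<and> \<rho>0 \<in> U \<and> ach d (iid_seq (U \<inter> dens)) (iid_seq B) y"
proof -
  \<comment> \<open>The gap k (z - y) is 4 \<delta>: one \<delta> is lost in the observable, one in
    the neighbourhood, one in the Chernoff bound, and one keeps the final inequality strict.\<close>
  define \<delta> where "\<delta> = real k * (z - y) / 4"
  have dl: "0 < \<delta>" using k y by (simp add: \<delta>_def)
  let ?S = "{tpow k (to_mat \<rho>0)}"
  have c0: "tpow k (to_mat \<rho>0) \<in> carrier_mat (d ^ k) (d ^ k)" by (simp add: d_def)
  have "convmat ?S"
    unfolding convmat_def using c0 by (auto intro!: eq_matI simp: algebra_simps)
  moreover have "seqcomp (d ^ k) ?S"
    unfolding seqcomp_def by (auto intro!: exI[of _ id] simp: strict_mono_def)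
  ultimately have "\<exists>W x. unitary_mat (d ^ k) W \<and>
    (\<forall>\<sigma>\<in>B. Re (mtrace (tpow k (to_mat \<sigma>) * spec (d ^ k) W (\<lambda>i. exp (x i)))) \<le> univ_const d k) \<and>
    (\<forall>\<rho>\<in>?S. real k * z + ln (univ_const d k) - \<delta> \<le> Re (mtrace (\<rho> * spec (d ^ k) W x)))"
    using gt dl tpow_density[OF r0, of k] unfolding d_def by (intro block_observable_mixture[OF B mu]) auto
  then obtain W x where W: "unitary_mat (d ^ k) W"
    and WB: "\<And>\<sigma>. \<sigma> \<in> B \<Longrightarrow> Re (mtrace (tpow k (to_mat \<sigma>) * spec (d ^ k) W (\<lambda>i. exp (x i)))) \<le> univ_const d k"
    and W0: "real k * z + ln (univ_const d k) - \<delta> \<le> Re (mtrace (tpow k (to_mat \<rho>0) * spec (d ^ k) W x))" by blast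
  have Wc: "W \<in> carrier_mat (d ^ k) (d ^ k)" using W by (rule unitary_carrier)
  define c where "c = real k * z + ln (univ_const d k) - 3 * \<delta>"
  define U where "U = {\<rho> :: complex^'d^'d. c + \<delta> < Re (mtrace (tpow k (to_mat \<rho>) * spec (d ^ k) W x))}"
  have "spec (d ^ k) W x \<in> carrier_mat (CARD('d) ^ k) (CARD('d) ^ k)" using spec_carrier[OF Wc] by (simp add: d_def)
  then have "open U" unfolding U_def by (intro open_Collect_less continuous_on_const tpow_trace_continuous)
  moreover have "\<rho>0 \<in> U" unfolding U_def c_def using W0 dl by simp
  moreover have "ach d (iid_seq (U \<inter> dens)) (iid_seq B) y"
    unfolding iid_seq_tensor
  proof (rule block_ach[OF k W dl univ_const_pos])
    have "4 * \<delta> = real k * z - real k * y" by (simp add: \<delta>_def right_diff_distrib)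
    then show "real k * y < c - ln (univ_const d k)" using dl unfolding c_def by linarith
    show "length Ms = n \<and> (\<forall>M\<in>set Ms. density_mat d M) \<and>
      (\<forall>j. k * Suc j \<le> n \<longrightarrow> c + \<delta> \<le> Re (mtrace (tensor_list (take k (drop (k * j) Ms)) * spec (d ^ k) W x)))"
      if "Ms \<in> (\<lambda>\<sigma>. replicate n (to_mat \<sigma>)) ` (U \<inter> dens)" for n Ms
      unfolding d_def by (rule iid_list_blocks[OF _ that]) (auto simp: U_def d_def)
    show "length Ms = n \<and> (\<forall>M\<in>set Ms. density_mat d M) \<and>
      (\<forall>j. k * Suc j \<le> n \<longrightarrow> Re (mtrace (tensor_list (take k (drop (k * j) Ms)) * spec (d ^ k) W (\<lambda>i. exp (x i)))) \<le> univ_const d k)"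
      if "Ms \<in> (\<lambda>\<sigma>. replicate n (to_mat \<sigma>)) ` B" for n Ms
      unfolding d_def by (rule iid_list_blocks[OF B that]) (use WB in \<open>auto simp: d_def\<close>)
  qed
  ultimately show ?thesis by blast
qed

text \<open>One observable is large on the whole convex hull of k-fold products. Every block of a
  varying product lies in that hull, so blocks need not be alike.\<close>

lemma av_ach:
  fixes A B :: "(complex^'d::finite^'d) set"
  defines "d \<equiv> CARD('d)"
  assumes A: "A \<subseteq> dens" "compact A" "A \<noteq> {}" and B: "B \<subseteq> dens" and mu: "universal B \<mu>" and k: "0 < k"
    and gt: "\<And>\<rho>. \<rho> \<in> mat_co (d ^ k) (av_seq A k) \<Longrightarrow> ereal (real k * z + loss d k) < rel_ent (d ^ k) \<rho> (mixture k \<mu>)" and y: "y < z"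
  shows "ach d (av_seq A) (iid_seq B) y"
proof -
  define \<delta> where "\<delta> = real k * (z - y) / 4"
  have dl: "0 < \<delta>" using k y by (simp add: \<delta>_def)
  let ?S = "mat_co (d ^ k) (av_seq A k)"
  have dA: "\<And>M. M \<in> av_seq A k \<Longrightarrow> density_mat (d ^ k) M" unfolding d_def by (rule av_seq_density[OF A(1)])
  have Ac: "av_seq A k \<subseteq> carrier_mat (d ^ k) (d ^ k)" using dA density_carrier by blast
  obtain a where a: "a \<in> A" using A(3) by blast
  have "tensor_list (map to_mat (replicate k a)) \<in> av_seq A k"
    unfolding av_seq_def using a by (intro CollectI exI[of _ "replicate k a"]) auto
  then have "?S \<noteq> {}" using mat_co_self[OF Ac] by blast
  then have "\<exists>W x. unitary_mat (d ^ k) W \<and>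
    (\<forall>\<sigma>\<in>B. Re (mtrace (tpow k (to_mat \<sigma>) * spec (d ^ k) W (\<lambda>i. exp (x i)))) \<le> univ_const d k) \<and>
    (\<forall>\<rho>\<in>?S. real k * z + ln (univ_const d k) - \<delta> \<le> Re (mtrace (\<rho> * spec (d ^ k) W x)))"
    using gt dl convmat_mat_co[OF Ac] seqcomp_mat_co_av[OF A(1,2), of k] mat_co_density[OF dA] unfolding d_def
    by (intro block_observable_mixture[OF B mu]) blast+
  then obtain W x where W: "unitary_mat (d ^ k) W"
    and WB: "\<And>\<sigma>. \<sigma> \<in> B \<Longrightarrow> Re (mtrace (tpow k (to_mat \<sigma>) * spec (d ^ k) W (\<lambda>i. exp (x i)))) \<le> univ_const d k"
    and W0: "\<And>\<rho>. \<rho> \<in> ?S \<Longrightarrow> real k * z + ln (univ_const d k) - \<delta> \<le> Re (mtrace (\<rho> * spec (d ^ k) W x))" by blast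
  define c where "c = real k * z + ln (univ_const d k) - 2 * \<delta>"
  show ?thesis
    unfolding iid_seq_tensor av_seq_tensor
  proof (rule block_ach[OF k W dl univ_const_pos])
    have "4 * \<delta> = real k * z - real k * y" by (simp add: \<delta>_def right_diff_distrib)
    then show "real k * y < c - ln (univ_const d k)" using dl unfolding c_def by linarith
    show "length Ms = n \<and> (\<forall>M\<in>set Ms. density_mat d M) \<and>
      (\<forall>j. k * Suc j \<le> n \<longrightarrow> c + \<delta> \<le> Re (mtrace (tensor_list (take k (drop (k * j) Ms)) * spec (d ^ k) W x)))"
      if Ms: "Ms \<in> {map to_mat ss | ss. length ss = n \<and> set ss \<subseteq> A}" for n Ms
    proof -
      obtain ss where ss: "Ms = map to_mat ss" "length ss = n" "set ss \<subseteq> A" using Ms by blast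
      have "c + \<delta> \<le> Re (mtrace (tensor_list (take k (drop (k * j) Ms)) * spec (d ^ k) W x))" if j: "k * Suc j \<le> n" for j
      proof -
        have "tensor_list (take k (drop (k * j) Ms)) \<in> av_seq A k"
          unfolding av_seq_def ss(1) take_map drop_map using ss j
          by (intro CollectI exI[of _ "take k (drop (k * j) ss)"]) (auto dest: in_set_takeD in_set_dropD)
        then show ?thesis using W0[OF mat_co_self[OF Ac]] by (simp add: c_def)
      qed
      moreover have "\<forall>M\<in>set Ms. density_mat d M" unfolding d_def ss(1) using ss(3) A(1) dens_density by auto
      ultimately show ?thesis using ss by simp
    qed
    show "length Ms = n \<and> (\<forall>M\<in>set Ms. density_mat d M) \<and>
      (\<forall>j. k * Suc j \<le> n \<longrightarrow> Re (mtrace (tensor_list (take k (drop (k * j) Ms)) * spec (d ^ k) W (\<lambda>i. exp (x i)))) \<le> univ_const d k)"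
      if "Ms \<in> (\<lambda>\<sigma>. replicate n (to_mat \<sigma>)) ` B" for n Ms
      unfolding d_def by (rule iid_list_blocks[OF B that]) (use WB in \<open>auto simp: d_def\<close>)
  qed
qed

text \<open>A finite subcover has a smallest exponent, still strictly above \<open>v\<close>, and
  uniting the tests loses arbitrarily little.\<close>

lemma ach_cover:
  fixes A B :: "(complex^'d::finite^'d) set"
  defines "d \<equiv> CARD('d)"
  assumes A: "A \<subseteq> dens" "compact A" "A \<noteq> {}" and B: "B \<subseteq> dens"
    and loc: "\<And>\<rho>. \<rho> \<in> A \<Longrightarrow> \<exists>U y. open U \<and> \<rho> \<in> U \<and> v < ereal y \<and> ach d (iid_seq (U \<inter> dens)) (iid_seq B) y"
  shows "\<exists>y. v < ereal y \<and> ach d (iid_seq A) (iid_seq B) y"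
proof -
  have "\<forall>\<rho>\<in>A. \<exists>p. open (fst p) \<and> \<rho> \<in> fst p \<and> v < ereal (snd p) \<and> ach d (iid_seq (fst p \<inter> dens)) (iid_seq B) (snd p)"
    using loc by fastforce
  from bchoice[OF this] obtain p where p: "\<And>\<rho>. \<rho> \<in> A \<Longrightarrow> open (fst (p \<rho>)) \<and> \<rho> \<in> fst (p \<rho>) \<and> v < ereal (snd (p \<rho>)) \<and>
    ach d (iid_seq (fst (p \<rho>) \<inter> dens)) (iid_seq B) (snd (p \<rho>))" by blast
  have "A \<subseteq> (\<Union>\<rho>\<in>A. fst (p \<rho>))" using p by blast
  from compactE_image[OF A(2) _ this] p obtain D where D: "D \<subseteq> A" "finite D" "A \<subseteq> (\<Union>\<rho>\<in>D. fst (p \<rho>))" by metis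
  have D0: "D \<noteq> {}" using D(3) A(3) by auto
  define y0 where "y0 = Min ((\<lambda>\<rho>. snd (p \<rho>)) ` D)"
  have "y0 \<in> (\<lambda>\<rho>. snd (p \<rho>)) ` D" unfolding y0_def using D D0 by (intro Min_in) auto
  then have vy0: "v < ereal y0" using p D(1) by auto
  have y0: "y0 \<le> snd (p \<rho>)" if "\<rho> \<in> D" for \<rho> unfolding y0_def using D that by (intro Min_le) auto
  obtain y where y: "v < ereal y" "ereal y < ereal y0" using ereal_dense2[OF vy0] by blast
  have "ach d (\<lambda>n. \<Union>\<rho>\<in>D. iid_seq (fst (p \<rho>) \<inter> dens) n) (iid_seq B) y"
  proof (rule ach_union[OF D(2)])
    show "ach d (iid_seq (fst (p \<rho>) \<inter> dens)) (iid_seq B) y0" if r: "\<rho> \<in> D" for \<rho>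
    proof -
      have "ach d (iid_seq (fst (p \<rho>) \<inter> dens)) (iid_seq B) (snd (p \<rho>))" using p r D(1) by blast
      then show ?thesis by (rule ach_mono) (use y0[OF r] in simp_all)
    qed
    show "y < y0" using y by simp
    show "density_mat (d ^ n) \<rho>" if "\<rho> \<in> iid_seq (fst (p i) \<inter> dens) n" for i n \<rho>
      unfolding d_def by (rule iid_seq_density[OF _ that]) simp
    show "density_mat (d ^ n) \<sigma>" if "\<sigma> \<in> iid_seq B n" for n \<sigma>
      unfolding d_def by (rule iid_seq_density[OF B that])
  qed
  moreover have "iid_seq A n \<subseteq> (\<Union>\<rho>\<in>D. iid_seq (fst (p \<rho>) \<inter> dens) n)" for n
  proof -
    have "A \<subseteq> (\<Union>\<rho>\<in>D. fst (p \<rho>) \<inter> dens)" using D(3) A(1) by blast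
    then show ?thesis unfolding iid_seq_def by blast
  qed
  ultimately have "ach d (iid_seq A) (iid_seq B) y" by (rule ach_mono) auto
  then show ?thesis using y by blast
qed

text \<open>The upper hypothesis is used in contrapositive form: for real u above v, I n is at most
  n u + l n at every positive length, and l n / n tends to 0. Thus a statement about each single
  block length controls the limit superior.\<close>

lemma tendsto_from_bounds:
  fixes I :: "nat \<Rightarrow> ereal" and v :: ereal
  assumes l: "(\<lambda>n. l n / real n) \<longlonglongrightarrow> 0"
    and lower: "v \<le> liminf (\<lambda>n. ereal (1 / real n) * I n)"
    and upper: "\<And>k z. 0 < k \<Longrightarrow> ereal (real k * z + l k) < I k \<Longrightarrow> ereal z \<le> v"
  shows "(\<lambda>n. ereal (1 / real n) * I n) \<longlonglongrightarrow> v"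
proof -
  have "limsup (\<lambda>n. ereal (1 / real n) * I n) \<le> v"
  proof (rule dense_ge)
    fix w assume w: "v < w"
    show "limsup (\<lambda>n. ereal (1 / real n) * I n) \<le> w"
    proof (cases w)
      case (real w0)
      obtain u where u: "v < ereal u" "ereal u < ereal w0" using ereal_dense2[OF w] real by auto
      have "eventually (\<lambda>n. l n / real n < w0 - u) sequentially" using u by (intro order_tendstoD(2)[OF l]) simp
      then have "eventually (\<lambda>n. ereal (1 / real n) * I n \<le> ereal w0) sequentially"
        using eventually_gt_at_top[of 0]
      proof eventually_elim
        case (elim n)
        have "I n \<le> ereal (real n * u + l n)" using upper[OF elim(2), of u] u(1) by (meson leD leI)
        then have "ereal (1 / real n) * I n \<le> ereal (1 / real n) * ereal (real n * u + l n)" by (intro ereal_mult_left_mono) auto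
        also have "\<dots> = ereal (u + l n / real n)" using elim(2) by (simp add: field_simps)
        also have "\<dots> \<le> ereal w0" using elim(1) by simp
        finally show ?case .
      qed
      then show ?thesis using real by (simp add: Limsup_bounded)
    qed (use w in auto)
  qed
  then show ?thesis using lower
    by (metis Liminf_le_Limsup antisym order.trans sequentially_bot tendsto_iff_Liminf_eq_Limsup)
qed

lemma av_seq_nonempty: "A \<noteq> {} \<Longrightarrow> av_seq A n \<noteq> {}"
proof -
  assume "A \<noteq> {}"
  then obtain a where "a \<in> A" by blast
  then have "tensor_list (map to_mat (replicate n a)) \<in> av_seq A n"
    unfolding av_seq_def by (intro CollectI exI[of _ "replicate n a"]) (auto simp: set_replicate_conv_if)
  then show ?thesis by blast
qed

context
  fixes A B :: "(complex^'d::finite^'d) set" and d :: nat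
  assumes d: "d = CARD('d)" and A: "A \<subseteq> dens" "A \<noteq> {}" "compact A" and B: "B \<subseteq> dens" "B \<noteq> {}"
begin

lemma iid_nonempty: "iid_seq A n \<noteq> {}" "iid_seq B n \<noteq> {}"
  using A B by (auto simp: iid_seq_def)

lemma iid_dens: "\<rho> \<in> iid_seq A n \<Longrightarrow> density_mat (d ^ n) \<rho>" "\<rho> \<in> iid_seq B n \<Longrightarrow> density_mat (d ^ n) \<rho>"
  using iid_seq_density[OF A(1)] iid_seq_density[OF B(1)] by (auto simp: d)

lemma av_dens: "\<rho> \<in> av_seq A n \<Longrightarrow> density_mat (d ^ n) \<rho>"
  using av_seq_density[OF A(1)] by (simp add: d)

lemma stein_iid_ge: "ach d (iid_seq A) (iid_seq B) x \<Longrightarrow> ereal x \<le> stein d (iid_seq A) (iid_seq B)"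
  by (rule ach_imp_le_stein) (use iid_nonempty(1) iid_nonempty(2) iid_dens in auto)

lemma stein_iid_less: "ereal x < stein d (iid_seq A) (iid_seq B) \<Longrightarrow> ach d (iid_seq A) (iid_seq B) x"
  by (rule less_stein_imp_ach) (use iid_nonempty(1) iid_nonempty(2) iid_dens in auto)

lemma stein_av_ge: "ach d (av_seq A) (iid_seq B) x \<Longrightarrow> ereal x \<le> stein d (av_seq A) (iid_seq B)"
  by (rule ach_imp_le_stein) (use av_seq_nonempty[OF A(2)] av_dens iid_nonempty(2) iid_dens in auto)

lemma stein_av_less: "ereal x < stein d (av_seq A) (iid_seq B) \<Longrightarrow> ach d (av_seq A) (iid_seq B) x"
  by (rule less_stein_imp_ach) (use av_seq_nonempty[OF A(2)] av_dens iid_nonempty(2) iid_dens in auto)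

lemma mixture_dom:
  assumes mu: "\<mu> \<in> prob_on B" and E: "is_test (d ^ n) E" and le: "\<forall>\<sigma>\<in>iid_seq B n. Re (mtrace (\<sigma> * E)) \<le> b"
  shows "Re (mtrace (mixture n \<mu> * E)) \<le> b"
proof -
  interpret prob_space \<mu> using prob_onD(1)[OF mu] .
  have Ec: "E \<in> carrier_mat (CARD('d) ^ n) (CARD('d) ^ n)" using is_test_carrier[OF E] by (simp add: d)
  show ?thesis unfolding mixture_trace(1)[OF mu B(1) Ec]
    using le prob_onD(2)[OF mu] by (intro integral_le_const mixture_trace(2)[OF mu B(1) Ec] AE_I2) (auto simp: iid_seq_def)
qed

text \<open>A test against all i.i.d. states is a test against their mixture by linearity, so the
  converse applies to every measure, whether or not its limit exists.\<close>

lemma lower_bound: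
  assumes mu: "\<mu> \<in> prob_on B" and N: "\<And>n \<rho>. \<rho> \<in> N n \<Longrightarrow> density_mat (d ^ n) \<rho>"
    and R: "\<And>n. R n \<subseteq> mat_co (d ^ n) (N n)" and less: "\<And>x. ereal x < v \<Longrightarrow> ach d N (iid_seq B) x"
  shows "v \<le> liminf (\<lambda>n. ereal (1 / real n) * (INF \<rho>\<in>R n. rel_ent (d ^ n) \<rho> (mixture n \<mu>)))"
proof (rule ereal_le_realI)
  fix x assume "ereal x < v"
  show "ereal x \<le> liminf (\<lambda>n. ereal (1 / real n) * (INF \<rho>\<in>R n. rel_ent (d ^ n) \<rho> (mixture n \<mu>)))"
  proof (rule ach_le_liminf_rel_ent[where A = N and B = "iid_seq B"])
    show "ach d N (iid_seq B) x" using less[OF \<open>ereal x < v\<close>] .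
    show "density_mat (d ^ n) \<rho>" if "\<rho> \<in> N n" for n \<rho> using N[OF that] .
    show "R n \<subseteq> mat_co (d ^ n) (N n)" for n by (rule R)
    show "density_mat (d ^ n) (mixture n \<mu>)" for n unfolding d by (rule mixture_density[OF mu B(1)])
    show "Re (mtrace (mixture n \<mu> * E)) \<le> b" if "is_test (d ^ n) E" "\<forall>\<sigma>\<in>iid_seq B n. Re (mtrace (\<sigma> * E)) \<le> b" for n E b
      by (rule mixture_dom[OF mu that])
  qed
qed

lemma iid_sub: "F \<subseteq> A \<Longrightarrow> (\<lambda>\<rho>. tpow n (to_mat \<rho>)) ` F \<subseteq> mat_co (d ^ n) (iid_seq A n)"
proof -
  assume F: "F \<subseteq> A"
  have "iid_seq A n \<subseteq> carrier_mat (d ^ n) (d ^ n)" using iid_dens(1) density_carrier by blast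
  then show ?thesis using mat_co_self F unfolding iid_seq_def by blast
qed

lemma lower_iid:
  assumes "\<mu> \<in> prob_on B" "F \<subseteq> A"
  shows "stein d (iid_seq A) (iid_seq B) \<le> liminf (\<lambda>n. ereal (1 / real n) * (INF \<rho>\<in>F. rel_ent (d ^ n) (tpow n (to_mat \<rho>)) (mixture n \<mu>)))"
proof -
  have "stein d (iid_seq A) (iid_seq B) \<le> liminf (\<lambda>n. ereal (1 / real n) * (INF \<rho>\<in>(\<lambda>\<rho>. tpow n (to_mat \<rho>)) ` F. rel_ent (d ^ n) \<rho> (mixture n \<mu>)))"
  proof (rule lower_bound[OF assms(1)])
    show "density_mat (d ^ n) \<rho>" if "\<rho> \<in> iid_seq A n" for n \<rho> using that by (rule iid_dens(1))
    show "(\<lambda>\<rho>. tpow n (to_mat \<rho>)) ` F \<subseteq> mat_co (d ^ n) (iid_seq A n)" for n by (rule iid_sub[OF assms(2)])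
    show "ach d (iid_seq A) (iid_seq B) x" if "ereal x < stein d (iid_seq A) (iid_seq B)" for x using that by (rule stein_iid_less)
  qed
  then show ?thesis by (simp add: image_image)
qed

lemma lower_av:
  assumes "\<mu> \<in> prob_on B"
  shows "stein d (av_seq A) (iid_seq B) \<le> liminf (\<lambda>n. ereal (1 / real n) * (INF \<rho>\<in>mat_co (d ^ n) (av_seq A n). rel_ent (d ^ n) \<rho> (mixture n \<mu>)))"
proof (rule lower_bound[OF assms])
  show "density_mat (d ^ n) \<rho>" if "\<rho> \<in> av_seq A n" for n \<rho> using that by (rule av_dens)
  show "ach d (av_seq A) (iid_seq B) x" if "ereal x < stein d (av_seq A) (iid_seq B)" for x using that by (rule stein_av_less)
qed auto

lemma loss_lim: "(\<lambda>n. loss d n / real n) \<longlonglongrightarrow> 0"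
  unfolding loss_def by (rule univ_loss_subexponential)

lemma universal_exists: "\<exists>\<mu>. universal B \<mu>"
  using universal_measure[OF B] unfolding universal_def by blast

text \<open>If at some block length every null state exceeds k z + \<open>loss\<close>, each has a
  neighbourhood with exponent close to z, and a finite cover unites the tests. So the universal
  measure attains the minimum.\<close>

theorem iid_iid_min:
  "is_min_star (prob_on B)
      (\<lambda>\<mu> n. ereal (1 / real n) * (INF \<rho>\<in>A. rel_ent (d ^ n) (tpow n (to_mat \<rho>)) (mixture n \<mu>)))
      (stein d (iid_seq A) (iid_seq B))"
proof -
  obtain \<mu> where mu: "universal B \<mu>" using universal_exists by blast
  then have mp: "\<mu> \<in> prob_on B" by (simp add: universal_def)
  have "(\<lambda>n. ereal (1 / real n) * (INF \<rho>\<in>A. rel_ent (d ^ n) (tpow n (to_mat \<rho>)) (mixture n \<mu>))) \<longlonglongrightarrow> stein d (iid_seq A) (iid_seq B)"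
  proof (rule tendsto_from_bounds[OF loss_lim lower_iid[OF mp order.refl]])
    fix k z assume k: "0 < k" and lt: "ereal (real k * z + loss d k) < (INF \<rho>\<in>A. rel_ent (d ^ k) (tpow k (to_mat \<rho>)) (mixture k \<mu>))"
    show "ereal z \<le> stein d (iid_seq A) (iid_seq B)"
    proof (rule ereal_le_realI)
      fix y' assume y': "ereal y' < ereal z"
      obtain y where y: "y' < y" "y < z" using y' dense by auto
      have "\<exists>U y. open U \<and> \<rho> \<in> U \<and> ereal y' < ereal y \<and> ach CARD('d) (iid_seq (U \<inter> dens)) (iid_seq B) y" if r: "\<rho> \<in> A" for \<rho>
      proof -
        have "ereal (real k * z + loss CARD('d) k) < rel_ent (CARD('d) ^ k) (tpow k (to_mat \<rho>)) (mixture k \<mu>)"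
          using lt r unfolding d by (rule order.strict_trans2[OF _ INF_lower])
        from iid_local_ach[OF B(1) mu k _ this y(2)] r A(1) y(1) show ?thesis by auto
      qed
      from ach_cover[OF A(1,3,2) B(1) this] obtain y2 where "ereal y' < ereal y2" "ach d (iid_seq A) (iid_seq B) y2" unfolding d by blast
      then show "ereal y' \<le> stein d (iid_seq A) (iid_seq B)" using stein_iid_ge by (meson less_imp_le order.trans)
    qed
  qed
  moreover have "stein d (iid_seq A) (iid_seq B) \<le> L"
    if "\<mu>' \<in> prob_on B" "(\<lambda>n. ereal (1 / real n) * (INF \<rho>\<in>A. rel_ent (d ^ n) (tpow n (to_mat \<rho>)) (mixture n \<mu>'))) \<longlonglongrightarrow> L" for \<mu>' L
    using lower_iid[OF that(1) order.refl] lim_imp_Liminf[OF _ that(2)] by simp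
  ultimately show ?thesis unfolding is_min_star_def using mp by blast
qed

text \<open>Here the block observable already serves the whole hull of null states, so no covering
  is required.\<close>

theorem av_iid_min:
  "is_min_star (prob_on B)
      (\<lambda>\<mu> n. ereal (1 / real n) * (INF \<rho>\<in>mat_co (d ^ n) (av_seq A n). rel_ent (d ^ n) \<rho> (mixture n \<mu>)))
      (stein d (av_seq A) (iid_seq B))"
proof -
  obtain \<mu> where mu: "universal B \<mu>" using universal_exists by blast
  then have mp: "\<mu> \<in> prob_on B" by (simp add: universal_def)
  have "(\<lambda>n. ereal (1 / real n) * (INF \<rho>\<in>mat_co (d ^ n) (av_seq A n). rel_ent (d ^ n) \<rho> (mixture n \<mu>))) \<longlonglongrightarrow> stein d (av_seq A) (iid_seq B)"
  proof (rule tendsto_from_bounds[OF loss_lim lower_av[OF mp]])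
    fix k z assume k: "0 < k" and lt: "ereal (real k * z + loss d k) < (INF \<rho>\<in>mat_co (d ^ k) (av_seq A k). rel_ent (d ^ k) \<rho> (mixture k \<mu>))"
    show "ereal z \<le> stein d (av_seq A) (iid_seq B)"
    proof (rule ereal_le_realI)
      fix y assume y: "ereal y < ereal z"
      have "ereal (real k * z + loss CARD('d) k) < rel_ent (CARD('d) ^ k) \<rho> (mixture k \<mu>)"
        if "\<rho> \<in> mat_co (CARD('d) ^ k) (av_seq A k)" for \<rho>
        using lt that unfolding d by (rule order.strict_trans2[OF _ INF_lower])
      from av_ach[OF A(1,3,2) B(1) mu k this, of y] y have "ach d (av_seq A) (iid_seq B) y" by (simp add: d)
      then show "ereal y \<le> stein d (av_seq A) (iid_seq B)" by (rule stein_av_ge)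
    qed
  qed
  moreover have "stein d (av_seq A) (iid_seq B) \<le> L"
    if "\<mu>' \<in> prob_on B" "(\<lambda>n. ereal (1 / real n) * (INF \<rho>\<in>mat_co (d ^ n) (av_seq A n). rel_ent (d ^ n) \<rho> (mixture n \<mu>'))) \<longlonglongrightarrow> L" for \<mu>' L
    using lower_av[OF that(1)] lim_imp_Liminf[OF _ that(2)] by simp
  ultimately show ?thesis unfolding is_min_star_def using mp by blast
qed

text \<open>By compactness some single \<open>\<rho>\<close> attains the exponent: otherwise every \<open>\<rho>\<close> would have a neighbourhood with a
  strictly better exponent, and finitely many of the corresponding tests could be combined.\<close>
theorem iid_iid_pair_min:
  "is_min_star (A \<times> prob_on B)
      (\<lambda>(\<rho>, \<mu>) n. ereal (1 / real n) * rel_ent (d ^ n) (tpow n (to_mat \<rho>)) (mixture n \<mu>))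
      (stein d (iid_seq A) (iid_seq B))"
proof -
  let ?v = "stein d (iid_seq A) (iid_seq B)"
  obtain \<mu> where mu: "universal B \<mu>" using universal_exists by blast
  then have mp: "\<mu> \<in> prob_on B" by (simp add: universal_def)
  \<comment> \<open>The chosen \<rho> must satisfy the upper bound at all block lengths
    simultaneously; only then does its own sequence converge.\<close>
  have "\<exists>\<rho>\<in>A. \<forall>k z. 0 < k \<longrightarrow> ereal (real k * z + loss d k) < rel_ent (d ^ k) (tpow k (to_mat \<rho>)) (mixture k \<mu>) \<longrightarrow> ereal z \<le> ?v"
  proof (rule ccontr)
    assume neg: "\<not> ?thesis"
    have "\<exists>U y. open U \<and> \<rho> \<in> U \<and> ?v < ereal y \<and> ach CARD('d) (iid_seq (U \<inter> dens)) (iid_seq B) y" if r: "\<rho> \<in> A" for \<rho>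
    proof -
      obtain k z where kz: "0 < k" "ereal (real k * z + loss d k) < rel_ent (d ^ k) (tpow k (to_mat \<rho>)) (mixture k \<mu>)" "?v < ereal z"
        using neg r by (meson not_le)
      obtain y where y: "?v < ereal y" "ereal y < ereal z" using ereal_dense2[OF kz(3)] by blast
      from iid_local_ach[OF B(1) mu kz(1) _ kz(2)[unfolded d], of y] r A(1) y show ?thesis by auto
    qed
    from ach_cover[OF A(1,3,2) B(1) this] obtain y2 where "?v < ereal y2" "ach d (iid_seq A) (iid_seq B) y2" unfolding d by blast
    then show False using stein_iid_ge by (meson leD)
  qed
  then obtain \<rho> where r: "\<rho> \<in> A" "\<And>k z. 0 < k \<Longrightarrow> ereal (real k * z + loss d k) < rel_ent (d ^ k) (tpow k (to_mat \<rho>)) (mixture k \<mu>) \<Longrightarrow> ereal z \<le> ?v"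
    by blast
  have low: "?v \<le> liminf (\<lambda>n. ereal (1 / real n) * rel_ent (d ^ n) (tpow n (to_mat \<rho>')) (mixture n \<mu>'))"
    if "\<rho>' \<in> A" "\<mu>' \<in> prob_on B" for \<rho>' \<mu>' using lower_iid[OF that(2), of "{\<rho>'}"] that(1) by simp
  have "(\<lambda>n. ereal (1 / real n) * rel_ent (d ^ n) (tpow n (to_mat \<rho>)) (mixture n \<mu>)) \<longlonglongrightarrow> ?v"
    by (rule tendsto_from_bounds[OF loss_lim low[OF r(1) mp]]) (rule r(2))
  moreover have "?v \<le> L" if "\<rho>' \<in> A" "\<mu>' \<in> prob_on B"
    "(\<lambda>n. ereal (1 / real n) * rel_ent (d ^ n) (tpow n (to_mat \<rho>')) (mixture n \<mu>')) \<longlonglongrightarrow> L" for \<rho>' \<mu>' L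
    using low[OF that(1,2)] lim_imp_Liminf[OF _ that(3)] by simp
  ultimately show ?thesis unfolding is_min_star_def using mp r(1) by (auto intro!: bexI[of _ "(\<rho>, \<mu>)"])
qed

end

section \<open>Arbitrarily varying alternatives\<close>

definition val :: "complex Matrix.mat \<Rightarrow> (complex^'d::finite^'d) list \<Rightarrow> real" where
  "val E ss = Re (mtrace (tensor_list (map to_mat ss) * E))"

lemma tensor_lincomb:
  fixes x y :: "complex^'d::finite^'d"
  assumes k: "k < length ss"
  shows "tensor_list (map to_mat (ss[k := a *\<^sub>R x + b *\<^sub>R y])) =
    complex_of_real a \<cdot>\<^sub>m tensor_list (map to_mat (ss[k := x])) + complex_of_real b \<cdot>\<^sub>m tensor_list (map to_mat (ss[k := y]))"
proof (rule eq_matI)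
  let ?N = "CARD('d) ^ length ss"
  have c: "tensor_list (map to_mat (ss[k := z])) \<in> carrier_mat ?N ?N" for z using tensor_to_mat_carrier[of "ss[k := z]"] by simp
  fix i j assume "i < dim_row (complex_of_real a \<cdot>\<^sub>m tensor_list (map to_mat (ss[k := x])) + complex_of_real b \<cdot>\<^sub>m tensor_list (map to_mat (ss[k := y])))"
    "j < dim_col (complex_of_real a \<cdot>\<^sub>m tensor_list (map to_mat (ss[k := x])) + complex_of_real b \<cdot>\<^sub>m tensor_list (map to_mat (ss[k := y])))"
  then have ij: "i < ?N" "j < ?N" using c[of y] by auto
  let ?I = "\<lambda>l. idx (digs CARD('d) (length ss) i ! l) :: 'd" and ?J = "\<lambda>l. idx (digs CARD('d) (length ss) j ! l) :: 'd"
  have e: "tensor_list (map to_mat (ss[k := z])) $$ (i, j) = z $ ?I k $ ?J k * (\<Prod>l\<in>{..<length ss} - {k}. ss ! l $ ?I l $ ?J l)" for z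
  proof -
    have "tensor_list (map to_mat (ss[k := z])) $$ (i, j) = (\<Prod>l<length ss. ss[k := z] ! l $ ?I l $ ?J l)"
      using tensor_to_mat_index[of i "ss[k := z]" j] ij by simp
    also have "\<dots> = ss[k := z] ! k $ ?I k $ ?J k * (\<Prod>l\<in>{..<length ss} - {k}. ss[k := z] ! l $ ?I l $ ?J l)"
      using k by (intro prod.remove) auto
    also have "(\<Prod>l\<in>{..<length ss} - {k}. ss[k := z] ! l $ ?I l $ ?J l) = (\<Prod>l\<in>{..<length ss} - {k}. ss ! l $ ?I l $ ?J l)"
      by (intro prod.cong refl) auto
    finally show ?thesis using k by simp
  qed
  have "(complex_of_real a \<cdot>\<^sub>m tensor_list (map to_mat (ss[k := x])) + complex_of_real b \<cdot>\<^sub>m tensor_list (map to_mat (ss[k := y]))) $$ (i, j)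
    = of_real a * tensor_list (map to_mat (ss[k := x])) $$ (i, j) + of_real b * tensor_list (map to_mat (ss[k := y])) $$ (i, j)"
    using c[of x] c[of y] ij by (subst index_add_mat) auto
  moreover have "tensor_list (map to_mat (ss[k := a *\<^sub>R x + b *\<^sub>R y])) $$ (i, j)
    = of_real a * tensor_list (map to_mat (ss[k := x])) $$ (i, j) + of_real b * tensor_list (map to_mat (ss[k := y])) $$ (i, j)"
    unfolding e vector_add_component vector_scaleR_component by (simp add: scaleR_conv_of_real algebra_simps)
  ultimately show "tensor_list (map to_mat (ss[k := a *\<^sub>R x + b *\<^sub>R y])) $$ (i, j) = (complex_of_real a \<cdot>\<^sub>m tensor_list (map to_mat (ss[k := x])) + complex_of_real b \<cdot>\<^sub>m tensor_list (map to_mat (ss[k := y]))) $$ (i, j)"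
    by (rule trans[OF _ sym, rotated])
qed (use tensor_to_mat_carrier[of "ss[k := y]"] tensor_to_mat_carrier[of "ss[k := a *\<^sub>R x + b *\<^sub>R y]"] in auto)

lemma val_lincomb:
  fixes x y :: "complex^'d::finite^'d"
  assumes k: "k < length ss" and E: "E \<in> carrier_mat (CARD('d) ^ length ss) (CARD('d) ^ length ss)"
  shows "val E (ss[k := a *\<^sub>R x + b *\<^sub>R y]) = a * val E (ss[k := x]) + b * val E (ss[k := y])"
proof -
  have c: "tensor_list (map to_mat (ss[k := z])) \<in> carrier_mat (CARD('d) ^ length ss) (CARD('d) ^ length ss)" for z
    using tensor_to_mat_carrier[of "ss[k := z]"] by simp
  show ?thesis unfolding val_def tensor_lincomb[OF k] mtrace_lincomb[OF c c E] by simp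
qed

lemma val_nonneg:
  assumes "set ss \<subseteq> dens" "is_test (CARD('d) ^ length ss) E"
  shows "0 \<le> val E (ss :: (complex^'d::finite^'d) list)"
  unfolding val_def by (rule test_trace_bounds(1)[OF tensor_to_mat_density[OF assms(1)] assms(2)])

text \<open>Slots are released one at a time: with the others fixed, the states satisfying the bound
  form a convex set that contains \<open>B\<close>. The induction counts the leading slots already
  allowed in the hull.\<close>

lemma val_hull:
  fixes B :: "(complex^'d::finite^'d) set"
  assumes E: "E \<in> carrier_mat (CARD('d) ^ n) (CARD('d) ^ n)"
    and le: "\<And>ss. length ss = n \<Longrightarrow> set ss \<subseteq> B \<Longrightarrow> val E ss \<le> b"
    and ss: "length ss = n" "set ss \<subseteq> convex hull B"
  shows "val E ss \<le> b"
proof -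
  have "\<forall>ss. length ss = n \<longrightarrow> (\<forall>l<n. ss ! l \<in> (if l < m then convex hull B else B)) \<longrightarrow> val E ss \<le> b" if "m \<le> n" for m
    using that
  proof (induction m)
    case 0
    then show ?case using le by (auto simp: set_conv_nth)
  next
    case (Suc m)
    show ?case
    proof (intro allI impI)
      fix ss :: "(complex^'d::finite^'d) list"
      assume len: "length ss = n" and mem: "\<forall>l<n. ss ! l \<in> (if l < Suc m then convex hull B else B)"
      let ?H = "{x. val E (ss[m := x]) \<le> b}"
      have m: "m < length ss" using Suc.prems len by simp
      have "B \<subseteq> ?H"
      proof
        fix x assume x: "x \<in> B"
        have "\<forall>l<n. ss[m := x] ! l \<in> (if l < m then convex hull B else B)"
        proof (intro allI impI)
          fix l assume l: "l < n"
          show "ss[m := x] ! l \<in> (if l < m then convex hull B else B)"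
            using mem[rule_format, OF l] x m by (cases "l = m") (auto split: if_splits)
        qed
        then show "x \<in> ?H" using Suc.IH[THEN spec, of "ss[m := x]"] Suc.prems len by simp
      qed
      moreover have "convex ?H"
      proof (rule convexI)
        fix x y :: "complex^'d^'d" and u v :: real assume h: "x \<in> ?H" "y \<in> ?H" "0 \<le> u" "0 \<le> v" "u + v = 1"
        have "u * val E (ss[m := x]) + v * val E (ss[m := y]) \<le> u * b + v * b" using h by (intro add_mono mult_left_mono) auto
        also have "\<dots> = b" using h(5) by (metis distrib_right mult_1)
        finally show "u *\<^sub>R x + v *\<^sub>R y \<in> ?H" using val_lincomb[OF m, of E u x v y] E len by simp
      qed
      ultimately have "convex hull B \<subseteq> ?H" by (rule hull_minimal)
      moreover have "ss ! m \<in> convex hull B" using mem[rule_format, of m] m len by auto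
      ultimately have "val E (ss[m := ss ! m]) \<le> b" by blast
      then show "val E ss \<le> b" by simp
    qed
  qed
  from this[of n] show ?thesis using ss by (auto simp: set_conv_nth)
qed

lemma ach_av_hull:
  fixes B :: "(complex^'d::finite^'d) set"
  assumes "ach CARD('d) A (av_seq B) x"
  shows "ach CARD('d) A (av_seq (convex hull B)) x"
  unfolding ach_def
proof (intro allI impI)
  fix e :: real assume "0 < e"
  with assms have "eventually (\<lambda>n. \<exists>E. is_test (CARD('d) ^ n) E \<and> (\<forall>\<rho>\<in>A n. Re (mtrace (\<rho> * (1\<^sub>m (CARD('d) ^ n) - E))) \<le> e) \<and>
     (\<forall>\<sigma>\<in>av_seq B n. Re (mtrace (\<sigma> * E)) \<le> exp (- (real n * x)))) sequentially" unfolding ach_def by blast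
  then show "eventually (\<lambda>n. \<exists>E. is_test (CARD('d) ^ n) E \<and> (\<forall>\<rho>\<in>A n. Re (mtrace (\<rho> * (1\<^sub>m (CARD('d) ^ n) - E))) \<le> e) \<and>
     (\<forall>\<sigma>\<in>av_seq (convex hull B) n. Re (mtrace (\<sigma> * E)) \<le> exp (- (real n * x)))) sequentially"
  proof (rule eventually_mono)
    fix n assume "\<exists>E. is_test (CARD('d) ^ n) E \<and> (\<forall>\<rho>\<in>A n. Re (mtrace (\<rho> * (1\<^sub>m (CARD('d) ^ n) - E))) \<le> e) \<and>
     (\<forall>\<sigma>\<in>av_seq B n. Re (mtrace (\<sigma> * E)) \<le> exp (- (real n * x)))"
    then obtain E where E: "is_test (CARD('d) ^ n) E" "\<forall>\<rho>\<in>A n. Re (mtrace (\<rho> * (1\<^sub>m (CARD('d) ^ n) - E))) \<le> e"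
      "\<forall>\<sigma>\<in>av_seq B n. Re (mtrace (\<sigma> * E)) \<le> exp (- (real n * x))" by blast
    have "val E ss \<le> exp (- (real n * x))" if "length ss = n" "set ss \<subseteq> convex hull B" for ss :: "(complex^'d::finite^'d) list"
    proof (rule val_hull[OF is_test_carrier[OF E(1)] _ that])
      fix ss :: "(complex^'d::finite^'d) list" assume "length ss = n" "set ss \<subseteq> B"
      then show "val E ss \<le> exp (- (real n * x))" using E(3) unfolding val_def av_seq_def by blast
    qed
    then show "\<exists>E. is_test (CARD('d) ^ n) E \<and> (\<forall>\<rho>\<in>A n. Re (mtrace (\<rho> * (1\<^sub>m (CARD('d) ^ n) - E))) \<le> e) \<and>
     (\<forall>\<sigma>\<in>av_seq (convex hull B) n. Re (mtrace (\<sigma> * E)) \<le> exp (- (real n * x)))"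
      using E(1,2) unfolding val_def by (intro exI[of _ E]) (auto simp: av_seq_def)
  qed
qed

section \<open>Symmetrised tests\<close>

definition symt :: "nat \<Rightarrow> nat \<Rightarrow> complex Matrix.mat \<Rightarrow> complex Matrix.mat" where
  "symt d n E = Matrix.mat (d ^ n) (d ^ n) (\<lambda>(i, j). (\<Sum>p | p permutes {..<n}. pmat d n p E $$ (i, j)) / fact n)"

lemma symt_carrier [simp]: "symt d n E \<in> carrier_mat (d ^ n) (d ^ n)"
  by (simp add: symt_def)

lemma symt_psd:
  assumes "psd_mat (d ^ n) E"
  shows "psd_mat (d ^ n) (symt d n E)"
proof -
  have h: "hermitian_mat (d ^ n) E" and q: "\<And>v. 0 \<le> Re (qfc (d ^ n) E v)" using assms by (auto simp: psd_iff)
  have pm: "pmat d n p E $$ (i, j) = cnj (pmat d n p E $$ (j, i))" if "p permutes {..<n}" "i < d ^ n" "j < d ^ n" for p i j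
    unfolding pmat_index[OF that(2,3)] pmat_index[OF that(3,2)]
    by (rule hermitian_index[OF h pidx(1)[OF that(1,2)] pidx(1)[OF that(1,3)]])
  have "symt d n E $$ (i, j) = cnj (symt d n E $$ (j, i))" if ij: "i < d ^ n" "j < d ^ n" for i j
  proof -
    have "(\<Sum>p | p permutes {..<n}. pmat d n p E $$ (i, j)) = (\<Sum>p | p permutes {..<n}. cnj (pmat d n p E $$ (j, i)))"
      by (rule sum.cong[OF refl], rule pm) (use ij in auto)
    then show ?thesis using ij by (simp add: symt_def)
  qed
  then have "hermitian_mat (d ^ n) (symt d n E)"
    unfolding hermitian_iff using symt_carrier by blast
  moreover have "0 \<le> Re (qfc (d ^ n) (symt d n E) v)" for v
  proof -
    have "qfc (d ^ n) (symt d n E) v = (\<Sum>x<d ^ n. \<Sum>y<d ^ n. \<Sum>p | p permutes {..<n}. cnj (v x) * pmat d n p E $$ (x, y) * v y / fact n)"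
      unfolding qfc_def by (intro sum.cong refl) (auto simp: symt_def sum_divide_distrib sum_distrib_left sum_distrib_right)
    also have "\<dots> = (\<Sum>x<d ^ n. \<Sum>p | p permutes {..<n}. \<Sum>y<d ^ n. cnj (v x) * pmat d n p E $$ (x, y) * v y / fact n)"
      by (intro sum.cong refl, rule sum.swap)
    also have "\<dots> = (\<Sum>p | p permutes {..<n}. \<Sum>x<d ^ n. \<Sum>y<d ^ n. cnj (v x) * pmat d n p E $$ (x, y) * v y / fact n)"
      by (rule sum.swap)
    also have "\<dots> = (\<Sum>p | p permutes {..<n}. qfc (d ^ n) (pmat d n p E) v / fact n)"
      unfolding qfc_def by (simp add: sum_divide_distrib)
    also have "\<dots> = (\<Sum>p | p permutes {..<n}. qfc (d ^ n) E (\<lambda>i. v (pidx d n (inv_into UNIV p) i)) / fact n)"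
      by (intro sum.cong refl) (simp add: qfc_pmat)
    finally have "Re (qfc (d ^ n) (symt d n E) v) = (\<Sum>p | p permutes {..<n}. Re (qfc (d ^ n) E (\<lambda>i. v (pidx d n (inv_into UNIV p) i)) / fact n))"
      by simp
    also have "\<dots> \<ge> 0"
    proof (intro sum_nonneg)
      fix p show "0 \<le> Re (qfc (d ^ n) E (\<lambda>i. v (pidx d n (inv_into UNIV p) i)) / fact n)"
        using q[of "\<lambda>i. v (pidx d n (inv_into UNIV p) i)"] Re_divide_of_real[of _ "fact n"] by simp
    qed
    finally show ?thesis .
  qed
  ultimately show ?thesis by (simp add: psd_iff)
qed

lemma symt_one_minus:
  assumes "E \<in> carrier_mat (d ^ n) (d ^ n)"
  shows "1\<^sub>m (d ^ n) - symt d n E = symt d n (1\<^sub>m (d ^ n) - E)"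
proof (rule eq_matI)
  fix i j assume "i < dim_row (symt d n (1\<^sub>m (d ^ n) - E))" "j < dim_col (symt d n (1\<^sub>m (d ^ n) - E))"
  then have ij: "i < d ^ n" "j < d ^ n" by (auto simp: symt_def)
  have "pmat d n p (1\<^sub>m (d ^ n) - E) $$ (i, j) = (if i = j then 1 else 0) - pmat d n p E $$ (i, j)" if p: "p permutes {..<n}" for p
  proof -
    have b: "bij_betw (pidx d n p) {..<d ^ n} {..<d ^ n}" using pidx_bij[OF p] .
    have "pidx d n p i < d ^ n" "pidx d n p j < d ^ n" using bij_betwE[OF b] ij by auto
    moreover have "pidx d n p i = pidx d n p j \<longleftrightarrow> i = j" using bij_betw_imp_inj_on[OF b] ij by (auto dest: inj_onD)
    ultimately show ?thesis using ij assms by (simp add: pmat_index)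
  qed
  then have "(\<Sum>p | p permutes {..<n}. pmat d n p (1\<^sub>m (d ^ n) - E) $$ (i, j))
    = of_nat (card {p. p permutes {..<n}}) * (if i = j then 1 else 0) - (\<Sum>p | p permutes {..<n}. pmat d n p E $$ (i, j))"
    by (simp add: sum_subtractf)
  moreover have "card {p. p permutes {..<n}} = fact n" by (rule card_permutations) auto
  ultimately show "(1\<^sub>m (d ^ n) - symt d n E) $$ (i, j) = symt d n (1\<^sub>m (d ^ n) - E) $$ (i, j)"
    using ij by (auto simp: symt_def diff_divide_distrib)
qed (auto simp: symt_def)

lemma symt_test: "is_test (d ^ n) E \<Longrightarrow> is_test (d ^ n) (symt d n E)"
  using symt_psd symt_one_minus[OF is_test_carrier] by (simp add: is_test_def)

lemma val_symt:
  fixes ss :: "(complex^'d::finite^'d) list"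
  assumes E: "E \<in> carrier_mat (CARD('d) ^ length ss) (CARD('d) ^ length ss)"
  shows "val (symt CARD('d) (length ss) E) ss = (\<Sum>p | p permutes {..<length ss}. val E (permute_list p ss)) / fact (length ss)"
proof -
  let ?n = "length ss" and ?N = "CARD('d) ^ length ss" and ?T = "tensor_list (map to_mat ss)"
  have T: "?T \<in> carrier_mat ?N ?N" by (rule tensor_to_mat_carrier)
  have tr: "mtrace (?T * pmat CARD('d) ?n p E) = mtrace (tensor_list (map to_mat (permute_list p ss)) * E)" if p: "p permutes {..<?n}" for p
  proof -
    let ?Ms = "map to_mat (permute_list p ss)"
    have i: "inv_into UNIV p permutes {..<?n}" using p by (rule permutes_inv)
    have "pmat CARD('d) (length ?Ms) p (tensor_list ?Ms) = tensor_list (permute_list (inv_into UNIV p) ?Ms)"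
      using p by (intro pmat_tensor_list) auto
    also have "permute_list (inv_into UNIV p) ?Ms = map to_mat (permute_list (p \<circ> inv_into UNIV p) ss)"
      using i by (simp add: permute_list_map permute_list_compose)
    also have "p \<circ> inv_into UNIV p = id" using p by (rule permutes_inv_o)
    finally have "pmat CARD('d) ?n p (tensor_list ?Ms) = ?T" by simp
    then show ?thesis using pmat_mtrace[OF p _ E, of "tensor_list ?Ms"] tensor_to_mat_carrier[of "permute_list p ss"] by simp
  qed
  have "mtrace (?T * symt CARD('d) ?n E) = (\<Sum>i<?N. \<Sum>j<?N. \<Sum>p | p permutes {..<?n}. ?T $$ (i, j) * pmat CARD('d) ?n p E $$ (j, i) / fact ?n)"
    unfolding mtrace_mult[OF T symt_carrier] by (intro sum.cong refl) (simp add: symt_def sum_divide_distrib sum_distrib_left)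
  also have "\<dots> = (\<Sum>i<?N. \<Sum>p | p permutes {..<?n}. \<Sum>j<?N. ?T $$ (i, j) * pmat CARD('d) ?n p E $$ (j, i) / fact ?n)"
    by (intro sum.cong refl, rule sum.swap)
  also have "\<dots> = (\<Sum>p | p permutes {..<?n}. \<Sum>i<?N. \<Sum>j<?N. ?T $$ (i, j) * pmat CARD('d) ?n p E $$ (j, i) / fact ?n)"
    by (rule sum.swap)
  also have "\<dots> = (\<Sum>p | p permutes {..<?n}. mtrace (?T * pmat CARD('d) ?n p E)) / fact ?n"
    unfolding mtrace_mult[OF T pmat_carrier] by (simp add: sum_divide_distrib)
  also have "(\<Sum>p | p permutes {..<?n}. mtrace (?T * pmat CARD('d) ?n p E)) = (\<Sum>p | p permutes {..<?n}. mtrace (tensor_list (map to_mat (permute_list p ss)) * E))"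
    by (intro sum.cong refl) (simp add: tr)
  finally show ?thesis unfolding val_def using Re_divide_of_real[of _ "fact ?n"] by simp
qed

text \<open>Rearranging the factors only permutes the summands of the average, so a symmetrised test
  sees nothing but the type of a word.\<close>

lemma val_symt_mset:
  fixes ss ts :: "(complex^'d::finite^'d) list"
  assumes E: "E \<in> carrier_mat (CARD('d) ^ n) (CARD('d) ^ n)" and n: "length ss = n" and eq: "mset ts = mset ss"
  shows "val (symt CARD('d) n E) ts = val (symt CARD('d) n E) ss"
proof -
  obtain q where q: "q permutes {..<length ss}" "permute_list q ss = ts" using mset_eq_permutation[OF eq] by blast
  have l: "length ts = n" using mset_eq_length[OF eq] n by simp
  have "val (symt CARD('d) n E) ss * fact n = (\<Sum>p | p permutes {..<n}. val E (permute_list p ss))"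
    using val_symt[of E ss] E n by simp
  also have "\<dots> = (\<Sum>p | p permutes {..<n}. val E (permute_list (q \<circ> p) ss))"
    using q n by (intro setum_permutations_compose_left) simp
  also have "\<dots> = (\<Sum>p | p permutes {..<n}. val E (permute_list p ts))"
    using q n by (intro sum.cong refl) (simp add: permute_list_compose)
  also have "\<dots> = val (symt CARD('d) n E) ts * fact n"
    using val_symt[of E ts] E l by simp
  finally show ?thesis by simp
qed


text \<open>Closeness in norm would not give a multiplicative error. The net is built so that (1 +
  \<delta>) f - \<sigma> is a positive multiple of an element of \<open>C\<close>; for sets of
  states this is an operator inequality.\<close>

lemma finite_net:
  fixes C :: "'a::euclidean_space set"
  assumes C: "convex C" "compact C" "C \<noteq> {}" and dl: "0 < \<delta>"
  shows "\<exists>F. finite F \<and> F \<subseteq> C \<and> (\<forall>\<sigma>\<in>C. \<exists>f\<in>F. \<exists>\<omega>\<in>C. (1 + \<delta>) *\<^sub>R f = \<sigma> + \<delta> *\<^sub>R \<omega>)"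
proof -
  obtain s0 where "s0 \<in> rel_interior C" using rel_interior_eq_empty[OF C(1)] C(3) by blast
  then obtain e where s0: "s0 \<in> C" and e: "0 < e" "ball s0 e \<inter> affine hull C \<subseteq> C" unfolding mem_rel_interior_ball by blast
  have de: "0 < \<delta> * e" using dl e by simp
  have "C \<subseteq> (\<Union>x\<in>C. ball x (\<delta> * e))" using de by force
  then obtain K where K: "K \<subseteq> C" "finite K" "C \<subseteq> (\<Union>x\<in>K. ball x (\<delta> * e))"
    using compactE_image[OF C(2), of C "\<lambda>x. ball x (\<delta> * e)"] by auto
  \<comment> \<open>Centres are pulled towards the relative interior point s0. Then \<omega> = s0 +
    (x - \<sigma>) / \<delta> lies within e of s0 and in the affine hull, hence in \<open>C\<close>.
    The covering radius \<delta> e is chosen for this.\<close>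
  define g where "g x = (1 / (1 + \<delta>)) *\<^sub>R x + (\<delta> / (1 + \<delta>)) *\<^sub>R s0" for x
  have "g ` K \<subseteq> C"
  proof -
    have "g x \<in> C" if "x \<in> K" for x
      unfolding g_def using that K(1) s0 dl by (intro convexD[OF C(1)]) (auto simp: field_simps)
    then show ?thesis by blast
  qed
  moreover have "\<exists>f\<in>g ` K. \<exists>\<omega>\<in>C. (1 + \<delta>) *\<^sub>R f = \<sigma> + \<delta> *\<^sub>R \<omega>" if s: "\<sigma> \<in> C" for \<sigma>
  proof -
    obtain x where x: "x \<in> K" "dist x \<sigma> < \<delta> * e" using K(3) s by auto
    let ?w = "s0 + (1 / \<delta>) *\<^sub>R (x - \<sigma>)"
    have "norm ((1 / \<delta>) *\<^sub>R (x - \<sigma>)) < e" using x(2) dl unfolding norm_scaleR by (simp add: dist_norm pos_divide_less_eq mult.commute)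
    then have "?w \<in> ball s0 e" by (simp only: mem_ball dist_norm norm_minus_commute[of s0] add_diff_cancel_left')
    moreover have "?w \<in> affine hull C"
    proof -
      have "?w = 1 *\<^sub>R s0 + (1 / \<delta>) *\<^sub>R x + (- (1 / \<delta>)) *\<^sub>R \<sigma>" by (simp add: algebra_simps)
      moreover have "1 *\<^sub>R s0 + (1 / \<delta>) *\<^sub>R x + (- (1 / \<delta>)) *\<^sub>R \<sigma> \<in> affine hull C"
        using s0 x(1) K(1) s by (intro mem_affine_3[OF affine_affine_hull]) (auto intro: hull_inc)
      ultimately show ?thesis by (simp only:)
    qed
    ultimately have w: "?w \<in> C" using e(2) by blast
    have "(1 + \<delta>) *\<^sub>R g x = x + \<delta> *\<^sub>R s0" unfolding g_def scaleR_right_distrib scaleR_scaleR using dl by simp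
    also have "\<dots> = \<sigma> + \<delta> *\<^sub>R ?w" unfolding scaleR_right_distrib scaleR_scaleR using dl by simp
    finally show ?thesis using w x(1) by blast
  qed
  ultimately show ?thesis using K(2) by (intro exI[of _ "g ` K"]) auto
qed

text \<open>Each slot is rounded separately at the cost of a factor 1 + \<delta>; the discarded term
  with \<omega> is a value of the test on states and hence non-negative.\<close>

lemma val_round:
  fixes C F :: "(complex^'d::finite^'d) set"
  assumes C: "C \<subseteq> dens" and F: "F \<subseteq> C" "\<And>\<sigma>. \<sigma> \<in> C \<Longrightarrow> \<exists>f\<in>F. \<exists>\<omega>\<in>C. (1 + \<delta>) *\<^sub>R f = \<sigma> + \<delta> *\<^sub>R \<omega>" and dl: "0 < \<delta>"
    and E: "is_test (CARD('d) ^ n) E" and ss: "length ss = n" "set ss \<subseteq> C"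
  shows "\<exists>fs. length fs = n \<and> set fs \<subseteq> F \<and> val E ss \<le> (1 + \<delta>) ^ n * val E fs"
proof -
  have Ec: "E \<in> carrier_mat (CARD('d) ^ n) (CARD('d) ^ n)" using E by (rule is_test_carrier)
  have "\<exists>ts. length ts = n \<and> (\<forall>l<n. ts ! l \<in> C \<and> (l < m \<longrightarrow> ts ! l \<in> F)) \<and> val E ss \<le> (1 + \<delta>) ^ m * val E ts" if "m \<le> n" for m
    using that
  proof (induction m)
    case 0
    then show ?case using ss by (intro exI[of _ ss]) auto
  next
    case (Suc m)
    then obtain ts where ts: "length ts = n" "\<forall>l<n. ts ! l \<in> C \<and> (l < m \<longrightarrow> ts ! l \<in> F)" "val E ss \<le> (1 + \<delta>) ^ m * val E ts" by auto
    have m: "m < length ts" using ts(1) Suc.prems by simp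
    obtain f w where f: "f \<in> F" "w \<in> C" "(1 + \<delta>) *\<^sub>R f = ts ! m + \<delta> *\<^sub>R w" using F(2) ts(2) m ts(1) by metis
    have set: "set (ts[m := z]) \<subseteq> C" if "z \<in> C" for z using ts(1,2) that by (intro set_update_subsetI) (auto simp: set_conv_nth)
    have "(1 + \<delta>) * val E (ts[m := f]) = val E (ts[m := (1 + \<delta>) *\<^sub>R f + 0 *\<^sub>R f])"
      using val_lincomb[OF m, of E "1 + \<delta>" f 0 f] Ec ts(1) by simp
    also have "(1 + \<delta>) *\<^sub>R f + 0 *\<^sub>R f = 1 *\<^sub>R (ts ! m) + \<delta> *\<^sub>R w" using f(3) by simp
    also have "val E (ts[m := 1 *\<^sub>R (ts ! m) + \<delta> *\<^sub>R w]) = 1 * val E (ts[m := ts ! m]) + \<delta> * val E (ts[m := w])"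
      using Ec ts(1) by (intro val_lincomb[OF m]) simp
    also have "\<dots> \<ge> val E ts"
      using val_nonneg[of "ts[m := w]" E] set[OF f(2)] C E ts(1) dl by simp
    finally have "val E ts \<le> (1 + \<delta>) * val E (ts[m := f])" .
    then have "(1 + \<delta>) ^ m * val E ts \<le> (1 + \<delta>) ^ m * ((1 + \<delta>) * val E (ts[m := f]))" using dl by (intro mult_left_mono) auto
    then have "val E ss \<le> (1 + \<delta>) ^ Suc m * val E (ts[m := f])" using ts(3) by (simp add: mult_ac)
    moreover have "ts[m := f] ! l \<in> C \<and> (l < Suc m \<longrightarrow> ts[m := f] ! l \<in> F)" if l: "l < n" for l
      using ts(2)[rule_format, OF l] f(1) F(1) m by (cases "l = m") auto
    ultimately show ?case using ts(1) by (intro exI[of _ "ts[m := f]"]) simp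
  qed
  from this[of n] obtain ts where "length ts = n" "\<forall>l<n. ts ! l \<in> F" "val E ss \<le> (1 + \<delta>) ^ n * val E ts" by auto
  then show ?thesis by (intro exI[of _ ts]) (auto simp: set_conv_nth)
qed

text \<open>The tensor power of a convex combination expands over words, as for an i.i.d. source
  with letter probabilities \<open>p\<close>.\<close>

lemma val_replicate_sum:
  fixes F :: "(complex^'d::finite^'d) set" and p :: "complex^'d^'d \<Rightarrow> real"
  assumes F: "finite F" and E: "E \<in> carrier_mat (CARD('d) ^ n) (CARD('d) ^ n)"
  shows "val E (replicate n (\<Sum>a\<in>F. p a *\<^sub>R a)) = (\<Sum>g\<in>PiE {..<n} (\<lambda>_. F). (\<Prod>k<n. p (g k)) * val E (map g [0..<n]))"
proof -
  let ?N = "CARD('d) ^ n" and ?P = "PiE {..<n} (\<lambda>_. F)" and ?f = "\<Sum>a\<in>F. p a *\<^sub>R a"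
  let ?I = "\<lambda>i l. idx (digs CARD('d) n i ! l) :: 'd"
  have T: "tensor_list (map to_mat ts) \<in> carrier_mat ?N ?N" if "length ts = n" for ts :: "(complex^'d::finite^'d) list"
    using tensor_to_mat_carrier[of ts] that by simp
  have ix: "tensor_list (map to_mat (replicate n ?f)) $$ (i, j) = (\<Sum>g\<in>?P. complex_of_real (\<Prod>k<n. p (g k)) * tensor_list (map to_mat (map g [0..<n])) $$ (i, j))"
    if ij: "i < ?N" "j < ?N" for i j
  proof -
    have "tensor_list (map to_mat (replicate n ?f)) $$ (i, j) = (\<Prod>k<n. ?f $ ?I i k $ ?I j k)"
      using tensor_to_mat_index[of i "replicate n ?f" j] ij by simp
    also have "\<dots> = (\<Prod>k<n. \<Sum>a\<in>F. complex_of_real (p a) * a $ ?I i k $ ?I j k)"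
      by (intro prod.cong refl) (simp only: sum_component vector_scaleR_component, simp only: scaleR_conv_of_real)
    also have "\<dots> = (\<Sum>g\<in>?P. \<Prod>k<n. complex_of_real (p (g k)) * g k $ ?I i k $ ?I j k)"
      using F by (intro prod_sum_PiE) auto
    also have "\<dots> = (\<Sum>g\<in>?P. complex_of_real (\<Prod>k<n. p (g k)) * tensor_list (map to_mat (map g [0..<n])) $$ (i, j))"
    proof (intro sum.cong refl)
      fix g :: "nat \<Rightarrow> complex^'d::finite^'d"
      have "tensor_list (map to_mat (map g [0..<n])) $$ (i, j) = (\<Prod>k<n. g k $ ?I i k $ ?I j k)"
        using tensor_to_mat_index[of i "map g [0..<n]" j] ij by simp
      then show "(\<Prod>k<n. complex_of_real (p (g k)) * g k $ ?I i k $ ?I j k) = complex_of_real (\<Prod>k<n. p (g k)) * tensor_list (map to_mat (map g [0..<n])) $$ (i, j)"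
        by (simp add: prod.distrib)
    qed
    finally show ?thesis .
  qed
  have "mtrace (tensor_list (map to_mat (replicate n ?f)) * E) = (\<Sum>i<?N. \<Sum>j<?N. \<Sum>g\<in>?P. complex_of_real (\<Prod>k<n. p (g k)) * (tensor_list (map to_mat (map g [0..<n])) $$ (i, j) * E $$ (j, i)))"
    unfolding mtrace_mult[OF T[OF length_replicate] E]
    by (intro sum.cong refl) (simp only: lessThan_iff ix sum_distrib_right mult.assoc)
  also have "\<dots> = (\<Sum>i<?N. \<Sum>g\<in>?P. \<Sum>j<?N. complex_of_real (\<Prod>k<n. p (g k)) * (tensor_list (map to_mat (map g [0..<n])) $$ (i, j) * E $$ (j, i)))"
    by (rule sum.cong[OF refl], rule sum.swap)
  also have "\<dots> = (\<Sum>g\<in>?P. \<Sum>i<?N. \<Sum>j<?N. complex_of_real (\<Prod>k<n. p (g k)) * (tensor_list (map to_mat (map g [0..<n])) $$ (i, j) * E $$ (j, i)))"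
    by (rule sum.swap)
  also have "\<dots> = (\<Sum>g\<in>?P. complex_of_real (\<Prod>k<n. p (g k)) * mtrace (tensor_list (map to_mat (map g [0..<n])) * E))"
  proof (rule sum.cong[OF refl])
    fix g :: "nat \<Rightarrow> complex^'d::finite^'d"
    have l: "length (map g [0..<n]) = n" by simp
    show "(\<Sum>i<?N. \<Sum>j<?N. complex_of_real (\<Prod>k<n. p (g k)) * (tensor_list (map to_mat (map g [0..<n])) $$ (i, j) * E $$ (j, i)))
      = complex_of_real (\<Prod>k<n. p (g k)) * mtrace (tensor_list (map to_mat (map g [0..<n])) * E)"
      unfolding mtrace_mult[OF T[OF l] E] sum_distrib_left ..
  qed
  finally show ?thesis unfolding val_def by (simp add: Re_sum del: of_real_prod map_map)
qed

text \<open>A Stirling-type upper bound for factorials. The induction carries the factor t instead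
  of t + 1, which fails at 0 and is relaxed at the end.\<close>

lemma fact_exp_le: "fact t * exp (real t) \<le> exp 1 * (real t + 1) * real t ^ t"
proof (cases "t = 0")
  case False
  have "fact t * exp (real t) \<le> exp 1 * real t * real t ^ t" if "1 \<le> t"
    using that
  proof (induction t rule: nat_induct_at_least)
    case base
    then show ?case by simp
  next
    case (Suc t)
    have t: "0 < real t" using Suc by simp
    have "real t / (real t + 1) = 1 + (- 1 / (real t + 1))" using t by (simp add: field_simps)
    also have "\<dots> \<le> exp (- 1 / (real t + 1))" by (rule exp_ge_add_one_self)
    finally have "(real t / (real t + 1)) ^ Suc t \<le> exp (- 1 / (real t + 1)) ^ Suc t" using t by (intro power_mono) auto
    also have "\<dots> = exp (real (Suc t) * (- 1 / (real t + 1)))" by (rule exp_of_nat_mult[symmetric])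
    also have "real (Suc t) * (- 1 / (real t + 1)) = - 1" using t by (simp add: field_simps)
    finally have "real t ^ Suc t / (real t + 1) ^ Suc t \<le> 1 / exp 1" by (simp add: power_divide exp_minus inverse_eq_divide)
    then have k: "exp 1 * real t ^ Suc t \<le> (real t + 1) ^ Suc t" using t by (simp add: pos_divide_le_eq pos_le_divide_eq mult.commute del: power_Suc)
    have "fact (Suc t) * exp (real (Suc t)) = (real t + 1) * exp 1 * (fact t * exp (real t))" by (simp add: exp_add algebra_simps)
    also have "\<dots> \<le> (real t + 1) * exp 1 * (exp 1 * real t * real t ^ t)" using Suc.IH by (intro mult_left_mono) auto
    also have "\<dots> = (real t + 1) * exp 1 * (exp 1 * real t ^ Suc t)" by simp
    also have "\<dots> \<le> (real t + 1) * exp 1 * (real t + 1) ^ Suc t" by (rule mult_left_mono[OF k]) auto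
    finally show ?case by (simp add: algebra_simps)
  qed
  also have "exp 1 * real t * real t ^ t \<le> exp 1 * (real t + 1) * real t ^ t" by (intro mult_right_mono) auto
  finally show ?thesis using False by simp
qed simp

text \<open>One term of the exponential series at n; it is the lower bound on the factorial that
  pairs with \<open>fact_exp_le\<close>.\<close>

lemma power_self_le_fact: "real n ^ n \<le> exp (real n) * fact n"
proof -
  have "(\<lambda>k. real n ^ k /\<^sub>R fact k) sums exp (real n)" by (rule exp_converges)
  then have s: "summable (\<lambda>k. real n ^ k /\<^sub>R fact k)" "(\<Sum>k. real n ^ k /\<^sub>R fact k) = exp (real n)" by (auto simp: sums_iff)
  have "(\<Sum>k\<in>{n}. real n ^ k /\<^sub>R fact k) \<le> (\<Sum>k. real n ^ k /\<^sub>R fact k)" using s(1) by (intro sum_le_suminf) auto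
  then have "real n ^ n / fact n \<le> exp (real n)" unfolding s(2) by (simp add: divide_inverse mult.commute)
  then show ?thesis by (simp add: field_simps)
qed

text \<open>Under its own empirical distribution a type class has at least polynomially small
  probability. The multinomial coefficient is estimated by the two factorial bounds, with one factor
  e (n + 1) for each letter.\<close>

lemma type_class_weight:
  fixes M :: "'a multiset"
  assumes F: "finite F" "set_mset M \<subseteq> F" and n: "size M = n"
  shows "1 \<le> (exp 1 * (real n + 1)) ^ card F * (real (card (permutations_of_multiset M)) * (\<Prod>a\<in>F. (real (count M a) / real n) ^ count M a))"
proof -
  let ?K = "real (card (permutations_of_multiset M))" and ?t = "count M"
  have sz: "(\<Sum>a\<in>F. ?t a) = n"
    using F n by (subst n[symmetric], subst size_multiset_overloaded_eq) (intro sum.mono_neutral_right, auto simp: count_eq_zero_iff)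
  have "card (permutations_of_multiset M) * (\<Prod>a\<in>F. fact (?t a)) = fact n"
  proof -
    have "(\<Prod>a\<in>F. fact (?t a)) = (\<Prod>a\<in>set_mset M. fact (?t a) :: nat)"
      using F by (intro prod.mono_neutral_right) (auto simp: not_in_iff)
    then show ?thesis using card_permutations_of_multiset_aux[of M] n by simp
  qed
  then have "real (card (permutations_of_multiset M) * (\<Prod>a\<in>F. fact (?t a))) = real (fact n)" by (rule arg_cong)
  then have c: "?K * (\<Prod>a\<in>F. fact (?t a)) = fact n" by simp
  have "real n ^ n * (\<Prod>a\<in>F. fact (?t a)) * exp (real n) = real n ^ n * (\<Prod>a\<in>F. fact (?t a) * exp (real (?t a)))"
    unfolding prod.distrib by (simp add: exp_sum[OF F(1), symmetric] sz[symmetric])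
  also have "\<dots> \<le> real n ^ n * (\<Prod>a\<in>F. exp 1 * (real n + 1) * real (?t a) ^ ?t a)"
  proof (intro mult_left_mono prod_mono conjI)
    fix a assume a: "a \<in> F"
    have "?t a \<le> n" using sz F(1) a by (metis member_le_sum zero_le)
    then have "exp 1 * (real (?t a) + 1) * real (?t a) ^ ?t a \<le> exp 1 * (real n + 1) * real (?t a) ^ ?t a" by (intro mult_right_mono mult_left_mono) auto
    then show "fact (?t a) * exp (real (?t a)) \<le> exp 1 * (real n + 1) * real (?t a) ^ ?t a" using fact_exp_le[of "?t a"] by linarith
  qed auto
  also have "\<dots> = real n ^ n * ((exp 1 * (real n + 1)) ^ card F * (\<Prod>a\<in>F. real (?t a) ^ ?t a))" by (simp add: prod.distrib)
  also have "\<dots> \<le> (exp (real n) * fact n) * ((exp 1 * (real n + 1)) ^ card F * (\<Prod>a\<in>F. real (?t a) ^ ?t a))"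
    by (intro mult_right_mono power_self_le_fact mult_nonneg_nonneg prod_nonneg) auto
  finally have "real n ^ n * (\<Prod>a\<in>F. fact (?t a)) \<le> fact n * ((exp 1 * (real n + 1)) ^ card F * (\<Prod>a\<in>F. real (?t a) ^ ?t a))"
    by (simp add: mult_ac)
  then have "real n ^ n * (\<Prod>a\<in>F. fact (?t a)) \<le> (?K * (\<Prod>a\<in>F. fact (?t a))) * ((exp 1 * (real n + 1)) ^ card F * (\<Prod>a\<in>F. real (?t a) ^ ?t a))"
    unfolding c .
  moreover have "(0::real) < (\<Prod>a\<in>F. fact (?t a))" by (intro prod_pos) auto
  ultimately have "real n ^ n \<le> ?K * ((exp 1 * (real n + 1)) ^ card F * (\<Prod>a\<in>F. real (?t a) ^ ?t a))"
    by (simp add: mult_ac)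
  moreover have "(\<Prod>a\<in>F. real (?t a) ^ ?t a) = real n ^ n * (\<Prod>a\<in>F. (real (?t a) / real n) ^ ?t a)"
  proof -
    have "real n ^ n = (\<Prod>a\<in>F. real n ^ ?t a)" by (simp add: power_sum[symmetric] sz)
    moreover have "real (?t a) ^ ?t a = real n ^ ?t a * (real (?t a) / real n) ^ ?t a" for a
      using sz F(1) by (cases "n = 0") (auto simp: power_divide n[symmetric])
    ultimately show ?thesis by (simp add: prod.distrib)
  qed
  ultimately have "real n ^ n * 1 \<le> real n ^ n * ((exp 1 * (real n + 1)) ^ card F * (?K * (\<Prod>a\<in>F. (real (?t a) / real n) ^ ?t a)))"
    by (simp add: mult_ac)
  moreover have "0 < real n ^ n" by (cases "n = 0") auto
  ultimately show ?thesis by (rule mult_left_le_imp_le)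
qed

text \<open>The state \<open>f\<close> is the empirical average of the word. Its tensor power
  expands into non-negative terms, and all rearrangements of \<open>fs\<close> give the same value
  because the test is symmetric, so the weight of the type class applies.\<close>

lemma val_type_class:
  fixes C F :: "(complex^'d::finite^'d) set"
  assumes C: "C \<subseteq> dens" "convex C" and F: "finite F" "F \<subseteq> C" and n: "0 < n" and E: "is_test (CARD('d) ^ n) E"
    and fs: "length fs = n" "set fs \<subseteq> F"
  shows "\<exists>f\<in>C. val (symt CARD('d) n E) fs \<le> (exp 1 * (real n + 1)) ^ card F * val (symt CARD('d) n E) (replicate n f)"
proof -
  let ?S = "symt CARD('d) n E" and ?M = "mset fs" and ?P = "PiE {..<n} (\<lambda>_. F)"
  have S: "is_test (CARD('d) ^ n) ?S" by (rule symt_test[OF E])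
  have Ec: "E \<in> carrier_mat (CARD('d) ^ n) (CARD('d) ^ n)" using E by (rule is_test_carrier)
  define p where "p a = real (count ?M a) / real n" for a
  define f where "f = (\<Sum>a\<in>F. p a *\<^sub>R a)"
  have p0: "0 \<le> p a" for a by (simp add: p_def)
  have "(\<Sum>a\<in>F. count ?M a) = n"
    using F fs by (subst fs(1)[symmetric], subst size_mset[symmetric], subst size_multiset_overloaded_eq) (intro sum.mono_neutral_right, auto simp: count_eq_zero_iff)
  then have "(\<Sum>a\<in>F. real (count ?M a)) = real n" by (metis of_nat_sum)
  then have "(\<Sum>a\<in>F. p a) = 1" using n by (simp add: p_def sum_divide_distrib[symmetric])
  then have "f \<in> C" unfolding f_def using F p0 by (intro convex_sum[OF F(1) C(2)]) auto
  let ?h = "\<lambda>g. (\<Prod>k<n. p (g k)) * val ?S (map g [0..<n])"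
  let ?r = "\<lambda>w. restrict (\<lambda>k. w ! k) {..<n}"
  let ?W = "permutations_of_multiset ?M"
  have w: "length w = n" "mset w = ?M" "set w \<subseteq> F" "map (?r w) [0..<n] = w" if "w \<in> ?W" for w
  proof -
    show m: "mset w = ?M" using that by (simp add: permutations_of_multiset_def)
    show l: "length w = n" using mset_eq_length[OF m] fs by simp
    show "set w \<subseteq> F" using mset_eq_setD[OF m] fs by simp
    show "map (?r w) [0..<n] = w" using l by (intro nth_equalityI) auto
  qed
  have inj: "inj_on ?r ?W"
  proof (rule inj_onI)
    fix u v assume uv: "u \<in> ?W" "v \<in> ?W" "?r u = ?r v"
    from uv(3) have "map (?r u) [0..<n] = map (?r v) [0..<n]" by (rule arg_cong)
    then show "u = v" unfolding w(4)[OF uv(1)] w(4)[OF uv(2)] .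
  qed
  have sub: "?r ` ?W \<subseteq> ?P"
  proof (rule image_subsetI)
    fix w assume "w \<in> ?W"
    from w[OF this] show "?r w \<in> ?P" by (auto simp: subset_iff)
  qed
  have hw: "?h (?r w) = (\<Prod>a\<in>F. p a ^ count ?M a) * val ?S fs" if "w \<in> ?W" for w
  proof -
    have z: "count ?M a = 0" if "a \<notin> set fs" for a using that by (simp add: count_eq_zero_iff)
    have "(\<Prod>k<n. p (?r w k)) = (\<Prod>k<length w. p (w ! k))" using w(1)[OF that] by (intro prod.cong) auto
    also have "\<dots> = prod_list (map p w)" by (simp add: prod.list_conv_set_nth atLeast0LessThan)
    also have "\<dots> = prod_mset (image_mset p (mset w))" by (simp add: prod_mset_prod_list flip: mset_map)
    also have "\<dots> = (\<Prod>a\<in>set_mset ?M. p a ^ count ?M a)" unfolding w(2)[OF that] by (rule image_prod_mset_multiplicity)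
    also have "\<dots> = (\<Prod>a\<in>F. p a ^ count ?M a)" using F fs by (intro prod.mono_neutral_left) (auto simp: z)
    finally show ?thesis using w(4)[OF that] val_symt_mset[OF Ec fs(1) w(2)[OF that]] by simp
  qed
  have "real (card ?W) * ((\<Prod>a\<in>F. p a ^ count ?M a) * val ?S fs) = (\<Sum>w\<in>?W. ?h (?r w))" using hw by simp
  also have "\<dots> = sum ?h (?r ` ?W)" using inj by (simp add: sum.reindex)
  also have "\<dots> \<le> sum ?h ?P"
  proof (rule sum_mono2[OF _ sub])
    show "finite ?P" using F(1) by (intro finite_PiE) auto
    fix g assume "g \<in> ?P - ?r ` ?W"
    then have "g ` {..<n} \<subseteq> F" by (auto simp: PiE_def Pi_def)
    then have "set (map g [0..<n]) \<subseteq> dens" using F(2) C(1) by (auto simp: atLeast0LessThan)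
    then have "0 \<le> val ?S (map g [0..<n])" using S by (intro val_nonneg) auto
    then show "0 \<le> ?h g" using p0 by (intro mult_nonneg_nonneg prod_nonneg) auto
  qed
  also have "\<dots> = val ?S (replicate n f)" unfolding f_def by (rule val_replicate_sum[symmetric, OF F(1) is_test_carrier[OF S]])
  finally have le: "real (card ?W) * (\<Prod>a\<in>F. p a ^ count ?M a) * val ?S fs \<le> val ?S (replicate n f)" by (simp add: mult.assoc)
  have v0: "0 \<le> val ?S fs" using fs F(2) C(1) S by (intro val_nonneg) auto
  have "1 * val ?S fs \<le> (exp 1 * (real n + 1)) ^ card F * (real (card ?W) * (\<Prod>a\<in>F. p a ^ count ?M a)) * val ?S fs"
    unfolding p_def using type_class_weight[OF F(1), of ?M n] fs v0 by (intro mult_right_mono) auto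
  also have "\<dots> = (exp 1 * (real n + 1)) ^ card F * (real (card ?W) * (\<Prod>a\<in>F. p a ^ count ?M a) * val ?S fs)" by simp
  also have "\<dots> \<le> (exp 1 * (real n + 1)) ^ card F * val ?S (replicate n f)" by (rule mult_left_mono[OF le]) auto
  finally show ?thesis using \<open>f \<in> C\<close> by auto
qed

lemma permute_list_replicate: "p permutes {..<n} \<Longrightarrow> permute_list p (replicate n a) = replicate n a"
  using permutes_in_image[of p "{..<n}"] by (intro nth_equalityI) (auto simp: permute_list_nth)

text \<open>A test against i.i.d. states, once symmetrized, also works against products of varying states: round every factor to a
  finite net, and note that the resulting word is a not too unlikely realisation of the i.i.d. state of its empirical average.\<close>
lemma ach_iid_av:
  fixes C :: "(complex^'d::finite^'d) set" and L :: "nat \<Rightarrow> (complex^'d::finite^'d) list set"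
  assumes C: "C \<subseteq> dens" "convex C" "compact C" "C \<noteq> {}"
    and A: "\<And>n. A n = (\<lambda>ss. tensor_list (map to_mat ss)) ` L n"
    and L: "\<And>n ss. ss \<in> L n \<Longrightarrow> length ss = n \<and> set ss \<subseteq> dens" "\<And>n ss p. ss \<in> L n \<Longrightarrow> p permutes {..<n} \<Longrightarrow> permute_list p ss \<in> L n"
    and ach: "ach CARD('d) A (iid_seq C) x" and y: "y < x"
  shows "ach CARD('d) A (av_seq C) y"
  unfolding ach_def
proof (intro allI impI)
  fix e :: real assume e: "0 < e"
  \<comment> \<open>Half of the exponent gap pays for rounding, since (1 + \<delta>)^n = exp (n c),
    and the other half for the polynomial factor of the type class.\<close>
  define c where "c = (x - y) / 2"
  define \<delta> where "\<delta> = exp c - 1"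
  have c: "0 < c" using y by (simp add: c_def)
  then have dl: "0 < \<delta>" by (simp add: \<delta>_def)
  obtain F where F: "finite F" "F \<subseteq> C" "\<And>\<sigma>. \<sigma> \<in> C \<Longrightarrow> \<exists>f\<in>F. \<exists>\<omega>\<in>C. (1 + \<delta>) *\<^sub>R f = \<sigma> + \<delta> *\<^sub>R \<omega>"
    using finite_net[OF C(2,3,4) dl] by blast
  have "(\<lambda>n. real (card F) * ((1 + ln (real n + 1)) / real n)) \<longlonglongrightarrow> real (card F) * 0"
    by (intro tendsto_intros) real_asymp
  then have "eventually (\<lambda>n. real (card F) * ((1 + ln (real n + 1)) / real n) < c) sequentially" using c by (intro order_tendstoD(2)) auto
  moreover have "eventually (\<lambda>n. \<exists>E. is_test (CARD('d) ^ n) E \<and> (\<forall>\<rho>\<in>A n. Re (mtrace (\<rho> * (1\<^sub>m (CARD('d) ^ n) - E))) \<le> e) \<and>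
     (\<forall>\<sigma>\<in>iid_seq C n. Re (mtrace (\<sigma> * E)) \<le> exp (- (real n * x)))) sequentially" using ach e unfolding ach_def by blast
  ultimately show "eventually (\<lambda>n. \<exists>E. is_test (CARD('d) ^ n) E \<and> (\<forall>\<rho>\<in>A n. Re (mtrace (\<rho> * (1\<^sub>m (CARD('d) ^ n) - E))) \<le> e) \<and>
     (\<forall>\<sigma>\<in>av_seq C n. Re (mtrace (\<sigma> * E)) \<le> exp (- (real n * y)))) sequentially"
    using eventually_gt_at_top[of 0]
  proof eventually_elim
    case (elim n)
    obtain E where E: "is_test (CARD('d) ^ n) E" "\<forall>\<rho>\<in>A n. Re (mtrace (\<rho> * (1\<^sub>m (CARD('d) ^ n) - E))) \<le> e"
      "\<forall>\<sigma>\<in>iid_seq C n. Re (mtrace (\<sigma> * E)) \<le> exp (- (real n * x))" using elim(2) by blast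
    let ?S = "symt CARD('d) n E"
    have Ec: "E \<in> carrier_mat (CARD('d) ^ n) (CARD('d) ^ n)" using E(1) by (rule is_test_carrier)
    have E': "1\<^sub>m (CARD('d) ^ n) - E \<in> carrier_mat (CARD('d) ^ n) (CARD('d) ^ n)" by (rule minus_carrier_mat[OF Ec])
    have S: "is_test (CARD('d) ^ n) ?S" by (rule symt_test[OF E(1)])
    have cp: "card {p. p permutes {..<n}} = fact n" by (rule card_permutations) auto
    have "Re (mtrace (\<rho> * (1\<^sub>m (CARD('d) ^ n) - ?S))) \<le> e" if r: "\<rho> \<in> A n" for \<rho>
    proof -
      obtain ss where ss: "ss \<in> L n" "\<rho> = tensor_list (map to_mat ss)" using r A by blast
      have l: "length ss = n" using L(1)[OF ss(1)] by simp
      have "Re (mtrace (\<rho> * (1\<^sub>m (CARD('d) ^ n) - ?S))) = val (symt CARD('d) n (1\<^sub>m (CARD('d) ^ n) - E)) ss"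
        unfolding symt_one_minus[OF Ec] val_def ss(2) ..
      also have "\<dots> = (\<Sum>p | p permutes {..<n}. val (1\<^sub>m (CARD('d) ^ n) - E) (permute_list p ss)) / fact n"
        using val_symt[of "1\<^sub>m (CARD('d) ^ n) - E" ss] E' l by simp
      also have "\<dots> \<le> (\<Sum>p | p permutes {..<n}. e) / fact n"
        using L(2)[OF ss(1)] E(2) A by (intro divide_right_mono sum_mono) (auto simp: val_def)
      also have "\<dots> = e" by (simp add: cp)
      finally show ?thesis .
    qed
    moreover have "Re (mtrace (\<sigma> * ?S)) \<le> exp (- (real n * y))" if s: "\<sigma> \<in> av_seq C n" for \<sigma>
    proof -
      obtain ss where ss: "length ss = n" "set ss \<subseteq> C" "\<sigma> = tensor_list (map to_mat ss)" using s unfolding av_seq_def by blast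
      obtain fs where fs: "length fs = n" "set fs \<subseteq> F" "val ?S ss \<le> (1 + \<delta>) ^ n * val ?S fs"
        using val_round[OF C(1) F(2) F(3) dl S ss(1,2)] by blast
      obtain f where f: "f \<in> C" "val ?S fs \<le> (exp 1 * (real n + 1)) ^ card F * val ?S (replicate n f)"
        using val_type_class[OF C(1,2) F(1,2) elim(3) E(1) fs(1,2)] by blast
      have "val ?S (replicate n f) = (\<Sum>p | p permutes {..<n}. val E (permute_list p (replicate n f))) / fact n"
        using val_symt[of E "replicate n f"] Ec by simp
      also have "\<dots> = (\<Sum>p | p permutes {..<n}. val E (replicate n f)) / fact n"
        by (simp add: permute_list_replicate)
      also have "\<dots> = val E (replicate n f)" by (simp add: cp)
      also have "\<dots> \<le> exp (- (real n * x))" using E(3) f(1) unfolding val_def iid_seq_def tpow_to_mat by blast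
      finally have v: "val ?S (replicate n f) \<le> exp (- (real n * x))" .
      have "(exp 1 * (real n + 1)) ^ card F = exp (real (card F) * (1 + ln (real n + 1)))"
        by (simp add: exp_of_nat_mult exp_add)
      also have "\<dots> \<le> exp (real n * c)" using elim(1,3) by (simp add: field_simps)
      finally have poly: "(exp 1 * (real n + 1)) ^ card F \<le> exp (real n * c)" .
      have "val ?S ss \<le> (1 + \<delta>) ^ n * ((exp 1 * (real n + 1)) ^ card F * val ?S (replicate n f))"
        by (rule order.trans[OF fs(3) mult_left_mono[OF f(2)]]) (use dl in simp)
      also have "\<dots> \<le> (1 + \<delta>) ^ n * (exp (real n * c) * exp (- (real n * x)))"
      proof (rule mult_left_mono[OF mult_mono[OF poly v]])
        have "set (replicate n f) \<subseteq> dens" using f(1) C(1) by (auto simp: set_replicate_conv_if)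
        then show "0 \<le> val ?S (replicate n f)" using S by (intro val_nonneg) simp_all
      qed (use dl in simp_all)
      also have "(1 + \<delta>) ^ n = exp (real n * c)" by (simp add: \<delta>_def exp_of_nat_mult)
      also have "exp (real n * c) * (exp (real n * c) * exp (- (real n * x))) = exp (- (real n * y))"
        unfolding exp_add[symmetric] by (rule arg_cong[where f = exp]) (simp add: c_def field_simps)
      finally show ?thesis unfolding val_def ss(3) .
    qed
    ultimately show ?case using S by blast
  qed
qed

section \<open>Comparison of Stein exponents for different alternatives\<close>

lemma stein_le_if_ach:
  assumes "\<And>n. A n \<noteq> {}" "\<And>n \<rho>. \<rho> \<in> A n \<Longrightarrow> density_mat (d ^ n) \<rho>"
    and B: "\<And>n. B n \<noteq> {}" "\<And>n \<sigma>. \<sigma> \<in> B n \<Longrightarrow> density_mat (d ^ n) \<sigma>"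
    and B': "\<And>n. B' n \<noteq> {}" "\<And>n \<sigma>. \<sigma> \<in> B' n \<Longrightarrow> density_mat (d ^ n) \<sigma>"
    and imp: "\<And>x y. ach d A B x \<Longrightarrow> y < x \<Longrightarrow> ach d A B' y"
  shows "stein d A B \<le> stein d A B'"
proof (rule ereal_le_realI)
  fix y assume "ereal y < stein d A B"
  then obtain x where x: "ereal y < ereal x" "ereal x < stein d A B" using ereal_dense2 by blast
  have "ach d A B x" by (rule less_stein_imp_ach) (use assms x in auto)
  then have "ach d A B' y" using imp x(1) by simp
  then show "ereal y \<le> stein d A B'" by (rule ach_imp_le_stein[rotated -1]) (use assms in auto)
qed

lemma iid_seq_subset_av_seq: "iid_seq C n \<subseteq> av_seq C n"
proof
  fix M assume "M \<in> iid_seq C n"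
  then obtain \<sigma> where "\<sigma> \<in> C" "M = tensor_list (map to_mat (replicate n \<sigma>))" by (auto simp: iid_seq_def tpow_def)
  then show "M \<in> av_seq C n" unfolding av_seq_def by (intro CollectI exI[of _ "replicate n \<sigma>"]) (auto simp: set_replicate_conv_if)
qed

text \<open>The null hypothesis is given by sets of words closed under permutation, which covers the
  i.i.d. and the varying case alike: symmetrising a test then keeps its first error. Two
  inequalities are inclusions of alternatives; the other two are multilinearity and the comparison
  of types.\<close>

lemma stein_av_alternative:
  fixes B :: "(complex^'d::finite^'d) set" and L :: "nat \<Rightarrow> (complex^'d::finite^'d) list set"
  assumes B: "B \<subseteq> dens" "B \<noteq> {}" "compact B"
    and A: "\<And>n. A n = (\<lambda>ss. tensor_list (map to_mat ss)) ` L n" "\<And>n. L n \<noteq> {}"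
    and L: "\<And>n ss. ss \<in> L n \<Longrightarrow> length ss = n \<and> set ss \<subseteq> dens" "\<And>n ss p. ss \<in> L n \<Longrightarrow> p permutes {..<n} \<Longrightarrow> permute_list p ss \<in> L n"
  shows "stein CARD('d) A (av_seq B) = stein CARD('d) A (av_seq (convex hull B))"
    and "stein CARD('d) A (av_seq (convex hull B)) = stein CARD('d) A (iid_seq (convex hull B))"
proof -
  let ?C = "convex hull B"
  have C: "?C \<subseteq> dens" "convex ?C" "compact ?C" "?C \<noteq> {}"
    using hull_minimal[where S = convex, OF B(1) dens_convex] compact_convex_hull[OF B(3)] B(2) by auto
  have An: "A n \<noteq> {}" for n using A by simp
  have Ad: "density_mat (CARD('d) ^ n) \<rho>" if r: "\<rho> \<in> A n" for n \<rho>
  proof -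
    obtain ss where ss: "ss \<in> L n" "\<rho> = tensor_list (map to_mat ss)" using r A(1) by blast
    then show ?thesis using tensor_to_mat_density[of ss] L(1)[OF ss(1)] by simp
  qed
  have ne: "iid_seq F n \<noteq> {}" "av_seq F n \<noteq> {}" if "F \<noteq> {}" for F :: "(complex^'d::finite^'d) set" and n
    using that iid_seq_subset_av_seq[of F n] by (auto simp: iid_seq_def)
  have sub: "av_seq B n \<subseteq> av_seq ?C n" for n unfolding av_seq_def using hull_subset[of B convex] by blast
  have den: "density_mat (CARD('d) ^ n) \<sigma>" if "\<sigma> \<in> av_seq B n \<or> \<sigma> \<in> av_seq ?C n \<or> \<sigma> \<in> iid_seq ?C n" for n \<sigma>
    using that av_seq_density[OF B(1)] av_seq_density[OF C(1)] iid_seq_density[OF C(1)] by blast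
  show "stein CARD('d) A (av_seq B) = stein CARD('d) A (av_seq ?C)"
  proof (rule antisym)
    show "stein CARD('d) A (av_seq B) \<le> stein CARD('d) A (av_seq ?C)"
    proof (rule stein_le_if_ach)
      show "ach CARD('d) A (av_seq ?C) y" if "ach CARD('d) A (av_seq B) x" "y < x" for x y
        by (rule ach_mono[OF ach_av_hull[OF that(1)]]) (use that(2) in auto)
    qed (use An Ad ne B(2) C(4) den in blast)+
    show "stein CARD('d) A (av_seq ?C) \<le> stein CARD('d) A (av_seq B)"
    proof (rule stein_le_if_ach)
      show "ach CARD('d) A (av_seq B) y" if "ach CARD('d) A (av_seq ?C) x" "y < x" for x y
        by (rule ach_mono[OF that(1)]) (use that(2) sub in auto)
    qed (use An Ad ne B(2) C(4) den in blast)+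
  qed
  show "stein CARD('d) A (av_seq ?C) = stein CARD('d) A (iid_seq ?C)"
  proof (rule antisym)
    show "stein CARD('d) A (av_seq ?C) \<le> stein CARD('d) A (iid_seq ?C)"
    proof (rule stein_le_if_ach)
      show "ach CARD('d) A (iid_seq ?C) y" if "ach CARD('d) A (av_seq ?C) x" "y < x" for x y
        by (rule ach_mono[OF that(1)]) (use that(2) iid_seq_subset_av_seq[of ?C] in auto)
    qed (use An Ad ne B(2) C(4) den in blast)+
    show "stein CARD('d) A (iid_seq ?C) \<le> stein CARD('d) A (av_seq ?C)"
    proof (rule stein_le_if_ach)
      show "ach CARD('d) A (av_seq ?C) y" if "ach CARD('d) A (iid_seq ?C) x" "y < x" for x y
        by (rule ach_iid_av[OF C A(1) _ _ that]) (use L in auto)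
    qed (use An Ad ne B(2) C(4) den in blast)+
  qed
qed

theorem mainTheorem4:
  fixes A1 B1 :: "(complex^'d::finite^'d) set"
  defines "d \<equiv> CARD('d)"
  assumes "A1 \<subseteq> dens" "B1 \<subseteq> dens" "A1 \<noteq> {}" "B1 \<noteq> {}" "closed A1" "closed B1"
  shows
   "is_min_star (prob_on B1)
      (\<lambda>\<mu> n. ereal (1 / real n) * (INF \<rho>\<in>A1. rel_ent (d ^ n) (tpow n (to_mat \<rho>)) (mixture n \<mu>)))
      (stein d (iid_seq A1) (iid_seq B1))
    \<and> is_min_star (prob_on B1)
      (\<lambda>\<mu> n. ereal (1 / real n) * (INF \<rho>\<in>mat_co (d ^ n) (av_seq A1 n). rel_ent (d ^ n) \<rho> (mixture n \<mu>)))
      (stein d (av_seq A1) (iid_seq B1))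
    \<and> (convex B1 \<longrightarrow> is_min_star (A1 \<times> prob_on B1)
      (\<lambda>(\<rho>, \<mu>) n. ereal (1 / real n) * rel_ent (d ^ n) (tpow n (to_mat \<rho>)) (mixture n \<mu>))
      (stein d (iid_seq A1) (iid_seq B1)))
    \<and> stein d (iid_seq A1) (av_seq B1) = stein d (iid_seq A1) (av_seq (convex hull B1))
    \<and> stein d (iid_seq A1) (av_seq (convex hull B1)) = stein d (iid_seq A1) (iid_seq (convex hull B1))
    \<and> is_min_star (A1 \<times> prob_on (convex hull B1))
      (\<lambda>(\<rho>, \<mu>) n. ereal (1 / real n) * rel_ent (d ^ n) (tpow n (to_mat \<rho>)) (mixture n \<mu>))
      (stein d (iid_seq A1) (iid_seq (convex hull B1)))
    \<and> stein d (av_seq A1) (av_seq B1) = stein d (av_seq A1) (av_seq (convex hull B1))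
    \<and> stein d (av_seq A1) (av_seq (convex hull B1)) = stein d (av_seq A1) (iid_seq (convex hull B1))
    \<and> is_min_star (prob_on (convex hull B1))
      (\<lambda>\<mu> n. ereal (1 / real n) * (INF \<rho>\<in>mat_co (d ^ n) (av_seq A1 n). rel_ent (d ^ n) \<rho> (mixture n \<mu>)))
      (stein d (av_seq A1) (iid_seq (convex hull B1)))"
proof -
  have cA: "compact A1" and cB: "compact B1" using assms dens_compact by auto
  let ?C = "convex hull B1"
  have C: "?C \<subseteq> dens" "?C \<noteq> {}" using hull_minimal[where S = convex, OF \<open>B1 \<subseteq> dens\<close> dens_convex] \<open>B1 \<noteq> {}\<close> by auto
  note A = \<open>A1 \<subseteq> dens\<close> \<open>A1 \<noteq> {}\<close> cA and B = \<open>B1 \<subseteq> dens\<close> \<open>B1 \<noteq> {}\<close>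
  have d: "d = CARD('d)" by (simp add: d_def)
  have iid: "stein d (iid_seq A1) (av_seq B1) = stein d (iid_seq A1) (av_seq ?C)"
    "stein d (iid_seq A1) (av_seq ?C) = stein d (iid_seq A1) (iid_seq ?C)"
  proof -
    \<comment> \<open>Constant words are fixed by every permutation, which gives the closure
      condition in the i.i.d. case.\<close>
    let ?L = "\<lambda>n. (\<lambda>a. replicate n a) ` A1"
    have L: "iid_seq A1 n = (\<lambda>ss. tensor_list (map to_mat ss)) ` ?L n" "?L n \<noteq> {}" for n
      using A(2) by (auto simp: iid_seq_def tpow_to_mat image_image)
    have l: "length ss = n \<and> set ss \<subseteq> dens" if "ss \<in> ?L n" for n ss using that A(1) by (auto simp: set_replicate_conv_if split: if_splits)
    have p: "permute_list p ss \<in> ?L n" if ss: "ss \<in> ?L n" and p: "p permutes {..<n}" for n ss p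
      using ss p by (auto simp: permute_list_replicate)
    show "stein d (iid_seq A1) (av_seq B1) = stein d (iid_seq A1) (av_seq ?C)"
      unfolding d by (rule stein_av_alternative(1)[OF B cB L]) (use l p in blast)+
    show "stein d (iid_seq A1) (av_seq ?C) = stein d (iid_seq A1) (iid_seq ?C)"
      unfolding d by (rule stein_av_alternative(2)[OF B cB L]) (use l p in blast)+
  qed
  have av: "stein d (av_seq A1) (av_seq B1) = stein d (av_seq A1) (av_seq ?C)"
    "stein d (av_seq A1) (av_seq ?C) = stein d (av_seq A1) (iid_seq ?C)"
  proof -
    let ?L = "\<lambda>n. {ss. length ss = n \<and> set ss \<subseteq> A1}"
    have L: "av_seq A1 n = (\<lambda>ss. tensor_list (map to_mat ss)) ` ?L n" "?L n \<noteq> {}" for n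
      using av_seq_nonempty[OF A(2), of n] by (auto simp: av_seq_def)
    have l: "length ss = n \<and> set ss \<subseteq> dens" if "ss \<in> ?L n" for n ss using that A(1) by auto
    have p: "permute_list p ss \<in> ?L n" if ss: "ss \<in> ?L n" and p: "p permutes {..<n}" for n ss p
      using ss p by (auto simp: set_permute_list)
    show "stein d (av_seq A1) (av_seq B1) = stein d (av_seq A1) (av_seq ?C)"
      unfolding d by (rule stein_av_alternative(1)[OF B cB L]) (use l p in blast)+
    show "stein d (av_seq A1) (av_seq ?C) = stein d (av_seq A1) (iid_seq ?C)"
      unfolding d by (rule stein_av_alternative(2)[OF B cB L]) (use l p in blast)+
  qed
  show ?thesis
    using iid_iid_min[OF d A B] av_iid_min[OF d A B] iid_iid_pair_min[OF d A B] iid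
      iid_iid_pair_min[OF d A C] av av_iid_min[OF d A C] by blast
qed

end
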